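(* Let $\gamma\in(-1,1)$ and let $m\ge1$ be an integer. If $I_md^\gamma f=0$ for some $f\in L^2_\gamma(\mathbb{D};S^m(T^*\mathbb{D}))$, then $f=d^{-\gamma}\,\mathrm{d}^sq$ for some $q\in H^{1,-\gamma}_0(\mathbb{D};S^{m-1}(T^*\mathbb{D}))$.
   Context: $\mathbb{D}=\{z=x+iy\in\mathbb{C}:|z|\le 1\}$ with the Euclidean metric, $d(z)=1-|z|^2$; functions and tensors are complex-valued. $L^2_\gamma(\mathbb{D})=L^2(\mathbb{D},d^\gamma\,\mathrm{d}x\,\mathrm{d}y)$. $H^{1,\gamma}_0(\mathbb{D})$ is the completion of $C_c^\infty(\mathbb{D}^\circ)$ for $\|u\|^2=\|u\|^2_{L^2_\gamma}+\|\nabla u\|^2_{L^2_\gamma}$. $L^2_\gamma(\mathbb{D};S^m(T^*\mathbb{D}))$, $H^{1,\gamma}_0(\mathbb{D};S^m(T^*\mathbb{D}))$ are the symmetric covariant $m$-tensor fields with all components in $L^2_\gamma(\mathbb{D})$, resp. $H^{1,\gamma}_0(\mathbb{D})$ ($S^0$: functions). $\mathrm{d}^s=\sigma\circ\nabla$ ($\nabla$ total covariant derivative, $\sigma$ symmetrization), extended to a bounded operator $H^{1,-\gamma}_0(\mathbb{D};S^{m-1}(T^*\mathbb{D}))\to L^2_{-\gamma}(\mathbb{D};S^m(T^*\mathbb{D}))$. $I_md^\gamma f(\beta,\alpha)=\int_0^{2\cos\alpha}f_{z(t)}(v,\dots,v)\,d(z(t))^\gamma\,\mathrm{d}t$ for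 $(\beta,\alpha)\in\partial_+S\mathbb{D}=(\mathbb{R}/2\pi\mathbb{Z})\times[-\pi/2,\pi/2]$, with $z(t)=e^{i\beta}+te^{i(\beta+\pi+\alpha)}$ and $v$ the unit vector of angle $\beta+\pi+\alpha$; it is bounded into $L^2(\partial_+S\mathbb{D},(\cos\alpha)^{-2\gamma}\,\mathrm{d}\beta\,\mathrm{d}\alpha)$. *)

theory Defs
  imports "HOL-Analysis.Analysis" "HOL-Combinatorics.Permutations"
begin

section \<open>Weighted spaces of functions on the closed unit disk\<close>

text \<open>The plane is the type \<^typ>\<open>complex\<close>; \<^term>\<open>lebesgue :: complex measure\<close> is
  $dx\,dy$. Elements of $L^2$ are represented by functions, and only their values on the closed
  disk matter. Since \<open>0 powr g = 0\<close>, the weights below take the value 0 on the boundary circle,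
  a null set, even for nonpositive exponents.\<close>

definition bdf :: "complex \<Rightarrow> real" where
  "bdf z = 1 - (cmod z)\<^sup>2"

definition disk_measure :: "real \<Rightarrow> complex measure" where
  "disk_measure g = density (lebesgue_on (cball 0 1)) (\<lambda>z. ennreal (bdf z powr g))"

definition L2 :: "real \<Rightarrow> (complex \<Rightarrow> complex) set" where
  "L2 g = {u \<in> borel_measurable (disk_measure g).
             integrable (disk_measure g) (\<lambda>z. (cmod (u z))\<^sup>2)}"

text \<open>Bochner integrals of non-integrable functions are 0, so the following is
  a seminorm only on \<^term>\<open>L2 g\<close>; it is used only there.\<close>

definition L2_norm :: "real \<Rightarrow> (complex \<Rightarrow> complex) \<Rightarrow> real" where
  "L2_norm g u = sqrt (LINT z|disk_measure g. (cmod (u z))\<^sup>2)"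

text \<open>Derivatives are real Frechet derivatives on the plane, and \<^term>\<open>dir_deriv v u\<close> is the
  derivative of \<open>u\<close> in the direction \<open>v\<close>.\<close>

definition dir_deriv :: "complex \<Rightarrow> (complex \<Rightarrow> complex) \<Rightarrow> complex \<Rightarrow> complex" where
  "dir_deriv v u z = frechet_derivative u (at z) v"

primrec C_times_diff :: "nat \<Rightarrow> (complex \<Rightarrow> complex) \<Rightarrow> bool" where
  "C_times_diff 0 u \<longleftrightarrow> continuous_on UNIV u"
| "C_times_diff (Suc k) u \<longleftrightarrow>
     (\<forall>z. u differentiable (at z)) \<and> (\<forall>v. C_times_diff k (dir_deriv v u))"

text \<open>Smooth functions with compact support in the open disk, extended by zero to the plane.\<close>

definition test_functions :: "(complex \<Rightarrow> complex) set" where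
  "test_functions = {\<phi>. (\<forall>k. C_times_diff k \<phi>) \<and>
                       (\<exists>K. compact K \<and> K \<subseteq> ball 0 1 \<and> (\<forall>z. z \<notin> K \<longrightarrow> \<phi> z = 0))}"

definition H1_norm :: "real \<Rightarrow> (complex \<Rightarrow> complex) \<Rightarrow> real" where
  "H1_norm g \<phi> = sqrt ((L2_norm g \<phi>)\<^sup>2 +
                      ((L2_norm g (dir_deriv 1 \<phi>))\<^sup>2 + (L2_norm g (dir_deriv \<i> \<phi>))\<^sup>2))"

text \<open>The completion of the test functions for \<^const>\<open>H1_norm\<close> consists of the classes of
  $H^1$-Cauchy sequences. The weight being positive and smooth inside the disk, the weighted
  gradient is closable there, so the $L^2$-limit of such a sequence determines its class. The
  completion is therefore identified with the set of these limits;
  \<^term>\<open>H1_approx g \<phi> u\<close> says that the class of \<open>\<phi>\<close> is the element \<open>u\<close>.\<close>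

definition H1_approx :: "real \<Rightarrow> (nat \<Rightarrow> complex \<Rightarrow> complex) \<Rightarrow> (complex \<Rightarrow> complex) \<Rightarrow> bool" where
  "H1_approx g \<phi> u \<longleftrightarrow>
     (\<forall>n. \<phi> n \<in> test_functions) \<and>
     (\<forall>e>0. \<exists>N. \<forall>k\<ge>N. \<forall>n\<ge>N. H1_norm g (\<lambda>z. \<phi> k z - \<phi> n z) < e) \<and>
     u \<in> L2 g \<and> (\<lambda>n. L2_norm g (\<lambda>z. \<phi> n z - u z)) \<longlonglongrightarrow> 0"

definition H10 :: "real \<Rightarrow> (complex \<Rightarrow> complex) set" where
  "H10 g = {u. \<exists>\<phi>. H1_approx g \<phi> u}"


section \<open>Symmetric covariant tensor fields\<close>

text \<open>A covariant $m$-tensor at a point is a real-multilinear map on $m$ tangent vectors with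
  complex values, encoded as a function on lists of vectors; its values on lists of length
  other than $m$ are irrelevant.\<close>

definition sym_tensor :: "nat \<Rightarrow> (complex list \<Rightarrow> complex) \<Rightarrow> bool" where
  "sym_tensor m T \<longleftrightarrow> (\<forall>vs. length vs = m \<longrightarrow>
     (\<forall>i<m. linear (\<lambda>v. T (vs[i := v]))) \<and>
     (\<forall>\<pi>. \<pi> permutes {..<m} \<longrightarrow> T (permute_list \<pi> vs) = T vs))"

text \<open>The components of a tensor field are its values on lists of coordinate vectors.\<close>

definition frames :: "nat \<Rightarrow> complex list set" where
  "frames m = {es. length es = m \<and> set es \<subseteq> {1, \<i>}}"

definition L2_tensor :: "real \<Rightarrow> nat \<Rightarrow> (complex \<Rightarrow> complex list \<Rightarrow> complex) set" where
  "L2_tensor g m = {f. (\<forall>z\<in>cball 0 1. sym_tensor m (f z)) \<and>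
                       (\<forall>es\<in>frames m. (\<lambda>z. f z es) \<in> L2 g)}"

definition H10_tensor :: "real \<Rightarrow> nat \<Rightarrow> (complex \<Rightarrow> complex list \<Rightarrow> complex) set" where
  "H10_tensor g m = {q. (\<forall>z\<in>cball 0 1. sym_tensor m (q z)) \<and>
                        (\<forall>es\<in>frames m. (\<lambda>z. q z es) \<in> H10 g)}"

text \<open>The total covariant derivative of the flat metric; the first slot is the direction of
  differentiation.\<close>

definition nabla ::
  "(complex \<Rightarrow> complex list \<Rightarrow> complex) \<Rightarrow> complex \<Rightarrow> complex list \<Rightarrow> complex" where
  "nabla q z vs = dir_deriv (hd vs) (\<lambda>w. q w (tl vs)) z"

definition symmetrize :: "nat \<Rightarrow> (complex list \<Rightarrow> complex) \<Rightarrow> complex list \<Rightarrow> complex" where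
  "symmetrize m T vs = (\<Sum>\<pi> | \<pi> permutes {..<m}. T (permute_list \<pi> vs)) / fact m"

definition sym_diff ::
  "nat \<Rightarrow> (complex \<Rightarrow> complex list \<Rightarrow> complex) \<Rightarrow> complex \<Rightarrow> complex list \<Rightarrow> complex" where
  "sym_diff k q z = symmetrize (Suc k) (nabla q z)"

text \<open>\<^term>\<open>has_sym_diff g k q h\<close>: the extension by continuity of \<^term>\<open>sym_diff k\<close> from test
  tensor fields to a bounded operator from \<^term>\<open>H10_tensor g k\<close> to
  \<^term>\<open>L2_tensor g (Suc k)\<close> maps \<open>q\<close> to (the class of) \<open>h\<close>.\<close>

definition has_sym_diff ::
  "real \<Rightarrow> nat \<Rightarrow> (complex \<Rightarrow> complex list \<Rightarrow> complex) \<Rightarrow>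
     (complex \<Rightarrow> complex list \<Rightarrow> complex) \<Rightarrow> bool" where
  "has_sym_diff g k q h \<longleftrightarrow> q \<in> H10_tensor g k \<and> h \<in> L2_tensor g (Suc k) \<and>
     (\<exists>\<Phi>. (\<forall>n z. sym_tensor k (\<Phi> n z)) \<and>
          (\<forall>es\<in>frames k. H1_approx g (\<lambda>n z. \<Phi> n z es) (\<lambda>z. q z es)) \<and>
          (\<forall>es\<in>frames (Suc k).
             (\<lambda>n. L2_norm g (\<lambda>z. sym_diff k (\<Phi> n) z es - h z es)) \<longlonglongrightarrow> 0))"


section \<open>The weighted X-ray transform in fan-beam coordinates\<close>

text \<open>For \<open>f\<close> in \<^term>\<open>L2_tensor g m\<close> with \<open>g > -1\<close>, the integral converges absolutely for
  almost every \<open>(\<beta>, \<alpha>)\<close> by the Cauchy-Schwarz inequality and Santalo's formula, so it can be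
  defined pointwise. Lebesgue (not Borel) measure is used on chords because \<open>f\<close> is only
  Lebesgue measurable.\<close>

definition xray ::
  "real \<Rightarrow> nat \<Rightarrow> (complex \<Rightarrow> complex list \<Rightarrow> complex) \<Rightarrow> real \<Rightarrow> real \<Rightarrow> complex" where
  "xray g m f \<beta> \<alpha> =
     (let v = cis (\<beta> + pi + \<alpha>); z = (\<lambda>t. cis \<beta> + of_real t * v)
      in LINT t|lebesgue_on {0..2 * cos \<alpha>}.
           f (z t) (replicate m v) * of_real (bdf (z t) powr g))"

text \<open>The inward boundary, with \<open>\<beta>\<close> in a fundamental domain of $\mathbb{R}/2\pi\mathbb{Z}$ and
  the measure $(\cos\alpha)^{-2\gamma}\,d\beta\,d\alpha$.\<close>

definition influx_measure :: "real \<Rightarrow> (real \<times> real) measure" where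
  "influx_measure g = density (lebesgue_on ({0..2 * pi} \<times> {- (pi / 2)..pi / 2}))
                              (\<lambda>(\<beta>, \<alpha>). ennreal (cos \<alpha> powr (- 2 * g)))"

end

theory Submission
  imports Defs
begin

text \<open>Write \<open>s = - \<gamma>\<close>. On vectors \<open>(v, \<dots>, v)\<close> the tensor \<open>d\<^sup>\<gamma> f\<close> is
  \<open>\<Sum>j\<le>m. F j * v ^ (m - j) * cnj v ^ j\<close> with coefficients \<open>F j\<close> in \<open>L\<^sup>2\<close> with weight \<open>d\<^sup>s\<close>. In terms
  of \<open>dz = (\<partial>x - \<i> \<partial>y) / 2\<close> and \<open>dzb = (\<partial>x + \<i> \<partial>y) / 2\<close> the symmetrized derivative of a tensor with
  coefficients \<open>\<phi> j\<close> has the coefficients \<open>dz (\<phi> j) + dzb (\<phi> (j - 1))\<close>. So the theorem asks for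
  \<open>\<phi> 0, \<dots>, \<phi> (m - 1)\<close>, vanishing at the boundary, with \<open>dz (\<phi> j) + dzb (\<phi> (j - 1)) = F j\<close> for all
  \<open>j \<le> m\<close>, an overdetermined system. It is solved in the sense of limits of test functions.

  The vanishing of the transform gives the compatibility conditions. By Fubini's theorem, for
  almost every direction \<open>v\<close> in some interval, the integral of \<open>\<Sum>j\<le>m. F j * v ^ (m - j) * cnj v ^ j\<close>
  against any power of the coordinate transversal to \<open>v\<close> is an average of integrals over parallel
  chords, hence zero. In the variable \<open>w = v\<^sup>2\<close> these conditions are polynomial, so they hold for all
  complex \<open>w\<close> and can be read coefficient by coefficient
  (\<open>xray_zero_imp_transversal_moments_vanish\<close>). The top coefficients say that \<open>F 0\<close> is orthogonal to
  all powers of \<open>z\<close>.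

  The equation \<open>dz (\<phi> 0) = F 0\<close> can then be solved. In each angular mode it is an ordinary
  differential equation with explicit compactly supported solutions, so the range of \<open>dz\<close> on test
  functions contains a dense set of functions orthogonal to the powers of \<open>z\<close>; Bessel's inequality
  turns this into density in the space of all functions with that orthogonality property
  (\<open>dz_range_dense\<close>). For \<open>-1 < s < 1\<close> integration by parts and a Hardy inequality bound the
  weighted norms of \<open>\<phi>\<close> and \<open>dzb \<phi>\<close> by that of \<open>dz \<phi>\<close> (\<open>dz_controls_dzb\<close>), so that approximate
  solutions converge in the weighted Sobolev norm.

  Replacing \<open>F 1\<close> by \<open>F 1 - dzb (\<phi> 0)\<close> and dropping \<open>F 0\<close> preserves the moment conditions, because
  the derivative of a test function has vanishing moments, and lowers \<open>m\<close> by one. When one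
  coefficient is left, all its moments vanish, hence so does the coefficient
  (\<open>symmetric_gradient_range\<close>). Finally symmetric tensors are recovered from their diagonals by
  polarization (\<open>sym_tensor_expansion\<close>).\<close>

section \<open>Square-integrable functions on a measure space\<close>

definition sq_int :: "'a measure \<Rightarrow> ('a \<Rightarrow> complex) \<Rightarrow> bool" where
  "sq_int M u \<longleftrightarrow> u \<in> borel_measurable M \<and> integrable M (\<lambda>z. (cmod (u z))\<^sup>2)"

text \<open>The square of the norm. Without the square root, all estimates use the triangle inequality
  in the form \<open>|a + b|\<^sup>2 \<le> 2 |a|\<^sup>2 + 2 |b|\<^sup>2\<close>.\<close>

definition sq_norm :: "'a measure \<Rightarrow> ('a \<Rightarrow> complex) \<Rightarrow> real" where
  "sq_norm M u = (LINT z|M. (cmod (u z))\<^sup>2)"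

lemma sq_norm_nonneg: "0 \<le> sq_norm M u"
  by (simp add: sq_norm_def)

lemma borel_measurable_cnj [measurable]:
  "f \<in> borel_measurable M \<Longrightarrow> (\<lambda>z. cnj (f z)) \<in> borel_measurable M"
  by (rule measurable_compose[OF _ borel_measurable_continuous_onI[OF continuous_on_cnj[OF continuous_on_id]]])

lemma cmod_add_sq_le: "(cmod (a + b))\<^sup>2 \<le> 2 * (cmod a)\<^sup>2 + 2 * (cmod b)\<^sup>2"
proof -
  have "(cmod (a + b))\<^sup>2 \<le> (cmod a + cmod b)\<^sup>2"
    by (intro power_mono norm_triangle_ineq norm_ge_zero)
  also have "\<dots> \<le> 2 * (cmod a)\<^sup>2 + 2 * (cmod b)\<^sup>2"
    using sum_squares_bound[of "cmod a" "cmod b"] by (simp add: power2_sum)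
  finally show ?thesis .
qed

lemma sq_int_measurable: "sq_int M u \<Longrightarrow> u \<in> borel_measurable M"
  by (simp add: sq_int_def)

lemma sq_int_bound:
  assumes "sq_int M v" and "u \<in> borel_measurable M"
    and "AE z in M. cmod (u z) \<le> C * cmod (v z)"
  shows "sq_int M u"
proof -
  have "integrable M (\<lambda>z. C\<^sup>2 * (cmod (v z))\<^sup>2)"
    using assms(1) by (simp add: sq_int_def)
  then have "integrable M (\<lambda>z. (cmod (u z))\<^sup>2)"
  proof (rule Bochner_Integration.integrable_bound)
    show "AE z in M. norm ((cmod (u z))\<^sup>2) \<le> norm (C\<^sup>2 * (cmod (v z))\<^sup>2)"
      using assms(3)
    proof eventually_elim
      case (elim z)
      then have "(cmod (u z))\<^sup>2 \<le> (C * cmod (v z))\<^sup>2" by (intro power_mono) auto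
      then show ?case by (simp add: power_mult_distrib)
    qed
  qed (use assms in measurable)
  then show ?thesis using assms(2) by (simp add: sq_int_def)
qed

lemma sq_int_add:
  assumes "sq_int M u" "sq_int M v"
  shows "sq_int M (\<lambda>z. u z + v z)"
    and "sq_norm M (\<lambda>z. u z + v z) \<le> 2 * sq_norm M u + 2 * sq_norm M v"
proof -
  have [measurable]: "u \<in> borel_measurable M" "v \<in> borel_measurable M"
    using assms by (auto simp: sq_int_def)
  have i: "integrable M (\<lambda>z. 2 * (cmod (u z))\<^sup>2 + 2 * (cmod (v z))\<^sup>2)"
    using assms by (auto simp: sq_int_def)
  have j: "integrable M (\<lambda>z. (cmod (u z + v z))\<^sup>2)"
    by (rule Bochner_Integration.integrable_bound[OF i]) (auto simp: cmod_add_sq_le)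
  then show "sq_int M (\<lambda>z. u z + v z)" by (simp add: sq_int_def)
  have "sq_norm M (\<lambda>z. u z + v z) \<le> (LINT z|M. 2 * (cmod (u z))\<^sup>2 + 2 * (cmod (v z))\<^sup>2)"
    unfolding sq_norm_def by (intro integral_mono i j cmod_add_sq_le)
  also have "\<dots> = 2 * sq_norm M u + 2 * sq_norm M v"
    using assms by (simp add: sq_norm_def sq_int_def)
  finally show "sq_norm M (\<lambda>z. u z + v z) \<le> 2 * sq_norm M u + 2 * sq_norm M v" .
qed

lemma sq_int_zero [simp]: "sq_int M (\<lambda>z. 0)"
  and sq_norm_zero [simp]: "sq_norm M (\<lambda>z. 0) = 0"
  by (auto simp: sq_int_def sq_norm_def)

lemma sq_int_scale:
  assumes "sq_int M u"
  shows "sq_int M (\<lambda>z. c * u z)"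
    and "sq_norm M (\<lambda>z. c * u z) = (cmod c)\<^sup>2 * sq_norm M u"
  using assms by (auto simp: sq_int_def sq_norm_def norm_mult power_mult_distrib)

lemma sq_int_uminus: "sq_int M u \<Longrightarrow> sq_int M (\<lambda>z. - u z)"
  by (auto simp: sq_int_def)

lemma sq_norm_uminus: "sq_norm M (\<lambda>z. - u z) = sq_norm M u"
  by (simp add: sq_norm_def)

lemma sq_norm_minus_commute: "sq_norm M (\<lambda>z. u z - v z) = sq_norm M (\<lambda>z. v z - u z)"
  by (simp add: sq_norm_def norm_minus_commute)

lemma sq_int_diff:
  assumes "sq_int M u" "sq_int M v"
  shows "sq_int M (\<lambda>z. u z - v z)"
    and "sq_norm M (\<lambda>z. u z - v z) \<le> 2 * sq_norm M u + 2 * sq_norm M v"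
  using sq_int_add[OF assms(1) sq_int_uminus[OF assms(2)]] by (auto simp: sq_norm_uminus)

lemma sq_norm_diff_trans:
  assumes "sq_int M u" "sq_int M v" "sq_int M w"
  shows "sq_norm M (\<lambda>z. u z - w z) \<le> 2 * sq_norm M (\<lambda>z. u z - v z) + 2 * sq_norm M (\<lambda>z. v z - w z)"
  using sq_int_add(2)[OF sq_int_diff(1)[OF assms(1,2)] sq_int_diff(1)[OF assms(2,3)]] by simp

lemma sq_int_sum:
  assumes "\<And>i. i \<in> I \<Longrightarrow> sq_int M (u i)"
  shows "sq_int M (\<lambda>z. \<Sum>i\<in>I. u i z)"
  using assms by (induction I rule: infinite_finite_induct) (auto intro: sq_int_add)

lemma sq_norm_cong_AE:
  assumes "u \<in> borel_measurable M" "v \<in> borel_measurable M" "AE z in M. u z = v z"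
  shows "sq_norm M u = sq_norm M v"
  unfolding sq_norm_def by (rule integral_cong_AE) (use assms in auto)

lemma sq_norm_eq_0:
  assumes "sq_int M u" "sq_norm M u = 0"
  shows "AE z in M. u z = 0"
  using assms integral_nonneg_eq_0_iff_AE[of M "\<lambda>z. (cmod (u z))\<^sup>2"]
  by (auto simp: sq_norm_def sq_int_def)

lemma sq_int_mult_integrable:
  assumes "sq_int M u" "sq_int M v"
  shows "integrable M (\<lambda>z. u z * cnj (v z))"
proof (rule Bochner_Integration.integrable_bound)
  have [measurable]: "u \<in> borel_measurable M" "v \<in> borel_measurable M"
    using assms by (auto simp: sq_int_def)
  show "integrable M (\<lambda>z. (cmod (u z))\<^sup>2 + (cmod (v z))\<^sup>2)"
    using assms by (auto simp: sq_int_def)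
  show "(\<lambda>z. u z * cnj (v z)) \<in> borel_measurable M"
    by measurable
  have "cmod a * cmod b \<le> (cmod a)\<^sup>2 + (cmod b)\<^sup>2" for a b
  proof -
    have "2 * (cmod a * cmod b) \<le> (cmod a)\<^sup>2 + (cmod b)\<^sup>2"
      using sum_squares_bound[of "cmod a" "cmod b"] by (simp add: mult.assoc)
    moreover have "0 \<le> cmod a * cmod b" by simp
    ultimately show ?thesis by linarith
  qed
  then show "AE z in M. norm (u z * cnj (v z)) \<le> norm ((cmod (u z))\<^sup>2 + (cmod (v z))\<^sup>2)"
    by (simp add: norm_mult)
qed

text \<open>The quadratic polynomial \<open>t \<mapsto> \<integral>(|u| - t |v|)\<^sup>2\<close> is nonnegative, so its discriminant is not
  positive.\<close>

lemma Cauchy_Schwarz_integral: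
  assumes "sq_int M u" "sq_int M v"
  shows "(cmod (LINT z|M. u z * cnj (v z)))\<^sup>2 \<le> sq_norm M u * sq_norm M v"
proof -
  define a where "a = (LINT z|M. cmod (u z) * cmod (v z))"
  have i: "integrable M (\<lambda>z. cmod (u z) * cmod (v z))"
    using integrable_norm[OF sq_int_mult_integrable[OF assms]] by (simp add: norm_mult)
  have a0: "0 \<le> a" by (simp add: a_def)
  have le: "cmod (LINT z|M. u z * cnj (v z)) \<le> a"
    using integral_norm_bound[of M "\<lambda>z. u z * cnj (v z)"] by (simp add: a_def norm_mult)
  have q: "0 \<le> sq_norm M u - 2 * t * a + t\<^sup>2 * sq_norm M v" for t :: real
  proof -
    have "0 \<le> (LINT z|M. (cmod (u z) - t * cmod (v z))\<^sup>2)" by simp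
    also have "(\<lambda>z. (cmod (u z) - t * cmod (v z))\<^sup>2) =
        (\<lambda>z. (cmod (u z))\<^sup>2 - 2 * t * (cmod (u z) * cmod (v z)) + t\<^sup>2 * (cmod (v z))\<^sup>2)"
      by (auto simp: power2_eq_square algebra_simps)
    also have "(LINT z|M. \<dots> z) = sq_norm M u - 2 * t * a + t\<^sup>2 * sq_norm M v"
      using i assms by (simp add: sq_int_def sq_norm_def a_def)
    finally show ?thesis .
  qed
  have "a\<^sup>2 \<le> sq_norm M u * sq_norm M v"
  proof (cases "sq_norm M v = 0")
    case True
    have "a = 0"
    proof (rule ccontr)
      assume "a \<noteq> 0"
      define t where "t = (sq_norm M u + 1) / a"
      have "t * a = sq_norm M u + 1" using \<open>a \<noteq> 0\<close> by (simp add: t_def)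
      then have "2 * t * a = 2 * (sq_norm M u + 1)" by (simp add: mult.assoc)
      with q[of t] sq_norm_nonneg[of M u] show False unfolding True by simp
    qed
    then show ?thesis using True by simp
  next
    case False
    then have p: "0 < sq_norm M v" using sq_norm_nonneg[of M v] by simp
    have "2 * (a / sq_norm M v) * a = 2 * (a\<^sup>2 / sq_norm M v)"
      "(a / sq_norm M v)\<^sup>2 * sq_norm M v = a\<^sup>2 / sq_norm M v"
      using p by (simp_all add: power2_eq_square)
    with q[of "a / sq_norm M v"] have "a\<^sup>2 / sq_norm M v \<le> sq_norm M u" by linarith
    with p show ?thesis by (simp add: pos_divide_le_eq)
  qed
  moreover have "(cmod (LINT z|M. u z * cnj (v z)))\<^sup>2 \<le> a\<^sup>2"
    using le by (intro power_mono) auto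
  ultimately show ?thesis by linarith
qed

lemma pairing_tendsto:
  assumes "\<And>n. sq_int M (u n)" "sq_int M u'" "sq_int M v"
    and "(\<lambda>n. sq_norm M (\<lambda>z. u n z - u' z)) \<longlonglongrightarrow> 0"
  shows "(\<lambda>n. LINT z|M. u n z * cnj (v z)) \<longlonglongrightarrow> (LINT z|M. u' z * cnj (v z))"
proof -
  have "(\<lambda>n. sqrt (sq_norm M (\<lambda>z. u n z - u' z) * sq_norm M v)) \<longlonglongrightarrow> sqrt (0 * sq_norm M v)"
    by (intro tendsto_intros assms)
  then have lim: "(\<lambda>n. sqrt (sq_norm M (\<lambda>z. u n z - u' z) * sq_norm M v)) \<longlonglongrightarrow> 0" by simp
  have "(\<lambda>n. (LINT z|M. u n z * cnj (v z)) - (LINT z|M. u' z * cnj (v z))) \<longlonglongrightarrow> 0"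
  proof (rule Lim_null_comparison[OF always_eventually lim], rule allI)
    fix n
    have "(LINT z|M. u n z * cnj (v z)) - (LINT z|M. u' z * cnj (v z))
        = (LINT z|M. (u n z - u' z) * cnj (v z))"
      using assms by (simp add: sq_int_mult_integrable left_diff_distrib)
    also have "cmod \<dots> \<le> sqrt (sq_norm M (\<lambda>z. u n z - u' z) * sq_norm M v)"
      using Cauchy_Schwarz_integral[OF sq_int_diff(1)[OF assms(1,2)] assms(3)]
      by (rule real_le_rsqrt)
    finally show "norm ((LINT z|M. u n z * cnj (v z)) - (LINT z|M. u' z * cnj (v z)))
      \<le> sqrt (sq_norm M (\<lambda>z. u n z - u' z) * sq_norm M v)" .
  qed
  then show ?thesis by (rule LIM_zero_cancel)
qed

lemma sq_norm_tendsto_add: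
  assumes "\<And>n. sq_int M (u n)" "sq_int M u'" "\<And>n. sq_int M (v n)" "sq_int M v'"
    and "(\<lambda>n. sq_norm M (\<lambda>z. u n z - u' z)) \<longlonglongrightarrow> 0"
    and "(\<lambda>n. sq_norm M (\<lambda>z. v n z - v' z)) \<longlonglongrightarrow> 0"
  shows "(\<lambda>n. sq_norm M (\<lambda>z. (u n z + v n z) - (u' z + v' z))) \<longlonglongrightarrow> 0"
proof -
  have "(\<lambda>n. 2 * sq_norm M (\<lambda>z. u n z - u' z) + 2 * sq_norm M (\<lambda>z. v n z - v' z)) \<longlonglongrightarrow> 2 * 0 + 2 * 0"
    by (intro tendsto_intros assms)
  then have lim: "(\<lambda>n. 2 * sq_norm M (\<lambda>z. u n z - u' z) + 2 * sq_norm M (\<lambda>z. v n z - v' z)) \<longlonglongrightarrow> 0"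
    by simp
  show ?thesis
  proof (rule Lim_null_comparison[OF always_eventually lim], rule allI)
    fix n
    have eq: "(\<lambda>z. (u n z + v n z) - (u' z + v' z)) = (\<lambda>z. (u n z - u' z) + (v n z - v' z))"
      by auto
    show "norm (sq_norm M (\<lambda>z. (u n z + v n z) - (u' z + v' z)))
        \<le> 2 * sq_norm M (\<lambda>z. u n z - u' z) + 2 * sq_norm M (\<lambda>z. v n z - v' z)"
      unfolding eq real_norm_def abs_of_nonneg[OF sq_norm_nonneg]
      by (rule sq_int_add(2)[OF sq_int_diff(1)[OF assms(1,2)] sq_int_diff(1)[OF assms(3,4)]])
  qed
qed

lemma sq_norm_tendsto_scale:
  assumes "\<And>n. sq_int M (u n)" "sq_int M u'"
    and "(\<lambda>n. sq_norm M (\<lambda>z. u n z - u' z)) \<longlonglongrightarrow> 0"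
  shows "(\<lambda>n. sq_norm M (\<lambda>z. c * u n z - c * u' z)) \<longlonglongrightarrow> 0"
proof -
  have "(\<lambda>n. (cmod c)\<^sup>2 * sq_norm M (\<lambda>z. u n z - u' z)) \<longlonglongrightarrow> (cmod c)\<^sup>2 * 0"
    by (intro tendsto_intros assms)
  then show ?thesis
    using sq_int_scale(2)[OF sq_int_diff(1)[OF assms(1,2)], of c]
    by (simp add: right_diff_distrib)
qed

lemma sq_norm_tendsto_sum:
  assumes "finite I" "\<And>i n. i \<in> I \<Longrightarrow> sq_int M (u i n)" "\<And>i. i \<in> I \<Longrightarrow> sq_int M (u' i)"
    and "\<And>i. i \<in> I \<Longrightarrow> (\<lambda>n. sq_norm M (\<lambda>z. u i n z - u' i z)) \<longlonglongrightarrow> 0"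
  shows "(\<lambda>n. sq_norm M (\<lambda>z. (\<Sum>i\<in>I. u i n z) - (\<Sum>i\<in>I. u' i z))) \<longlonglongrightarrow> 0"
  using assms
proof (induction I rule: finite_induct)
  case (insert i I)
  have "(\<lambda>n. sq_norm M (\<lambda>z. (u i n z + (\<Sum>i\<in>I. u i n z)) - (u' i z + (\<Sum>i\<in>I. u' i z)))) \<longlonglongrightarrow> 0"
    by (rule sq_norm_tendsto_add) (use insert in \<open>auto intro: sq_int_sum\<close>)
  then show ?case using insert(1,2) by simp
qed simp

subsection \<open>Completeness\<close>

text \<open>By \<open>2 b \<le> 2 ^ k * b\<^sup>2 + (1/2) ^ k\<close> the gaps themselves are summable.\<close>

lemma geometric_Cauchy_limit:
  fixes x :: "nat \<Rightarrow> complex"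
  assumes "summable (\<lambda>k. 2 ^ k * (cmod (x (Suc k) - x k))\<^sup>2)"
  shows "convergent x"
proof -
  let ?a = "\<lambda>k. 2 ^ k * (cmod (x (Suc k) - x k))\<^sup>2"
  have le: "cmod (x (Suc k) - x k) \<le> ?a k + (1/2) ^ k" for k
  proof -
    let ?b = "cmod (x (Suc k) - x k)"
    have "0 \<le> (2 ^ k * ?b - 1)\<^sup>2" by simp
    also have "\<dots> = (2 ^ k) * (2 ^ k * ?b\<^sup>2 - 2 * ?b + (1/2)^k)"
      by (simp add: power2_eq_square algebra_simps power_divide)
    finally have "2 ^ k * 0 \<le> 2 ^ k * (2 ^ k * ?b\<^sup>2 - 2 * ?b + (1/2)^k)" by simp
    then have "0 \<le> 2 ^ k * ?b\<^sup>2 - 2 * ?b + (1/2)^k" by (rule mult_left_le_imp_le) simp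
    moreover have "0 \<le> ?b" by simp
    moreover have "0 \<le> 2 ^ k * ?b\<^sup>2" "0 \<le> (1/2::real)^k" by simp_all
    ultimately show ?thesis by linarith
  qed
  have s: "summable (\<lambda>k. cmod (x (Suc k) - x k))"
  proof (rule summable_comparison_test')
    show "summable (\<lambda>k. ?a k + (1/2) ^ k)"
      by (intro summable_add assms summable_geometric) simp
    show "norm (cmod (x (Suc k) - x k)) \<le> ?a k + (1/2) ^ k" if "k \<ge> 0" for k using le by simp
  qed
  then have "summable (\<lambda>k. x (Suc k) - x k)" by (rule summable_norm_cancel)
  then have c: "convergent (\<lambda>n. \<Sum>k<n. x (Suc k) - x k)" by (simp add: summable_iff_convergent)
  then have "convergent (\<lambda>n. x n - x 0)" by (simp add: sum_lessThan_telescope)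
  then have "convergent (\<lambda>n. (x n - x 0) + x 0)" by (intro convergent_add convergent_const)
  then show ?thesis by simp
qed

lemma fast_Cauchy_limit:
  assumes u: "\<And>n. sq_int M (u n)"
    and gap: "\<And>k. sq_norm M (\<lambda>z. u (Suc k) z - u k z) \<le> (1/8) ^ k"
  shows "\<exists>u'\<in>borel_measurable M. AE z in M. (\<lambda>n. u n z) \<longlonglongrightarrow> u' z"
proof -
  let ?a = "\<lambda>k z. 2 ^ k * (cmod (u (Suc k) z - u k z))\<^sup>2"
  have [measurable]: "u n \<in> borel_measurable M" for n using u by (simp add: sq_int_def)
  have ai: "integrable M (?a k)" for k
    using sq_int_diff(1)[OF u u] by (simp add: sq_int_def)
  have "(\<integral>\<^sup>+z. (\<Sum>k. ennreal (?a k z)) \<partial>M) = (\<Sum>k. \<integral>\<^sup>+z. ennreal (?a k z) \<partial>M)"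
    by (rule nn_integral_suminf) measurable
  also have "\<dots> \<le> (\<Sum>k. ennreal ((1/4) ^ k))"
  proof (intro suminf_le summableI)
    fix k
    have "(\<integral>\<^sup>+z. ennreal (?a k z) \<partial>M) = ennreal (LINT z|M. ?a k z)"
      by (rule nn_integral_eq_integral[OF ai]) simp
    also have "(LINT z|M. ?a k z) = 2 ^ k * sq_norm M (\<lambda>z. u (Suc k) z - u k z)"
      by (simp add: sq_norm_def)
    also have "\<dots> \<le> 2 ^ k * (1/8) ^ k" by (intro mult_left_mono gap) simp
    also have "\<dots> = (1/4) ^ k" by (simp flip: power_mult_distrib)
    finally show "(\<integral>\<^sup>+z. ennreal (?a k z) \<partial>M) \<le> ennreal ((1/4) ^ k)" by (simp add: ennreal_leI)
  qed
  also have "\<dots> < top"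
  proof -
    have "(\<Sum>k. ennreal ((1/4) ^ k)) = ennreal (\<Sum>k. (1/4) ^ k)"
      by (rule suminf_ennreal2) (auto intro: summable_geometric)
    then show ?thesis by simp
  qed
  finally have "(\<integral>\<^sup>+z. (\<Sum>k. ennreal (?a k z)) \<partial>M) \<noteq> \<infinity>" by simp
  then have "AE z in M. (\<Sum>k. ennreal (?a k z)) \<noteq> \<infinity>"
    by (intro nn_integral_PInf_AE) measurable
  then have ae: "AE z in M. convergent (\<lambda>n. u n z)"
  proof eventually_elim
    case (elim z)
    then have "summable (\<lambda>k. ?a k z)"
      by (intro summable_suminf_not_top) auto
    then show ?case by (rule geometric_Cauchy_limit)
  qed
  define u' where "u' z = lim (\<lambda>n. u n z)" for z
  have "u' \<in> borel_measurable M" unfolding u'_def by (rule borel_measurable_lim_metric) measurable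
  moreover have "AE z in M. (\<lambda>n. u n z) \<longlonglongrightarrow> u' z"
    using ae by eventually_elim (simp add: u'_def convergent_LIMSEQ_iff)
  ultimately show ?thesis by blast
qed

lemma Fatou_sq_norm:
  assumes u: "\<And>n. sq_int M (u n)" and v: "sq_int M v"
    and [measurable]: "u' \<in> borel_measurable M" and lim: "AE z in M. (\<lambda>n. u n z) \<longlonglongrightarrow> u' z"
    and le: "\<And>n. n \<ge> N \<Longrightarrow> sq_norm M (\<lambda>z. u n z - v z) \<le> C"
  shows "sq_int M (\<lambda>z. u' z - v z)" "sq_norm M (\<lambda>z. u' z - v z) \<le> C"
proof -
  have [measurable]: "u n \<in> borel_measurable M" "v \<in> borel_measurable M" for n
    using u v by (auto simp: sq_int_def)
  have C0: "0 \<le> C" using le[of N] sq_norm_nonneg[of M "\<lambda>z. u N z - v z"] by linarith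
  have "(\<integral>\<^sup>+z. ennreal ((cmod (u' z - v z))\<^sup>2) \<partial>M)
      = (\<integral>\<^sup>+z. liminf (\<lambda>n. ennreal ((cmod (u (n + N) z - v z))\<^sup>2)) \<partial>M)"
  proof (rule nn_integral_cong_AE, use lim in eventually_elim)
    fix z assume "(\<lambda>n. u n z) \<longlonglongrightarrow> u' z"
    then have "(\<lambda>n. u (n + N) z) \<longlonglongrightarrow> u' z" by (rule LIMSEQ_ignore_initial_segment)
    then have "(\<lambda>n. ennreal ((cmod (u (n + N) z - v z))\<^sup>2)) \<longlonglongrightarrow> ennreal ((cmod (u' z - v z))\<^sup>2)"
      by (intro tendsto_ennrealI tendsto_power tendsto_norm tendsto_diff tendsto_const)
    then show "ennreal ((cmod (u' z - v z))\<^sup>2) = liminf (\<lambda>n. ennreal ((cmod (u (n + N) z - v z))\<^sup>2))"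
      by (rule lim_imp_Liminf[OF sequentially_bot, symmetric])
  qed
  also have "\<dots> \<le> liminf (\<lambda>n. \<integral>\<^sup>+z. ennreal ((cmod (u (n + N) z - v z))\<^sup>2) \<partial>M)"
    by (rule nn_integral_liminf) measurable
  also have "\<dots> \<le> liminf (\<lambda>n::nat. ennreal C)"
  proof (rule Liminf_mono, rule always_eventually, rule allI)
    fix n
    have "(\<integral>\<^sup>+z. ennreal ((cmod (u (n + N) z - v z))\<^sup>2) \<partial>M) = ennreal (sq_norm M (\<lambda>z. u (n + N) z - v z))"
      unfolding sq_norm_def
      by (rule nn_integral_eq_integral) (use sq_int_diff(1)[OF u v] in \<open>auto simp: sq_int_def\<close>)
    then show "(\<integral>\<^sup>+z. ennreal ((cmod (u (n + N) z - v z))\<^sup>2) \<partial>M) \<le> ennreal C"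
      using le by (simp add: ennreal_leI)
  qed
  finally have b: "(\<integral>\<^sup>+z. ennreal ((cmod (u' z - v z))\<^sup>2) \<partial>M) \<le> ennreal C"
    by (simp add: Liminf_const)
  then have i: "integrable M (\<lambda>z. (cmod (u' z - v z))\<^sup>2)"
    by (intro integrableI_bounded) (auto intro: order.strict_trans1)
  then show "sq_int M (\<lambda>z. u' z - v z)" by (simp add: sq_int_def)
  from b show "sq_norm M (\<lambda>z. u' z - v z) \<le> C"
    using nn_integral_eq_integral[OF i] C0 by (simp add: sq_norm_def)
qed

text \<open>The Riesz-Fischer theorem. Along a subsequence with \<open>sq_norm\<close>-gaps below \<open>(1/8) ^ k\<close> the series
  of the weighted squares \<open>2 ^ k |u (k + 1) - u k|\<^sup>2\<close> has a finite integral, hence converges almost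
  everywhere, and then so does the subsequence. Fatou's lemma controls the distance of the whole
  sequence to the pointwise limit.\<close>

lemma Riesz_Fischer:
  assumes u: "\<And>n. sq_int M (u n)"
    and Cauchy: "\<And>e. e > 0 \<Longrightarrow> \<exists>N. \<forall>k\<ge>N. \<forall>n\<ge>N. sq_norm M (\<lambda>z. u k z - u n z) < e"
  shows "\<exists>u'. sq_int M u' \<and> (\<lambda>n. sq_norm M (\<lambda>z. u n z - u' z)) \<longlonglongrightarrow> 0"
proof -
  define N where "N j = (SOME N. \<forall>k\<ge>N. \<forall>n\<ge>N. sq_norm M (\<lambda>z. u k z - u n z) < (1/8) ^ j)" for j
  have N: "sq_norm M (\<lambda>z. u k z - u n z) < (1/8) ^ j" if "k \<ge> N j" "n \<ge> N j" for j k n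
    using someI_ex[OF Cauchy[of "(1/8) ^ j"]] that unfolding N_def by simp
  define r where "r j = (\<Sum>i\<le>j. N i)  + j" for j
  have rN: "N j \<le> r j" for j using member_le_sum[of j "{..j}" N] by (simp add: r_def)
  have rS: "r j < r (Suc j)" for j by (simp add: r_def)
  then have rm: "strict_mono r" by (simp add: strict_mono_Suc_iff)
  have gap: "sq_norm M (\<lambda>z. u (r (Suc k)) z - u (r k) z) \<le> (1/8) ^ k" for k
    by (rule less_imp_le, rule N) (use rN[of k] rS[of k] in linarith)+
  obtain u' where u' [measurable]: "u' \<in> borel_measurable M"
    and lim: "AE z in M. (\<lambda>n. u (r n) z) \<longlonglongrightarrow> u' z"
    using fast_Cauchy_limit[where u="\<lambda>n. u (r n)", OF u gap] by (elim bexE)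
  have close: "\<exists>K. \<forall>k\<ge>K. sq_int M (\<lambda>z. u' z - u k z) \<and> sq_norm M (\<lambda>z. u' z - u k z) \<le> e" if "e > 0" for e
  proof -
    obtain K where K: "\<And>k n. k \<ge> K \<Longrightarrow> n \<ge> K \<Longrightarrow> sq_norm M (\<lambda>z. u k z - u n z) < e"
      using Cauchy[OF \<open>e > 0\<close>] by blast
    have "sq_int M (\<lambda>z. u' z - u k z) \<and> sq_norm M (\<lambda>z. u' z - u k z) \<le> e" if k: "k \<ge> K" for k
    proof -
      have le: "sq_norm M (\<lambda>z. u (r n) z - u k z) \<le> e" if "n \<ge> K" for n
        using K[of "r n" k] seq_suble[OF rm, of n] that k by simp
      show ?thesis
        using Fatou_sq_norm[of M "\<lambda>n. u (r n)" "u k" u' K e, OF u u u' lim le] by simp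
    qed
    then show ?thesis by blast
  qed
  obtain K where "sq_int M (\<lambda>z. u' z - u K z)" using close[of 1] by auto
  from sq_int_add(1)[OF this u[of K]] have s: "sq_int M u'" by simp
  have "(\<lambda>n. sq_norm M (\<lambda>z. u n z - u' z)) \<longlonglongrightarrow> 0"
  proof (rule LIMSEQ_I)
    fix e :: real assume "e > 0"
    then obtain K where K: "\<And>k. k \<ge> K \<Longrightarrow> sq_norm M (\<lambda>z. u' z - u k z) \<le> e / 2"
      using close[of "e/2"] by auto
    have "norm (sq_norm M (\<lambda>z. u n z - u' z) - 0) < e" if "n \<ge> K" for n
      using K[OF that] \<open>e > 0\<close> sq_norm_nonneg[of M "\<lambda>z. u n z - u' z"]
        sq_norm_minus_commute[of M "u n" u'] by simp
    then show "\<exists>K. \<forall>n\<ge>K. norm (sq_norm M (\<lambda>z. u n z - u' z) - 0) < e" by blast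
  qed
  with s show ?thesis by blast
qed

section \<open>Smooth functions\<close>

subsection \<open>Smooth functions of one real variable\<close>

text \<open>Derivatives are taken on the whole line, not within \<open>T\<close>, so this is the usual notion only for
  open \<open>T\<close>.\<close>

primrec Ck_on :: "nat \<Rightarrow> real set \<Rightarrow> (real \<Rightarrow> real) \<Rightarrow> bool" where
  "Ck_on 0 T f \<longleftrightarrow> continuous_on T f"
| "Ck_on (Suc k) T f \<longleftrightarrow> (\<exists>f'. (\<forall>t\<in>T. (f has_real_derivative f' t) (at t)) \<and> Ck_on k T f')"

lemma Ck_on_continuous: "Ck_on k T f \<Longrightarrow> continuous_on T f"
  by (cases k) (auto intro: DERIV_continuous_on has_field_derivative_at_within)

lemma Ck_on_SucD: "Ck_on (Suc k) T f \<Longrightarrow> Ck_on k T f"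
proof (induction k arbitrary: f)
  case 0
  then show ?case using Ck_on_continuous[OF 0] by simp
next
  case (Suc k)
  from Suc.prems obtain f' where "\<forall>t\<in>T. (f has_real_derivative f' t) (at t)" "Ck_on (Suc k) T f'"
    by auto
  then show ?case using Suc.IH[of f'] by auto
qed

lemma Ck_on_subset: "Ck_on k T f \<Longrightarrow> S \<subseteq> T \<Longrightarrow> Ck_on k S f"
proof (induction k arbitrary: f)
  case 0
  then show ?case using continuous_on_subset by auto
next
  case (Suc k)
  then obtain f' where "\<forall>t\<in>T. (f has_real_derivative f' t) (at t)" "Ck_on k T f'"
    by auto
  then show ?case using Suc.IH[of f'] Suc.prems(2) by auto
qed

lemma Ck_on_const: "Ck_on k T (\<lambda>t. c)"
proof (induction k arbitrary: c)
  case (Suc k)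
  show ?case using Suc[of 0] by (auto intro!: exI[of _ "\<lambda>t. 0"])
qed simp

lemma Ck_on_add: "Ck_on k T f \<Longrightarrow> Ck_on k T g \<Longrightarrow> Ck_on k T (\<lambda>t. f t + g t)"
proof (induction k arbitrary: f g)
  case 0
  then show ?case by (auto intro: continuous_on_add)
next
  case (Suc k)
  then obtain f' g' where "\<forall>t\<in>T. (f has_real_derivative f' t) (at t)" "Ck_on k T f'"
     "\<forall>t\<in>T. (g has_real_derivative g' t) (at t)" "Ck_on k T g'"
    by auto
  then show ?case using Suc.IH[of f' g'] by (auto intro!: exI[of _ "\<lambda>t. f' t + g' t"] DERIV_add)
qed

lemma Ck_on_mult: "Ck_on k T f \<Longrightarrow> Ck_on k T g \<Longrightarrow> Ck_on k T (\<lambda>t. f t * g t)"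
proof (induction k arbitrary: f g)
  case 0
  then show ?case by (auto intro: continuous_on_mult)
next
  case (Suc k)
  then obtain f' g' where d: "\<forall>t\<in>T. (f has_real_derivative f' t) (at t)" "Ck_on k T f'"
     "\<forall>t\<in>T. (g has_real_derivative g' t) (at t)" "Ck_on k T g'"
    by auto
  have "Ck_on k T (\<lambda>t. f' t * g t + g' t * f t)"
    using Suc.IH[of f' g] Suc.IH[of g' f] Ck_on_SucD[OF Suc.prems(1)] Ck_on_SucD[OF Suc.prems(2)] d
    by (intro Ck_on_add) auto
  then show ?case using d by (auto intro!: exI[of _ "\<lambda>t. f' t * g t + g' t * f t"] DERIV_mult)
qed

lemma Ck_on_affine:
  "Ck_on k T f \<Longrightarrow> (\<And>t. t \<in> S \<Longrightarrow> a * t + b \<in> T) \<Longrightarrow> Ck_on k S (\<lambda>t. f (a * t + b))"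
proof (induction k arbitrary: f)
  case 0
  then show ?case
    by (auto intro!: continuous_on_compose2[of T f S "\<lambda>t. a * t + b"] continuous_intros)
next
  case (Suc k)
  then obtain f' where d: "\<forall>t\<in>T. (f has_real_derivative f' t) (at t)" "Ck_on k T f'" by auto
  have "((\<lambda>t. f (a * t + b)) has_real_derivative f' (a * t + b) * a) (at t)" if "t \<in> S" for t
  proof -
    have "(f has_real_derivative f' (a * t + b)) (at (a * t + b))" using d that Suc.prems by auto
    moreover have "((\<lambda>t. a * t + b) has_real_derivative a) (at t)"
      by (auto intro!: derivative_eq_intros)
    ultimately show ?thesis by (rule DERIV_chain2)
  qed
  moreover have "Ck_on k S (\<lambda>t. f' (a * t + b) * a)"
    using Suc.IH[OF d(2)] Suc.prems(2) by (intro Ck_on_mult Ck_on_const) auto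
  ultimately show ?case unfolding Ck_on.simps by (intro exI[of _ "\<lambda>t. f' (a * t + b) * a"]) blast
qed

lemma Ck_on_cong:
  assumes "open T" "\<And>t. t \<in> T \<Longrightarrow> f t = g t" "Ck_on k T f"
  shows "Ck_on k T g"
proof (cases k)
  case 0
  then show ?thesis using assms continuous_on_cong[of T T f g] by simp
next
  case (Suc j)
  with assms obtain f' where d: "\<forall>t\<in>T. (f has_real_derivative f' t) (at t)" "Ck_on j T f'" by auto
  have "(g has_real_derivative f' t) (at t)" if "t \<in> T" for t
    by (rule has_field_derivative_transform_within_open[of f _ _ T]) (use assms d that in auto)
  then show ?thesis using d Suc by auto
qed

lemma Ck_on_Un:
  assumes "open S" "open T"
  shows "Ck_on k S f \<Longrightarrow> Ck_on k T f \<Longrightarrow> Ck_on k (S \<union> T) f"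
proof (induction k arbitrary: f)
  case 0
  then show ?case using assms by (auto intro: continuous_on_open_Un)
next
  case (Suc k)
  then obtain f1 f2 where d: "\<forall>t\<in>S. (f has_real_derivative f1 t) (at t)" "Ck_on k S f1"
    "\<forall>t\<in>T. (f has_real_derivative f2 t) (at t)" "Ck_on k T f2"
    by auto
  define f' where "f' t = (if t \<in> S then f1 t else f2 t)" for t
  have "f1 t = f2 t" if "t \<in> S" "t \<in> T" for t
    using d that DERIV_unique by blast
  then have e: "\<And>t. t \<in> S \<Longrightarrow> f' t = f1 t" and e2: "\<And>t. t \<in> T \<Longrightarrow> f' t = f2 t"
    by (auto simp: f'_def)
  have "Ck_on k (S \<union> T) f'"
  proof (rule Suc.IH)
    show "Ck_on k S f'" by (rule Ck_on_cong[OF assms(1) _ d(2)]) (simp add: e)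
    show "Ck_on k T f'" by (rule Ck_on_cong[OF assms(2) _ d(4)]) (simp add: e2)
  qed
  moreover have "\<forall>t\<in>S \<union> T. (f has_real_derivative f' t) (at t)"
    using d e e2 by auto
  ultimately show ?case by auto
qed

lemma Ck_on_powr: "Ck_on k {0<..} (\<lambda>t. t powr s)"
proof (induction k arbitrary: s)
  case 0
  then show ?case by (auto intro!: continuous_intros)
next
  case (Suc k)
  have "((\<lambda>t. t powr s) has_real_derivative s * t powr (s - 1)) (at t)" if "t > 0" for t
    using has_real_derivative_powr[OF that] .
  moreover have "Ck_on k {0<..} (\<lambda>t. s * t powr (s - 1))"
    by (intro Ck_on_mult Ck_on_const Suc)
  ultimately show ?case by (auto intro!: exI[of _ "\<lambda>t. s * t powr (s - 1)"])
qed

subsection \<open>Cutoff functions\<close>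

text \<open>All derivatives of \<open>exp (- 1 / t)\<close> are polynomials in \<open>1 / t\<close> times \<open>exp (- 1 / t)\<close>, so
  it is convenient to prove smoothness for this whole family at once.\<close>

definition flat_poly :: "real poly \<Rightarrow> real \<Rightarrow> real" where
  "flat_poly p t = (if t > 0 then poly p (1 / t) * exp (- (1 / t)) else 0)"

lemma poly_times_exp_minus_tendsto_0: "((\<lambda>y. poly p y * exp (- y)) \<longlongrightarrow> (0::real)) at_top"
proof -
  have "((\<lambda>y. \<Sum>i\<le>degree p. coeff p i * (y ^ i / exp y)) \<longlongrightarrow> (\<Sum>i\<le>degree p. coeff p i * 0)) at_top"
    by (intro tendsto_sum tendsto_mult tendsto_const tendsto_power_div_exp_0)
  then show ?thesis
    by (simp add: poly_altdef sum_distrib_right exp_minus divide_inverse mult.assoc)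
qed

lemma flat_poly_derivative:
  "(flat_poly p has_real_derivative flat_poly ((p - pderiv p) * [:0, 0, 1:]) t) (at t)"
proof -
  consider "t > 0" | "t < 0" | "t = 0" by linarith
  then show ?thesis
  proof cases
    case 1
    have d: "((\<lambda>t. poly p (1 / t) * exp (- (1 / t))) has_real_derivative
        poly ((p - pderiv p) * [:0, 0, 1:]) (1 / t) * exp (- (1 / t))) (at t)"
      using 1 by (auto intro!: derivative_eq_intros simp: field_simps power2_eq_square)
    show ?thesis
      by (rule has_field_derivative_transform_within_open[of "\<lambda>t. poly p (1 / t) * exp (- (1 / t))" _ _ "{0<..}"])
         (use d 1 in \<open>auto simp: flat_poly_def\<close>)
  next
    case 2
    show ?thesis
      by (rule has_field_derivative_transform_within_open[of "\<lambda>t. 0" _ _ "{..<0}"])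
         (use 2 in \<open>auto simp: flat_poly_def\<close>)
  next
    case 3
    have "((\<lambda>h. flat_poly p h / h) \<longlongrightarrow> 0) (at_right 0)"
    proof (rule Lim_transform_eventually)
      have "((\<lambda>h::real. poly (p * [:0, 1:]) (inverse h) * exp (- inverse h)) \<longlongrightarrow> 0) (at_right 0)"
        by (rule filterlim_compose[OF poly_times_exp_minus_tendsto_0 filterlim_inverse_at_top_right])
      then show "((\<lambda>h::real. poly (p * [:0, 1:]) (inverse h) * exp (- inverse h)) \<longlongrightarrow> 0) (at_right 0)" .
      show "\<forall>\<^sub>F h in at_right 0. poly (p * [:0, 1:]) (inverse h) * exp (- inverse h) = flat_poly p h / h"
        by (auto simp: eventually_at_right_field flat_poly_def divide_inverse intro!: exI[of _ 1])
    qed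
    moreover have "((\<lambda>h. flat_poly p h / h) \<longlongrightarrow> 0) (at_left 0)"
    proof (rule Lim_transform_eventually)
      show "((\<lambda>h::real. 0::real) \<longlongrightarrow> 0) (at_left 0)" by simp
      show "\<forall>\<^sub>F h in at_left 0. 0 = flat_poly p h / h"
        by (auto simp: eventually_at_left_field flat_poly_def intro!: exI[of _ "-1"])
    qed
    ultimately have "((\<lambda>h. flat_poly p h / h) \<longlongrightarrow> 0) (at 0)"
      by (simp add: filterlim_at_split)
    then show ?thesis using 3 by (simp add: DERIV_def flat_poly_def)
  qed
qed

lemma Ck_on_flat_poly: "Ck_on k UNIV (flat_poly p)"
proof (induction k arbitrary: p)
  case 0
  then show ?case using flat_poly_derivative DERIV_continuous_on by (auto intro!: DERIV_continuous_on)
next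
  case (Suc k)
  then show ?case using flat_poly_derivative by auto
qed

text \<open>Smooth functions compactly supported in the open interval; composed with \<open>|z|\<^sup>2\<close> they
  become radial test functions that also vanish near the centre of the disk.\<close>

definition interval_bump :: "(real \<Rightarrow> real) \<Rightarrow> bool" where
  "interval_bump X \<longleftrightarrow> (\<forall>k. Ck_on k UNIV X) \<and>
     (\<exists>a b. 0 < a \<and> a < b \<and> b < 1 \<and> (\<forall>t. t \<notin> {a..b} \<longrightarrow> X t = 0))"

text \<open>The factor \<open>g\<close> may be singular at the end points of the interval, like \<open>(1 - t) powr s\<close>: the
  product vanishes near them.\<close>

lemma interval_bump_mult:
  assumes "interval_bump X" "\<And>k. Ck_on k {0<..<1} g"
  shows "interval_bump (\<lambda>t. g t * X t)"
proof -
  obtain a b where ab: "0 < a" "a < b" "b < 1" "\<And>t. t \<notin> {a..b} \<Longrightarrow> X t = 0"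
    using assms(1) by (auto simp: interval_bump_def)
  have "Ck_on k UNIV (\<lambda>t. g t * X t)" for k
  proof -
    have "Ck_on k {0<..<1} (\<lambda>t. g t * X t)"
      using assms Ck_on_subset[of k UNIV X] by (intro Ck_on_mult) (auto simp: interval_bump_def)
    moreover have "Ck_on k (- {a..b}) (\<lambda>t. g t * X t)"
      by (rule Ck_on_cong[OF _ _ Ck_on_const[of k _ 0]]) (use ab in auto)
    moreover have "{0<..<1} \<union> (- {a..b}) = UNIV" using ab by auto
    ultimately show ?thesis using Ck_on_Un[of "{0<..<1}" "- {a..b}" k] by auto
  qed
  moreover have "\<forall>t. t \<notin> {a..b} \<longrightarrow> g t * X t = 0" using ab by simp
  ultimately show ?thesis using ab(1-3) unfolding interval_bump_def by blast
qed

text \<open>The two factors vanish for \<open>t \<le> 1 / (n + 3)\<close> and for \<open>t \<ge> 1 - 1 / (n + 3)\<close>. The shift by 3 makes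
  all of these functions positive at \<open>1 / 2\<close>.\<close>

definition cutoff :: "nat \<Rightarrow> real \<Rightarrow> real" where
  "cutoff n t = flat_poly 1 (real (n + 3) * t - 1) * flat_poly 1 (real (n + 3) * (1 - t) - 1)"

lemma flat_poly_1_range: "0 \<le> flat_poly 1 t" "flat_poly 1 t \<le> 1"
  by (auto simp: flat_poly_def)

lemma cutoff_range: "0 \<le> cutoff n t" "cutoff n t \<le> 1"
  using flat_poly_1_range by (auto simp: cutoff_def intro: mult_le_one)

lemma interval_bump_cutoff: "interval_bump (cutoff n)"
  unfolding interval_bump_def
proof (intro conjI allI exI impI)
  fix k
  have "Ck_on k UNIV (\<lambda>t. flat_poly 1 (real (n + 3) * t + (- 1)))"
       "Ck_on k UNIV (\<lambda>t. flat_poly 1 (- real (n + 3) * t + (real (n + 3) - 1)))"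
    by (rule Ck_on_affine[OF Ck_on_flat_poly]; simp)+
  then have "Ck_on k UNIV (\<lambda>t. flat_poly 1 (real (n + 3) * t + (- 1)) *
      flat_poly 1 (- real (n + 3) * t + (real (n + 3) - 1)))"
    by (rule Ck_on_mult)
  also have "(\<lambda>t. flat_poly 1 (real (n + 3) * t + (- 1)) *
      flat_poly 1 (- real (n + 3) * t + (real (n + 3) - 1))) = cutoff n"
    by (auto simp: cutoff_def algebra_simps)
  finally show "Ck_on k UNIV (cutoff n)" .
next
  show "0 < 1 / real (n + 3)" by simp
  show "1 / real (n + 3) < 1 - 1 / real (n + 3)" by (simp add: field_simps)
  show "1 - 1 / real (n + 3) < 1" by simp
  fix t assume t: "t \<notin> {1 / real (n + 3)..1 - 1 / real (n + 3)}"
  then have "real (n + 3) * t - 1 \<le> 0 \<or> real (n + 3) * (1 - t) - 1 \<le> 0"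
    by (auto simp: field_simps)
  then show "cutoff n t = 0" by (auto simp: cutoff_def flat_poly_def)
qed

lemma cutoff_pos: "0 < cutoff n (1 / 2)"
proof -
  have "real (n + 3) * (1/2) - 1 > 0" by simp
  then show ?thesis by (simp add: cutoff_def flat_poly_def)
qed

lemma cutoff_tendsto:
  assumes "0 < t" "t < 1"
  shows "(\<lambda>n. cutoff n t) \<longlonglongrightarrow> 1"
proof -
  have fl: "(\<lambda>n. flat_poly 1 (real (n + 3) * c - 1)) \<longlonglongrightarrow> 1" if "c > 0" for c
  proof -
    have "filterlim (\<lambda>n. real (n + 3) * c) at_top sequentially"
      using that filterlim_tendsto_pos_mult_at_top[OF tendsto_const[of c], of "\<lambda>n. real (n+3)" sequentially]
        filterlim_compose[OF filterlim_real_sequentially filterlim_add_const_nat_at_top[of 3]]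
      by (simp add: mult.commute)
    then have inf: "filterlim (\<lambda>n. real (n + 3) * c - 1) at_top sequentially"
      using filterlim_tendsto_add_at_top[OF tendsto_const[of "-1"], of "\<lambda>n. real (n + 3) * c" sequentially]
      by (simp add: algebra_simps)
    have "(\<lambda>n. exp (- (1 / (real (n + 3) * c - 1)))) \<longlonglongrightarrow> exp (- 0)"
      by (intro tendsto_exp tendsto_minus tendsto_divide_0[OF tendsto_const]
          filterlim_at_top_imp_at_infinity inf)
    moreover have "\<forall>\<^sub>F n in sequentially. exp (- (1 / (real (n + 3) * c - 1))) = flat_poly 1 (real (n + 3) * c - 1)"
      using inf[unfolded filterlim_at_top_dense, rule_format, of 0]
      by eventually_elim (simp add: flat_poly_def)
    ultimately have "(\<lambda>n. flat_poly 1 (real (n + 3) * c - 1)) \<longlonglongrightarrow> exp (- 0)"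
      by (rule Lim_transform_eventually)
    then show ?thesis by simp
  qed
  have "(\<lambda>n. cutoff n t) \<longlonglongrightarrow> 1 * 1"
    unfolding cutoff_def by (intro tendsto_mult fl) (use assms in auto)
  then show ?thesis by simp
qed

text \<open>The primitive is normalized to vanish above the support of \<open>X\<close>.\<close>

lemma interval_bump_primitive:
  assumes "interval_bump X"
  obtains Y a b where "\<And>t. (Y has_real_derivative X t) (at t)" "\<And>k. Ck_on k UNIV Y"
    "0 < a" "a < b" "b < 1" "\<And>t. t \<ge> b \<Longrightarrow> Y t = 0" "\<And>t. t \<le> a \<Longrightarrow> Y t = Y 0"
proof -
  obtain a b where ab: "0 < a" "a < b" "b < 1" "\<And>t. t \<notin> {a..b} \<Longrightarrow> X t = 0"
    using assms(1) by (auto simp: interval_bump_def)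
  have sm: "\<And>k. Ck_on k UNIV X" using assms by (simp add: interval_bump_def)
  have c: "continuous_on UNIV X" using sm[of 0] by simp
  obtain F where F: "\<And>t. (F has_vector_derivative X t) (at t)"
    using einterval_antiderivative[of "-\<infinity>" "\<infinity>" X] c
    by (auto simp: continuous_on_eq_continuous_at)
  define Y where "Y t = F t - F 1" for t
  have d: "(Y has_real_derivative X t) (at t)" for t
    unfolding Y_def using F[of t]
    by (auto intro!: derivative_eq_intros simp: has_real_derivative_iff_has_vector_derivative)
  have "continuous_on UNIV X" using sm[of 0] by simp
  have sY: "Ck_on k UNIV Y" for k
    using sm d by (cases k) (auto intro!: DERIV_continuous_on)
  have Yb: "Y t = 0" if "t \<ge> b" for t
  proof -
    have x: "X t = 0" if "t \<ge> b" for t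
    proof (cases "t = b")
      case True
      have "isCont X b" using c by (simp add: continuous_on_eq_continuous_at)
      then have "(X \<longlongrightarrow> X b) (at_right b)"
        by (simp add: isCont_def filterlim_at_split)
      moreover have "(X \<longlongrightarrow> 0) (at_right b)"
        by (rule Lim_transform_eventually[OF tendsto_const])
           (use ab(4) in \<open>auto simp: eventually_at_right_field intro!: exI[of _ "b + 1"]\<close>)
      ultimately show ?thesis using True tendsto_unique[OF trivial_limit_at_right_real] by blast
    qed (use ab(4) that in auto)
    have "\<exists>c. \<forall>t\<in>{b..}. Y t = c"
    proof (rule has_field_derivative_zero_constant)
      fix t assume "t \<in> {b..}"
      then have "X t = 0" by (simp add: x)
      with d[of t] show "(Y has_real_derivative 0) (at t within {b..})"
        by (auto intro: has_field_derivative_at_within)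
    qed simp
    then obtain c where c: "\<forall>t\<in>{b..}. Y t = c" by (elim exE)
    have "Y 1 = 0" by (simp add: Y_def)
    with c bspec[OF c, of 1] bspec[OF c, of t] that ab(3) show ?thesis by simp
  qed
  have Ya: "Y t = Y 0" if "t \<le> a / 2" for t
  proof -
    have "\<exists>c. \<forall>t\<in>{..a/2}. Y t = c"
    proof (rule has_field_derivative_zero_constant)
      fix t assume "t \<in> {..a/2}"
      then have "X t = 0" using ab by auto
      with d[of t] show "(Y has_real_derivative 0) (at t within {..a/2})"
        by (auto intro: has_field_derivative_at_within)
    qed simp
    then obtain c where c: "\<forall>t\<in>{..a/2}. Y t = c" by (elim exE)
    from bspec[OF c, of 0] bspec[OF c, of t] that ab(1) show ?thesis by simp
  qed
  show ?thesis by (rule that[of Y "a / 2" b, OF d sY _ _ ab(3) Yb Ya]) (use ab(1,2) in auto)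
qed

subsection \<open>Smooth functions on the plane\<close>

lemma dir_deriv_eqI: "(u has_derivative D) (at z) \<Longrightarrow> dir_deriv v u z = D v"
  unfolding dir_deriv_def by (drule frechet_derivative_at) simp

lemma C_times_diff_continuous: "C_times_diff k u \<Longrightarrow> continuous_on UNIV u"
  by (cases k) (auto simp: continuous_on_eq_continuous_at intro: differentiable_imp_continuous_within)

lemma C_times_diff_SucD: "C_times_diff (Suc k) u \<Longrightarrow> C_times_diff k u"
proof (induction k arbitrary: u)
  case 0
  then show ?case using C_times_diff_continuous[OF 0] by simp
next
  case (Suc k)
  have "u differentiable (at z)" "C_times_diff (Suc k) (dir_deriv v u)" for v z
    using Suc.prems by simp_all
  then show ?case using Suc.IH by simp
qed

definition smooth :: "(complex \<Rightarrow> complex) \<Rightarrow> bool" where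
  "smooth u \<longleftrightarrow> (\<forall>k. C_times_diff k u)"

lemma smooth_continuous: "smooth u \<Longrightarrow> continuous_on UNIV u"
  by (auto simp: smooth_def intro: C_times_diff_continuous)

lemma smooth_differentiable: "smooth u \<Longrightarrow> u differentiable (at z)"
  unfolding smooth_def by (drule spec[of _ "Suc 0"]) simp

lemma smooth_dir_deriv: "smooth u \<Longrightarrow> smooth (dir_deriv v u)"
  unfolding smooth_def
proof
  fix k assume "\<forall>k. C_times_diff k u"
  from spec[OF this, of "Suc k"] show "C_times_diff k (dir_deriv v u)" by simp
qed

lemma smooth_has_derivative: "smooth u \<Longrightarrow> (u has_derivative (\<lambda>v. dir_deriv v u z)) (at z)"
  using smooth_differentiable[of u z] by (simp add: dir_deriv_def frechet_derivative_works)

lemma dir_deriv_add: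
  assumes "f differentiable (at z)" "g differentiable (at z)"
  shows "dir_deriv v (\<lambda>z. f z + g z) z = dir_deriv v f z + dir_deriv v g z"
  using dir_deriv_eqI[OF has_derivative_add[OF assms[unfolded frechet_derivative_works]]]
  by (simp add: dir_deriv_def)

lemma dir_deriv_mult:
  assumes "f differentiable (at z)" "g differentiable (at z)"
  shows "dir_deriv v (\<lambda>z. f z * g z) z = dir_deriv v f z * g z + f z * dir_deriv v g z"
  using dir_deriv_eqI[OF has_derivative_mult[OF assms[unfolded frechet_derivative_works]]]
  by (simp add: dir_deriv_def)

lemma dir_deriv_const: "dir_deriv v (\<lambda>z. c) z = 0"
  by (rule dir_deriv_eqI[OF has_derivative_const])

lemma C_times_diff_const: "C_times_diff k (\<lambda>z. c)"
proof (induction k arbitrary: c)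
  case (Suc k)
  have "dir_deriv v (\<lambda>z. c) = (\<lambda>z. 0)" for v by (auto simp: dir_deriv_const)
  then show ?case using Suc by simp
qed simp

lemma C_times_diff_add:
  "C_times_diff k f \<Longrightarrow> C_times_diff k g \<Longrightarrow> C_times_diff k (\<lambda>z. f z + g z)"
proof (induction k arbitrary: f g)
  case 0
  then show ?case by (auto intro: continuous_on_add)
next
  case (Suc k)
  then have "dir_deriv v (\<lambda>z. f z + g z) = (\<lambda>z. dir_deriv v f z + dir_deriv v g z)" for v
    by (auto simp: dir_deriv_add)
  then show ?case using Suc by (auto intro: differentiable_add)
qed

lemma C_times_diff_mult:
  "C_times_diff k f \<Longrightarrow> C_times_diff k g \<Longrightarrow> C_times_diff k (\<lambda>z. f z * g z)"
proof (induction k arbitrary: f g)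
  case 0
  then show ?case by (auto intro: continuous_on_mult)
next
  case (Suc k)
  then have "dir_deriv v (\<lambda>z. f z * g z) = (\<lambda>z. dir_deriv v f z * g z + f z * dir_deriv v g z)" for v
    by (auto simp: dir_deriv_mult)
  moreover have "C_times_diff k (\<lambda>z. dir_deriv v f z * g z + f z * dir_deriv v g z)" for v
    using Suc.prems C_times_diff_SucD[OF Suc.prems(1)] C_times_diff_SucD[OF Suc.prems(2)]
    by (intro C_times_diff_add Suc.IH) auto
  ultimately show ?case using Suc.prems by (auto intro: differentiable_mult)
qed

lemma smooth_const: "smooth (\<lambda>z. c)"
  and smooth_add: "smooth f \<Longrightarrow> smooth g \<Longrightarrow> smooth (\<lambda>z. f z + g z)"
  and smooth_mult: "smooth f \<Longrightarrow> smooth g \<Longrightarrow> smooth (\<lambda>z. f z * g z)"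
  by (auto simp: smooth_def C_times_diff_const C_times_diff_add C_times_diff_mult)

lemma smooth_bounded_linear:
  assumes "bounded_linear L" shows "smooth L"
proof -
  have d: "(L has_derivative L) (at z)" for z by (rule bounded_linear_imp_has_derivative[OF assms])
  have "dir_deriv v L = (\<lambda>z. L v)" for v using dir_deriv_eqI[OF d] by auto
  then have "C_times_diff (Suc k) L" for k
    using d by (auto simp: C_times_diff_const differentiable_def)
  then have "C_times_diff k L" for k by (rule C_times_diff_SucD)
  then show ?thesis by (simp add: smooth_def)
qed

lemma smooth_ident: "smooth (\<lambda>z. z)" and smooth_cnj: "smooth cnj"
  by (intro smooth_bounded_linear bounded_linear_ident bounded_linear_cnj)+

lemma smooth_power: "smooth f \<Longrightarrow> smooth (\<lambda>z. f z ^ n)"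
  by (induction n) (auto intro: smooth_const smooth_mult)

lemma radial_has_derivative:
  assumes "(X has_real_derivative X') (at ((cmod z)\<^sup>2))"
  shows "((\<lambda>z. complex_of_real (X ((cmod z)\<^sup>2))) has_derivative
     (\<lambda>v. of_real (X' * (2 * (z \<bullet> v))))) (at z)"
proof -
  have "((\<lambda>z::complex. (cmod z)\<^sup>2) has_derivative (\<lambda>v. 2 * (z \<bullet> v))) (at z)"
    unfolding power2_norm_eq_inner
    by (auto intro!: derivative_eq_intros simp: inner_commute)
  then have "((\<lambda>z. X ((cmod z)\<^sup>2)) has_derivative (\<lambda>v. X' * (2 * (z \<bullet> v)))) (at z)"
    using has_derivative_compose[of "\<lambda>z::complex. (cmod z)\<^sup>2" _ z UNIV X "(*) X'"] assms
    by (simp add: has_field_derivative_def)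
  then show ?thesis by (rule has_derivative_of_real)
qed

lemma smooth_radial:
  assumes "\<And>k. Ck_on k UNIV X"
  shows "smooth (\<lambda>z. of_real (X ((cmod z)\<^sup>2)))"
proof -
  have "C_times_diff k (\<lambda>z. of_real (X ((cmod z)\<^sup>2)))" if "Ck_on k UNIV X" for k X
    using that
  proof (induction k arbitrary: X)
    case 0
    then show ?case
      by (auto intro!: continuous_intros continuous_on_compose2[of UNIV X])
  next
    case (Suc k)
    then obtain X' where d: "\<And>t. (X has_real_derivative X' t) (at t)" "Ck_on k UNIV X'" by auto
    have "dir_deriv v (\<lambda>z. of_real (X ((cmod z)\<^sup>2)))
        = (\<lambda>z. of_real (X' ((cmod z)\<^sup>2)) * of_real (2 * (z \<bullet> v)))" for v
      using dir_deriv_eqI[OF radial_has_derivative[OF d(1)]] by auto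
    moreover have "C_times_diff k (\<lambda>z. of_real (X' ((cmod z)\<^sup>2)) * of_real (2 * (z \<bullet> v)))" for v
      using smooth_bounded_linear[OF bounded_linear_compose[OF bounded_linear_of_real
          bounded_linear_compose[OF bounded_linear_mult_right bounded_linear_inner_left]], of 2 v]
      by (intro C_times_diff_mult Suc.IH d) (simp add: smooth_def)
    ultimately show ?case
      using radial_has_derivative[OF d(1)] by (auto simp: differentiable_def)
  qed
  then show ?thesis using assms by (auto simp: smooth_def)
qed

subsection \<open>Complex derivatives and test functions\<close>

definition dz :: "(complex \<Rightarrow> complex) \<Rightarrow> complex \<Rightarrow> complex" where
  "dz u z = (dir_deriv 1 u z - \<i> * dir_deriv \<i> u z) / 2"

definition dzb :: "(complex \<Rightarrow> complex) \<Rightarrow> complex \<Rightarrow> complex" where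
  "dzb u z = (dir_deriv 1 u z + \<i> * dir_deriv \<i> u z) / 2"

lemma dir_deriv_linear:
  assumes "u differentiable (at z)"
  shows "dir_deriv v u z = of_real (Re v) * dir_deriv 1 u z + of_real (Im v) * dir_deriv \<i> u z"
proof -
  have l: "linear (frechet_derivative u (at z))" by (rule linear_frechet_derivative[OF assms])
  have "v = Re v *\<^sub>R 1 + Im v *\<^sub>R \<i>" by (simp add: complex_eq_iff)
  then have "frechet_derivative u (at z) v = frechet_derivative u (at z) (Re v *\<^sub>R 1 + Im v *\<^sub>R \<i>)"
    by simp
  also have "\<dots> = Re v *\<^sub>R frechet_derivative u (at z) 1 + Im v *\<^sub>R frechet_derivative u (at z) \<i>"
    by (simp only: linear_add[OF l] linear_scale[OF l])
  finally show ?thesis by (simp add: dir_deriv_def scaleR_conv_of_real)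
qed

lemma dir_deriv_complex:
  assumes "u differentiable (at z)"
  shows "dir_deriv v u z = v * dz u z + cnj v * dzb u z"
proof -
  have alg: "a * p + b * q = (a + \<i> * b) * ((p - \<i> * q) / 2) + (a - \<i> * b) * ((p + \<i> * q) / 2)"
    for a b p q :: complex
  proof -
    have "(a + \<i> * b) * (p - \<i> * q) + (a - \<i> * b) * (p + \<i> * q) = 2 * (a * p) - 2 * ((\<i> * \<i>) * (b * q))"
      by (simp only: algebra_simps) simp
    then show ?thesis by (simp add: add_divide_distrib[symmetric])
  qed
  have v: "of_real (Re v) + \<i> * of_real (Im v) = v" "of_real (Re v) - \<i> * of_real (Im v) = cnj v"
    by (simp_all add: complex_eq_iff)
  show ?thesis
    unfolding dir_deriv_linear[OF assms, of v] dz_def dzb_def by (rule trans[OF alg]) (simp only: v)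
qed

lemma dz_eqI: "(u has_derivative D) (at z) \<Longrightarrow> dz u z = (D 1 - \<i> * D \<i>) / 2"
  by (simp add: dz_def dir_deriv_eqI)

lemma dz_mult:
  assumes "f differentiable (at z)" "g differentiable (at z)"
  shows "dz (\<lambda>z. f z * g z) z = dz f z * g z + f z * dz g z"
  by (simp add: dz_def dir_deriv_mult[OF assms] field_simps)

lemma dzb_mult:
  assumes "f differentiable (at z)" "g differentiable (at z)"
  shows "dzb (\<lambda>z. f z * g z) z = dzb f z * g z + f z * dzb g z"
  by (simp add: dzb_def dir_deriv_mult[OF assms] field_simps)

lemma dz_power: "dz (\<lambda>z. z ^ n) z = of_nat n * z ^ (n - 1)"
proof -
  have "((\<lambda>z::complex. z ^ n) has_field_derivative of_nat n * z ^ (n - 1)) (at z)"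
    by (auto intro!: derivative_eq_intros)
  from dz_eqI[OF this[unfolded has_field_derivative_def]] show ?thesis
    by (simp add: mult.commute mult.left_commute)
qed

lemma dz_cnj_power: "dz (\<lambda>z. cnj z ^ n) z = 0"
proof -
  have "((\<lambda>z::complex. z ^ n) has_field_derivative of_nat n * z ^ (n - 1)) (at z)"
    by (auto intro!: derivative_eq_intros)
  from dz_eqI[OF has_derivative_cnj[OF this[unfolded has_field_derivative_def]]]
  show ?thesis by (simp add: mult.commute mult.left_commute)
qed

lemma dz_radial:
  assumes "(X has_real_derivative X') (at ((cmod z)\<^sup>2))"
  shows "dz (\<lambda>z. of_real (X ((cmod z)\<^sup>2))) z = of_real X' * cnj z"
  unfolding dz_eqI[OF radial_has_derivative[OF assms]]
  by (simp add: complex_eq_iff inner_complex_def)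

lemma test_function_iff:
  "\<phi> \<in> test_functions \<longleftrightarrow> smooth \<phi> \<and> (\<exists>K. compact K \<and> K \<subseteq> ball 0 1 \<and> (\<forall>z. z \<notin> K \<longrightarrow> \<phi> z = 0))"
  by (simp add: test_functions_def smooth_def)

lemma test_functions_smooth: "\<phi> \<in> test_functions \<Longrightarrow> smooth \<phi>"
  by (simp add: test_function_iff)

lemma test_functions_zero: "(\<lambda>z. 0) \<in> test_functions"
  unfolding test_function_iff by (auto intro!: smooth_const exI[of _ "{}"])

lemma test_functions_mult: "\<phi> \<in> test_functions \<Longrightarrow> smooth f \<Longrightarrow> (\<lambda>z. f z * \<phi> z) \<in> test_functions"
  unfolding test_function_iff by (metis smooth_mult mult_zero_right)

lemma test_functions_add:
  assumes "\<phi> \<in> test_functions" "\<psi> \<in> test_functions"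
  shows "(\<lambda>z. \<phi> z + \<psi> z) \<in> test_functions"
proof -
  obtain K L where "compact K" "K \<subseteq> ball 0 1" "\<And>z. z \<notin> K \<Longrightarrow> \<phi> z = 0"
      "compact L" "L \<subseteq> ball 0 1" "\<And>z. z \<notin> L \<Longrightarrow> \<psi> z = 0"
    using assms unfolding test_function_iff by blast
  then have "compact (K \<union> L) \<and> K \<union> L \<subseteq> ball 0 1 \<and> (\<forall>z. z \<notin> K \<union> L \<longrightarrow> \<phi> z + \<psi> z = 0)"
    by auto
  moreover have "smooth (\<lambda>z. \<phi> z + \<psi> z)"
    using assms by (simp add: test_function_iff smooth_add)
  ultimately show ?thesis unfolding test_function_iff by (intro conjI exI[of _ "K \<union> L"]) auto
qed

lemma test_functions_scale: "\<phi> \<in> test_functions \<Longrightarrow> (\<lambda>z. c * \<phi> z) \<in> test_functions"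
  by (rule test_functions_mult[OF _ smooth_const])

lemma test_functions_diff:
  "\<phi> \<in> test_functions \<Longrightarrow> \<psi> \<in> test_functions \<Longrightarrow> (\<lambda>z. \<phi> z - \<psi> z) \<in> test_functions"
  using test_functions_add[of \<phi> "\<lambda>z. (- 1) * \<psi> z"] test_functions_scale[of \<psi> "- 1"] by simp

lemma test_functions_sum:
  "(\<And>i. i \<in> I \<Longrightarrow> \<phi> i \<in> test_functions) \<Longrightarrow> (\<lambda>z. \<Sum>i\<in>I. \<phi> i z) \<in> test_functions"
  by (induction I rule: infinite_finite_induct) (auto intro: test_functions_zero test_functions_add)

lemma test_functions_dir_deriv:
  assumes "\<phi> \<in> test_functions"
  shows "dir_deriv v \<phi> \<in> test_functions"
proof -
  obtain K where K: "compact K" "K \<subseteq> ball 0 1" "\<And>z. z \<notin> K \<Longrightarrow> \<phi> z = 0"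
    using assms unfolding test_function_iff by blast
  have "dir_deriv v \<phi> z = 0" if "z \<notin> K" for z
  proof -
    have "(\<phi> has_derivative (\<lambda>v. 0)) (at z)"
      by (rule has_derivative_transform_within_open[of "\<lambda>z. 0" _ _ _ "- K"])
         (use K that in \<open>auto intro: compact_imp_closed\<close>)
    then show ?thesis by (rule dir_deriv_eqI)
  qed
  then show ?thesis using K assms unfolding test_function_iff
    by (intro conjI smooth_dir_deriv exI[of _ K]) auto
qed

lemma test_functions_dz: "\<phi> \<in> test_functions \<Longrightarrow> dz \<phi> \<in> test_functions"
  and test_functions_dzb: "\<phi> \<in> test_functions \<Longrightarrow> dzb \<phi> \<in> test_functions"
proof -
  assume p: "\<phi> \<in> test_functions"
  have e: "dz \<phi> = (\<lambda>z. (1/2) * (dir_deriv 1 \<phi> z - \<i> * dir_deriv \<i> \<phi> z))"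
    "dzb \<phi> = (\<lambda>z. (1/2) * (dir_deriv 1 \<phi> z + \<i> * dir_deriv \<i> \<phi> z))"
    by (auto simp: dz_def dzb_def)
  show "dz \<phi> \<in> test_functions" "dzb \<phi> \<in> test_functions" unfolding e
    by (intro test_functions_scale test_functions_diff test_functions_add test_functions_dir_deriv p)+
qed

lemma dir_deriv_scale:
  assumes "f differentiable (at z)"
  shows "dir_deriv v (\<lambda>z. c * f z) z = c * dir_deriv v f z"
  using dir_deriv_mult[of "\<lambda>z. c" z f v] assms by (simp add: dir_deriv_const)

lemma dir_deriv_diff:
  assumes "f differentiable (at z)" "g differentiable (at z)"
  shows "dir_deriv v (\<lambda>z. f z - g z) z = dir_deriv v f z - dir_deriv v g z"
  using dir_deriv_eqI[OF has_derivative_diff[OF assms[unfolded frechet_derivative_works]]]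
  by (simp add: dir_deriv_def)

lemma dir_deriv_sum:
  assumes "\<And>i. i \<in> I \<Longrightarrow> f i differentiable (at z)"
  shows "dir_deriv v (\<lambda>z. \<Sum>i\<in>I. f i z) z = (\<Sum>i\<in>I. dir_deriv v (f i) z)"
  using assms
proof (induction I rule: infinite_finite_induct)
  case (insert i I)
  then show ?case
    by (simp add: dir_deriv_add differentiable_sum)
qed (auto simp: dir_deriv_const)

lemma dz_scale: "f differentiable (at z) \<Longrightarrow> dz (\<lambda>z. c * f z) z = c * dz f z"
  by (simp add: dz_def dir_deriv_scale field_simps)

subsection \<open>Explicit solutions of the inhomogeneous Cauchy-Riemann equation\<close>

lemma radial_test_function:
  assumes "smooth p" "\<And>k. Ck_on k UNIV W" "b < 1" "\<And>t. b < t \<Longrightarrow> W t = 0"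
  shows "(\<lambda>z. p z * of_real (W ((cmod z)\<^sup>2))) \<in> test_functions"
proof -
  have "W ((cmod z)\<^sup>2) = 0" if "z \<notin> cball 0 (sqrt b)" for z
  proof (rule assms(4), rule ccontr)
    assume "\<not> b < (cmod z)\<^sup>2"
    then have "sqrt ((cmod z)\<^sup>2) \<le> sqrt b" by (intro real_sqrt_le_mono) simp
    then show False using that by simp
  qed
  moreover have "cball 0 (sqrt b) \<subseteq> ball (0::complex) 1"
  proof
    fix z :: complex assume "z \<in> cball 0 (sqrt b)"
    then have "cmod z \<le> sqrt b" by simp
    also have "sqrt b < 1" using assms(3) by simp
    finally show "z \<in> ball 0 1" by simp
  qed
  ultimately show ?thesis unfolding test_function_iff
    by (intro conjI smooth_mult assms smooth_radial exI[of _ "cball 0 (sqrt b)"]) auto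
qed

text \<open>In each angular mode the equation \<open>dz \<phi> = g\<close> is an ordinary differential equation in
  \<open>t = |z|\<^sup>2\<close>. For antiholomorphic modes the primitive can be normalized at the boundary and the
  homogeneous solution near the centre, a power of \<open>cnj z\<close>, is smooth.\<close>

lemma dz_solution_antiholomorphic:
  assumes "interval_bump X"
  shows "\<exists>\<phi>\<in>test_functions. \<forall>z. dz \<phi> z = cnj z ^ Suc l * of_real (X ((cmod z)\<^sup>2))"
proof -
  obtain Y a b where Y: "\<And>t. (Y has_real_derivative X t) (at t)" "\<And>k. Ck_on k UNIV Y"
    and ab: "0 < a" "a < b" "b < 1" and Y0: "\<And>t. t \<ge> b \<Longrightarrow> Y t = 0"
    using interval_bump_primitive[OF assms] by metis
  define \<phi> where "\<phi> z = cnj z ^ l * of_real (Y ((cmod z)\<^sup>2))" for z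
  have s: "smooth (\<lambda>z. cnj z ^ l)" "smooth (\<lambda>z. of_real (Y ((cmod z)\<^sup>2)))"
    using smooth_power[OF smooth_cnj] smooth_radial[OF Y(2)] by auto
  have "\<phi> \<in> test_functions" unfolding \<phi>_def
    by (rule radial_test_function[OF s(1) Y(2) ab(3)]) (simp add: Y0)
  moreover have "dz \<phi> z = cnj z ^ Suc l * of_real (X ((cmod z)\<^sup>2))" for z
    unfolding \<phi>_def
    by (subst dz_mult[OF smooth_differentiable[OF s(1)] smooth_differentiable[OF s(2)]])
       (simp add: dz_cnj_power dz_radial[OF Y(1)])
  ultimately show ?thesis by blast
qed

text \<open>For holomorphic modes the solution must vanish near the centre as well as near the
  boundary, so one moment of the right-hand side has to vanish; this is arranged by
  subtracting a multiple of a fixed bump.\<close>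

lemma dz_solution_holomorphic:
  assumes X: "interval_bump X" and E: "interval_bump E" "\<And>t. 0 \<le> E t" "0 < t0" "0 < E t0"
  shows "\<exists>c. \<exists>\<phi>\<in>test_functions. \<forall>z. dz \<phi> z = z ^ l * of_real (X ((cmod z)\<^sup>2) - c * E ((cmod z)\<^sup>2))"
proof -
  have pw: "Ck_on k {0<..<1} (\<lambda>t. t ^ l)" for k
    by (rule Ck_on_cong[OF _ _ Ck_on_subset[OF Ck_on_powr[of k "real l"]]]) (auto simp: powr_realpow)
  obtain Y1 a1 b1 where Y1: "\<And>t. (Y1 has_real_derivative t ^ l * X t) (at t)" "\<And>k. Ck_on k UNIV Y1"
    and ab1: "0 < a1" "a1 < b1" "b1 < 1" "\<And>t. t \<ge> b1 \<Longrightarrow> Y1 t = 0" "\<And>t. t \<le> a1 \<Longrightarrow> Y1 t = Y1 0"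
    using interval_bump_primitive[OF interval_bump_mult[OF X pw]] by metis
  obtain Y2 a2 b2 where Y2: "\<And>t. (Y2 has_real_derivative t ^ l * E t) (at t)" "\<And>k. Ck_on k UNIV Y2"
    and ab2: "0 < a2" "a2 < b2" "b2 < 1" "\<And>t. t \<ge> b2 \<Longrightarrow> Y2 t = 0" "\<And>t. t \<le> a2 \<Longrightarrow> Y2 t = Y2 0"
    using interval_bump_primitive[OF interval_bump_mult[OF E(1) pw]] by metis
  have mono: "Y2 s \<le> Y2 t" if "0 \<le> s" "s \<le> t" for s t
    by (rule DERIV_nonneg_imp_nondecreasing[OF that(2)]) (use Y2(1) E(2) that(1) in \<open>force intro!: exI[of _ "x ^ l * E x" for x]\<close>)
  have "Y2 0 \<noteq> 0"
  proof
    assume z: "Y2 0 = 0"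
    have "t0 < 1"
    proof (rule ccontr)
      assume "\<not> t0 < 1"
      then show False using E(1,4) unfolding interval_bump_def by force
    qed
    have "Y2 t = 0" if "0 < t" "t < 1" for t
      using mono[of 0 t] mono[of t 1] ab2 z that by auto
    then have "(Y2 has_real_derivative 0) (at t0)"
      by (intro has_field_derivative_transform_within_open[of "\<lambda>t. 0" _ _ "{0<..<1}" Y2])
         (use E(3) \<open>t0 < 1\<close> in auto)
    with Y2(1)[of t0] have "t0 ^ l * E t0 = 0" using DERIV_unique by blast
    then show False using E(3,4) by simp
  qed
  define c where "c = Y1 0 / Y2 0"
  define Y where "Y t = Y1 t - c * Y2 t" for t
  have dY: "(Y has_real_derivative t ^ l * (X t - c * E t)) (at t)" for t
    unfolding Y_def using Y1(1)[of t] Y2(1)[of t] by (auto intro!: derivative_eq_intros simp: algebra_simps)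
  have sY: "Ck_on k UNIV Y" for k
    using Ck_on_add[OF Y1(2) Ck_on_mult[OF Ck_on_const[of k UNIV "-c"] Y2(2)]]
    by (simp add: Y_def[abs_def])
  have "Y t = 0" if "t \<notin> {min a1 a2..max b1 b2}" for t
  proof (cases "t < min a1 a2")
    case True
    then have "Y1 t = Y1 0" "Y2 t = Y2 0" using ab1(5)[of t] ab2(5)[of t] by auto
    then show ?thesis using \<open>Y2 0 \<noteq> 0\<close> by (simp add: Y_def c_def)
  next
    case False
    then have "t \<ge> b1" "t \<ge> b2" using that by auto
    then show ?thesis by (simp add: Y_def ab1 ab2)
  qed
  then have bY: "interval_bump Y" unfolding interval_bump_def using sY ab1(1-3) ab2(1-3)
    by (intro conjI allI exI[of _ "min a1 a2"] exI[of _ "max b1 b2"]) auto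
  define W where "W t = t powr (- real (Suc l)) * Y t" for t
  have bW: "interval_bump W" unfolding W_def
    by (rule interval_bump_mult[OF bY Ck_on_subset[OF Ck_on_powr]]) auto
  then obtain a b where ab: "0 < a" "b < 1" "\<And>t. t \<notin> {a..b} \<Longrightarrow> W t = 0"
    unfolding interval_bump_def by blast
  have b: "b < 1" "\<And>t. b < t \<Longrightarrow> W t = 0" and W0: "W 0 = 0"
    using ab by simp_all
  have sW: "Ck_on k UNIV W" for k using bW by (simp add: interval_bump_def)
  obtain W' where W': "\<And>t. (W has_real_derivative W' t) (at t)" using sW[of 1] by auto
  have ode: "real (Suc l) * W t + t * W' t = X t - c * E t" if "0 < t" for t
  proof -
    have "((\<lambda>t. t powr (- real (Suc l)) * Y t) has_real_derivative
        (- real (Suc l)) * t powr (- real (Suc l) - 1) * Y t +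
        t ^ l * (X t - c * E t) * t powr (- real (Suc l))) (at t)"
      by (rule DERIV_mult[OF has_real_derivative_powr[OF that] dY])
    then have "W' t = (- real (Suc l)) * t powr (- real (Suc l) - 1) * Y t +
        t ^ l * (X t - c * E t) * t powr (- real (Suc l))"
      using DERIV_unique[OF W'[of t]] by (simp add: W_def[abs_def])
    then have "t * W' t = (- real (Suc l)) * (t * t powr (- real (Suc l) - 1)) * Y t +
        (t * t ^ l * t powr (- real (Suc l))) * (X t - c * E t)"
      by (simp only: distrib_left mult_ac)
    also have "t * t powr (- real (Suc l) - 1) = t powr (- real (Suc l))"
      using that powr_add[of t 1 "- real (Suc l) - 1"] by simp
    also have "t * t ^ l = t powr (real (Suc l))"
      using that by (simp only: powr_realpow power_Suc)
    also have "t powr (real (Suc l)) * t powr (- real (Suc l)) = 1"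
      using that by (simp only: powr_add[symmetric]) simp
    finally show ?thesis by (simp add: W_def del: of_nat_Suc)
  qed
  define \<phi> where "\<phi> z = z ^ Suc l * of_real (W ((cmod z)\<^sup>2))" for z
  have s: "smooth (\<lambda>z. z ^ Suc l)" "smooth (\<lambda>z. of_real (W ((cmod z)\<^sup>2)))"
    by (intro smooth_power smooth_ident smooth_radial sW)+
  have "\<phi> \<in> test_functions" unfolding \<phi>_def
    by (rule radial_test_function[OF s(1) sW b])
  moreover have "dz \<phi> z = z ^ l * of_real (X ((cmod z)\<^sup>2) - c * E ((cmod z)\<^sup>2))" for z
  proof -
    have "dz \<phi> z = of_nat (Suc l) * z ^ l * of_real (W ((cmod z)\<^sup>2))
        + z ^ Suc l * (of_real (W' ((cmod z)\<^sup>2)) * cnj z)"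
      unfolding \<phi>_def
      by (subst dz_mult[OF smooth_differentiable[OF s(1)] smooth_differentiable[OF s(2)]])
         (simp only: dz_power dz_radial[OF W'] diff_Suc_1)
    also have "\<dots> = z ^ l * of_real (real (Suc l) * W ((cmod z)\<^sup>2) + (cmod z)\<^sup>2 * W' ((cmod z)\<^sup>2))"
      using complex_norm_square[of z] by (simp add: algebra_simps)
    also have "\<dots> = z ^ l * of_real (X ((cmod z)\<^sup>2) - c * E ((cmod z)\<^sup>2))"
    proof (cases "z = 0")
      case True
      have "X 0 = 0" "E 0 = 0" using X E(1) unfolding interval_bump_def by force+
      then show ?thesis using True W0 by simp
    next
      case False
      then show ?thesis by (subst ode) auto
    qed
    finally show ?thesis .
  qed
  ultimately show ?thesis by blast
qed

section \<open>The weighted measures\<close>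

lemma bdf_pos_iff: "0 < bdf z \<longleftrightarrow> cmod z < 1"
  unfolding bdf_def using abs_square_less_1[of "cmod z"] by simp

lemma bdf_le_1: "bdf z \<le> 1"
  by (simp add: bdf_def)

lemma bdf_nonneg_iff: "0 \<le> bdf z \<longleftrightarrow> cmod z \<le> 1"
  unfolding bdf_def using abs_square_le_1[of "cmod z"] by simp

lemma continuous_on_bdf: "continuous_on S bdf"
  unfolding bdf_def[abs_def] by (intro continuous_intros)

lemma bdf_measurable [measurable]: "bdf \<in> borel_measurable borel"
  by (rule borel_measurable_continuous_onI[OF continuous_on_bdf])

lemma measurable_lebesgue_on: "f \<in> borel_measurable borel \<Longrightarrow> f \<in> borel_measurable (lebesgue_on S)"
  by (rule measurable_restrict_space1) (simp add: measurable_completion)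

lemma weight_measurable: "(\<lambda>z. bdf z powr s) \<in> borel_measurable (lebesgue_on (cball 0 1))"
  by (rule measurable_lebesgue_on) measurable

lemma space_disk_measure: "space (disk_measure s) = cball 0 1"
  by (simp add: disk_measure_def)

lemma measurable_disk_iff: "f \<in> borel_measurable (disk_measure s) \<longleftrightarrow> f \<in> borel_measurable (lebesgue_on (cball 0 1))"
  by (simp add: disk_measure_def)

lemma measurable_disk_cong: "f \<in> borel_measurable (disk_measure s) \<Longrightarrow> f \<in> borel_measurable (disk_measure t)"
  by (simp add: measurable_disk_iff)

lemma borel_measurable_disk: "f \<in> borel_measurable borel \<Longrightarrow> f \<in> borel_measurable (disk_measure s)"
  by (simp add: measurable_disk_iff measurable_lebesgue_on)

lemma continuous_measurable_disk: "continuous_on UNIV f \<Longrightarrow> f \<in> borel_measurable (disk_measure s)"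
  by (rule borel_measurable_disk[OF borel_measurable_continuous_onI])

lemma AE_lebesgue_on_interior: "AE z in lebesgue_on (cball 0 1). z \<in> ball (0::complex) 1"
proof -
  have "negligible (sphere (0::complex) 1)" by (rule negligible_sphere)
  then have "AE z in lebesgue. z \<notin> sphere (0::complex) 1"
    unfolding negligible_iff_null_sets by (rule AE_not_in)
  then have "AE z in lebesgue. z \<in> cball 0 1 \<longrightarrow> z \<in> ball (0::complex) 1"
    by eventually_elim auto
  then show ?thesis by (simp add: AE_restrict_space_iff)
qed

lemma AE_disk_iff: "(AE z in disk_measure s. P z) \<longleftrightarrow> (AE z in lebesgue_on (cball 0 1). P z)"
proof -
  have "(AE z in disk_measure s. P z) \<longleftrightarrow> (AE z in lebesgue_on (cball 0 1). 0 < ennreal (bdf z powr s) \<longrightarrow> P z)"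
    unfolding disk_measure_def
    by (rule AE_density) (use weight_measurable in measurable)
  also have "\<dots> \<longleftrightarrow> (AE z in lebesgue_on (cball 0 1). P z)"
  proof (rule iffI)
    assume "AE z in lebesgue_on (cball 0 1). 0 < ennreal (bdf z powr s) \<longrightarrow> P z"
    with AE_lebesgue_on_interior show "AE z in lebesgue_on (cball 0 1). P z"
    proof eventually_elim
      case (elim z)
      then have "0 < bdf z" by (simp add: bdf_pos_iff)
      then have "0 < bdf z powr s" by simp
      then show ?case using elim by (simp only: ennreal_less_zero_iff)
    qed
  qed (auto elim: eventually_mono)
  finally show ?thesis .
qed

lemma AE_disk_interior: "AE z in disk_measure s. cmod z < 1"
  using AE_lebesgue_on_interior by (simp add: AE_disk_iff)

lemma AE_disk_cong: "(AE z in disk_measure s. P z) \<Longrightarrow> (AE z in disk_measure t. P z)"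
  by (simp add: AE_disk_iff)

lemma integral_disk:
  fixes g :: "complex \<Rightarrow> 'b::{banach, second_countable_topology}"
  assumes "g \<in> borel_measurable (disk_measure s)"
  shows "(LINT z|disk_measure s. g z) = (LINT z|lebesgue_on (cball 0 1). (bdf z powr s) *\<^sub>R g z)"
  unfolding disk_measure_def
  by (rule integral_density) (use assms weight_measurable in \<open>auto simp: measurable_disk_iff\<close>)

lemma integrable_disk_iff:
  fixes g :: "complex \<Rightarrow> 'b::{banach, second_countable_topology}"
  assumes "g \<in> borel_measurable (disk_measure s)"
  shows "integrable (disk_measure s) g \<longleftrightarrow> integrable (lebesgue_on (cball 0 1)) (\<lambda>z. (bdf z powr s) *\<^sub>R g z)"
  unfolding disk_measure_def
  by (rule integrable_density) (use assms weight_measurable in \<open>auto simp: measurable_disk_iff\<close>)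

lemma disk_reweight:
  fixes g :: "complex \<Rightarrow> 'b::{banach, second_countable_topology}"
  assumes "g \<in> borel_measurable (disk_measure s)"
  shows "integrable (disk_measure s) g \<longleftrightarrow> integrable (disk_measure t) (\<lambda>z. (bdf z powr (s - t)) *\<^sub>R g z)"
    and "(LINT z|disk_measure s. g z) = (LINT z|disk_measure t. (bdf z powr (s - t)) *\<^sub>R g z)"
proof -
  have [measurable]: "(\<lambda>z. bdf z powr r) \<in> borel_measurable (disk_measure t)" for r
    by (rule borel_measurable_disk) measurable
  have m: "(\<lambda>z. (bdf z powr (s - t)) *\<^sub>R g z) \<in> borel_measurable (disk_measure t)"
    using measurable_disk_cong[OF assms, of t] by measurable
  have ae: "AE z in lebesgue_on (cball 0 1). (bdf z powr t) *\<^sub>R ((bdf z powr (s - t)) *\<^sub>R g z) = (bdf z powr s) *\<^sub>R g z"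
    by (rule eventually_mono[OF AE_lebesgue_on_interior])
       (simp add: bdf_pos_iff[symmetric] powr_add[symmetric])
  have m1: "(\<lambda>z. (bdf z powr s) *\<^sub>R g z) \<in> borel_measurable (lebesgue_on (cball 0 1))"
    "(\<lambda>z. (bdf z powr t) *\<^sub>R ((bdf z powr (s - t)) *\<^sub>R g z)) \<in> borel_measurable (lebesgue_on (cball 0 1))"
    using assms m weight_measurable[of s] weight_measurable[of t]
    unfolding measurable_disk_iff by (simp_all only: borel_measurable_scaleR)
  show "integrable (disk_measure s) g \<longleftrightarrow> integrable (disk_measure t) (\<lambda>z. (bdf z powr (s - t)) *\<^sub>R g z)"
    unfolding integrable_disk_iff[OF assms] integrable_disk_iff[OF m]
    by (rule integrable_cong_AE[OF m1]) (use ae in auto)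
  show "(LINT z|disk_measure s. g z) = (LINT z|disk_measure t. (bdf z powr (s - t)) *\<^sub>R g z)"
    unfolding integral_disk[OF assms] integral_disk[OF m]
    by (rule integral_cong_AE[OF m1]) (use ae in auto)
qed

lemma emeasure_annulus:
  assumes "0 \<le> e" "e \<le> 1"
  shows "emeasure lborel {z. 0 < bdf z \<and> bdf z \<le> e} \<le> ennreal (pi * e)"
proof -
  let ?r = "sqrt (1 - e)"
  have eq: "{z. 0 < bdf z \<and> bdf z \<le> e} = ball (0::complex) 1 - ball 0 ?r"
  proof -
    have iff: "bdf z \<le> e \<longleftrightarrow> ?r \<le> cmod z" for z
    proof -
      have "bdf z \<le> e \<longleftrightarrow> 1 - e \<le> (cmod z)\<^sup>2" by (auto simp: bdf_def)
      also have "\<dots> \<longleftrightarrow> ?r \<le> sqrt ((cmod z)\<^sup>2)" by (simp only: real_sqrt_le_iff)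
      finally show ?thesis by simp
    qed
    show ?thesis
      by (intro set_eqI) (simp only: mem_Collect_eq Diff_iff mem_ball_0 bdf_pos_iff iff not_less)
  qed
  have vol: "emeasure lborel (ball (0::complex) r) = ennreal (pi * r\<^sup>2)" if "0 \<le> r" for r
    using emeasure_ball[OF that, of "0::complex"] by (simp add: unit_ball_vol_2)
  have r1: "?r \<le> 1" using assms by simp
  have "emeasure lborel (ball (0::complex) 1 - ball 0 ?r)
      = emeasure lborel (ball (0::complex) 1) - emeasure lborel (ball (0::complex) ?r)"
    proof (rule emeasure_Diff[OF _ _ _ subset_ball[OF r1]])
    show "emeasure lborel (ball (0::complex) ?r) \<noteq> \<infinity>"
      by (subst vol) (use assms in simp_all)
  qed simp_all
  also have "\<dots> = ennreal (pi - pi * (1 - e))"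
    by (subst (1 2) vol) (use assms in \<open>simp_all add: ennreal_minus\<close>)
  also have "\<dots> = ennreal (pi * e)" by (simp add: algebra_simps)
  finally show ?thesis unfolding eq by simp
qed

lemma dyadic_powr_bound:
  assumes "0 < x" "x \<le> (1::real)" "s < 0"
  shows "\<exists>k::nat. x \<le> (1/2) ^ k \<and> x powr s \<le> (2 powr (- s)) ^ Suc k"
proof -
  obtain n where "(1/2::real) ^ n < x" using real_arch_pow_inv[OF assms(1), of "1/2"] by auto
  define m where "m = (LEAST n. (1/2::real) ^ n < x)"
  have m: "(1/2) ^ m < x" unfolding m_def by (rule LeastI) fact
  have "m \<noteq> 0" using m assms(2) by (cases m) auto
  then obtain k where k: "m = Suc k" by (cases m) auto
  have "\<not> (1/2) ^ k < x" using not_less_Least[of k "\<lambda>n. (1/2::real) ^ n < x"] k by (simp add: m_def)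
  moreover have "x powr s \<le> ((1/2) ^ Suc k) powr s"
    by (rule powr_mono2') (use m k assms in \<open>simp_all only: less_imp_le zero_less_power half_gt_zero_iff zero_less_one\<close>)
  moreover have "((1/2::real) ^ Suc k) powr s = (2 powr (- s)) ^ Suc k"
  proof -
    have "(1/2::real) ^ n = 2 powr (- real n)" for n
      by (simp add: powr_minus powr_realpow inverse_eq_divide power_divide)
    then have "((1/2::real) ^ Suc k) powr s = (2 powr (- real (Suc k))) powr s"
      by (simp only:)
    also have "\<dots> = (2 powr (- s)) powr (real (Suc k))"
      by (simp add: powr_powr mult.commute del: of_nat_Suc)
    also have "\<dots> = (2 powr (- s)) ^ Suc k" by (rule powr_realpow) simp
    finally show ?thesis .
  qed
  ultimately show ?thesis by (intro exI[of _ k] conjI) (simp_all only: not_less)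
qed

text \<open>For negative \<open>s\<close> the weight is at most \<open>2 powr (- s * (k + 1))\<close> on suitable annuli where
  \<open>bdf z \<le> (1/2) ^ k\<close>. Their area is at most \<open>pi * (1/2) ^ k\<close>, so for \<open>s > -1\<close> the sum over \<open>k\<close> is a
  convergent geometric series.\<close>

lemma weight_integrable:
  assumes "-1 < s"
  shows "finite_measure (disk_measure s)"
proof (rule finite_measureI)
  have "emeasure (disk_measure s) (space (disk_measure s))
      = (\<integral>\<^sup>+z. ennreal (bdf z powr s) * indicator (cball 0 1) z \<partial>lebesgue_on (cball 0 1))"
    unfolding disk_measure_def
    by (subst emeasure_density) (use weight_measurable in auto)
  also have "\<dots> = (\<integral>\<^sup>+z. ennreal (bdf z powr s) * indicator (cball 0 1) z \<partial>lebesgue)"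
    by (subst nn_integral_restrict_space) (auto intro!: nn_integral_cong simp: indicator_def)
  also have "\<dots> = (\<integral>\<^sup>+z. ennreal (bdf z powr s) * indicator (cball 0 1) z \<partial>lborel)"
    by (simp add: nn_integral_completion)
  also have "\<dots> < \<infinity>"
  proof (cases "0 \<le> s")
    case True
    have "(\<integral>\<^sup>+z. ennreal (bdf z powr s) * indicator (cball 0 1) z \<partial>lborel) \<le> (\<integral>\<^sup>+z. indicator (cball (0::complex) 1) z \<partial>lborel)"
    proof (rule nn_integral_mono)
      fix z
      show "ennreal (bdf z powr s) * indicator (cball 0 1) z \<le> indicator (cball 0 1) z"
        using powr_mono2[OF True, of "bdf z" 1] bdf_le_1[of z]
        by (auto simp: indicator_def bdf_nonneg_iff intro: ennreal_leI)
    qed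
    also have "\<dots> < \<infinity>" using emeasure_lborel_cball_finite[of "0::complex" 1] by simp
    finally show ?thesis .
  next
    case False
    let ?A = "\<lambda>k. {z. 0 < bdf z \<and> bdf z \<le> (1/2) ^ k}"
    let ?c = "\<lambda>k. (2 powr (- s)) ^ Suc k"
    have [measurable]: "?A k \<in> sets borel" for k by measurable
    have "(\<integral>\<^sup>+z. ennreal (bdf z powr s) * indicator (cball 0 1) z \<partial>lborel)
        \<le> (\<integral>\<^sup>+z. (\<Sum>k. ennreal (?c k) * indicator (?A k) z) \<partial>lborel)"
    proof (rule nn_integral_mono)
      fix z
      show "ennreal (bdf z powr s) * indicator (cball 0 1) z \<le> (\<Sum>k. ennreal (?c k) * indicator (?A k) z)"
      proof (cases "0 < bdf z")
        case True
        then obtain k where k: "bdf z \<le> (1/2) ^ k" "bdf z powr s \<le> ?c k"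
          using dyadic_powr_bound[of "bdf z" s] bdf_le_1[of z] False by auto
        have "ennreal (bdf z powr s) * indicator (cball 0 1) z \<le> ennreal (?c k) * indicator (?A k) z"
          using k True bdf_nonneg_iff[of z] by (auto simp: indicator_def intro: ennreal_leI)
        also have "\<dots> \<le> (\<Sum>k. ennreal (?c k) * indicator (?A k) z)"
          using sum_le_suminf[of "\<lambda>k. ennreal (?c k) * indicator (?A k) z" "{k}", OF summableI]
          by (simp only: sum.insert_if sum.empty finite.intros) simp
        finally show ?thesis .
      next
        case False
        then have "bdf z powr s = 0 \<or> z \<notin> cball 0 1"
          using bdf_nonneg_iff[of z] by auto
        then show ?thesis by auto
      qed
    qed
    also have "\<dots> = (\<Sum>k. \<integral>\<^sup>+z. ennreal (?c k) * indicator (?A k) z \<partial>lborel)"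
      by (rule nn_integral_suminf) measurable
    also have "\<dots> = (\<Sum>k. ennreal (?c k) * emeasure lborel (?A k))"
      by (simp add: nn_integral_cmult_indicator)
    also have "\<dots> \<le> (\<Sum>k. ennreal (?c k) * ennreal (pi * (1/2) ^ k))"
      by (intro suminf_le summableI mult_left_mono emeasure_annulus) (auto simp: power_le_one)
    also have "\<dots> = (\<Sum>k. ennreal (pi * 2 powr (- s) * (2 powr (- s) / 2) ^ k))"
      by (simp add: ennreal_mult[symmetric] power_divide mult_ac)
    also have "\<dots> < \<infinity>"
    proof -
      have "2 powr (- s) < 2 powr (1::real)" using assms by (intro powr_less_mono) auto
      then have "summable (\<lambda>k. pi * 2 powr (- s) * (2 powr (- s) / 2) ^ k)"
        by (intro summable_mult summable_geometric) auto
      then show ?thesis by (subst suminf_ennreal2) auto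
    qed
    finally show ?thesis .
  qed
  finally show "emeasure (disk_measure s) (space (disk_measure s)) \<noteq> \<infinity>" by simp
qed

lemma L2_iff_sq_int: "u \<in> L2 s \<longleftrightarrow> sq_int (disk_measure s) u"
  by (simp add: L2_def sq_int_def)

lemma L2_norm_sq: "(L2_norm s u)\<^sup>2 = sq_norm (disk_measure s) u"
  by (simp add: L2_norm_def sq_norm_def)

lemma L2_norm_eq_sqrt: "L2_norm s u = sqrt (sq_norm (disk_measure s) u)"
  by (simp add: L2_norm_def sq_norm_def)

lemma sq_int_bounded:
  assumes "-1 < s" "u \<in> borel_measurable (disk_measure s)" "AE z in disk_measure s. cmod (u z) \<le> B"
  shows "sq_int (disk_measure s) u"
proof -
  interpret finite_measure "disk_measure s" by (rule weight_integrable[OF assms(1)])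
  have "sq_int (disk_measure s) (\<lambda>z. 1)" by (simp add: sq_int_def)
  then show ?thesis by (rule sq_int_bound[of _ _ _ B]) (use assms in auto)
qed

text \<open>For \<open>-1 < s < 1\<close> the spaces with weights \<open>s\<close> and \<open>- s\<close> are dual to each other under the
  unweighted pairing. The pairing of \<open>u\<close> with a bounded function \<open>p\<close> is thus the inner product
  with \<open>dual_weight s p\<close>.\<close>

definition dual_weight :: "real \<Rightarrow> (complex \<Rightarrow> complex) \<Rightarrow> complex \<Rightarrow> complex" where
  "dual_weight s p z = of_real (bdf z powr (- s)) * p z"

lemma dual_weight_cancel:
  assumes "cmod z < 1"
  shows "(bdf z powr s) *\<^sub>R (a * cnj (dual_weight s p z)) = a * cnj (p z)"
proof -
  have "bdf z powr s * bdf z powr (- s) = 1"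
    using assms by (simp add: bdf_pos_iff[symmetric] powr_add[symmetric])
  then have "complex_of_real (bdf z powr s) * of_real (bdf z powr (- s)) = 1"
    by (simp only: of_real_mult[symmetric] of_real_1)
  moreover have "(bdf z powr s) *\<^sub>R (a * cnj (dual_weight s p z))
      = (complex_of_real (bdf z powr s) * of_real (bdf z powr (- s))) * (a * cnj (p z))"
    by (simp add: dual_weight_def scaleR_conv_of_real)
  ultimately show ?thesis by simp
qed

lemma dual_weight_measurable:
  "p \<in> borel_measurable (disk_measure s) \<Longrightarrow> dual_weight t p \<in> borel_measurable (disk_measure s)"
proof -
  assume [measurable]: "p \<in> borel_measurable (disk_measure s)"
  have [measurable]: "(\<lambda>z. bdf z powr r) \<in> borel_measurable (disk_measure s)" for r
    by (rule borel_measurable_disk) measurable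
  show ?thesis unfolding dual_weight_def[abs_def] by measurable
qed

lemma dual_weight_isometry:
  assumes "sq_int (disk_measure (- s)) p"
  shows "sq_int (disk_measure s) (dual_weight s p)"
    and "sq_norm (disk_measure s) (dual_weight s p) = sq_norm (disk_measure (- s)) p"
proof -
  have m: "(\<lambda>z. (cmod (p z))\<^sup>2) \<in> borel_measurable (disk_measure (- s))"
    and i: "integrable (disk_measure (- s)) (\<lambda>z. (cmod (p z))\<^sup>2)"
    using assms by (auto simp: sq_int_def)
  have sq: "(cmod (dual_weight s p z))\<^sup>2 = (bdf z powr (- s - s)) *\<^sub>R (cmod (p z))\<^sup>2" for z
  proof -
    have "(bdf z powr (- s))\<^sup>2 = bdf z powr (- s - s)"
      unfolding power2_eq_square powr_add[symmetric] by simp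
    then show ?thesis by (simp add: dual_weight_def norm_mult power_mult_distrib)
  qed
  have "p \<in> borel_measurable (disk_measure s)"
    by (rule measurable_disk_cong[OF sq_int_measurable[OF assms]])
  then show "sq_int (disk_measure s) (dual_weight s p)"
    unfolding sq_int_def sq using dual_weight_measurable i disk_reweight(1)[OF m, of s] by (simp only:)
  show "sq_norm (disk_measure s) (dual_weight s p) = sq_norm (disk_measure (- s)) p"
    unfolding sq_norm_def sq by (rule disk_reweight(2)[OF m, symmetric])
qed

lemma sq_int_dual_weight:
  assumes "s < 1" "p \<in> borel_measurable (disk_measure s)" "AE z in disk_measure s. cmod (p z) \<le> B"
  shows "sq_int (disk_measure s) (dual_weight s p)"
  by (rule dual_weight_isometry(1)[OF sq_int_bounded[OF _ measurable_disk_cong[OF assms(2)] AE_disk_cong[OF assms(3)]]])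
     (use assms(1) in simp)

lemma pairing_dual_weight:
  assumes [measurable]: "u \<in> borel_measurable (disk_measure s)" "p \<in> borel_measurable (disk_measure s)"
  shows "(LINT z|disk_measure s. u z * cnj (dual_weight s p z)) = (LINT z|lebesgue_on (cball 0 1). u z * cnj (p z))"
proof -
  have m: "(\<lambda>z. u z * cnj (dual_weight s p z)) \<in> borel_measurable (disk_measure s)"
    by (intro borel_measurable_times borel_measurable_cnj dual_weight_measurable assms)
  show ?thesis unfolding integral_disk[OF m]
  proof (rule integral_cong_AE)
    show "(\<lambda>z. (bdf z powr s) *\<^sub>R (u z * cnj (dual_weight s p z))) \<in> borel_measurable (lebesgue_on (cball 0 1))"
      using m weight_measurable[of s] unfolding measurable_disk_iff by (intro borel_measurable_scaleR)
    show "(\<lambda>z. u z * cnj (p z)) \<in> borel_measurable (lebesgue_on (cball 0 1))"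
      using assms unfolding measurable_disk_iff by (intro borel_measurable_times borel_measurable_cnj)
    show "AE z in lebesgue_on (cball 0 1). (bdf z powr s) *\<^sub>R (u z * cnj (dual_weight s p z)) = u z * cnj (p z)"
      by (rule eventually_mono[OF AE_lebesgue_on_interior]) (simp add: dual_weight_cancel)
  qed
qed

lemma unweighted_integrable:
  assumes "s < 1" "sq_int (disk_measure s) u" "p \<in> borel_measurable (disk_measure s)" "AE z in disk_measure s. cmod (p z) \<le> B"
  shows "integrable (lebesgue_on (cball 0 1)) (\<lambda>z. u z * cnj (p z))"
proof -
  have m: "u \<in> borel_measurable (disk_measure s)" using assms(2) by (simp add: sq_int_def)
  have i: "integrable (disk_measure s) (\<lambda>z. u z * cnj (dual_weight s p z))"
    by (rule sq_int_mult_integrable[OF assms(2) sq_int_dual_weight[OF assms(1,3,4)]])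
  then have "integrable (lebesgue_on (cball 0 1)) (\<lambda>z. (bdf z powr s) *\<^sub>R (u z * cnj (dual_weight s p z)))"
    by (simp only: integrable_disk_iff[OF borel_measurable_integrable[OF i]])
  then show ?thesis
  proof (rule integrable_cong_AE_imp)
    show "AE z in lebesgue_on (cball 0 1). (bdf z powr s) *\<^sub>R (u z * cnj (dual_weight s p z)) = u z * cnj (p z)"
      by (rule eventually_mono[OF AE_lebesgue_on_interior]) (simp add: dual_weight_cancel)
    show "(\<lambda>z. u z * cnj (p z)) \<in> borel_measurable (lebesgue_on (cball 0 1))"
      using m assms(3) unfolding measurable_disk_iff by (intro borel_measurable_times borel_measurable_cnj)
  qed
qed

section \<open>The weighted a priori estimate\<close>

subsection \<open>Symmetry of second derivatives\<close>

text \<open>By the mean value theorem the second difference of \<open>f\<close> over a small square is \<open>h\<^sup>2\<close> times a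
  value of either mixed derivative.\<close>

lemma mixed_derivatives_equal:
  fixes f fx fy fxy fyx :: "real \<Rightarrow> real \<Rightarrow> real"
  assumes fx: "\<And>s t. ((\<lambda>s. f s t) has_real_derivative fx s t) (at s)"
    and fy: "\<And>s t. ((\<lambda>t. f s t) has_real_derivative fy s t) (at t)"
    and fxy: "\<And>s t. ((\<lambda>t. fx s t) has_real_derivative fxy s t) (at t)"
    and fyx: "\<And>s t. ((\<lambda>s. fy s t) has_real_derivative fyx s t) (at s)"
    and c1: "isCont (\<lambda>p. fxy (fst p) (snd p)) (x, y)"
    and c2: "isCont (\<lambda>p. fyx (fst p) (snd p)) (x, y)"
  shows "fxy x y = fyx x y"
proof (rule ccontr)
  assume ne: "fxy x y \<noteq> fyx x y"
  define e where "e = \<bar>fxy x y - fyx x y\<bar> / 2"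
  have e: "e > 0" using ne by (simp add: e_def)
  obtain d1 where d1: "d1 > 0" "\<And>p. dist p (x, y) < d1 \<Longrightarrow> dist (fxy (fst p) (snd p)) (fxy x y) < e"
    using c1[unfolded continuous_at_eps_delta] e by force
  obtain d2 where d2: "d2 > 0" "\<And>p. dist p (x, y) < d2 \<Longrightarrow> dist (fyx (fst p) (snd p)) (fyx x y) < e"
    using c2[unfolded continuous_at_eps_delta] e by force
  define h where "h = min d1 d2 / 2"
  have h: "h > 0" using d1 d2 by (simp add: h_def)
  have close: "dist (a, b) (x, y) < d1" "dist (a, b) (x, y) < d2"
    if "x < a" "a < x + h" "y < b" "b < y + h" for a b
  proof -
    have "dist (a, b) (x, y) \<le> dist a x + dist b y"
      unfolding dist_Pair_Pair by (rule sqrt_sum_squares_le_sum) auto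
    also have "\<dots> < 2 * h" using that by (simp add: dist_real_def)
    finally show "dist (a, b) (x, y) < d1" "dist (a, b) (x, y) < d2" by (auto simp: h_def)
  qed
  define \<Delta> where "\<Delta> = f (x + h) (y + h) - f (x + h) y - f x (y + h) + f x y"
  obtain a b where ab: "x < a" "a < x + h" "y < b" "b < y + h" "\<Delta> = h * (h * fxy a b)"
  proof -
    obtain a where a: "x < a" "a < x + h"
      "(f (x + h) (y + h) - f (x + h) y) - (f x (y + h) - f x y) = (x + h - x) * (fx a (y + h) - fx a y)"
      using MVT2[of x "x + h" "\<lambda>s. f s (y + h) - f s y" "\<lambda>s. fx s (y + h) - fx s y",
          OF _ DERIV_diff[OF fx fx]] h by auto
    moreover obtain b where "y < b" "b < y + h" "fx a (y + h) - fx a y = (y + h - y) * fxy a b"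
      using MVT2[of y "y + h" "\<lambda>t. fx a t" "\<lambda>t. fxy a t"] h fxy by auto
    ultimately show ?thesis using that[of a b] by (simp add: \<Delta>_def)
  qed
  obtain a' b' where ab': "x < a'" "a' < x + h" "y < b'" "b' < y + h" "\<Delta> = h * (h * fyx a' b')"
  proof -
    obtain b where b: "y < b" "b < y + h"
      "(f (x + h) (y + h) - f x (y + h)) - (f (x + h) y - f x y) = (y + h - y) * (fy (x + h) b - fy x b)"
      using MVT2[of y "y + h" "\<lambda>t. f (x + h) t - f x t" "\<lambda>t. fy (x + h) t - fy x t",
          OF _ DERIV_diff[OF fy fy]] h by auto
    moreover obtain a where "x < a" "a < x + h" "fy (x + h) b - fy x b = (x + h - x) * fyx a b"
      using MVT2[of x "x + h" "\<lambda>s. fy s b" "\<lambda>s. fyx s b"] h fyx by auto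
    ultimately show ?thesis using that[of a b] by (simp add: \<Delta>_def)
  qed
  have "fxy a b = fyx a' b'" using ab(5) ab'(5) h by simp
  moreover have "dist (fxy a b) (fxy x y) < e" using d1(2)[OF close(1)[OF ab(1-4)]] by simp
  moreover have "dist (fyx a' b') (fyx x y) < e" using d2(2)[OF close(2)[OF ab'(1-4)]] by simp
  moreover have "\<bar>fxy x y - fyx x y\<bar> \<le> dist (fxy a b) (fxy x y) + dist (fxy a b) (fyx x y)"
    using dist_triangle3[of "fxy x y" "fyx x y" "fxy a b"] by (simp add: dist_real_def)
  ultimately show False unfolding e_def by simp
qed

lemma dir_deriv_scaleR:
  assumes "u differentiable (at z)"
  shows "dir_deriv (h *\<^sub>R v) u z = h *\<^sub>R dir_deriv v u z"
  unfolding dir_deriv_def by (rule linear_scale[OF linear_frechet_derivative[OF assms]])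

lemma line_has_derivative:
  assumes "smooth u" "bounded_linear L"
  shows "((\<lambda>s. L (u (z + s *\<^sub>R v))) has_real_derivative L (dir_deriv v u (z + s *\<^sub>R v))) (at s)"
proof -
  interpret L: bounded_linear L by fact
  let ?w = "z + s *\<^sub>R v"
  have "((\<lambda>s. z + s *\<^sub>R v) has_derivative (\<lambda>h. h *\<^sub>R v)) (at s)"
    by (auto intro!: derivative_eq_intros)
  then have "((\<lambda>s. u (z + s *\<^sub>R v)) has_derivative (\<lambda>h. dir_deriv (h *\<^sub>R v) u ?w)) (at s)"
    by (rule has_derivative_compose) (rule smooth_has_derivative[OF assms(1)])
  then have "((\<lambda>s. L (u (z + s *\<^sub>R v))) has_derivative (\<lambda>h. L (dir_deriv (h *\<^sub>R v) u ?w))) (at s)"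
    by (rule L.has_derivative)
  moreover have "(\<lambda>h. L (dir_deriv (h *\<^sub>R v) u ?w)) = (*) (L (dir_deriv v u ?w))"
    by (auto simp: dir_deriv_scaleR[OF smooth_differentiable[OF assms(1)]] L.scaleR)
  ultimately show ?thesis by (simp add: has_field_derivative_def)
qed

lemma dir_deriv_commute:
  assumes "smooth u"
  shows "dir_deriv 1 (dir_deriv \<i> u) z = dir_deriv \<i> (dir_deriv 1 u) z"
proof -
  have L: "L (dir_deriv \<i> (dir_deriv 1 u) z) = L (dir_deriv 1 (dir_deriv \<i> u) z)"
    if "bounded_linear L" for L :: "complex \<Rightarrow> real"
  proof -
    interpret L: bounded_linear L by fact
    let ?P = "\<lambda>s t. s *\<^sub>R (1::complex) + t *\<^sub>R \<i>"
    have c: "isCont (\<lambda>p. L (w (?P (fst p) (snd p)))) (Re z, Im z)" if "smooth w" for w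
    proof -
      have "continuous_on UNIV (\<lambda>p. L (w (?P (fst p) (snd p))))"
        by (intro L.continuous_on continuous_on_compose2[OF smooth_continuous[OF that]] continuous_intros) auto
      then show ?thesis by (simp add: continuous_on_eq_continuous_at)
    qed
    have h: "((\<lambda>s. L (w (?P s t))) has_real_derivative L (dir_deriv 1 w (?P s t))) (at s)"
      if "smooth w" for w s t
      using line_has_derivative[OF that \<open>bounded_linear L\<close>, of "t *\<^sub>R \<i>" 1 s] by (simp only: add.commute)
    have v: "((\<lambda>t. L (w (?P s t))) has_real_derivative L (dir_deriv \<i> w (?P s t))) (at t)"
      if "smooth w" for w s t
      using line_has_derivative[OF that \<open>bounded_linear L\<close>, of "s *\<^sub>R 1" \<i> t] .
    have "L (dir_deriv \<i> (dir_deriv 1 u) (?P (Re z) (Im z))) = L (dir_deriv 1 (dir_deriv \<i> u) (?P (Re z) (Im z)))"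
      by (rule mixed_derivatives_equal[of "\<lambda>s t. L (u (?P s t))" "\<lambda>s t. L (dir_deriv 1 u (?P s t))"
            "\<lambda>s t. L (dir_deriv \<i> u (?P s t))" "\<lambda>s t. L (dir_deriv \<i> (dir_deriv 1 u) (?P s t))"
            "\<lambda>s t. L (dir_deriv 1 (dir_deriv \<i> u) (?P s t))"])
         (intro h v c smooth_dir_deriv assms)+
    moreover have "?P (Re z) (Im z) = z" by (simp add: complex_eq_iff)
    ultimately show ?thesis by (simp only:)
  qed
  show ?thesis
    using L[OF bounded_linear_Re] L[OF bounded_linear_Im] by (simp add: complex_eq_iff)
qed

lemma dzb_dz_commute:
  assumes "smooth u"
  shows "dzb (dz u) z = dz (dzb u) z"
proof -
  note d = smooth_differentiable[OF smooth_dir_deriv[OF assms]]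
  have e: "dz u = (\<lambda>z. (1/2) * (dir_deriv 1 u z - \<i> * dir_deriv \<i> u z))"
    "dzb u = (\<lambda>z. (1/2) * (dir_deriv 1 u z + \<i> * dir_deriv \<i> u z))"
    by (auto simp: dz_def dzb_def)
  have dd: "(\<lambda>z. \<i> * dir_deriv \<i> u z) differentiable (at z)"
    by (intro differentiable_mult d) auto
  have i: "dir_deriv v (\<lambda>z. \<i> * dir_deriv \<i> u z) z = \<i> * dir_deriv v (dir_deriv \<i> u) z" for v
    by (rule dir_deriv_scale[OF d])
  have 1: "dir_deriv v (dz u) z = (1/2) * (dir_deriv v (dir_deriv 1 u) z - \<i> * dir_deriv v (dir_deriv \<i> u) z)" for v
    unfolding e(1) by (simp only: dir_deriv_scale[OF differentiable_diff[OF d dd]] dir_deriv_diff[OF d dd] i)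
  have 2: "dir_deriv v (dzb u) z = (1/2) * (dir_deriv v (dir_deriv 1 u) z + \<i> * dir_deriv v (dir_deriv \<i> u) z)" for v
    unfolding e(2) by (simp only: dir_deriv_scale[OF differentiable_add[OF d dd]] dir_deriv_add[OF d dd] i)
  show ?thesis
    unfolding dzb_def[of "dz u"] dz_def[of "dzb u"] 1 2 dir_deriv_commute[OF assms]
    by (simp add: algebra_simps)
qed

subsection \<open>Integration by parts\<close>

text \<open>The integral of \<open>u (z + v / n) - u z\<close> vanishes by translation invariance; the difference
  quotients converge boundedly to the derivative.\<close>

lemma integral_dir_deriv_zero:
  assumes d: "\<And>z. u differentiable (at z)" and c: "\<And>v. continuous_on UNIV (dir_deriv v u)"
    and K: "compact K" "\<And>z. z \<notin> K \<Longrightarrow> u z = 0"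
  shows "(LINT z|lborel. dir_deriv v u z) = 0"
proof -
  have D0: "dir_deriv v u z = 0" if "z \<notin> K" for v z
  proof -
    have "(u has_derivative (\<lambda>v. 0)) (at z)"
      by (rule has_derivative_transform_within_open[of "\<lambda>z. 0" _ _ _ "- K"])
         (use K that in \<open>auto intro: compact_imp_closed\<close>)
    then show ?thesis by (rule dir_deriv_eqI)
  qed
  have "compact ((\<lambda>z. cmod (dir_deriv 1 u z) + cmod (dir_deriv \<i> u z)) ` K)"
    by (intro compact_continuous_image K continuous_intros continuous_on_subset[OF c]) auto
  then have "bounded ((\<lambda>z. cmod (dir_deriv 1 u z) + cmod (dir_deriv \<i> u z)) ` K)"
    by (rule compact_imp_bounded)
  then obtain B where B: "B > 0" "\<And>z. z \<in> K \<Longrightarrow> cmod (dir_deriv 1 u z) + cmod (dir_deriv \<i> u z) \<le> B"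
    unfolding bounded_pos by fastforce
  have B': "cmod (dir_deriv w u z) \<le> B * cmod w" for w z
  proof (cases "z \<in> K")
    case True
    have "cmod (dir_deriv w u z) \<le> \<bar>Re w\<bar> * cmod (dir_deriv 1 u z) + \<bar>Im w\<bar> * cmod (dir_deriv \<i> u z)"
      unfolding dir_deriv_linear[OF d, of w z]
      by (rule order_trans[OF norm_triangle_ineq]) (simp add: norm_mult)
    also have "\<dots> \<le> cmod w * cmod (dir_deriv 1 u z) + cmod w * cmod (dir_deriv \<i> u z)"
      by (intro add_mono mult_right_mono abs_Re_le_cmod abs_Im_le_cmod) auto
    also have "\<dots> = (cmod (dir_deriv 1 u z) + cmod (dir_deriv \<i> u z)) * cmod w" by (simp add: algebra_simps)
    also have "\<dots> \<le> B * cmod w" by (intro mult_right_mono B True) auto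
    finally show ?thesis .
  next
    case False
    then show ?thesis using B(1) by (simp add: D0)
  qed
  have lip: "cmod (u x - u y) \<le> B * cmod (x - y)" for x y
  proof (rule differentiable_bound[of UNIV])
    show "(u has_derivative (\<lambda>w. dir_deriv w u z)) (at z within UNIV)" for z
      using d[of z] by (simp add: dir_deriv_def frechet_derivative_works)
    show "onorm (\<lambda>w. dir_deriv w u z) \<le> B" for z
      by (rule onorm_le) (rule B')
  qed auto
  have cu: "continuous_on UNIV u" using d
    by (auto simp: continuous_on_eq_continuous_at intro: differentiable_imp_continuous_within)
  have mu [measurable]: "u \<in> borel_measurable borel"
    by (rule borel_measurable_continuous_onI[OF cu])
  have iu: "integrable lborel u"
  proof -
    have "integrable lborel (\<lambda>z. indicator K z *\<^sub>R u z)"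
      by (rule borel_integrable_compact[OF K(1) continuous_on_subset[OF cu]]) auto
    moreover have "(\<lambda>z. indicator K z *\<^sub>R u z) = u" using K(2) by (auto simp: indicator_def)
    ultimately show ?thesis by simp
  qed
  obtain R where R: "\<And>z. z \<in> K \<Longrightarrow> cmod z \<le> R"
    using compact_imp_bounded[OF K(1)] unfolding bounded_iff by auto
  define U where "U n z = of_nat (Suc n) * (u (v /\<^sub>R real (Suc n) + z) - u z)" for n :: nat and z
  have tr: "integrable lborel (\<lambda>z. u (w + z))" "(LINT z|lborel. u (w + z)) = (LINT z|lborel. u z)" for w
  proof -
    have "distr lborel borel ((+) w) = (lborel :: complex measure)" by (rule lborel_distr_plus)
    then show "integrable lborel (\<lambda>z. u (w + z))" "(LINT z|lborel. u (w + z)) = (LINT z|lborel. u z)"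
      using iu integrable_distr_eq[of "(+) w" lborel borel u] integral_distr[of "(+) w" lborel borel u] by auto
  qed
  have U0: "(LINT z|lborel. U n z) = 0" for n
    unfolding U_def using tr iu by simp
  have "(\<lambda>n. LINT z|lborel. U n z) \<longlonglongrightarrow> (LINT z|lborel. dir_deriv v u z)"
  proof (rule integral_dominated_convergence[where w = "\<lambda>z. indicator (cball 0 (R + cmod v)) z *\<^sub>R (B * cmod v)"])
    show "dir_deriv v u \<in> borel_measurable lborel"
      using borel_measurable_continuous_onI[OF c] by simp
    show "U n \<in> borel_measurable lborel" for n unfolding U_def by measurable
    have "emeasure lborel (cball (0::complex) (R + cmod v)) < \<infinity>"
      by (rule emeasure_lborel_cball_finite)
    then show "integrable lborel (\<lambda>z. indicator (cball (0::complex) (R + cmod v)) z *\<^sub>R (B * cmod v))"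
      by (intro integrable_scaleR_left integrable_real_indicator) auto
    show "AE z in lborel. norm (U n z) \<le> indicator (cball 0 (R + cmod v)) z *\<^sub>R (B * cmod v)" for n
    proof (rule AE_I2)
      fix z :: complex
      let ?w = "v /\<^sub>R real (Suc n)"
      have w: "cmod ?w \<le> cmod v" "real (Suc n) * cmod ?w = cmod v"
        by (simp_all add: divide_le_eq mult_le_cancel_left1 field_simps)
      show "norm (U n z) \<le> indicator (cball 0 (R + cmod v)) z *\<^sub>R (B * cmod v)"
      proof (cases "z \<in> cball 0 (R + cmod v)")
        case True
        have "norm (U n z) = real (Suc n) * cmod (u (?w + z) - u z)"
          unfolding U_def by (simp only: norm_mult norm_of_nat)
        also have "\<dots> \<le> real (Suc n) * (B * cmod (?w + z - z))"
          by (intro mult_left_mono lip) auto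
        also have "\<dots> = B * (real (Suc n) * cmod ?w)" by (simp only: add_diff_cancel_right' mult.left_commute)
        also have "\<dots> = B * cmod v" unfolding w(2) ..
        finally show ?thesis using True by simp
      next
        case False
        then have big: "R + cmod v < cmod z" by simp
        have "cmod (?w + z) \<ge> cmod z - cmod ?w" using norm_triangle_ineq2[of z "- ?w"] by (simp add: add.commute)
        then have "z \<notin> K" "?w + z \<notin> K" using R[of z] R[of "?w + z"] big w(1) norm_ge_zero[of v] by linarith+
        then show ?thesis using K(2) False by (simp add: U_def)
      qed
    qed
    show "AE z in lborel. (\<lambda>n. U n z) \<longlonglongrightarrow> dir_deriv v u z"
    proof (rule AE_I2)
      fix z
      have "((\<lambda>s. z + s *\<^sub>R v) has_derivative (\<lambda>h. h *\<^sub>R v)) (at 0)"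
        by (auto intro!: derivative_eq_intros)
      moreover have "(u has_derivative (\<lambda>w. dir_deriv w u z)) (at (z + 0 *\<^sub>R v))"
        using d[of z] by (simp add: dir_deriv_def frechet_derivative_works)
      ultimately have "((\<lambda>s. u (z + s *\<^sub>R v)) has_derivative (\<lambda>h. dir_deriv (h *\<^sub>R v) u z)) (at 0)"
        by (rule has_derivative_compose)
      then have "((\<lambda>s. u (z + s *\<^sub>R v)) has_vector_derivative dir_deriv v u z) (at 0)"
        by (simp add: has_vector_derivative_def dir_deriv_scaleR[OF d])
      then have "((\<lambda>h. cmod (u (z + h *\<^sub>R v) - u z - h *\<^sub>R dir_deriv v u z) / \<bar>h\<bar>) \<longlongrightarrow> 0) (at 0)"
        by (simp add: has_vector_derivative_def has_derivative_at)
      moreover have "filterlim (\<lambda>n. inverse (real (Suc n))) (at 0) sequentially"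
        by (rule filterlim_atI[OF LIMSEQ_inverse_real_of_nat]) auto
      ultimately have "(\<lambda>n. cmod (u (z + inverse (real (Suc n)) *\<^sub>R v) - u z - inverse (real (Suc n)) *\<^sub>R dir_deriv v u z)
          / \<bar>inverse (real (Suc n))\<bar>) \<longlonglongrightarrow> 0"
        by (rule filterlim_compose)
      also have "(\<lambda>n. cmod (u (z + inverse (real (Suc n)) *\<^sub>R v) - u z - inverse (real (Suc n)) *\<^sub>R dir_deriv v u z)
          / \<bar>inverse (real (Suc n))\<bar>) = (\<lambda>n. cmod (U n z - dir_deriv v u z))"
      proof
        fix n
        let ?a = "u (z + inverse (real (Suc n)) *\<^sub>R v) - u z"
        have "U n z - dir_deriv v u z = real (Suc n) *\<^sub>R (?a - inverse (real (Suc n)) *\<^sub>R dir_deriv v u z)"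
          by (simp only: U_def scaleR_right_diff_distrib scaleR_scaleR add.commute[of z])
             (simp add: scaleR_conv_of_real right_diff_distrib del: of_nat_Suc)
        then show "cmod (?a - inverse (real (Suc n)) *\<^sub>R dir_deriv v u z) / \<bar>inverse (real (Suc n))\<bar>
            = cmod (U n z - dir_deriv v u z)"
          by (simp add: divide_inverse del: of_nat_Suc)
      qed
      finally have "(\<lambda>n. U n z - dir_deriv v u z) \<longlonglongrightarrow> 0" by (rule tendsto_norm_zero_cancel)
      then show "(\<lambda>n. U n z) \<longlonglongrightarrow> dir_deriv v u z" by (rule LIM_zero_cancel)
    qed
  qed
  then show ?thesis using U0 by (simp add: LIMSEQ_const_iff)
qed

text \<open>Continuous functions whose support avoids the boundary, where the weights degenerate; they can
  be integrated against every weight.\<close>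

definition inner_supported :: "(complex \<Rightarrow> complex) \<Rightarrow> bool" where
  "inner_supported g \<longleftrightarrow> continuous_on UNIV g \<and> (\<exists>K. compact K \<and> K \<subseteq> ball 0 1 \<and> (\<forall>z. z \<notin> K \<longrightarrow> g z = 0))"

lemma inner_supported_test: "\<phi> \<in> test_functions \<Longrightarrow> inner_supported \<phi>"
  unfolding inner_supported_def test_function_iff using smooth_continuous by blast

lemma inner_supported_mult:
  assumes "inner_supported g" "continuous_on (ball 0 1) w"
  shows "inner_supported (\<lambda>z. w z * g z)"
proof -
  obtain K where K: "compact K" "K \<subseteq> ball 0 1" "\<And>z. z \<notin> K \<Longrightarrow> g z = 0" "continuous_on UNIV g"
    using assms(1) unfolding inner_supported_def by blast
  have "continuous_on (ball 0 1) (\<lambda>z. w z * g z)"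
    by (intro continuous_on_mult assms(2) continuous_on_subset[OF K(4)]) auto
  moreover have "continuous_on (- K) (\<lambda>z. w z * g z)"
    using K(3) continuous_on_cong[of "- K" "- K" "\<lambda>z. w z * g z" "\<lambda>z. 0"] by simp
  ultimately have "continuous_on (ball 0 1 \<union> - K) (\<lambda>z. w z * g z)"
    by (intro continuous_on_open_Un) (use K(1) in \<open>auto intro: compact_imp_closed\<close>)
  moreover have "ball 0 1 \<union> - K = UNIV" using K(2) by auto
  ultimately show ?thesis using K unfolding inner_supported_def by (intro conjI exI[of _ K]) auto
qed

lemma continuous_on_weight: "continuous_on (ball 0 1) (\<lambda>z. complex_of_real (bdf z powr s))"
proof (intro continuous_on_of_real continuous_on_powr continuous_on_bdf continuous_on_const ballI)
  fix z :: complex assume "z \<in> ball 0 1"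
  then show "bdf z \<noteq> 0" using bdf_pos_iff[of z] by simp
qed

lemma inner_supported_measurable:
  assumes "inner_supported g" shows "g \<in> borel_measurable borel"
  using assms by (auto simp: inner_supported_def intro: borel_measurable_continuous_onI)

lemma inner_supported_lborel:
  assumes "inner_supported g"
  shows "integrable lborel g" "integrable (lebesgue_on (cball 0 1)) g"
    "(LINT z|lebesgue_on (cball 0 1). g z) = (LINT z|lborel. g z)"
proof -
  obtain K where K: "compact K" "K \<subseteq> ball 0 1" "\<And>z. z \<notin> K \<Longrightarrow> g z = 0" "continuous_on UNIV g"
    using assms unfolding inner_supported_def by blast
  have "integrable lborel (\<lambda>z. indicator K z *\<^sub>R g z)"
    by (rule borel_integrable_compact[OF K(1) continuous_on_subset[OF K(4)]]) auto
  moreover have "(\<lambda>z. indicator K z *\<^sub>R g z) = g" using K(3) by (auto simp: indicator_def)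
  ultimately show i: "integrable lborel g" by simp
  have z: "(\<lambda>z. indicator (cball 0 1) z *\<^sub>R g z) = g"
  proof
    fix z show "indicator (cball 0 1) z *\<^sub>R g z = g z"
      using K(2) K(3)[of z] by (cases "z \<in> K") (auto simp: indicator_def)
  qed
  have il: "integrable lebesgue g" using i by (simp add: integrable_completion borel_measurable_integrable)
  then show "integrable (lebesgue_on (cball 0 1)) g" by (subst integrable_restrict_space) (simp_all add: z)
  have "(LINT z|lebesgue_on (cball 0 1). g z) = (LINT z|lebesgue. indicator (cball 0 1) z *\<^sub>R g z)"
    by (rule integral_restrict_space) simp
  also have "\<dots> = (LINT z|lborel. g z)"
    unfolding z by (rule integral_completion) (use i in simp)
  finally show "(LINT z|lebesgue_on (cball 0 1). g z) = (LINT z|lborel. g z)" .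
qed

lemma inner_supported_disk:
  assumes "inner_supported g"
  shows "integrable (disk_measure s) g"
    "(LINT z|disk_measure s. g z) = (LINT z|lborel. of_real (bdf z powr s) * g z)"
proof -
  have m: "g \<in> borel_measurable (disk_measure s)"
    by (rule borel_measurable_disk[OF inner_supported_measurable[OF assms]])
  note w = inner_supported_lborel[OF inner_supported_mult[OF assms continuous_on_weight]]
  show "integrable (disk_measure s) g"
    unfolding integrable_disk_iff[OF m] using w(2) by (simp add: scaleR_conv_of_real)
  show "(LINT z|disk_measure s. g z) = (LINT z|lborel. of_real (bdf z powr s) * g z)"
    unfolding integral_disk[OF m] using w(3) by (simp add: scaleR_conv_of_real)
qed

text \<open>The derivative of \<open>bdf\<close> along \<open>v\<close> is \<open>- 2 (z \<bullet> v)\<close>. The weight is not differentiable at the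
  boundary, but its product with a test function is differentiable everywhere.\<close>

lemma weighted_integration_by_parts:
  assumes "\<phi> \<in> test_functions"
  shows "(LINT z|disk_measure s. dir_deriv v \<phi> z)
      = of_real (2 * s) * (LINT z|disk_measure (s - 1). of_real (z \<bullet> v) * \<phi> z)"
proof -
  obtain K where K: "compact K" "K \<subseteq> ball 0 1" "\<And>z. z \<notin> K \<Longrightarrow> \<phi> z = 0"
    using assms unfolding test_function_iff by blast
  have sm: "smooth \<phi>" by (rule test_functions_smooth[OF assms])
  define u where "u z = of_real (bdf z powr s) * \<phi> z" for z
  define Du where "Du v z = of_real (bdf z powr s) * dir_deriv v \<phi> z
      - of_real (2 * s) * (of_real (bdf z powr (s - 1)) * (of_real (z \<bullet> v) * \<phi> z))" for v z
  have "(u has_derivative (\<lambda>v. Du v z)) (at z)" for z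
  proof (cases "z \<in> K")
    case True
    then have pos: "bdf z > 0" using K(2) by (auto simp: bdf_pos_iff)
    have "((\<lambda>t. (1 - t) powr s) has_real_derivative - (s * (1 - (cmod z)\<^sup>2) powr (s - 1))) (at ((cmod z)\<^sup>2))"
      using pos by (auto intro!: derivative_eq_intros simp: bdf_def)
    from radial_has_derivative[OF this]
    have "((\<lambda>z. complex_of_real (bdf z powr s)) has_derivative
        (\<lambda>v. of_real (- (s * bdf z powr (s - 1)) * (2 * (z \<bullet> v))))) (at z)"
      by (simp only: bdf_def)
    from has_derivative_mult[OF this smooth_has_derivative[OF sm]]
    show ?thesis unfolding u_def Du_def by (rule has_derivative_eq_rhs) (auto simp: algebra_simps)
  next
    case False
    have "dir_deriv v \<phi> z = 0" for v
    proof (rule dir_deriv_eqI)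
      show "(\<phi> has_derivative (\<lambda>v. 0)) (at z)"
        by (rule has_derivative_transform_within_open[of "\<lambda>z. 0" _ _ _ "- K"])
           (use K False in \<open>auto intro: compact_imp_closed\<close>)
    qed
    then have "Du v z = 0" for v using K(3)[OF False] by (simp add: Du_def)
    moreover have "(u has_derivative (\<lambda>v. 0)) (at z)"
      by (rule has_derivative_transform_within_open[of "\<lambda>z. 0" _ _ _ "- K"])
         (use K False in \<open>auto intro: compact_imp_closed simp: u_def\<close>)
    ultimately show ?thesis by simp
  qed
  note hd = this
  then have du1: "u differentiable (at z)" for z by (auto simp: differentiable_def)
  have du2: "dir_deriv v u z = Du v z" for v z by (rule dir_deriv_eqI[OF hd])
  have i1: "inner_supported (\<lambda>z. of_real (z \<bullet> v) * \<phi> z)" for v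
    by (intro inner_supported_mult inner_supported_test assms continuous_intros)
  have s1: "inner_supported (\<lambda>z. of_real (bdf z powr s) * dir_deriv v \<phi> z)"
     "inner_supported (\<lambda>z. of_real (bdf z powr (s - 1)) * (of_real (z \<bullet> v) * \<phi> z))" for v
    by (intro inner_supported_mult[OF _ continuous_on_weight] inner_supported_test
        test_functions_dir_deriv assms i1)+
  have "(LINT z|lborel. dir_deriv v u z) = 0"
  proof (rule integral_dir_deriv_zero[OF du1 _ K(1)])
    show "continuous_on UNIV (dir_deriv v u)" for v
    proof -
      have "dir_deriv v u = Du v" using du2 by auto
      then show ?thesis unfolding Du_def[abs_def] using s1[of v]
        by (auto simp: inner_supported_def intro!: continuous_intros)
    qed
  qed (use K in \<open>auto simp: u_def\<close>)
  also have "(LINT z|lborel. dir_deriv v u z) = (LINT z|lborel. of_real (bdf z powr s) * dir_deriv v \<phi> z)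
      - of_real (2 * s) * (LINT z|lborel. of_real (bdf z powr (s - 1)) * (of_real (z \<bullet> v) * \<phi> z))"
    unfolding du2 Du_def
    using inner_supported_lborel(1)[OF s1(1)] inner_supported_lborel(1)[OF s1(2)]
    by (subst Bochner_Integration.integral_diff) simp_all
  finally show ?thesis
    unfolding inner_supported_disk(2)[OF inner_supported_test[OF test_functions_dir_deriv[OF assms]]]
      inner_supported_disk(2)[OF i1] by simp
qed

lemma weighted_integration_by_parts_dz:
  assumes "\<phi> \<in> test_functions"
  shows "(LINT z|disk_measure s. dz \<phi> z) = of_real s * (LINT z|disk_measure (s - 1). cnj z * \<phi> z)"
    and "(LINT z|disk_measure s. dzb \<phi> z) = of_real s * (LINT z|disk_measure (s - 1). z * \<phi> z)"
proof -
  have i1: "inner_supported (\<lambda>z. of_real (z \<bullet> v) * \<phi> z)" for v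
    by (intro inner_supported_mult inner_supported_test assms continuous_intros)
  define A B where "A = (LINT z|disk_measure (s - 1). of_real (z \<bullet> 1) * \<phi> z)"
    and "B = (LINT z|disk_measure (s - 1). of_real (z \<bullet> \<i>) * \<phi> z)"
  note iA = inner_supported_disk(1)[OF i1[of 1]] and iB = inner_supported_disk(1)[OF i1[of \<i>]]
  note d1 = inner_supported_disk(1)[OF inner_supported_test[OF test_functions_dir_deriv[OF assms]]]
  have "(\<lambda>z. cnj z * \<phi> z) = (\<lambda>z. of_real (z \<bullet> 1) * \<phi> z - \<i> * (of_real (z \<bullet> \<i>) * \<phi> z))"
    by (auto simp: complex_eq_iff inner_complex_def algebra_simps)
  then have c: "(LINT z|disk_measure (s - 1). cnj z * \<phi> z) = A - \<i> * B"
    unfolding A_def B_def by (simp only: Bochner_Integration.integral_diff iA integrable_mult_right iB integral_mult_right_zero)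
  have "(\<lambda>z. z * \<phi> z) = (\<lambda>z. of_real (z \<bullet> 1) * \<phi> z + \<i> * (of_real (z \<bullet> \<i>) * \<phi> z))"
    by (auto simp: complex_eq_iff inner_complex_def algebra_simps)
  then have d: "(LINT z|disk_measure (s - 1). z * \<phi> z) = A + \<i> * B"
    unfolding A_def B_def by (simp only: Bochner_Integration.integral_add iA integrable_mult_right iB integral_mult_right_zero)
  have alg: "(2 * S * A - \<i> * (2 * S * B)) / 2 = S * (A - \<i> * B)"
    and alg': "(2 * S * A + \<i> * (2 * S * B)) / 2 = S * (A + \<i> * B)" for S
  proof -
    have "2 * S * A - \<i> * (2 * S * B) = 2 * (S * (A - \<i> * B))"
      "2 * S * A + \<i> * (2 * S * B) = 2 * (S * (A + \<i> * B))" by (simp_all add: algebra_simps)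
    then show "(2 * S * A - \<i> * (2 * S * B)) / 2 = S * (A - \<i> * B)"
      "(2 * S * A + \<i> * (2 * S * B)) / 2 = S * (A + \<i> * B)" by simp_all
  qed
  have w: "(LINT z|disk_measure s. dir_deriv 1 \<phi> z) = of_real (2 * s) * A"
    "(LINT z|disk_measure s. dir_deriv \<i> \<phi> z) = of_real (2 * s) * B"
    unfolding A_def B_def by (rule weighted_integration_by_parts[OF assms])+
  have "(LINT z|disk_measure s. dz \<phi> z)
      = ((LINT z|disk_measure s. dir_deriv 1 \<phi> z) - \<i> * (LINT z|disk_measure s. dir_deriv \<i> \<phi> z)) / 2"
    unfolding dz_def by (simp add: d1)
  then show "(LINT z|disk_measure s. dz \<phi> z) = of_real s * (LINT z|disk_measure (s - 1). cnj z * \<phi> z)"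
    unfolding c w of_real_mult of_real_numeral alg .
  have "(LINT z|disk_measure s. dzb \<phi> z)
      = ((LINT z|disk_measure s. dir_deriv 1 \<phi> z) + \<i> * (LINT z|disk_measure s. dir_deriv \<i> \<phi> z)) / 2"
    unfolding dzb_def by (simp add: d1)
  then show "(LINT z|disk_measure s. dzb \<phi> z) = of_real s * (LINT z|disk_measure (s - 1). z * \<phi> z)"
    unfolding d w of_real_mult of_real_numeral alg' .
qed

subsection \<open>The estimate\<close>

lemma smooth_cnj_comp: "smooth u \<Longrightarrow> smooth (\<lambda>z. cnj (u z))"
  and dir_deriv_cnj: "u differentiable (at z) \<Longrightarrow> dir_deriv v (\<lambda>z. cnj (u z)) z = cnj (dir_deriv v u z)"
proof -
  have dd: "dir_deriv v (\<lambda>z. cnj (u z)) z = cnj (dir_deriv v u z)"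
    and di: "(\<lambda>z. cnj (u z)) differentiable (at z)" if "u differentiable (at z)" for u v z
  proof -
    have h: "((\<lambda>z. cnj (u z)) has_derivative (\<lambda>v. cnj (dir_deriv v u z))) (at z)"
      using that unfolding frechet_derivative_works dir_deriv_def by (rule has_derivative_cnj)
    show "dir_deriv v (\<lambda>z. cnj (u z)) z = cnj (dir_deriv v u z)" by (rule dir_deriv_eqI[OF h])
    show "(\<lambda>z. cnj (u z)) differentiable (at z)" using h by (auto simp: differentiable_def)
  qed
  show "dir_deriv v (\<lambda>z. cnj (u z)) z = cnj (dir_deriv v u z)" if "u differentiable (at z)"
    using dd that .
  have "C_times_diff k u \<Longrightarrow> C_times_diff k (\<lambda>z. cnj (u z))" for k u
  proof (induction k arbitrary: u)
    case 0
    then show ?case by (auto intro: continuous_on_cnj)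
  next
    case (Suc k)
    then have "dir_deriv v (\<lambda>z. cnj (u z)) = (\<lambda>z. cnj (dir_deriv v u z))" for v by (auto simp: dd)
    then show ?case using Suc di by simp
  qed
  then show "smooth u \<Longrightarrow> smooth (\<lambda>z. cnj (u z))" by (simp add: smooth_def)
qed

lemma dz_cnj: "u differentiable (at z) \<Longrightarrow> dz (\<lambda>z. cnj (u z)) z = cnj (dzb u z)"
  and dzb_cnj: "u differentiable (at z) \<Longrightarrow> dzb (\<lambda>z. cnj (u z)) z = cnj (dz u z)"
  by (simp_all add: dz_def dzb_def dir_deriv_cnj)

lemma dzb_cnj_ident: "dzb cnj z = 1"
  using dzb_cnj[of "\<lambda>z. z" z] dz_power[of 1 z] by simp

lemma test_functions_cnj:
  assumes "\<phi> \<in> test_functions" shows "(\<lambda>z. cnj (\<phi> z)) \<in> test_functions"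
proof -
  obtain K where "compact K" "K \<subseteq> ball 0 1" "\<And>z. z \<notin> K \<Longrightarrow> \<phi> z = 0"
    using assms unfolding test_function_iff by blast
  then show ?thesis using assms unfolding test_function_iff
    by (intro conjI smooth_cnj_comp exI[of _ K]) auto
qed

text \<open>Both identities are integrations by parts. The first one integrates the derivative of \<open>|q|\<^sup>2\<close>
  along the Euler field \<open>z dz + cnj z dzb\<close>. For the second one, \<open>|dz q|\<^sup>2 - |dzb q|\<^sup>2\<close> is a divergence,
  because \<open>dz\<close> and \<open>dzb\<close> commute; so only the derivative of the weight contributes, which explains the
  factor \<open>s\<close>.\<close>

lemma complex_energy_identities:
  fixes s :: real
  assumes q: "q \<in> test_functions"
  defines "Q \<equiv> sq_norm (disk_measure (s - 1)) q"
    and "R \<equiv> sq_norm (disk_measure (s - 2)) (\<lambda>z. z * q z)"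
    and "U \<equiv> Re (LINT z|disk_measure (s - 1). cnj z * dzb q z * cnj (q z))"
    and "W \<equiv> Re (LINT z|disk_measure (s - 1). z * dz q z * cnj (q z))"
  shows "Q + U + W = (s - 1) * R"
    and "sq_norm (disk_measure s) (dz q) - sq_norm (disk_measure s) (dzb q) = s * (W - U)"
proof -
  note sm = test_functions_smooth
  note df = smooth_differentiable[OF sm]
  have a: "dz q \<in> test_functions" and b: "dzb q \<in> test_functions"
    using q by (auto intro: test_functions_dz test_functions_dzb)
  have c: "smooth (\<lambda>z. cnj (q z))" by (rule smooth_cnj_comp[OF sm[OF q]])
  have int: "integrable (disk_measure r) (\<lambda>z. w z * g z)" if "g \<in> test_functions" "continuous_on UNIV w" for r w g
    by (rule inner_supported_disk(1)[OF inner_supported_mult[OF inner_supported_test[OF that(1)]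
          continuous_on_subset[OF that(2)]]]) auto
  have norm: "of_real (sq_norm (disk_measure r) u) = (LINT z|disk_measure r. u z * cnj (u z))" for r u
    by (simp add: sq_norm_def complex_mult_cnj cmod_power2 flip: integral_complex_of_real)
  have cq: "continuous_on UNIV (\<lambda>z. cnj (q z))" "continuous_on UNIV q"
    using smooth_continuous c sm[OF q] by auto

  have qq: "(\<lambda>z. q z * cnj (q z)) \<in> test_functions"
    using test_functions_mult[OF q c] by (simp add: mult.commute)
  have d1: "dzb (\<lambda>z. cnj z * (q z * cnj (q z))) z
      = q z * cnj (q z) + (cnj z * cnj (q z)) * dzb q z + (cnj z * q z) * cnj (dz q z)" for z
  proof -
    have "dzb (\<lambda>z. cnj z * (q z * cnj (q z))) z
       = dzb cnj z * (q z * cnj (q z)) + cnj z * dzb (\<lambda>z. q z * cnj (q z)) z"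
      by (rule dzb_mult[OF smooth_differentiable[OF smooth_cnj] df[OF qq]])
    also have "dzb (\<lambda>z. q z * cnj (q z)) z = dzb q z * cnj (q z) + q z * cnj (dz q z)"
      unfolding dzb_mult[OF df[OF q] smooth_differentiable[OF c]] dzb_cnj[OF df[OF q]] ..
    finally show ?thesis unfolding dzb_cnj_ident by (simp add: algebra_simps)
  qed
  have t1: "(\<lambda>z. cnj z * (q z * cnj (q z))) \<in> test_functions"
    by (rule test_functions_mult[OF qq smooth_cnj])
  have i: "integrable (disk_measure (s - 1)) (\<lambda>z. q z * cnj (q z))"
    "integrable (disk_measure (s - 1)) (\<lambda>z. (cnj z * cnj (q z)) * dzb q z)"
    "integrable (disk_measure (s - 1)) (\<lambda>z. (cnj z * q z) * cnj (dz q z))"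
    using int[OF qq, of "\<lambda>z. 1"] int[OF b, of "\<lambda>z. cnj z * cnj (q z)"]
      int[OF test_functions_cnj[OF a], of "\<lambda>z. cnj z * q z"]
    by (simp_all add: cq continuous_on_mult continuous_on_cnj continuous_on_id)
  define U' where "U' = (LINT z|disk_measure (s - 1). (cnj z * cnj (q z)) * dzb q z)"
  define W' where "W' = (LINT z|disk_measure (s - 1). (cnj z * q z) * cnj (dz q z))"
  have U: "U = Re U'" unfolding U_def U'_def by (simp add: mult_ac)
  have W: "W = Re W'"
  proof -
    have "W' = cnj (LINT z|disk_measure (s - 1). z * dz q z * cnj (q z))"
      unfolding W'_def Bochner_Integration.integral_cnj[symmetric] by (simp add: mult_ac)
    then show ?thesis by (simp add: W_def)
  qed
  have "of_real Q + U' + W' = of_real (s - 1) * of_real R"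
  proof -
    have "of_real Q + U' + W' = (LINT z|disk_measure (s - 1). dzb (\<lambda>z. cnj z * (q z * cnj (q z))) z)"
      unfolding d1 Q_def norm U'_def W'_def using i by simp
    also have "\<dots> = of_real (s - 1) * (LINT z|disk_measure (s - 1 - 1). z * (cnj z * (q z * cnj (q z))))"
      by (rule weighted_integration_by_parts_dz(2)[OF t1])
    also have "(LINT z|disk_measure (s - 1 - 1). z * (cnj z * (q z * cnj (q z)))) = of_real R"
      unfolding R_def norm by (simp add: mult_ac)
    finally show ?thesis .
  qed
  then have "Re (of_real Q + U' + W') = Re (of_real (s - 1) * of_real R)" by (simp only:)
  then show "Q + U + W = (s - 1) * R" by (simp add: U W)

  have t2: "(\<lambda>z. q z * cnj (dz q z)) \<in> test_functions" "(\<lambda>z. q z * cnj (dzb q z)) \<in> test_functions"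
    using test_functions_mult[OF test_functions_cnj[OF a] sm[OF q]]
      test_functions_mult[OF test_functions_cnj[OF b] sm[OF q]] by auto
  have d2: "dz (\<lambda>z. q z * cnj (dz q z)) z = dz q z * cnj (dz q z) + q z * cnj (dzb (dz q) z)"
    "dzb (\<lambda>z. q z * cnj (dzb q z)) z = dzb q z * cnj (dzb q z) + q z * cnj (dzb (dz q) z)" for z
    unfolding dz_mult[OF df[OF q] smooth_differentiable[OF smooth_cnj_comp[OF sm[OF a]]]]
      dzb_mult[OF df[OF q] smooth_differentiable[OF smooth_cnj_comp[OF sm[OF b]]]]
      dz_cnj[OF df[OF a]] dzb_cnj[OF df[OF b]] dzb_dz_commute[OF sm[OF q]]
    by (rule refl)+
  have i2: "integrable (disk_measure s) (\<lambda>z. dz q z * cnj (dz q z))"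
    "integrable (disk_measure s) (\<lambda>z. dzb q z * cnj (dzb q z))"
    "integrable (disk_measure s) (\<lambda>z. q z * cnj (dzb (dz q) z))"
    using int[OF test_functions_cnj[OF a], of "dz q"] int[OF test_functions_cnj[OF b], of "dzb q"]
      int[OF test_functions_cnj[OF test_functions_dzb[OF a]], of q] cq sm[OF a] sm[OF b]
    by (auto intro: smooth_continuous)
  have "of_real (sq_norm (disk_measure s) (dz q)) - of_real (sq_norm (disk_measure s) (dzb q))
      = (LINT z|disk_measure s. dz (\<lambda>z. q z * cnj (dz q z)) z) - (LINT z|disk_measure s. dzb (\<lambda>z. q z * cnj (dzb q z)) z)"
    unfolding d2 norm using i2 by simp
  also have "\<dots> = of_real s * (LINT z|disk_measure (s - 1). cnj z * (q z * cnj (dz q z)))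
      - of_real s * (LINT z|disk_measure (s - 1). z * (q z * cnj (dzb q z)))"
    unfolding weighted_integration_by_parts_dz(1)[OF t2(1)] weighted_integration_by_parts_dz(2)[OF t2(2)] ..
  also have "(LINT z|disk_measure (s - 1). cnj z * (q z * cnj (dz q z))) = W'"
    unfolding W'_def by (simp add: mult_ac)
  also have "(LINT z|disk_measure (s - 1). z * (q z * cnj (dzb q z))) = cnj U'"
    unfolding U'_def Bochner_Integration.integral_cnj[symmetric] by (simp add: mult_ac)
  finally have "Re (of_real (sq_norm (disk_measure s) (dz q)) - of_real (sq_norm (disk_measure s) (dzb q)))
      = Re (of_real s * W' - of_real s * cnj U')" by (simp only:)
  then show "sq_norm (disk_measure s) (dz q) - sq_norm (disk_measure s) (dzb q) = s * (W - U)"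
    by (simp add: U W algebra_simps)
qed

lemma cmod_sq_eq_Re: "(cmod w)\<^sup>2 = Re (cnj w * w)"
  by (metis Re_complex_of_real complex_norm_square mult.commute)

text \<open>This is the expanded square of \<open>u + c p q / bdf\<close>. It is used for \<open>c = 1 - s\<close>, which lets the first
  of the identities above eliminate the last term, and with \<open>p z\<close> equal to \<open>z\<close> or \<open>cnj z\<close>.\<close>

lemma Hardy_square:
  assumes q: "q \<in> test_functions" and u: "u \<in> test_functions" and p: "continuous_on UNIV p"
    and cp: "\<And>z. cmod (p z) = cmod z"
  shows "0 \<le> sq_norm (disk_measure s) u + 2 * c * Re (LINT z|disk_measure (s - 1). cnj (p z) * u z * cnj (q z))
      + c\<^sup>2 * sq_norm (disk_measure (s - 2)) (\<lambda>z. z * q z)"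
proof -
  have iq: "inner_supported q" and iu: "inner_supported u" using q u by (auto intro: inner_supported_test)
  have cc: "continuous_on UNIV q" "continuous_on UNIV u"
    using iq iu by (auto simp: inner_supported_def)
  have m1: "inner_supported (\<lambda>z. (cnj (p z) * cnj (q z)) * u z)"
    by (rule inner_supported_mult[OF iu]) (intro continuous_intros continuous_on_subset[OF p] continuous_on_subset[OF cc(1)]; simp)+
  have m2: "inner_supported (\<lambda>z. (z * cnj z * cnj (q z)) * q z)"
    by (rule inner_supported_mult[OF iq]) (intro continuous_intros continuous_on_subset[OF cc(1)]; simp)+
  have m0: "inner_supported (\<lambda>z. cnj (u z) * u z)"
    by (rule inner_supported_mult[OF iu]) (intro continuous_intros continuous_on_subset[OF cc(2)]; simp)+
  have X: "integrable (disk_measure r) (\<lambda>z. Re (g z))"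
    "Re (LINT z|disk_measure r. g z) = (LINT z|disk_measure r. Re (g z))" if "inner_supported g" for g r
    using inner_supported_disk(1)[OF that, of r] by auto
  have e0: "sq_norm (disk_measure s) u = (LINT z|disk_measure s. Re (cnj (u z) * u z))"
    unfolding sq_norm_def by (simp only: cmod_sq_eq_Re)
  have e1: "Re (LINT z|disk_measure (s - 1). cnj (p z) * u z * cnj (q z))
      = (LINT z|disk_measure s. bdf z powr (- 1) * Re ((cnj (p z) * cnj (q z)) * u z))"
    and j1: "integrable (disk_measure s) (\<lambda>z. bdf z powr (- 1) * Re ((cnj (p z) * cnj (q z)) * u z))"
  proof -
    have m: "(\<lambda>z. Re ((cnj (p z) * cnj (q z)) * u z)) \<in> borel_measurable (disk_measure (s - 1))"
      using X(1)[OF m1] by (rule borel_measurable_integrable)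
    show "integrable (disk_measure s) (\<lambda>z. bdf z powr (- 1) * Re ((cnj (p z) * cnj (q z)) * u z))"
      using X(1)[OF m1, of "s - 1"] unfolding disk_reweight(1)[OF m, of s] by simp
    have "Re (LINT z|disk_measure (s - 1). cnj (p z) * u z * cnj (q z))
        = (LINT z|disk_measure (s - 1). Re ((cnj (p z) * cnj (q z)) * u z))"
      unfolding X(2)[OF m1, symmetric] by (simp add: mult_ac)
    then show "Re (LINT z|disk_measure (s - 1). cnj (p z) * u z * cnj (q z))
      = (LINT z|disk_measure s. bdf z powr (- 1) * Re ((cnj (p z) * cnj (q z)) * u z))"
      unfolding disk_reweight(2)[OF m, of s] by simp
  qed
  have e2: "sq_norm (disk_measure (s - 2)) (\<lambda>z. z * q z)
      = (LINT z|disk_measure s. bdf z powr (- 2) * Re ((z * cnj z * cnj (q z)) * q z))"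
    and j2: "integrable (disk_measure s) (\<lambda>z. bdf z powr (- 2) * Re ((z * cnj z * cnj (q z)) * q z))"
  proof -
    have m: "(\<lambda>z. Re ((z * cnj z * cnj (q z)) * q z)) \<in> borel_measurable (disk_measure (s - 2))"
      using X(1)[OF m2] by (rule borel_measurable_integrable)
    show "integrable (disk_measure s) (\<lambda>z. bdf z powr (- 2) * Re ((z * cnj z * cnj (q z)) * q z))"
      using X(1)[OF m2, of "s - 2"] unfolding disk_reweight(1)[OF m, of s] by simp
    have "(cmod (z * q z))\<^sup>2 = Re ((z * cnj z * cnj (q z)) * q z)" for z
    proof -
      have "(z * cnj z * cnj (q z)) * q z = of_real ((cmod (z * q z))\<^sup>2)"
        using complex_norm_square[of "z * q z"] by (simp add: mult_ac)
      then show ?thesis by (simp only: Re_complex_of_real)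
    qed
    then show "sq_norm (disk_measure (s - 2)) (\<lambda>z. z * q z)
      = (LINT z|disk_measure s. bdf z powr (- 2) * Re ((z * cnj z * cnj (q z)) * q z))"
      unfolding sq_norm_def using disk_reweight(2)[OF m, of s] by simp
  qed
  have "0 \<le> (LINT z|disk_measure s. Re (cnj (u z) * u z)
      + 2 * c * (bdf z powr (- 1) * Re ((cnj (p z) * cnj (q z)) * u z))
      + c\<^sup>2 * (bdf z powr (- 2) * Re ((z * cnj z * cnj (q z)) * q z)))"
  proof (rule integral_nonneg_AE, rule eventually_mono[OF AE_disk_interior])
    fix z assume "cmod z < 1"
    then have pos: "bdf z > 0" by (simp add: bdf_pos_iff)
    define k where "k = bdf z powr (- 1)"
    have k2: "bdf z powr (- 2) = k\<^sup>2" unfolding k_def power2_eq_square powr_add[symmetric] by simp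
    have alg: "(cmod (x + of_real r * y))\<^sup>2 = (cmod x)\<^sup>2 + 2 * r * Re (cnj y * x) + r\<^sup>2 * (cmod y)\<^sup>2" for x y r
      unfolding cmod_power2 by (simp add: power2_eq_square algebra_simps)
    have "0 \<le> (cmod (u z + of_real (c * k) * (p z * q z)))\<^sup>2" by simp
    also have "\<dots> = (cmod (u z))\<^sup>2 + 2 * (c * k) * Re (cnj (p z * q z) * u z) + (c * k)\<^sup>2 * (cmod (p z * q z))\<^sup>2"
      by (rule alg)
    also have "(cmod (u z))\<^sup>2 = Re (cnj (u z) * u z)" by (rule cmod_sq_eq_Re)
    also have "(cmod (p z * q z))\<^sup>2 = Re ((z * cnj z * cnj (q z)) * q z)"
    proof -
      have "(z * cnj z * cnj (q z)) * q z = of_real ((cmod (z * q z))\<^sup>2)"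
        using complex_norm_square[of "z * q z"] by (simp add: mult_ac)
      then show ?thesis by (simp only: Re_complex_of_real norm_mult cp)
    qed
    finally show "0 \<le> Re (cnj (u z) * u z)
      + 2 * c * (bdf z powr (- 1) * Re ((cnj (p z) * cnj (q z)) * u z))
      + c\<^sup>2 * (bdf z powr (- 2) * Re ((z * cnj z * cnj (q z)) * q z))"
      unfolding k2 k_def[symmetric] by (simp only: complex_cnj_mult power_mult_distrib mult.assoc)
  qed
  then show ?thesis
    unfolding e0 e1 e2
    by (simp only: Bochner_Integration.integral_add Bochner_Integration.integrable_add integrable_mult_right
        integral_mult_right_zero X(1)[OF m0] j1 j2)
qed

text \<open>Let \<open>\<alpha>\<close>, \<open>\<beta>\<close> be the energies of \<open>dz q\<close>, \<open>dzb q\<close> and \<open>T = W - U\<close> the difference of the cross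
  terms. The two Hardy squares become \<open>(1 - s) (Q + T) \<le> \<beta>\<close> and \<open>(1 - s) (Q - T) \<le> \<alpha>\<close>, and the
  second identity is \<open>\<alpha> - \<beta> = s T\<close>. Eliminating \<open>T\<close> bounds \<open>\<beta>\<close>, and then \<open>Q\<close>, by \<open>\<alpha>\<close>, as long as
  \<open>\<bar>s\<bar> < 1\<close>.\<close>

lemma dz_controls_dzb:
  assumes s: "-1 < s" "s < 1" and q: "q \<in> test_functions"
  shows "sq_norm (disk_measure s) (dzb q) \<le> 4 / (1 - s) * sq_norm (disk_measure s) (dz q)"
    and "sq_norm (disk_measure (s - 1)) q \<le> 3 / (1 - s)\<^sup>2 * sq_norm (disk_measure s) (dz q)"
proof -
  define \<alpha> \<beta> Q R where "\<alpha> = sq_norm (disk_measure s) (dz q)" and "\<beta> = sq_norm (disk_measure s) (dzb q)"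
    and "Q = sq_norm (disk_measure (s - 1)) q" and "R = sq_norm (disk_measure (s - 2)) (\<lambda>z. z * q z)"
  define U W where "U = Re (LINT z|disk_measure (s - 1). cnj z * dzb q z * cnj (q z))"
    and "W = Re (LINT z|disk_measure (s - 1). z * dz q z * cnj (q z))"
  have 1: "Q + U + W = (s - 1) * R" and 2: "\<alpha> - \<beta> = s * (W - U)"
    unfolding \<alpha>_def \<beta>_def Q_def R_def U_def W_def by (rule complex_energy_identities[OF q])+
  have 3: "0 \<le> \<beta> + 2 * (1 - s) * U + (1 - s)\<^sup>2 * R"
    unfolding \<beta>_def R_def U_def
    by (rule Hardy_square[OF q test_functions_dzb[OF q], of "\<lambda>z. z"]) auto
  have 4: "0 \<le> \<alpha> + 2 * (1 - s) * W + (1 - s)\<^sup>2 * R"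
    unfolding \<alpha>_def R_def W_def
    using Hardy_square[OF q test_functions_dz[OF q], of cnj s "1 - s"] by (auto intro: continuous_on_cnj)
  define T where "T = W - U"
  have nn: "0 \<le> Q" "0 \<le> \<alpha>" "0 \<le> \<beta>" by (simp_all add: Q_def \<alpha>_def \<beta>_def sq_norm_nonneg)
  have R: "(1 - s) * R = - Q - U - W" using 1 by (simp add: algebra_simps)
  have b: "(1 - s) * (Q + T) \<le> \<beta>"
  proof -
    have "\<beta> + 2 * (1 - s) * U + (1 - s)\<^sup>2 * R = \<beta> + (1 - s) * (2 * U + (1 - s) * R)"
      by (simp add: power2_eq_square algebra_simps)
    also have "\<dots> = \<beta> - (1 - s) * (Q + T)" unfolding R T_def by (simp add: algebra_simps)
    finally show ?thesis using 3 by simp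
  qed
  have a: "(1 - s) * (Q - T) \<le> \<alpha>"
  proof -
    have "\<alpha> + 2 * (1 - s) * W + (1 - s)\<^sup>2 * R = \<alpha> + (1 - s) * (2 * W + (1 - s) * R)"
      by (simp add: power2_eq_square algebra_simps)
    also have "\<dots> = \<alpha> - (1 - s) * (Q - T)" unfolding R T_def by (simp add: algebra_simps)
    finally show ?thesis using 4 by simp
  qed
  have ab: "\<beta> = \<alpha> - s * T" using 2 by (simp add: T_def)
  have QQ: "0 \<le> (1 - s) * Q" using s nn by simp
  have main: "(1 - s) * \<beta> \<le> 4 * \<alpha>"
  proof (cases "0 \<le> s")
    case True
    have "(1 - s) * (- T) \<le> \<alpha>"
      using a QQ by (simp add: algebra_simps)
    then have "s * ((1 - s) * (- T)) \<le> s * \<alpha>" using True by (rule mult_left_mono)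
    moreover have "(1 - s) * \<beta> = (1 - s) * \<alpha> + s * ((1 - s) * (- T))" unfolding ab by (simp add: algebra_simps)
    moreover have "(1 - s) * \<alpha> + s * \<alpha> = \<alpha>" by (simp add: algebra_simps)
    ultimately show ?thesis using nn(2) by linarith
  next
    case False
    have "(1 - s) * T \<le> \<beta>"
      using b QQ by (simp add: algebra_simps)
    then have "(- s) * ((1 - s) * T) \<le> (- s) * \<beta>" using False by (intro mult_left_mono) auto
    moreover have "(1 - s) * \<beta> = (1 - s) * \<alpha> + (- s) * ((1 - s) * T)" unfolding ab by (simp add: algebra_simps)
    moreover have "(1 - s) * \<beta> = \<beta> + (- s) * \<beta>" by (simp add: algebra_simps)
    ultimately have "\<beta> \<le> (1 - s) * \<alpha>" by linarith
    also have "\<dots> \<le> 2 * \<alpha>" using s nn by (intro mult_right_mono) auto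
    finally have "\<beta> \<le> 2 * \<alpha>" .
    moreover have "(1 - s) * \<beta> \<le> 2 * \<beta>" using s nn by (intro mult_right_mono) auto
    ultimately show ?thesis by linarith
  qed
  then show "\<beta> \<le> 4 / (1 - s) * \<alpha>" using s by (simp add: field_simps)
  have "(1 - s) * (2 * Q) \<le> \<alpha> + \<beta>" using a b by (simp add: algebra_simps)
  then have "(1 - s) * ((1 - s) * (2 * Q)) \<le> (1 - s) * (\<alpha> + \<beta>)" using s by (intro mult_left_mono) auto
  also have "\<dots> \<le> 2 * \<alpha> + 4 * \<alpha>"
    unfolding distrib_left using main s nn by (intro add_mono mult_right_mono) auto
  finally have "(1 - s)\<^sup>2 * Q \<le> 3 * \<alpha>" by (simp add: power2_eq_square algebra_simps)
  then show "Q \<le> 3 / (1 - s)\<^sup>2 * \<alpha>" using s by (simp add: field_simps)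
qed

lemma test_functions_sq_int:
  assumes g: "g \<in> test_functions"
  shows "sq_int (disk_measure r) g"
proof -
  have c: "continuous_on UNIV g" by (rule smooth_continuous[OF test_functions_smooth[OF g]])
  have "inner_supported (\<lambda>z. cnj (g z) * g z)"
    by (rule inner_supported_mult[OF inner_supported_test[OF g]])
       (intro continuous_on_cnj continuous_on_subset[OF c] subset_UNIV)
  then have "integrable (disk_measure r) (\<lambda>z. Re (cnj (g z) * g z))"
    by (intro integrable_Re inner_supported_disk(1))
  then show ?thesis unfolding sq_int_def cmod_sq_eq_Re
    using continuous_measurable_disk[OF c] by blast
qed

text \<open>The estimate of \<open>q\<close> with weight \<open>s - 1\<close> implies the one with the smaller weight \<open>s\<close>, and \<open>dz\<close>, \<open>dzb\<close>
  together control both partial derivatives.\<close>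

lemma H1_norm_le_dz:
  assumes "-1 < s" "s < 1"
  shows "\<exists>C>0. \<forall>q\<in>test_functions. (H1_norm s q)\<^sup>2 \<le> C * sq_norm (disk_measure s) (dz q)"
proof -
  define C where "C = 3 / (1 - s)\<^sup>2 + 4 * (1 + 4 / (1 - s))"
  have C: "C > 0" using assms by (auto simp: C_def intro!: add_pos_pos divide_pos_pos)
  have "(H1_norm s q)\<^sup>2 \<le> C * sq_norm (disk_measure s) (dz q)" if q: "q \<in> test_functions" for q
  proof -
    have le: "sq_norm (disk_measure s) q \<le> sq_norm (disk_measure (s - 1)) q"
    proof -
      have i: "integrable (disk_measure (s - 1)) (\<lambda>z. (cmod (q z))\<^sup>2)" and i': "integrable (disk_measure s) (\<lambda>z. (cmod (q z))\<^sup>2)"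
        using test_functions_sq_int[OF q] by (auto simp: sq_int_def)
      have "sq_norm (disk_measure s) q = (LINT z|disk_measure (s - 1). (bdf z powr 1) *\<^sub>R (cmod (q z))\<^sup>2)"
        unfolding sq_norm_def using disk_reweight(2)[OF borel_measurable_integrable[OF i'], of "s - 1"] by simp
      also have "\<dots> \<le> sq_norm (disk_measure (s - 1)) q"
        unfolding sq_norm_def
      proof (rule integral_mono_AE[OF _ i])
        show "integrable (disk_measure (s - 1)) (\<lambda>z. (bdf z powr 1) *\<^sub>R (cmod (q z))\<^sup>2)"
          using disk_reweight(1)[OF borel_measurable_integrable[OF i'], of "s - 1"] i' by simp
        show "AE z in disk_measure (s - 1). (bdf z powr 1) *\<^sub>R (cmod (q z))\<^sup>2 \<le> (cmod (q z))\<^sup>2"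
        proof (rule eventually_mono[OF AE_disk_interior])
          fix z assume "cmod z < 1"
          then have "0 < bdf z" by (simp add: bdf_pos_iff)
          then show "(bdf z powr 1) *\<^sub>R (cmod (q z))\<^sup>2 \<le> (cmod (q z))\<^sup>2"
            using bdf_le_1[of z] by (auto intro: mult_left_le_one_le)
        qed
      qed
      finally show ?thesis .
    qed
    have a: "sq_int (disk_measure s) (dz q)" and b: "sq_int (disk_measure s) (dzb q)"
      using q by (auto intro: test_functions_sq_int test_functions_dz test_functions_dzb)
    have "dir_deriv 1 q = (\<lambda>z. dz q z + dzb q z)" by (auto simp: dz_def dzb_def field_simps)
    then have x: "sq_norm (disk_measure s) (dir_deriv 1 q)
        \<le> 2 * sq_norm (disk_measure s) (dz q) + 2 * sq_norm (disk_measure s) (dzb q)"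
      using sq_int_add(2)[OF a b] by simp
    have "dir_deriv \<i> q = (\<lambda>z. \<i> * (dz q z - dzb q z))" by (auto simp: dz_def dzb_def field_simps)
    then have y: "sq_norm (disk_measure s) (dir_deriv \<i> q)
        \<le> 2 * sq_norm (disk_measure s) (dz q) + 2 * sq_norm (disk_measure s) (dzb q)"
      using sq_int_diff(2)[OF a b] sq_int_scale(2)[OF sq_int_diff(1)[OF a b], of \<i>] by simp
    have "(H1_norm s q)\<^sup>2 = sq_norm (disk_measure s) q
        + (sq_norm (disk_measure s) (dir_deriv 1 q) + sq_norm (disk_measure s) (dir_deriv \<i> q))"
      unfolding H1_norm_def L2_norm_sq by (simp add: sq_norm_nonneg)
    also have "\<dots> \<le> sq_norm (disk_measure (s - 1)) q + (4 * sq_norm (disk_measure s) (dz q) + 4 * sq_norm (disk_measure s) (dzb q))"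
      using le x y by linarith
    also have "\<dots> \<le> 3 / (1 - s)\<^sup>2 * sq_norm (disk_measure s) (dz q)
        + (4 * sq_norm (disk_measure s) (dz q) + 4 * (4 / (1 - s) * sq_norm (disk_measure s) (dz q)))"
      using dz_controls_dzb[OF assms q] by linarith
    also have "\<dots> = C * sq_norm (disk_measure s) (dz q)" by (simp add: C_def algebra_simps)
    finally show ?thesis .
  qed
  with C show ?thesis by blast
qed

section \<open>Lebesgue measure on the plane\<close>

text \<open>The Borel function \<open>v\<close> makes Fubini's theorem applicable; the continuous approximations \<open>g n\<close> lead
  to the density of continuous functions.\<close>

lemma borel_representative:
  fixes u :: "complex \<Rightarrow> complex"
  assumes "u \<in> borel_measurable (lebesgue_on S)" "S \<in> sets lebesgue"
  obtains v g N where "v \<in> borel_measurable borel" "negligible N" "\<And>n::nat. continuous_on UNIV (g n)"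
    "\<And>z. z \<notin> N \<Longrightarrow> v z = (if z \<in> S then u z else 0)"
    "\<And>z. z \<notin> N \<Longrightarrow> (\<lambda>n. g n z) \<longlonglongrightarrow> v z"
proof -
  have "u measurable_on S"
    using assms measurable_on_iff_borel_measurable by blast
  then obtain N g where N: "negligible N" and g: "\<And>n::nat. continuous_on UNIV (g n)"
    and lim: "\<And>z. z \<notin> N \<Longrightarrow> (\<lambda>n. g n z) \<longlonglongrightarrow> (if z \<in> S then u z else 0)"
    unfolding measurable_on_def by blast
  have [measurable]: "g n \<in> borel_measurable borel" for n
    by (rule borel_measurable_continuous_onI[OF g])
  define v where "v z = lim (\<lambda>n. g n z)" for z
  have "v \<in> borel_measurable borel" unfolding v_def by (rule borel_measurable_lim_metric) measurable
  moreover have "v z = (if z \<in> S then u z else 0)" if "z \<notin> N" for z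
    unfolding v_def by (rule limI[OF lim[OF that]])
  moreover have "(\<lambda>n. g n z) \<longlonglongrightarrow> v z" if "z \<notin> N" for z
    using lim[OF that] calculation(2)[OF that] by simp
  ultimately show ?thesis using that N g by blast
qed

lemma lborel_Complex: "distr lborel borel (\<lambda>p. Complex (fst p) (snd p)) = (lborel :: complex measure)"
proof (rule lborel_eqI[symmetric])
  have m [measurable]: "(\<lambda>p::real \<times> real. Complex (fst p) (snd p)) \<in> borel_measurable borel"
    unfolding complex_eq by (intro borel_measurable_continuous_onI continuous_intros)
  fix l u :: complex
  assume le: "\<And>b. b \<in> Basis \<Longrightarrow> l \<bullet> b \<le> u \<bullet> b"
  have "(\<lambda>p. Complex (fst p) (snd p)) -` box l u = box (Re l, Im l) (Re u, Im u)"
    by (auto simp: box_def Basis_complex_def Basis_prod_def inner_complex_def)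
  then have "emeasure (distr lborel borel (\<lambda>p. Complex (fst p) (snd p))) (box l u)
      = emeasure lborel (box (Re l, Im l) (Re u, Im u))"
    by (subst emeasure_distr) auto
  also have "box (Re l, Im l) (Re u, Im u) = {Re l<..<Re u} \<times> {Im l<..<Im u}"
    by (auto simp: box_def Basis_prod_def)
  also have "emeasure lborel ({Re l<..<Re u} \<times> {Im l<..<Im u}) = ennreal ((Re u - Re l) * (Im u - Im l))"
    using le[of 1] le[of \<i>] unfolding lborel_prod[symmetric]
    by (subst lborel.emeasure_pair_measure_Times) (auto simp: Basis_complex_def ennreal_mult inner_complex_def)
  also have "(Re u - Re l) * (Im u - Im l) = (\<Prod>b\<in>Basis. (u - l) \<bullet> b)"
    by (simp add: Basis_complex_def inner_complex_def)
  finally show "emeasure (distr lborel borel (\<lambda>p. Complex (fst p) (snd p))) (box l u)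
      = ennreal (\<Prod>b\<in>Basis. (u - l) \<bullet> b)" .
qed simp

text \<open>On every horizontal line the shear is a translation.\<close>

lemma lborel_shear_fst: "distr lborel borel (\<lambda>p::real \<times> real. (fst p + a * snd p, snd p)) = lborel"
proof (rule measure_eqI)
  fix A assume A: "A \<in> sets (distr lborel borel (\<lambda>p::real \<times> real. (fst p + a * snd p, snd p)))"
  have m [measurable]: "(\<lambda>p::real \<times> real. (fst p + a * snd p, snd p)) \<in> borel_measurable borel"
    by (intro borel_measurable_continuous_onI continuous_intros)
  let ?B = "(\<lambda>p. (fst p + a * snd p, snd p)) -` A"
  have Ab: "A \<in> sets borel" using A by simp
  have B: "?B \<in> sets borel" using measurable_sets[OF m Ab] by simp
  have s: "A \<in> sets (lborel \<Otimes>\<^sub>M lborel)" "?B \<in> sets (lborel \<Otimes>\<^sub>M lborel)"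
    using Ab B by (simp_all only: lborel_prod sets_lborel)
  have "emeasure (distr lborel borel (\<lambda>p. (fst p + a * snd p, snd p))) A = emeasure (lborel \<Otimes>\<^sub>M lborel) ?B"
    using Ab by (subst emeasure_distr) (auto simp: lborel_prod)
  also have "\<dots> = (\<integral>\<^sup>+y. emeasure lborel ((\<lambda>x. (x, y)) -` ?B) \<partial>lborel)"
    by (rule lborel_pair.emeasure_pair_measure_alt2[OF s(2)])
  also have "\<dots> = (\<integral>\<^sup>+y. emeasure lborel ((\<lambda>x. (x, y)) -` A) \<partial>lborel)"
  proof (rule nn_integral_cong)
    fix y :: real
    have Ay: "(\<lambda>x. (x, y)) -` A \<in> sets borel" using sets_Pair2[OF s(1), of y] by simp
    have "(\<lambda>x. (x, y)) -` ?B = (+) (a * y) -` ((\<lambda>x. (x, y)) -` A)" by (auto simp: add.commute)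
    also have "emeasure lborel \<dots> = emeasure (distr lborel borel ((+) (a * y))) ((\<lambda>x. (x, y)) -` A)"
      using Ay by (subst emeasure_distr) auto
    also have "\<dots> = emeasure lborel ((\<lambda>x. (x, y)) -` A)" by (simp only: lborel_distr_plus)
    finally show "emeasure lborel ((\<lambda>x. (x, y)) -` ?B) = emeasure lborel ((\<lambda>x. (x, y)) -` A)" .
  qed
  also have "\<dots> = emeasure (lborel \<Otimes>\<^sub>M lborel) A"
    by (rule lborel_pair.emeasure_pair_measure_alt2[OF s(1), symmetric])
  finally show "emeasure (distr lborel borel (\<lambda>p. (fst p + a * snd p, snd p))) A = emeasure lborel A"
    by (simp add: lborel_prod)
qed simp

lemma lborel_shear_snd: "distr lborel borel (\<lambda>p::real \<times> real. (fst p, snd p + a * fst p)) = lborel"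
proof (rule measure_eqI)
  fix A assume A: "A \<in> sets (distr lborel borel (\<lambda>p::real \<times> real. (fst p, snd p + a * fst p)))"
  have m [measurable]: "(\<lambda>p::real \<times> real. (fst p, snd p + a * fst p)) \<in> borel_measurable borel"
    by (intro borel_measurable_continuous_onI continuous_intros)
  let ?B = "(\<lambda>p. (fst p, snd p + a * fst p)) -` A"
  have Ab: "A \<in> sets borel" using A by simp
  have B: "?B \<in> sets borel" using measurable_sets[OF m Ab] by simp
  have s: "A \<in> sets (lborel \<Otimes>\<^sub>M lborel)" "?B \<in> sets (lborel \<Otimes>\<^sub>M lborel)"
    using Ab B by (simp_all only: lborel_prod sets_lborel)
  have "emeasure (distr lborel borel (\<lambda>p. (fst p, snd p + a * fst p))) A = emeasure (lborel \<Otimes>\<^sub>M lborel) ?B"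
    using Ab by (subst emeasure_distr) (auto simp: lborel_prod)
  also have "\<dots> = (\<integral>\<^sup>+x. emeasure lborel (Pair x -` ?B) \<partial>lborel)"
    by (rule lborel.emeasure_pair_measure_alt[OF s(2)])
  also have "\<dots> = (\<integral>\<^sup>+x. emeasure lborel (Pair x -` A) \<partial>lborel)"
  proof (rule nn_integral_cong)
    fix x :: real
    have Ax: "Pair x -` A \<in> sets borel" using sets_Pair1[OF s(1), of x] by simp
    have "Pair x -` ?B = (+) (a * x) -` (Pair x -` A)" by (auto simp: add.commute)
    also have "emeasure lborel \<dots> = emeasure (distr lborel borel ((+) (a * x))) (Pair x -` A)"
      using Ax by (subst emeasure_distr) auto
    also have "\<dots> = emeasure lborel (Pair x -` A)" by (simp only: lborel_distr_plus)
    finally show "emeasure lborel (Pair x -` ?B) = emeasure lborel (Pair x -` A)" .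
  qed
  also have "\<dots> = emeasure (lborel \<Otimes>\<^sub>M lborel) A"
    by (rule lborel.emeasure_pair_measure_alt[OF s(1), symmetric])
  finally show "emeasure (distr lborel borel (\<lambda>p. (fst p, snd p + a * fst p))) A = emeasure lborel A"
    by (simp add: lborel_prod)
qed simp

text \<open>A rotation by an angle that is no multiple of \<open>pi\<close> is a product of three shears.\<close>

lemma lborel_rotation:
  assumes w: "cmod w = 1" "Im w \<noteq> 0"
  shows "distr lborel borel ((*) w) = (lborel :: complex measure)"
proof -
  define c s a where "c = Re w" and "s = Im w" and "a = (c - 1) / s"
  have cs: "c\<^sup>2 + s\<^sup>2 = 1" using w(1) cmod_power2[of w] by (simp add: c_def s_def)
  have s0: "s \<noteq> 0" using w(2) by (simp add: s_def)
  have as: "a * s = c - 1" using s0 by (simp add: a_def)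
  have "(c - 1) * (c + 1) = - s * s" using cs by (simp add: power2_eq_square algebra_simps)
  then have ac: "a * (c + 1) = - s" using s0 by (simp add: a_def field_simps)
  let ?X = "\<lambda>p::real \<times> real. (fst p + a * snd p, snd p)" and ?Y = "\<lambda>p::real \<times> real. (fst p, snd p + s * fst p)"
  let ?C = "\<lambda>p::real \<times> real. Complex (fst p) (snd p)"
  have [measurable]: "?X \<in> borel_measurable borel" "?Y \<in> borel_measurable borel" "?C \<in> borel_measurable borel"
      "(*) w \<in> borel_measurable borel"
    unfolding complex_eq by (intro borel_measurable_continuous_onI continuous_intros)+
  have dd: "distr (distr lborel borel f) borel g = distr lborel borel (\<lambda>p. g (f p))"
    if "f \<in> borel_measurable borel" "g \<in> borel_measurable borel"
    for f :: "real \<times> real \<Rightarrow> real \<times> real" and g :: "real \<times> real \<Rightarrow> 'b::topological_space"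
    by (subst distr_distr) (use that in \<open>simp_all add: comp_def\<close>)
  have m: "?X \<in> borel_measurable borel" "?Y \<in> borel_measurable borel" "?C \<in> borel_measurable borel"
    "(\<lambda>p. ?Y (?X p)) \<in> borel_measurable borel" "(\<lambda>p. ?X (?Y (?X p))) \<in> borel_measurable borel"
    unfolding complex_eq by (intro borel_measurable_continuous_onI continuous_intros)+
  have rot: "?C (?X (?Y (?X p))) = w * ?C p" for p
  proof -
    have "fst p + a * snd p + a * (snd p + s * (fst p + a * snd p))
        = (1 + a * s) * fst p + (a * (a * s + 2)) * snd p" by (simp add: algebra_simps)
    also have "\<dots> = c * fst p - s * snd p" using ac by (simp add: as algebra_simps)
    finally have 1: "fst p + a * snd p + a * (snd p + s * (fst p + a * snd p)) = c * fst p - s * snd p" .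
    have "snd p + s * (fst p + a * snd p) = s * fst p + (1 + a * s) * snd p" by (simp add: algebra_simps)
    then have 2: "snd p + s * (fst p + a * snd p) = c * snd p + s * fst p" by (simp add: as)
    show ?thesis using 1 2 by (simp add: complex_eq_iff c_def s_def)
  qed
  have "distr lborel borel ((*) w) = distr (distr lborel borel ?C) borel ((*) w)" by (simp only: lborel_Complex)
  also have "\<dots> = distr lborel borel (\<lambda>p. w * ?C p)" by (subst distr_distr) (auto simp: comp_def)
  also have "\<dots> = distr lborel borel (\<lambda>p. ?C (?X (?Y (?X p))))" by (simp only: rot)
  also have "\<dots> = distr (distr (distr (distr lborel borel ?X) borel ?Y) borel ?X) borel ?C"
    by (simp only: dd m)
  also have "\<dots> = lborel" by (simp only: lborel_shear_fst lborel_shear_snd lborel_Complex)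
  finally show ?thesis .
qed

lemma rotation_root_exists:
  assumes "j \<noteq> (l::nat)"
  shows "\<exists>w. cmod w = 1 \<and> Im w \<noteq> 0 \<and> w ^ j * cnj w ^ l \<noteq> 1"
proof -
  define \<theta> where "\<theta> = pi / (2 * (real j + real l + 1))"
  have d: "0 < 2 * (real j + real l + 1)" by simp
  have \<theta>: "0 < \<theta>" "\<theta> < pi" using d by (auto simp: \<theta>_def divide_less_eq intro!: mult_less_cancel_left1[THEN iffD2])
  have "sin \<theta> > 0" using \<theta> by (rule sin_gt_zero)
  let ?x = "(real j - real l) * \<theta>"
  have "sin ?x \<noteq> 0"
  proof -
    have "\<bar>real j - real l\<bar> * \<theta> \<le> (real j + real l) * \<theta>" using \<theta> by (intro mult_right_mono) auto
    also have "\<dots> < (2 * (real j + real l + 1)) * \<theta>" using \<theta> by (intro mult_strict_right_mono) auto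
    also have "\<dots> = pi" using d by (simp add: \<theta>_def)
    finally have lt: "\<bar>real j - real l\<bar> * \<theta> < pi" .
    moreover have "0 < \<bar>real j - real l\<bar> * \<theta>" using assms \<theta> by simp
    ultimately have "sin (\<bar>real j - real l\<bar> * \<theta>) > 0" by (intro sin_gt_zero)
    then show ?thesis by (auto simp: abs_if algebra_simps sin_diff split: if_splits)
  qed
  moreover have "cis \<theta> ^ j * cnj (cis \<theta>) ^ l = cis ?x"
  proof -
    have "cis \<theta> ^ j * cnj (cis \<theta>) ^ l = cis (real j * \<theta> + real l * (- \<theta>))"
      unfolding cis_cnj Complex.DeMoivre cis_mult ..
    also have "real j * \<theta> + real l * (- \<theta>) = ?x" by (simp add: algebra_simps)
    finally show ?thesis .
  qed
  ultimately have "cis \<theta> ^ j * cnj (cis \<theta>) ^ l \<noteq> 1" by (auto simp: complex_eq_iff)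
  then show ?thesis using \<open>sin \<theta> > 0\<close> by (intro exI[of _ "cis \<theta>"]) auto
qed

text \<open>Rotating the plane by \<open>w\<close> multiplies the integral by \<open>w ^ j * cnj w ^ l\<close>, which differs from 1 for
  a suitable \<open>w\<close>.\<close>

lemma angular_orthogonality:
  assumes [measurable]: "A \<in> borel_measurable borel" and "j \<noteq> l"
  shows "(LINT z|disk_measure s. z ^ j * cnj z ^ l * A (cmod z)) = 0"
proof -
  define h where "h z = indicator (cball 0 1) z *\<^sub>R ((bdf z powr s) *\<^sub>R (z ^ j * cnj z ^ l * A (cmod z)))" for z
  have g [measurable]: "(\<lambda>z. z ^ j * cnj z ^ l * A (cmod z)) \<in> borel_measurable borel"
    by (intro borel_measurable_times borel_measurable_power borel_measurable_cnj) measurable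
  have hm [measurable]: "h \<in> borel_measurable borel" unfolding h_def[abs_def]
    by (intro borel_measurable_scaleR borel_measurable_indicator g borel_closed) simp_all
  have "(LINT z|disk_measure s. z ^ j * cnj z ^ l * A (cmod z)) = (LINT z|lebesgue. h z)"
    unfolding integral_disk[OF borel_measurable_disk[OF g]] h_def
    by (rule integral_restrict_space) simp
  also have "\<dots> = (LINT z|lborel. h z)" by (rule integral_completion) (use hm in simp)
  finally have I: "(LINT z|disk_measure s. z ^ j * cnj z ^ l * A (cmod z)) = (LINT z|lborel. h z)" .
  obtain w where w: "cmod w = 1" "Im w \<noteq> 0" "w ^ j * cnj w ^ l \<noteq> 1"
    using rotation_root_exists[OF assms(2)] by blast
  have "(LINT z|lborel. h z) = (LINT z|distr lborel borel ((*) w). h z)" by (simp only: lborel_rotation[OF w(1,2)])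
  also have "\<dots> = (LINT z|lborel. h (w * z))"
    by (rule integral_distr) (auto intro!: borel_measurable_continuous_onI continuous_intros)
  also have "(\<lambda>z. h (w * z)) = (\<lambda>z. (w ^ j * cnj w ^ l) * h z)"
    by (auto simp: h_def bdf_def norm_mult w(1) indicator_def power_mult_distrib scaleR_conv_of_real)
  finally have "(LINT z|lborel. h z) = (w ^ j * cnj w ^ l) * (LINT z|lborel. h z)" by simp
  then have "(1 - w ^ j * cnj w ^ l) * (LINT z|lborel. h z) = 0" by (simp add: algebra_simps)
  then show ?thesis unfolding I using w(3) by simp
qed

section \<open>Density of explicit functions\<close>

lemma sq_norm_dominated_convergence:
  assumes [measurable]: "\<And>n. u n \<in> borel_measurable M" "u' \<in> borel_measurable M"
    and w: "sq_int M w" and le: "\<And>n. AE z in M. cmod (u n z) \<le> cmod (w z)"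
    and lim: "AE z in M. (\<lambda>n. u n z) \<longlonglongrightarrow> u' z"
  shows "(\<lambda>n. sq_norm M (\<lambda>z. u n z - u' z)) \<longlonglongrightarrow> 0"
proof -
  have le': "AE z in M. \<forall>n. cmod (u n z) \<le> cmod (w z)" using le by (simp add: AE_all_countable)
  have "(\<lambda>n. LINT z|M. (cmod (u n z - u' z))\<^sup>2) \<longlonglongrightarrow> (LINT z|M. 0)"
  proof (rule integral_dominated_convergence[where w = "\<lambda>z. 4 * (cmod (w z))\<^sup>2"])
    show "integrable M (\<lambda>z. 4 * (cmod (w z))\<^sup>2)" using w by (simp add: sq_int_def)
    show "AE z in M. (\<lambda>n. (cmod (u n z - u' z))\<^sup>2) \<longlonglongrightarrow> 0"
    proof (rule eventually_mono[OF lim])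
      fix z assume "(\<lambda>n. u n z) \<longlonglongrightarrow> u' z"
      then have "(\<lambda>n. (cmod (u n z - u' z))\<^sup>2) \<longlonglongrightarrow> (cmod (u' z - u' z))\<^sup>2"
        by (intro tendsto_power tendsto_norm tendsto_diff tendsto_const)
      then show "(\<lambda>n. (cmod (u n z - u' z))\<^sup>2) \<longlonglongrightarrow> 0" by simp
    qed
    show "AE z in M. norm ((cmod (u n z - u' z))\<^sup>2) \<le> 4 * (cmod (w z))\<^sup>2" for n
    proof (rule eventually_mono[OF eventually_conj[OF le' lim]])
      fix z assume a: "(\<forall>n. cmod (u n z) \<le> cmod (w z)) \<and> (\<lambda>n. u n z) \<longlonglongrightarrow> u' z"
      then have "cmod (u' z) \<le> cmod (w z)" by (intro tendsto_upperbound[OF tendsto_norm]) auto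
      then have "cmod (u n z - u' z) \<le> 2 * cmod (w z)"
        using a norm_triangle_ineq4[of "u n z" "u' z"] by (auto dest!: spec[of _ n])
      then have "(cmod (u n z - u' z))\<^sup>2 \<le> (2 * cmod (w z))\<^sup>2" by (intro power_mono) auto
      then show "norm ((cmod (u n z - u' z))\<^sup>2) \<le> 4 * (cmod (w z))\<^sup>2" by (simp add: power_mult_distrib)
    qed
  qed measurable
  then show ?thesis by (simp add: sq_norm_def)
qed

lemma bounded_dense:
  assumes G: "sq_int M G" and "0 < e"
  shows "\<exists>B>0. sq_norm M (\<lambda>z. (if cmod (G z) \<le> B then G z else 0) - G z) < e"
proof -
  have [measurable]: "G \<in> borel_measurable M" using G by (simp add: sq_int_def)
  have "(\<lambda>n. sq_norm M (\<lambda>z. (if cmod (G z) \<le> real (Suc n) then G z else 0) - G z)) \<longlonglongrightarrow> 0"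
  proof (rule sq_norm_dominated_convergence[OF _ _ G])
    show "AE z in M. (\<lambda>n. if cmod (G z) \<le> real (Suc n) then G z else 0) \<longlonglongrightarrow> G z"
    proof (rule AE_I2, rule tendsto_eventually)
      fix z
      obtain N where N: "cmod (G z) \<le> real N" using real_arch_simple by blast
      show "\<forall>\<^sub>F n in sequentially. (if cmod (G z) \<le> real (Suc n) then G z else 0) = G z"
        using eventually_ge_at_top[of N] by eventually_elim (use N in auto)
    qed
  qed auto
  then have "\<forall>\<^sub>F n in sequentially. sq_norm M (\<lambda>z. (if cmod (G z) \<le> real (Suc n) then G z else 0) - G z) < e"
    using \<open>0 < e\<close> by (rule order_tendstoD)
  then obtain n where "sq_norm M (\<lambda>z. (if cmod (G z) \<le> real (Suc n) then G z else 0) - G z) < e"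
    by (auto dest: eventually_happens)
  then show ?thesis by (intro exI[of _ "real (Suc n)"]) auto
qed

text \<open>After truncation the function is bounded, and projecting continuous approximations to the same
  ball makes them dominated by a constant, which is integrable because the weight is.\<close>

lemma continuous_dense:
  assumes s: "-1 < s" and G: "sq_int (disk_measure s) G" and e: "0 < e"
  shows "\<exists>g. continuous_on UNIV g \<and> sq_int (disk_measure s) g \<and> sq_norm (disk_measure s) (\<lambda>z. g z - G z) < e"
proof -
  let ?M = "disk_measure s"
  obtain B where B: "0 < B" "sq_norm ?M (\<lambda>z. (if cmod (G z) \<le> B then G z else 0) - G z) < e / 4"
    using bounded_dense[OF G, of "e / 4"] e by auto
  define H where "H z = (if cmod (G z) \<le> B then G z else 0)" for z
  have [measurable]: "G \<in> borel_measurable ?M" using G by (simp add: sq_int_def)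
  have Hm: "H \<in> borel_measurable ?M" unfolding H_def[abs_def] by measurable
  have HB: "cmod (H z) \<le> B" for z using B(1) by (simp add: H_def)
  have Hs: "sq_int ?M H" by (rule sq_int_bounded[OF s Hm, of B]) (simp add: HB)
  obtain v g N where v: "v \<in> borel_measurable borel" "negligible N" "\<And>n::nat. continuous_on UNIV (g n)"
    "\<And>z. z \<notin> N \<Longrightarrow> v z = (if z \<in> cball 0 1 then H z else 0)"
    "\<And>z. z \<notin> N \<Longrightarrow> (\<lambda>n. g n z) \<longlonglongrightarrow> v z"
    by (rule borel_representative[OF Hm[unfolded measurable_disk_iff]]) auto
  define k where "k n z = closest_point (cball 0 B) (g n z)" for n z
  have ne: "cball (0::complex) B \<noteq> {}" using B(1) by simp
  have kc: "continuous_on UNIV (k n)" for n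
    unfolding k_def
    by (rule continuous_on_compose2[OF continuous_on_closest_point v(3)]) (use ne in auto)
  have kB: "cmod (k n z) \<le> B" for n z
    using closest_point_in_set[of "cball (0::complex) B" "g n z"] ne by (simp add: k_def)
  have ks: "sq_int ?M (k n)" for n
    by (rule sq_int_bounded[OF s continuous_measurable_disk[OF kc], where B = B]) (simp add: kB)
  have ae: "AE z in ?M. z \<notin> N"
  proof -
    have "AE z in lebesgue. z \<notin> N" using v(2) by (simp add: negligible_iff_null_sets AE_not_in)
    then show ?thesis unfolding AE_disk_iff by (auto simp: AE_restrict_space_iff elim: eventually_mono)
  qed
  have "(\<lambda>n. sq_norm ?M (\<lambda>z. k n z - H z)) \<longlonglongrightarrow> 0"
  proof (rule sq_norm_dominated_convergence[where w = "\<lambda>z. of_real B"])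
    show "sq_int ?M (\<lambda>z. of_real B)" by (rule sq_int_bounded[OF s, where B = B]) (use B in auto)
    show "AE z in ?M. (\<lambda>n. k n z) \<longlonglongrightarrow> H z"
    proof (rule eventually_mono[OF eventually_conj[OF ae AE_disk_interior]])
      fix z assume z: "z \<notin> N \<and> cmod z < 1"
      then have "(\<lambda>n. g n z) \<longlonglongrightarrow> H z" using v(5)[of z] v(4)[of z] by simp
      then have "(\<lambda>n. k n z) \<longlonglongrightarrow> closest_point (cball 0 B) (H z)"
        unfolding k_def
        by (rule isCont_tendsto_compose[OF continuous_at_closest_point[OF convex_cball closed_cball ne]])
      then show "(\<lambda>n. k n z) \<longlonglongrightarrow> H z" using HB[of z] by (simp add: closest_point_self)
    qed
    show "k n \<in> borel_measurable ?M" for n using ks by (simp add: sq_int_def)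
    show "AE z in ?M. cmod (k n z) \<le> cmod (complex_of_real B)" for n using kB B(1) by simp
  qed (rule Hm)
  then have "\<forall>\<^sub>F n in sequentially. sq_norm ?M (\<lambda>z. k n z - H z) < e / 4"
    by (rule order_tendstoD) (use e in simp)
  then obtain n where n: "sq_norm ?M (\<lambda>z. k n z - H z) < e / 4" by (auto dest: eventually_happens)
  have "sq_norm ?M (\<lambda>z. k n z - G z) \<le> 2 * sq_norm ?M (\<lambda>z. k n z - H z) + 2 * sq_norm ?M (\<lambda>z. H z - G z)"
    by (rule sq_norm_diff_trans[OF ks Hs G])
  then have "sq_norm ?M (\<lambda>z. k n z - G z) < e" using n B(2) by (simp add: H_def)
  then show ?thesis using kc ks by blast
qed

text \<open>Polynomials in \<open>z\<close> and \<open>cnj z\<close>.\<close>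

inductive bipoly :: "(complex \<Rightarrow> complex) \<Rightarrow> bool" where
  monom: "bipoly (\<lambda>z. z ^ a * cnj z ^ b)"
| scale: "bipoly p \<Longrightarrow> bipoly (\<lambda>z. c * p z)"
| add: "bipoly p \<Longrightarrow> bipoly q \<Longrightarrow> bipoly (\<lambda>z. p z + q z)"

lemma bipoly_continuous: "bipoly p \<Longrightarrow> continuous_on S p"
  by (induction rule: bipoly.induct) (auto intro!: continuous_intros)

lemma bipoly_mult:
  assumes "bipoly p" "bipoly q" shows "bipoly (\<lambda>z. p z * q z)"
  using assms
proof (induction arbitrary: q rule: bipoly.induct)
  case (monom a b)
  then show ?case
  proof (induction rule: bipoly.induct)
    case (monom c d)
    have "(\<lambda>z. z ^ a * cnj z ^ b * (z ^ c * cnj z ^ d)) = (\<lambda>z. z ^ (a + c) * cnj z ^ (b + d))"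
      by (auto simp: power_add)
    then show ?case by (simp add: bipoly.monom)
  next
    case (scale p c)
    have "(\<lambda>z. z ^ a * cnj z ^ b * (c * p z)) = (\<lambda>z. c * (z ^ a * cnj z ^ b * p z))" by auto
    then show ?case using bipoly.scale[OF scale.IH, of c] by simp
  next
    case (add p q)
    have "(\<lambda>z. z ^ a * cnj z ^ b * (p z + q z)) = (\<lambda>z. z ^ a * cnj z ^ b * p z + z ^ a * cnj z ^ b * q z)"
      by (auto simp: algebra_simps)
    then show ?case using bipoly.add[OF add.IH] by simp
  qed
next
  case (scale p c)
  have "(\<lambda>z. c * p z * q z) = (\<lambda>z. c * (p z * q z))" by auto
  then show ?case using bipoly.scale[OF scale.IH[OF scale.prems], of c] by simp
next
  case (add p p')
  have "(\<lambda>z. (p z + p' z) * q z) = (\<lambda>z. p z * q z + p' z * q z)" by (auto simp: algebra_simps)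
  then show ?case using bipoly.add[OF add.IH(1)[OF add.prems] add.IH(2)[OF add.prems]] by simp
qed

lemma bipoly_real_polynomial:
  "real_polynomial_function r \<Longrightarrow> bipoly (\<lambda>z. of_real (r z))"
proof (induction rule: real_polynomial_function.induct)
  case (linear f)
  interpret f: bounded_linear f by fact
  have fz: "f z = Re z * f 1 + Im z * f \<i>" for z
  proof -
    have "z = Re z *\<^sub>R 1 + Im z *\<^sub>R \<i>" by (simp add: complex_eq_iff)
    then show ?thesis by (metis f.add f.scaleR real_scaleR_def)
  qed
  have eq: "(\<lambda>z. complex_of_real (f z)) = (\<lambda>z. of_real (f 1 / 2) * (z ^ 1 * cnj z ^ 0)
      + of_real (f 1 / 2) * (z ^ 0 * cnj z ^ 1) + (- \<i> * of_real (f \<i> / 2)) * (z ^ 1 * cnj z ^ 0)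
      + (\<i> * of_real (f \<i> / 2)) * (z ^ 0 * cnj z ^ 1))"
  proof
    fix z
    show "complex_of_real (f z) = of_real (f 1 / 2) * (z ^ 1 * cnj z ^ 0)
      + of_real (f 1 / 2) * (z ^ 0 * cnj z ^ 1) + (- \<i> * of_real (f \<i> / 2)) * (z ^ 1 * cnj z ^ 0)
      + (\<i> * of_real (f \<i> / 2)) * (z ^ 0 * cnj z ^ 1)"
      unfolding fz[of z] by (simp add: complex_eq_iff algebra_simps)
  qed
  show ?case
    unfolding eq by (rule bipoly.add bipoly.scale bipoly.monom)+
next
  case (const c)
  show ?case using bipoly.scale[OF bipoly.monom[of 0 0], of "of_real c"] by simp
next
  case (add f g)
  then show ?case using bipoly.add[OF add.IH] by simp
next
  case (mult f g)
  then show ?case using bipoly_mult[OF mult.IH] by simp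
qed

text \<open>This is the Stone-Weierstrass theorem.\<close>

lemma bipoly_dense_uniform:
  assumes g: "continuous_on (cball 0 1) g" and e: "0 < e"
  shows "\<exists>p. bipoly p \<and> (\<forall>z\<in>cball 0 1. cmod (g z - p z) < e)"
proof -
  obtain p where p: "polynomial_function p" "\<And>z. z \<in> cball 0 1 \<Longrightarrow> cmod (g z - p z) < e"
    using Stone_Weierstrass_polynomial_function[OF compact_cball g e] by blast
  have "real_polynomial_function (f \<circ> p)" if "bounded_linear f" for f
    using p(1) that by (simp add: polynomial_function_def)
  from this[OF bounded_linear_Re] this[OF bounded_linear_Im]
  have "real_polynomial_function (\<lambda>z. Re (p z))" "real_polynomial_function (\<lambda>z. Im (p z))"
    by (simp_all add: comp_def)
  then have "bipoly (\<lambda>z. of_real (Re (p z)) + \<i> * of_real (Im (p z)))"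
    by (intro bipoly.add bipoly.scale bipoly_real_polynomial)
  moreover have "(\<lambda>z. of_real (Re (p z)) + \<i> * of_real (Im (p z))) = p" by (auto simp: complex_eq_iff)
  ultimately show ?thesis using p(2) by auto
qed

lemma bipoly_dense:
  assumes s: "-1 < s" and G: "sq_int (disk_measure s) G" and e: "0 < e"
  shows "\<exists>p. bipoly p \<and> sq_int (disk_measure s) p \<and> sq_norm (disk_measure s) (\<lambda>z. p z - G z) < e"
proof -
  let ?M = "disk_measure s"
  interpret finite_measure ?M by (rule weight_integrable[OF s])
  obtain g where g: "continuous_on UNIV g" "sq_int ?M g" "sq_norm ?M (\<lambda>z. g z - G z) < e / 16"
    using continuous_dense[OF s G, of "e / 16"] e by auto
  define \<mu> where "\<mu> = measure ?M (space ?M)"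
  define d where "d = sqrt (e / (32 * (\<mu> + 1)))"
  have mu: "0 \<le> \<mu>" by (simp add: \<mu>_def)
  have d: "0 < d" "d\<^sup>2 = e / (32 * (\<mu> + 1))" using e mu by (simp_all add: d_def)
  obtain p where p: "bipoly p" "\<And>z. z \<in> cball 0 1 \<Longrightarrow> cmod (g z - p z) < d"
    using bipoly_dense_uniform[OF continuous_on_subset[OF g(1)] d(1)] by blast
  have pc: "continuous_on UNIV p" by (rule bipoly_continuous[OF p(1)])
  obtain B where "\<forall>x\<in>p ` cball 0 1. cmod x \<le> B"
    using compact_imp_bounded[OF compact_continuous_image[OF bipoly_continuous[OF p(1)] compact_cball[of 0 1]]]
    unfolding bounded_iff by blast
  then have B: "\<And>z. z \<in> cball 0 1 \<Longrightarrow> cmod (p z) \<le> B" by simp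
  have ps: "sq_int ?M p"
    by (rule sq_int_bounded[OF s continuous_measurable_disk[OF pc], where B = B])
       (use B in \<open>auto simp: space_disk_measure intro!: AE_I2\<close>)
  have pg: "sq_norm ?M (\<lambda>z. p z - g z) < e / 16"
  proof -
    have "sq_norm ?M (\<lambda>z. p z - g z) \<le> (LINT z|?M. d\<^sup>2)"
      unfolding sq_norm_def
    proof (rule integral_mono_AE)
      show "integrable ?M (\<lambda>z. (cmod (p z - g z))\<^sup>2)" using sq_int_diff(1)[OF ps g(2)] by (simp add: sq_int_def)
      show "AE z in ?M. (cmod (p z - g z))\<^sup>2 \<le> d\<^sup>2"
      proof (rule AE_I2)
        fix z assume "z \<in> space ?M"
        then have "cmod (p z - g z) \<le> d" using p(2)[of z] by (simp add: space_disk_measure norm_minus_commute)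
        then show "(cmod (p z - g z))\<^sup>2 \<le> d\<^sup>2" by (intro power_mono) auto
      qed
    qed simp
    also have "\<dots> = d\<^sup>2 * \<mu>" by (simp add: \<mu>_def)
    also have "\<dots> < e / 16" unfolding d(2) using e mu by (simp add: field_simps add_pos_nonneg)
    finally show ?thesis .
  qed
  have "sq_norm ?M (\<lambda>z. p z - G z) \<le> 2 * sq_norm ?M (\<lambda>z. p z - g z) + 2 * sq_norm ?M (\<lambda>z. g z - G z)"
    by (rule sq_norm_diff_trans[OF ps g(2) G])
  then have "sq_norm ?M (\<lambda>z. p z - G z) < e" using pg g(3) e by linarith
  then show ?thesis using p(1) ps by blast
qed

lemma cutoff_bipoly_dense:
  assumes s: "-1 < s" and G: "sq_int (disk_measure s) G" and e: "0 < e"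
  shows "\<exists>p n. bipoly p \<and> sq_int (disk_measure s) (\<lambda>z. p z * of_real (cutoff n ((cmod z)\<^sup>2))) \<and>
     sq_norm (disk_measure s) (\<lambda>z. p z * of_real (cutoff n ((cmod z)\<^sup>2)) - G z) < e"
proof -
  let ?M = "disk_measure s"
  obtain p where p: "bipoly p" and ps: "sq_int ?M p" and pG: "sq_norm ?M (\<lambda>z. p z - G z) < e / 16"
    using bipoly_dense[OF s G, of "e / 16"] e by auto
  have pc: "continuous_on UNIV p" by (rule bipoly_continuous[OF p])
  define h where "h n z = p z * of_real (cutoff n ((cmod z)\<^sup>2))" for n z
  have cc: "continuous_on UNIV (\<lambda>z. complex_of_real (cutoff n ((cmod z)\<^sup>2)))" for n
    by (rule smooth_continuous[OF smooth_radial]) (use interval_bump_cutoff in \<open>simp add: interval_bump_def\<close>)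
  have hm: "h n \<in> borel_measurable ?M" for n
    unfolding h_def[abs_def] by (intro continuous_measurable_disk continuous_on_mult pc cc)
  have hle: "cmod (h n z) \<le> cmod (p z)" for n z
    using cutoff_range[of n "(cmod z)\<^sup>2"] by (simp add: h_def norm_mult mult_left_le)
  have hs: "sq_int ?M (h n)" for n
    by (rule sq_int_bound[OF ps hm, where C = 1]) (simp add: hle)
  have "AE z in ?M. z \<noteq> 0"
  proof -
    have "AE z in lebesgue. z \<notin> {0::complex}"
      by (rule AE_not_in) (simp add: negligible_iff_null_sets[symmetric])
    then show ?thesis unfolding AE_disk_iff by (auto simp: AE_restrict_space_iff elim: eventually_mono)
  qed
  then have lim: "AE z in ?M. (\<lambda>n. h n z) \<longlonglongrightarrow> p z"
    using AE_disk_interior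
  proof eventually_elim
    case (elim z)
    then have "0 < (cmod z)\<^sup>2" "(cmod z)\<^sup>2 < 1" using abs_square_less_1[of "cmod z"] by auto
    then have "(\<lambda>n. p z * of_real (cutoff n ((cmod z)\<^sup>2))) \<longlonglongrightarrow> p z * of_real 1"
      by (intro tendsto_mult tendsto_const tendsto_of_real cutoff_tendsto)
    then show ?case by (simp add: h_def)
  qed
  have "(\<lambda>n. sq_norm ?M (\<lambda>z. h n z - p z)) \<longlonglongrightarrow> 0"
    by (rule sq_norm_dominated_convergence[OF hm sq_int_measurable[OF ps] ps _ lim]) (simp add: hle)
  then have "\<forall>\<^sub>F n in sequentially. sq_norm ?M (\<lambda>z. h n z - p z) < e / 16"
    by (rule order_tendstoD) (use e in simp)
  then obtain n where n: "sq_norm ?M (\<lambda>z. h n z - p z) < e / 16" by (auto dest: eventually_happens)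
  have "sq_norm ?M (\<lambda>z. h n z - G z) \<le> 2 * sq_norm ?M (\<lambda>z. h n z - p z) + 2 * sq_norm ?M (\<lambda>z. p z - G z)"
    by (rule sq_norm_diff_trans[OF hs ps G])
  then have "sq_norm ?M (\<lambda>z. h n z - G z) < e" using n pG e by linarith
  then show ?thesis using p hs[of n] unfolding h_def by blast
qed

section \<open>Density of the range of dz\<close>

text \<open>For \<open>a < b\<close> the monomial \<open>z ^ a * cnj z ^ b\<close> times a radial function is an antiholomorphic mode
  and lies in the range of \<open>dz\<close>; for \<open>a \<ge> b\<close> it is a holomorphic mode and leaves one correction term.
  The order of the quantifiers matters: the number of correction terms is fixed before the bump \<open>E\<close>
  is chosen.\<close>

lemma bipoly_cutoff_decomposition:
  assumes "bipoly p" and X: "interval_bump X"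
  shows "\<exists>N. \<forall>E. interval_bump E \<and> (\<forall>t. 0 \<le> E t) \<and> 0 < E (1/2) \<longrightarrow> (\<exists>c. \<exists>\<phi>\<in>test_functions.
     \<forall>z. p z * of_real (X ((cmod z)\<^sup>2)) = dz \<phi> z + (\<Sum>l\<le>N. c l * (z ^ l * of_real (E ((cmod z)\<^sup>2)))))"
  using assms(1)
proof (induction rule: bipoly.induct)
  case (monom a b)
  have pw: "Ck_on k {0<..<1} (\<lambda>t. t ^ n)" for k n
    by (rule Ck_on_cong[OF _ _ Ck_on_subset[OF Ck_on_powr[of k "real n"]]]) (auto simp: powr_realpow)
  have zz: "z ^ n * cnj z ^ n = of_real (((cmod z)\<^sup>2) ^ n)" for z n
    by (simp only: power_mult_distrib[symmetric] complex_norm_square[symmetric] of_real_power)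
  show ?case
  proof (cases "a < b")
    case True
    then obtain l where l: "b = a + Suc l" using less_imp_Suc_add by fastforce
    have "interval_bump (\<lambda>t. t ^ a * X t)" by (rule interval_bump_mult[OF X pw])
    from dz_solution_antiholomorphic[OF this, of l]
    obtain \<phi> where \<phi>: "\<phi> \<in> test_functions"
      "\<And>z. dz \<phi> z = cnj z ^ Suc l * of_real (((cmod z)\<^sup>2) ^ a * X ((cmod z)\<^sup>2))" by blast
    have "z ^ a * cnj z ^ b * of_real (X ((cmod z)\<^sup>2)) = dz \<phi> z + (\<Sum>l\<le>0. 0 * (z ^ l * of_real (E ((cmod z)\<^sup>2))))" for z and E :: "real \<Rightarrow> real"
    proof -
      have "z ^ a * cnj z ^ b * of_real (X ((cmod z)\<^sup>2)) = cnj z ^ Suc l * ((z ^ a * cnj z ^ a) * of_real (X ((cmod z)\<^sup>2)))"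
        unfolding l power_add by (simp only: mult_ac)
      also have "\<dots> = dz \<phi> z" unfolding zz \<phi>(2) by (simp only: of_real_mult)
      finally show ?thesis by simp
    qed
    then show ?thesis using \<phi>(1) by (intro exI[of _ 0] allI impI exI[of _ "\<lambda>l. 0"] bexI[of _ \<phi>]) auto
  next
    case False
    then obtain l where l: "a = b + l" using le_Suc_ex not_less by blast
    have Xb: "interval_bump (\<lambda>t. t ^ b * X t)" by (rule interval_bump_mult[OF X pw])
    show ?thesis
    proof (intro exI[of _ l] allI impI)
    fix E :: "real \<Rightarrow> real" assume "interval_bump E \<and> (\<forall>t. 0 \<le> E t) \<and> 0 < E (1/2)"
    then have E: "interval_bump E" "\<And>t. 0 \<le> E t" "0 < E (1/2)" by auto
    from dz_solution_holomorphic[OF Xb E(1,2) half_gt_zero[OF zero_less_one] E(3), of l]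
    obtain c \<phi> where \<phi>: "\<phi> \<in> test_functions"
      "\<And>z. dz \<phi> z = z ^ l * of_real (((cmod z)\<^sup>2) ^ b * X ((cmod z)\<^sup>2) - c * E ((cmod z)\<^sup>2))" by blast
    have "z ^ a * cnj z ^ b * of_real (X ((cmod z)\<^sup>2))
        = dz \<phi> z + (\<Sum>j\<le>l. (if j = l then of_real c else 0) * (z ^ j * of_real (E ((cmod z)\<^sup>2))))" for z
    proof -
      have "z ^ a * cnj z ^ b * of_real (X ((cmod z)\<^sup>2)) = z ^ l * ((z ^ b * cnj z ^ b) * of_real (X ((cmod z)\<^sup>2)))"
        unfolding l power_add by (simp only: mult_ac)
      also have "\<dots> = dz \<phi> z + of_real c * (z ^ l * of_real (E ((cmod z)\<^sup>2)))"
        unfolding zz \<phi>(2) by (simp add: algebra_simps)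
      also have "of_real c * (z ^ l * of_real (E ((cmod z)\<^sup>2)))
          = (\<Sum>j\<le>l. (if j = l then of_real c else 0) * (z ^ j * of_real (E ((cmod z)\<^sup>2))))"
        by (simp add: if_distrib[of "\<lambda>x. x * _"] cong: if_cong)
      finally show ?thesis .
    qed
    then show "\<exists>c. \<exists>\<phi>\<in>test_functions. \<forall>z. z ^ a * cnj z ^ b * of_real (X ((cmod z)\<^sup>2))
        = dz \<phi> z + (\<Sum>l\<le>l. c l * (z ^ l * of_real (E ((cmod z)\<^sup>2))))" using \<phi>(1)
      by (intro exI[of _ "\<lambda>j. if j = l then of_real c else 0"] bexI[of _ \<phi>]) auto
    qed
  qed
next
  case (scale p k)
  then obtain N where N: "\<And>E. interval_bump E \<Longrightarrow> (\<forall>t. 0 \<le> E t) \<Longrightarrow> 0 < E (1/2) \<Longrightarrow> (\<exists>c. \<exists>\<phi>\<in>test_functions.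
     \<forall>z. p z * of_real (X ((cmod z)\<^sup>2)) = dz \<phi> z + (\<Sum>l\<le>N. c l * (z ^ l * of_real (E ((cmod z)\<^sup>2)))))"
    by blast
  show ?case
  proof (intro exI[of _ N] allI impI)
  fix E :: "real \<Rightarrow> real" assume E: "interval_bump E \<and> (\<forall>t. 0 \<le> E t) \<and> 0 < E (1/2)"
  then obtain c \<phi> where \<phi>: "\<phi> \<in> test_functions"
    "\<And>z. p z * of_real (X ((cmod z)\<^sup>2)) = dz \<phi> z + (\<Sum>l\<le>N. c l * (z ^ l * of_real (E ((cmod z)\<^sup>2))))" using N[of E] by blast
  have "k * p z * of_real (X ((cmod z)\<^sup>2)) = dz (\<lambda>z. k * \<phi> z) z + (\<Sum>l\<le>N. (k * c l) * (z ^ l * of_real (E ((cmod z)\<^sup>2))))" for z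
    using \<phi>(2)[of z] dz_scale[OF smooth_differentiable[OF test_functions_smooth[OF \<phi>(1)]], of k z]
    by (simp only: mult.assoc distrib_left sum_distrib_left)
  then show "\<exists>c. \<exists>\<phi>\<in>test_functions. \<forall>z. k * p z * of_real (X ((cmod z)\<^sup>2))
      = dz \<phi> z + (\<Sum>l\<le>N. c l * (z ^ l * of_real (E ((cmod z)\<^sup>2))))"
    using test_functions_scale[OF \<phi>(1), of k]
    by (intro exI[of _ "\<lambda>l. k * c l"] bexI[of _ "\<lambda>z. k * \<phi> z"]) auto
  qed
next
  case (add p q)
  obtain N where N: "\<And>E. interval_bump E \<Longrightarrow> (\<forall>t. 0 \<le> E t) \<Longrightarrow> 0 < E (1/2) \<Longrightarrow> (\<exists>c. \<exists>\<phi>\<in>test_functions.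
     \<forall>z. p z * of_real (X ((cmod z)\<^sup>2)) = dz \<phi> z + (\<Sum>l\<le>N. c l * (z ^ l * of_real (E ((cmod z)\<^sup>2)))))"
    using add.IH(1) by blast
  obtain K where K: "\<And>E. interval_bump E \<Longrightarrow> (\<forall>t. 0 \<le> E t) \<Longrightarrow> 0 < E (1/2) \<Longrightarrow> (\<exists>c. \<exists>\<phi>\<in>test_functions.
     \<forall>z. q z * of_real (X ((cmod z)\<^sup>2)) = dz \<phi> z + (\<Sum>l\<le>K. c l * (z ^ l * of_real (E ((cmod z)\<^sup>2)))))"
    using add.IH(2) by blast
  show ?case
  proof (intro exI[of _ "max N K"] allI impI)
  fix E :: "real \<Rightarrow> real" assume E: "interval_bump E \<and> (\<forall>t. 0 \<le> E t) \<and> 0 < E (1/2)"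
  obtain c \<phi> where \<phi>: "\<phi> \<in> test_functions"
    "\<And>z. p z * of_real (X ((cmod z)\<^sup>2)) = dz \<phi> z + (\<Sum>l\<le>N. c l * (z ^ l * of_real (E ((cmod z)\<^sup>2))))"
    using N[of E] E by blast
  obtain d \<psi> where \<psi>: "\<psi> \<in> test_functions"
    "\<And>z. q z * of_real (X ((cmod z)\<^sup>2)) = dz \<psi> z + (\<Sum>l\<le>K. d l * (z ^ l * of_real (E ((cmod z)\<^sup>2))))"
    using K[of E] E by blast
  let ?e = "\<lambda>l. (if l \<le> N then c l else 0) + (if l \<le> K then d l else 0)"
  have ext: "(\<Sum>l\<le>n. c l * x l) = (\<Sum>l\<le>max N K. (if l \<le> n then c l else 0) * x l)" if "n \<le> max N K" for n c and x :: "nat \<Rightarrow> complex"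
  proof -
    have "(\<Sum>l\<le>max N K. (if l \<le> n then c l else 0) * x l) = (\<Sum>l\<le>max N K. if l \<in> {..n} then c l * x l else 0)"
      by (rule sum.cong) auto
    also have "\<dots> = (\<Sum>l\<in>{..max N K} \<inter> {..n}. c l * x l)" by (rule sum.inter_restrict[symmetric]) simp
    also have "{..max N K} \<inter> {..n} = {..n}" using that by auto
    finally show ?thesis by simp
  qed
  have "dz (\<lambda>z. \<phi> z + \<psi> z) z = dz \<phi> z + dz \<psi> z" for z
    using dir_deriv_add[OF smooth_differentiable[OF test_functions_smooth[OF \<phi>(1)]]
        smooth_differentiable[OF test_functions_smooth[OF \<psi>(1)]], of _ z]
    by (simp add: dz_def field_simps)
  then have "(p z + q z) * of_real (X ((cmod z)\<^sup>2)) = dz (\<lambda>z. \<phi> z + \<psi> z) z + (\<Sum>l\<le>max N K. ?e l * (z ^ l * of_real (E ((cmod z)\<^sup>2))))" for z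
    using \<phi>(2)[of z] \<psi>(2)[of z] ext[of N c "\<lambda>l. z ^ l * of_real (E ((cmod z)\<^sup>2))"]
       ext[of K d "\<lambda>l. z ^ l * of_real (E ((cmod z)\<^sup>2))"]
    by (simp add: distrib_right sum.distrib)
  then show "\<exists>c. \<exists>\<phi>\<in>test_functions. \<forall>z. (p z + q z) * of_real (X ((cmod z)\<^sup>2))
      = dz \<phi> z + (\<Sum>l\<le>max N K. c l * (z ^ l * of_real (E ((cmod z)\<^sup>2))))"
    using test_functions_add[OF \<phi>(1) \<psi>(1)]
    by (intro exI[of _ ?e] bexI[of _ "\<lambda>z. \<phi> z + \<psi> z"]) auto
  qed
qed

subsection \<open>Bessel's inequality\<close>

lemma sq_norm_Pythagoras:
  assumes u: "sq_int M u" and v: "sq_int M v" and o: "(LINT z|M. u z * cnj (v z)) = 0"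
  shows "sq_norm M (\<lambda>z. u z + v z) = sq_norm M u + sq_norm M v"
proof -
  have i: "integrable M (\<lambda>z. Re (u z * cnj (v z)))" by (rule integrable_Re[OF sq_int_mult_integrable[OF u v]])
  have "(cmod (u z + v z))\<^sup>2 = (cmod (u z))\<^sup>2 + (cmod (v z))\<^sup>2 + 2 * Re (u z * cnj (v z))" for z
    unfolding cmod_power2 by (simp add: power2_eq_square algebra_simps)
  then have "sq_norm M (\<lambda>z. u z + v z) = sq_norm M u + sq_norm M v + 2 * (LINT z|M. Re (u z * cnj (v z)))"
    using u v i unfolding sq_norm_def sq_int_def
    by (simp only: Bochner_Integration.integral_add Bochner_Integration.integrable_add integrable_mult_right
        integral_mult_right_zero)
  also have "(LINT z|M. Re (u z * cnj (v z))) = 0"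
    unfolding integral_Re[OF sq_int_mult_integrable[OF u v]] o by simp
  finally show ?thesis by simp
qed

lemma pairing_sum_right:
  assumes "finite I" "sq_int M u" "\<And>i. i \<in> I \<Longrightarrow> sq_int M (f i)"
  shows "(LINT z|M. u z * cnj (\<Sum>i\<in>I. c i * f i z)) = (\<Sum>i\<in>I. cnj (c i) * (LINT z|M. u z * cnj (f i z)))"
proof -
  have "(LINT z|M. u z * cnj (\<Sum>i\<in>I. c i * f i z)) = (LINT z|M. (\<Sum>i\<in>I. cnj (c i) * (u z * cnj (f i z))))"
    by (intro Bochner_Integration.integral_cong) (simp_all add: sum_distrib_left mult_ac)
  also have "\<dots> = (\<Sum>i\<in>I. LINT z|M. cnj (c i) * (u z * cnj (f i z)))"
    by (intro Bochner_Integration.integral_sum integrable_mult_right sq_int_mult_integrable assms)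
  finally show ?thesis by simp
qed

lemma sq_norm_orthogonal_sum:
  assumes "finite I" "\<And>i. i \<in> I \<Longrightarrow> sq_int M (f i)"
    and "\<And>i j. i \<in> I \<Longrightarrow> j \<in> I \<Longrightarrow> i \<noteq> j \<Longrightarrow> (LINT z|M. f i z * cnj (f j z)) = 0"
  shows "sq_norm M (\<lambda>z. \<Sum>i\<in>I. c i * f i z) = (\<Sum>i\<in>I. (cmod (c i))\<^sup>2 * sq_norm M (f i))"
  using assms
proof (induction I rule: finite_induct)
  case (insert i I)
  have si: "sq_int M (\<lambda>z. c i * f i z)" by (rule sq_int_scale(1)) (use insert in auto)
  have sI: "sq_int M (\<lambda>z. \<Sum>i\<in>I. c i * f i z)"
    by (intro sq_int_sum sq_int_scale(1)) (use insert in auto)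
  have "(LINT z|M. (c i * f i z) * cnj (\<Sum>i\<in>I. c i * f i z)) = (\<Sum>j\<in>I. cnj (c j) * (LINT z|M. (c i * f i z) * cnj (f j z)))"
    by (rule pairing_sum_right[OF insert(1) si]) (use insert in auto)
  also have "\<dots> = 0"
  proof (rule sum.neutral, rule ballI)
    fix j assume j: "j \<in> I"
    then have "(LINT z|M. f i z * cnj (f j z)) = 0" using insert by (intro insert.prems) auto
    then show "cnj (c j) * (LINT z|M. (c i * f i z) * cnj (f j z)) = 0" by (simp add: mult.assoc)
  qed
  finally have "sq_norm M (\<lambda>z. c i * f i z + (\<Sum>i\<in>I. c i * f i z))
      = sq_norm M (\<lambda>z. c i * f i z) + sq_norm M (\<lambda>z. \<Sum>i\<in>I. c i * f i z)"
    by (rule sq_norm_Pythagoras[OF si sI])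
  also have "sq_norm M (\<lambda>z. \<Sum>i\<in>I. c i * f i z) = (\<Sum>i\<in>I. (cmod (c i))\<^sup>2 * sq_norm M (f i))"
    by (rule insert.IH) (use insert.prems in auto)
  also have "sq_norm M (\<lambda>z. c i * f i z) = (cmod (c i))\<^sup>2 * sq_norm M (f i)"
    by (rule sq_int_scale(2)) (use insert.prems in auto)
  finally show ?case using insert(1,2) by simp
qed simp

lemma Bessel_inequality:
  assumes I: "finite I" and f: "\<And>i. i \<in> I \<Longrightarrow> sq_int M (f i)"
    and orth: "\<And>i j. i \<in> I \<Longrightarrow> j \<in> I \<Longrightarrow> i \<noteq> j \<Longrightarrow> (LINT z|M. f i z * cnj (f j z)) = 0"
    and pos: "\<And>i. i \<in> I \<Longrightarrow> 0 < sq_norm M (f i)" and w: "sq_int M w"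
  shows "(\<Sum>i\<in>I. (cmod (LINT z|M. w z * cnj (f i z)))\<^sup>2 / sq_norm M (f i)) \<le> sq_norm M w"
proof -
  define b where "b i = (LINT z|M. w z * cnj (f i z))" for i
  define c where "c i = b i / of_real (sq_norm M (f i))" for i
  define S where "S = (\<Sum>i\<in>I. (cmod (b i))\<^sup>2 / sq_norm M (f i))"
  have S0: "0 \<le> S" unfolding S_def by (intro sum_nonneg divide_nonneg_nonneg sq_norm_nonneg) auto
  have sP: "sq_int M (\<lambda>z. \<Sum>i\<in>I. c i * f i z)" by (intro sq_int_sum sq_int_scale(1) f)
  have "sq_norm M (\<lambda>z. \<Sum>i\<in>I. c i * f i z) = (\<Sum>i\<in>I. (cmod (c i))\<^sup>2 * sq_norm M (f i))"
    by (rule sq_norm_orthogonal_sum[OF I f orth])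
  also have "\<dots> = S" unfolding S_def
  proof (rule sum.cong[OF refl])
    fix i assume "i \<in> I"
    from pos[OF this] show "(cmod (c i))\<^sup>2 * sq_norm M (f i) = (cmod (b i))\<^sup>2 / sq_norm M (f i)"
      by (simp add: c_def norm_divide power_divide power2_eq_square)
  qed
  finally have nP: "sq_norm M (\<lambda>z. \<Sum>i\<in>I. c i * f i z) = S" .
  have "(LINT z|M. w z * cnj (\<Sum>i\<in>I. c i * f i z)) = (\<Sum>i\<in>I. cnj (c i) * b i)"
    unfolding b_def by (rule pairing_sum_right[OF I w f])
  also have "\<dots> = of_real S"
    unfolding S_def of_real_sum
  proof (rule sum.cong[OF refl])
    fix i
    have "cnj (b i) * b i = of_real ((cmod (b i))\<^sup>2)" by (simp only: complex_norm_square mult.commute)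
    then show "cnj (c i) * b i = of_real ((cmod (b i))\<^sup>2 / sq_norm M (f i))" by (simp add: c_def)
  qed
  finally have "(cmod (of_real S))\<^sup>2 \<le> sq_norm M w * S"
    using Cauchy_Schwarz_integral[OF w sP] nP by simp
  then have "S * S \<le> sq_norm M w * S" by (simp add: power2_eq_square)
  then have "S \<le> sq_norm M w"
    using S0 sq_norm_nonneg[of M w] by (cases "S = 0") auto
  then show ?thesis by (simp add: S_def b_def)
qed

subsection \<open>The closure of the range\<close>

lemma interval_bump_test_function:
  assumes "interval_bump W" "smooth p"
  shows "(\<lambda>z. p z * of_real (W ((cmod z)\<^sup>2))) \<in> test_functions"
proof -
  obtain a b where "0 < a" "a < b" "b < 1" "\<And>t. t \<notin> {a..b} \<Longrightarrow> W t = 0"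
    using assms(1) by (auto simp: interval_bump_def)
  then show ?thesis
    using assms by (intro radial_test_function[of p W b]) (auto simp: interval_bump_def)
qed

lemma integral_dz_test:
  assumes "\<phi> \<in> test_functions"
  shows "(LINT z|lebesgue_on (cball 0 1). dz \<phi> z) = 0" "(LINT z|lebesgue_on (cball 0 1). dzb \<phi> z) = 0"
proof -
  have e: "(LINT z|disk_measure 0. u z) = (LINT z|lebesgue_on (cball 0 1). u z)" if "inner_supported u" for u
    unfolding integral_disk[OF borel_measurable_integrable[OF inner_supported_disk(1)[OF that]]]
  proof (rule integral_cong_AE)
    show m: "u \<in> borel_measurable (lebesgue_on (cball 0 1))"
      by (rule borel_measurable_integrable[OF inner_supported_lborel(2)[OF that]])
    show "(\<lambda>z. (bdf z powr 0) *\<^sub>R u z) \<in> borel_measurable (lebesgue_on (cball 0 1))"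
      by (intro borel_measurable_scaleR weight_measurable m)
    show "AE z in lebesgue_on (cball 0 1). (bdf z powr 0) *\<^sub>R u z = u z"
      by (rule eventually_mono[OF AE_lebesgue_on_interior]) (auto simp: bdf_pos_iff[symmetric])
  qed
  show "(LINT z|lebesgue_on (cball 0 1). dz \<phi> z) = 0"
    using weighted_integration_by_parts_dz(1)[OF assms, of 0] e[OF inner_supported_test[OF test_functions_dz[OF assms]]] by simp
  show "(LINT z|lebesgue_on (cball 0 1). dzb \<phi> z) = 0"
    using weighted_integration_by_parts_dz(2)[OF assms, of 0] e[OF inner_supported_test[OF test_functions_dzb[OF assms]]] by simp
qed

lemma integral_dz_cnj_power:
  assumes "\<phi> \<in> test_functions"
  shows "(LINT z|lebesgue_on (cball 0 1). dz \<phi> z * cnj (z ^ l)) = 0"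
proof -
  let ?\<psi> = "\<lambda>z. cnj z ^ l * \<phi> z"
  have p: "?\<psi> \<in> test_functions" by (rule test_functions_mult[OF assms smooth_power[OF smooth_cnj]])
  have "dz ?\<psi> z = dz \<phi> z * cnj (z ^ l)" for z
    by (subst dz_mult[OF smooth_differentiable[OF smooth_power[OF smooth_cnj]]
          smooth_differentiable[OF test_functions_smooth[OF assms]]])
       (simp add: dz_cnj_power)
  then show ?thesis using integral_dz_test(1)[OF p] by simp
qed

lemma dual_power_pos:
  assumes "s < 1"
  shows "0 < sq_norm (disk_measure s) (dual_weight s (\<lambda>z. z ^ l))"
proof (rule ccontr)
  let ?M = "disk_measure s"
  have m: "(\<lambda>z. z ^ l) \<in> borel_measurable ?M"
    by (rule continuous_measurable_disk) (intro continuous_intros)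
  have si: "sq_int ?M (dual_weight s (\<lambda>z. z ^ l))"
    by (rule sq_int_dual_weight[OF assms m, where B = 1])
       (auto simp: space_disk_measure norm_power power_le_one intro!: AE_I2)
  assume "\<not> 0 < sq_norm ?M (dual_weight s (\<lambda>z. z ^ l))"
  then have "sq_norm ?M (dual_weight s (\<lambda>z. z ^ l)) = 0"
    using sq_norm_nonneg[of ?M "dual_weight s (\<lambda>z. z ^ l)"] by simp
  then have "AE z in ?M. dual_weight s (\<lambda>z. z ^ l) z = 0" by (rule sq_norm_eq_0[OF si])
  then have "AE z in ?M. z = 0"
    using AE_disk_interior
  proof eventually_elim
    case (elim z)
    then have "bdf z > 0" by (simp add: bdf_pos_iff)
    then show ?case using elim(1) by (auto simp: dual_weight_def)
  qed
  then have "AE z in lebesgue. z \<in> cball 0 1 \<longrightarrow> z = (0::complex)"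
    unfolding AE_disk_iff by (simp add: AE_restrict_space_iff)
  then have "{z. \<not> (z \<in> cball 0 1 \<longrightarrow> z = (0::complex))} \<in> null_sets lebesgue"
    by (subst (asm) AE_iff_null) auto
  then have "negligible {z. \<not> (z \<in> cball 0 1 \<longrightarrow> z = (0::complex))}"
    by (simp add: negligible_iff_null_sets)
  then have "negligible (ball 0 1 - {0::complex})"
    by (rule negligible_subset) auto
  moreover have "open (ball 0 1 - {0::complex})" by (intro open_delete open_ball)
  moreover have "1/2 \<in> ball 0 1 - {0::complex}" by simp
  ultimately show False using open_not_negligible by blast
qed

text \<open>Approximate \<open>G\<close> by \<open>g = p \<cdot> cutoff\<close>, which is \<open>dz \<phi>\<close> up to finitely many terms
  \<open>c l * z ^ l * E\<close>. Since the moments of \<open>G\<close> and of \<open>dz \<phi>\<close> vanish, the coefficients \<open>c l\<close> are multiples of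
  the moments of \<open>g - G\<close>; taking \<open>E\<close> close to the dual weight, Bessel's inequality bounds the correction by the
  error \<open>g - G\<close>, uniformly in the number of terms.\<close>

lemma dz_range_dense:
  assumes s: "-1 < s" "s < 1" and G: "sq_int (disk_measure s) G"
    and mom: "\<And>l. (LINT z|lebesgue_on (cball 0 1). G z * cnj (z ^ l)) = 0" and e: "0 < e"
  shows "\<exists>\<phi>\<in>test_functions. sq_norm (disk_measure s) (\<lambda>z. dz \<phi> z - G z) < e"
proof -
  let ?M = "disk_measure s"
  obtain p n where p: "bipoly p" and gs: "sq_int ?M (\<lambda>z. p z * of_real (cutoff n ((cmod z)\<^sup>2)))"
    and gG: "sq_norm ?M (\<lambda>z. p z * of_real (cutoff n ((cmod z)\<^sup>2)) - G z) < e / 10"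
    using cutoff_bipoly_dense[OF s(1) G, of "e / 10"] e by auto
  define g where "g z = p z * of_real (cutoff n ((cmod z)\<^sup>2))" for z
  define w where "w z = g z - G z" for z
  have ws: "sq_int ?M w" unfolding w_def g_def by (rule sq_int_diff(1)[OF gs G])
  \<comment> \<open>For large \<open>k\<close> the functions \<open>z ^ l * E k\<close> are close to the representers \<open>el l\<close> of the moments.\<close>
  define E where "E k t = (1 - t) powr (- s) * cutoff k t" for k t
  have Eb: "interval_bump (E k)" for k
  proof -
    have "Ck_on j {0<..<1} (\<lambda>t. ((-1) * t + 1) powr (- s))" for j
      by (rule Ck_on_affine[OF Ck_on_powr]) auto
    then show ?thesis unfolding E_def[abs_def]
      by (intro interval_bump_mult[OF interval_bump_cutoff]) (simp add: algebra_simps)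
  qed
  have E0: "0 \<le> E k t" for k t using cutoff_range by (simp add: E_def)
  have E1: "0 < E k (1/2)" for k using cutoff_pos[of k] by (simp add: E_def)
  define el where "el l = dual_weight s (\<lambda>z. z ^ l)" for l
  define f where "f k l z = z ^ l * of_real (E k ((cmod z)\<^sup>2))" for k l z
  have pm: "(\<lambda>z. z ^ l) \<in> borel_measurable ?M" for l
    by (rule continuous_measurable_disk) (intro continuous_intros)
  have es: "sq_int ?M (el l)" for l unfolding el_def
    by (rule sq_int_dual_weight[OF s(2) pm, where B = 1])
       (auto simp: space_disk_measure norm_power power_le_one intro!: AE_I2)
  have fe: "f k l z = of_real (cutoff k ((cmod z)\<^sup>2)) * el l z" for k l z
    by (simp add: f_def E_def el_def dual_weight_def bdf_def)
  have fs: "sq_int ?M (f k l)" for k l unfolding f_def[abs_def]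
    by (intro test_functions_sq_int interval_bump_test_function Eb smooth_power smooth_ident)
  have fle: "cmod (f k l z) \<le> cmod (el l z)" for k l z
    using cutoff_range[of k "(cmod z)\<^sup>2"] by (simp add: fe norm_mult mult_left_le_one_le)
  have fn: "sq_norm ?M (f k l) \<le> sq_norm ?M (el l)" for k l
    unfolding sq_norm_def
    by (intro integral_mono power_mono fle) (use es fs in \<open>auto simp: sq_int_def\<close>)
  have z0: "AE z in ?M. z \<noteq> 0"
  proof -
    have "AE z in lebesgue. z \<notin> {0::complex}"
      by (rule AE_not_in) (simp add: negligible_iff_null_sets[symmetric])
    then show ?thesis unfolding AE_disk_iff by (auto simp: AE_restrict_space_iff elim: eventually_mono)
  qed
  have flim: "(\<lambda>k. sq_norm ?M (\<lambda>z. f k l z - el l z)) \<longlonglongrightarrow> 0" for l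
  proof (rule sq_norm_dominated_convergence[OF sq_int_measurable[OF fs] sq_int_measurable[OF es] es])
    show "AE z in ?M. cmod (f k l z) \<le> cmod (el l z)" for k by (simp add: fle)
    show "AE z in ?M. (\<lambda>k. f k l z) \<longlonglongrightarrow> el l z"
    proof (rule eventually_mono[OF eventually_conj[OF z0 AE_disk_interior]])
      fix z :: complex assume "z \<noteq> 0 \<and> cmod z < 1"
      then have "0 < (cmod z)\<^sup>2" "(cmod z)\<^sup>2 < 1" using abs_square_less_1[of "cmod z"] by auto
      then have "(\<lambda>k. of_real (cutoff k ((cmod z)\<^sup>2)) * el l z) \<longlonglongrightarrow> of_real 1 * el l z"
        by (intro tendsto_mult tendsto_const tendsto_of_real cutoff_tendsto)
      then show "(\<lambda>k. f k l z) \<longlonglongrightarrow> el l z" by (simp add: fe)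
    qed
  qed
  define \<kappa> where "\<kappa> l = sq_norm ?M (el l)" for l
  have \<kappa>: "0 < \<kappa> l" for l unfolding \<kappa>_def el_def by (rule dual_power_pos[OF s(2)])
  have lim: "(\<lambda>k. LINT z|?M. f k l z * cnj (el l z)) \<longlonglongrightarrow> of_real (\<kappa> l)" for l
  proof -
    have "(LINT z|?M. el l z * cnj (el l z)) = of_real (\<kappa> l)"
      unfolding \<kappa>_def sq_norm_def integral_complex_of_real[symmetric] complex_norm_square ..
    then show ?thesis using pairing_tendsto[where u = "\<lambda>k. f k l", OF fs es es flim, of l] by simp
  qed
  \<comment> \<open>The number \<open>N\<close> does not depend on \<open>k\<close>, so one \<open>k\<close> serves for all correction terms.\<close>
  obtain N where N': "\<forall>E. interval_bump E \<and> (\<forall>t. 0 \<le> E t) \<and> 0 < E (1/2) \<longrightarrow> (\<exists>c. \<exists>\<phi>\<in>test_functions.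
     \<forall>z. p z * of_real (cutoff n ((cmod z)\<^sup>2)) = dz \<phi> z + (\<Sum>l\<le>N. c l * (z ^ l * of_real (E ((cmod z)\<^sup>2)))))"
    using bipoly_cutoff_decomposition[OF p interval_bump_cutoff[of n]] by (elim exE)
  have N: "\<exists>c. \<exists>\<phi>\<in>test_functions. \<forall>z. g z = dz \<phi> z + (\<Sum>l\<le>N. c l * f k l z)" for k
    unfolding g_def f_def by (rule N'[rule_format]) (intro conjI allI Eb E0 E1)
  have "\<forall>\<^sub>F k in sequentially. \<forall>l\<in>{..N}. \<kappa> l / 2 < cmod (LINT z|?M. f k l z * cnj (el l z))"
  proof (rule eventually_ball_finite, simp, rule ballI)
    fix l
    have "(\<lambda>k. cmod (LINT z|?M. f k l z * cnj (el l z))) \<longlonglongrightarrow> cmod (of_real (\<kappa> l))"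
      by (rule tendsto_norm[OF lim])
    then show "\<forall>\<^sub>F k in sequentially. \<kappa> l / 2 < cmod (LINT z|?M. f k l z * cnj (el l z))"
      by (rule order_tendstoD) (use \<kappa>[of l] in simp)
  qed
  then obtain k where k: "\<And>l. l \<le> N \<Longrightarrow> \<kappa> l / 2 < cmod (LINT z|?M. f k l z * cnj (el l z))"
    unfolding eventually_sequentially by blast
  obtain c \<phi> where \<phi>: "\<phi> \<in> test_functions" and dec: "\<And>z. g z = dz \<phi> z + (\<Sum>l\<le>N. c l * f k l z)"
    using N[of k] by blast
  have Em: "(\<lambda>r. E k (r\<^sup>2)) \<in> borel_measurable borel"
  proof -
    have "Ck_on 0 UNIV (E k)" using Eb[of k] unfolding interval_bump_def by blast
    then have "continuous_on UNIV (E k)" by simp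
    then have "continuous_on UNIV (\<lambda>r. E k (r\<^sup>2))"
      by (rule continuous_on_compose2[OF _ continuous_on_power[OF continuous_on_id]]) simp
    then show ?thesis by (rule borel_measurable_continuous_onI)
  qed
  have orth1: "(LINT z|?M. f k j z * cnj (el l z)) = 0" if "j \<noteq> l" for j l
  proof -
    have "(LINT z|?M. z ^ j * cnj z ^ l * (of_real (E k ((cmod z)\<^sup>2)) * of_real ((1 - (cmod z)\<^sup>2) powr (- s)))) = 0"
      by (rule angular_orthogonality[OF _ that, where A = "\<lambda>r. of_real (E k (r\<^sup>2)) * of_real ((1 - r\<^sup>2) powr (- s))"])
         (use Em in measurable)
    then show ?thesis by (simp add: f_def el_def dual_weight_def bdf_def mult_ac)
  qed
  have orth2: "(LINT z|?M. f k j z * cnj (f k l z)) = 0" if "j \<noteq> l" for j l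
  proof -
    have "(LINT z|?M. z ^ j * cnj z ^ l * (of_real (E k ((cmod z)\<^sup>2)) * of_real (E k ((cmod z)\<^sup>2)))) = 0"
      by (rule angular_orthogonality[OF _ that, where A = "\<lambda>r. of_real (E k (r\<^sup>2)) * of_real (E k (r\<^sup>2))"])
         (use Em in measurable)
    then show ?thesis by (simp add: f_def mult_ac)
  qed
  have orth3: "(LINT z|?M. el j z * cnj (el l z)) = 0" if "j \<noteq> l" for j l
  proof -
    have "(LINT z|?M. z ^ j * cnj z ^ l * (of_real ((1 - (cmod z)\<^sup>2) powr (- s)) * of_real ((1 - (cmod z)\<^sup>2) powr (- s)))) = 0"
      by (rule angular_orthogonality[OF _ that, where A = "\<lambda>r. of_real ((1 - r\<^sup>2) powr (- s)) * of_real ((1 - r\<^sup>2) powr (- s))"])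
         measurable
    then show ?thesis by (simp add: el_def dual_weight_def bdf_def mult_ac)
  qed
  have ds: "sq_int ?M (dz \<phi>)" by (rule test_functions_sq_int[OF test_functions_dz[OF \<phi>]])
  define b where "b l = (LINT z|?M. w z * cnj (el l z))" for l
  have b: "b l = c l * (LINT z|?M. f k l z * cnj (el l z))" if "l \<le> N" for l
  proof -
    have i: "integrable ?M (\<lambda>z. dz \<phi> z * cnj (el l z))" "integrable ?M (\<lambda>z. G z * cnj (el l z))"
      "\<And>j. integrable ?M (\<lambda>z. f k j z * cnj (el l z))"
      by (intro sq_int_mult_integrable ds G fs es)+
    have "w z * cnj (el l z) = dz \<phi> z * cnj (el l z) + (\<Sum>j\<le>N. c j * (f k j z * cnj (el l z))) - G z * cnj (el l z)" for z
      by (simp only: w_def dec left_diff_distrib distrib_right sum_distrib_right mult.assoc)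
    then have "b l = (LINT z|?M. dz \<phi> z * cnj (el l z) + (\<Sum>j\<le>N. c j * (f k j z * cnj (el l z))) - G z * cnj (el l z))"
      unfolding b_def by (simp only:)
    also have "\<dots> = (LINT z|?M. dz \<phi> z * cnj (el l z)) + (\<Sum>j\<le>N. c j * (LINT z|?M. f k j z * cnj (el l z)))
        - (LINT z|?M. G z * cnj (el l z))"
      by (simp only: Bochner_Integration.integral_diff Bochner_Integration.integral_add Bochner_Integration.integrable_add
          Bochner_Integration.integral_sum Bochner_Integration.integrable_sum integrable_mult_right integral_mult_right_zero i)
    also have "(LINT z|?M. dz \<phi> z * cnj (el l z)) = 0"
      unfolding el_def pairing_dual_weight[OF sq_int_measurable[OF ds] pm] by (rule integral_dz_cnj_power[OF \<phi>])
    also have "(LINT z|?M. G z * cnj (el l z)) = 0"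
      unfolding el_def pairing_dual_weight[OF sq_int_measurable[OF G] pm] by (rule mom)
    also have "(\<Sum>j\<le>N. c j * (LINT z|?M. f k j z * cnj (el l z))) = (\<Sum>j\<le>N. if j = l then c l * (LINT z|?M. f k l z * cnj (el l z)) else 0)"
      by (rule sum.cong) (auto simp: orth1)
    finally show ?thesis using that by simp
  qed
  have "sq_norm ?M (\<lambda>z. \<Sum>l\<le>N. c l * f k l z) = (\<Sum>l\<le>N. (cmod (c l))\<^sup>2 * sq_norm ?M (f k l))"
    by (rule sq_norm_orthogonal_sum) (use fs orth2 in auto)
  also have "\<dots> \<le> (\<Sum>l\<le>N. 4 * ((cmod (b l))\<^sup>2 / \<kappa> l))"
  proof (rule sum_mono)
    fix l assume "l \<in> {..N}"
    then have l: "l \<le> N" by simp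
    have "cmod (c l) * (\<kappa> l / 2) \<le> cmod (c l) * cmod (LINT z|?M. f k l z * cnj (el l z))"
      using k[OF l] by (intro mult_left_mono) auto
    also have "\<dots> = cmod (b l)" by (simp add: b[OF l] norm_mult)
    finally have "cmod (c l) * \<kappa> l \<le> 2 * cmod (b l)" by simp
    then have "(cmod (c l) * \<kappa> l)\<^sup>2 \<le> (2 * cmod (b l))\<^sup>2"
      using \<kappa>[of l] by (intro power_mono) auto
    then have "((cmod (c l))\<^sup>2 * \<kappa> l) * \<kappa> l \<le> 4 * (cmod (b l))\<^sup>2"
      by (simp add: power2_eq_square mult_ac)
    then have "(cmod (c l))\<^sup>2 * \<kappa> l \<le> 4 * (cmod (b l))\<^sup>2 / \<kappa> l"
      using \<kappa>[of l] by (simp add: pos_le_divide_eq)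
    moreover have "(cmod (c l))\<^sup>2 * sq_norm ?M (f k l) \<le> (cmod (c l))\<^sup>2 * \<kappa> l"
      unfolding \<kappa>_def by (intro mult_left_mono fn) auto
    ultimately show "(cmod (c l))\<^sup>2 * sq_norm ?M (f k l) \<le> 4 * ((cmod (b l))\<^sup>2 / \<kappa> l)" by simp
  qed
  also have "\<dots> = 4 * (\<Sum>l\<le>N. (cmod (b l))\<^sup>2 / \<kappa> l)" by (simp add: sum_distrib_left)
  also have "\<dots> \<le> 4 * sq_norm ?M w"
    unfolding b_def \<kappa>_def
    by (intro mult_left_mono Bessel_inequality es ws orth3) (use \<kappa> in \<open>auto simp: \<kappa>_def\<close>)
  finally have corr: "sq_norm ?M (\<lambda>z. \<Sum>l\<le>N. c l * f k l z) \<le> 4 * sq_norm ?M w" .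
  have cs: "sq_int ?M (\<lambda>z. \<Sum>l\<le>N. c l * f k l z)" by (intro sq_int_sum sq_int_scale(1) fs)
  have "(\<lambda>z. dz \<phi> z - G z) = (\<lambda>z. w z - (\<Sum>l\<le>N. c l * f k l z))" by (auto simp: w_def dec)
  then have "sq_norm ?M (\<lambda>z. dz \<phi> z - G z) \<le> 2 * sq_norm ?M w + 2 * sq_norm ?M (\<lambda>z. \<Sum>l\<le>N. c l * f k l z)"
    using sq_int_diff(2)[OF ws cs] by simp
  also have "\<dots> \<le> 10 * sq_norm ?M w" using corr by simp
  also have "\<dots> < e" using gG by (simp add: w_def[abs_def] g_def)
  finally show ?thesis using \<phi> by blast
qed

section \<open>Solving the transport equation mode by mode\<close>

text \<open>A symmetric tensor field is encoded by the coefficients \<open>F j\<close> of \<open>v ^ (m - j) * cnj v ^ j\<close>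
  in its value on \<open>(v, \<dots>, v)\<close>. For a unit vector \<open>v\<close> and \<open>w = v\<^sup>2\<close> the expression below is, up to a
  constant and a power of \<open>v\<close>, the integral of that value against a power of the coordinate transversal
  to \<open>v\<close>. It is a polynomial in \<open>w\<close>; requiring it to vanish for all complex \<open>w\<close> makes its
  coefficients accessible.\<close>

definition transversal_moments_vanish :: "nat \<Rightarrow> (nat \<Rightarrow> complex \<Rightarrow> complex) \<Rightarrow> bool" where
  "transversal_moments_vanish m F \<longleftrightarrow>
     (\<forall>l w. (\<Sum>j\<le>m. w ^ (m - j) * (LINT z|lebesgue_on (cball 0 1). F j z * (z - cnj z * w) ^ l)) = 0)"

lemma poly_sum_leading_coeff:
  fixes A :: "nat \<Rightarrow> nat \<Rightarrow> complex"
  assumes "\<And>w. (\<Sum>j\<le>m. \<Sum>k\<le>l. A j k * w ^ (m - j + k)) = 0"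
  shows "A 0 l = 0"
proof -
  define P where "P = (\<Sum>j\<le>m. \<Sum>k\<le>l. monom (A j k) (m - j + k))"
  have "poly P w = 0" for w
    using assms[of w] by (simp add: P_def poly_sum poly_monom)
  then have "P = 0" using poly_all_0_iff_0 by blast
  then have "0 = coeff P (m + l)" by simp
  also have "\<dots> = (\<Sum>j\<le>m. \<Sum>k\<le>l. if m - j + k = m + l then A j k else 0)"
    by (simp add: P_def coeff_sum)
  also have "\<dots> = (\<Sum>j\<le>m. \<Sum>k\<le>l. if j = 0 \<and> k = l then A 0 l else 0)"
    by (intro sum.cong refl) auto
  also have "\<dots> = (\<Sum>j\<le>m. if j = 0 then A 0 l else 0)"
    by (intro sum.cong refl) auto
  also have "\<dots> = A 0 l" by simp
  finally show ?thesis by simp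
qed

lemma bounded_on_disk:
  assumes "continuous_on UNIV p"
  shows "\<exists>B. AE z in disk_measure s. cmod (p z) \<le> B"
proof -
  have "bounded (p ` cball 0 1)"
    by (intro compact_imp_bounded compact_continuous_image compact_cball continuous_on_subset[OF assms]) simp
  then obtain B where "\<forall>x\<in>p ` cball 0 1. cmod x \<le> B" unfolding bounded_iff by blast
  then show ?thesis by (intro exI[of _ B] AE_I2) (simp add: space_disk_measure)
qed

lemma unweighted_continuous_integrable:
  assumes "s < 1" "sq_int (disk_measure s) u" "continuous_on UNIV p"
  shows "integrable (lebesgue_on (cball 0 1)) (\<lambda>z. u z * p z)"
proof -
  have c: "continuous_on UNIV (\<lambda>z. cnj (p z))" by (intro continuous_on_cnj assms)
  obtain B where "AE z in disk_measure s. cmod (cnj (p z)) \<le> B"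
    using bounded_on_disk[OF c] by blast
  from unweighted_integrable[OF assms(1,2) continuous_measurable_disk[OF c] this] show ?thesis by simp
qed

lemma unweighted_pairing_tendsto:
  assumes "s < 1" "\<And>n. sq_int (disk_measure s) (u n)" "sq_int (disk_measure s) u'" "continuous_on UNIV p"
    and "(\<lambda>n. sq_norm (disk_measure s) (\<lambda>z. u n z - u' z)) \<longlonglongrightarrow> 0"
  shows "(\<lambda>n. LINT z|lebesgue_on (cball 0 1). u n z * p z) \<longlonglongrightarrow> (LINT z|lebesgue_on (cball 0 1). u' z * p z)"
proof -
  have c: "continuous_on UNIV (\<lambda>z. cnj (p z))" by (intro continuous_on_cnj assms)
  obtain B where B: "AE z in disk_measure s. cmod (cnj (p z)) \<le> B"
    using bounded_on_disk[OF c] by blast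
  note m = continuous_measurable_disk[OF c]
  have "(LINT z|disk_measure s. v z * cnj (dual_weight s (\<lambda>z. cnj (p z)) z)) = (LINT z|lebesgue_on (cball 0 1). v z * p z)"
    if "sq_int (disk_measure s) v" for v
    using pairing_dual_weight[OF sq_int_measurable[OF that] m] by simp
  then show ?thesis
    using pairing_tendsto[OF assms(2,3) sq_int_dual_weight[OF assms(1) m B] assms(5)] assms(2,3) by simp
qed

lemma binomial_moment_expansion:
  assumes "s < 1" "sq_int (disk_measure s) u"
  shows "(LINT z|lebesgue_on (cball 0 1). u z * (z - cnj z * w) ^ l)
    = (\<Sum>k\<le>l. (of_nat (l choose k) * (- 1) ^ k * (LINT z|lebesgue_on (cball 0 1). u z * (z ^ (l - k) * cnj z ^ k))) * w ^ k)"
proof -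
  have i: "integrable (lebesgue_on (cball 0 1)) (\<lambda>z. u z * (z ^ (l - k) * cnj z ^ k))" for k
    by (intro unweighted_continuous_integrable[OF assms] continuous_intros)
  have "u z * (z - cnj z * w) ^ l = (\<Sum>k\<le>l. (of_nat (l choose k) * (- 1) ^ k * w ^ k) * (u z * (z ^ (l - k) * cnj z ^ k)))" for z
  proof -
    have "(z - cnj z * w) ^ l = (- (cnj z * w) + z) ^ l" by simp
    also have "\<dots> = (\<Sum>k\<le>l. of_nat (l choose k) * (- (cnj z * w)) ^ k * z ^ (l - k))" by (rule binomial_ring)
    also have "\<dots> = (\<Sum>k\<le>l. (of_nat (l choose k) * (- 1) ^ k * w ^ k) * (z ^ (l - k) * cnj z ^ k))"
      by (intro sum.cong refl) (simp add: power_minus[of "cnj z * w"] power_mult_distrib)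
    finally show ?thesis by (simp only: sum_distrib_left mult.left_commute)
  qed
  then have "(LINT z|lebesgue_on (cball 0 1). u z * (z - cnj z * w) ^ l)
      = (\<Sum>k\<le>l. (of_nat (l choose k) * (- 1) ^ k * w ^ k) * (LINT z|lebesgue_on (cball 0 1). u z * (z ^ (l - k) * cnj z ^ k)))"
    by (simp only: Bochner_Integration.integral_sum integrable_mult_right i integral_mult_right_zero)
  also have "\<dots> = (\<Sum>k\<le>l. (of_nat (l choose k) * (- 1) ^ k * (LINT z|lebesgue_on (cball 0 1). u z * (z ^ (l - k) * cnj z ^ k))) * w ^ k)"
    by (intro sum.cong refl) (simp only: mult_ac)
  finally show ?thesis .
qed

text \<open>The coefficient of \<open>w ^ (m + l)\<close>, the highest possible power, comes from the component \<open>F 0\<close>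
  alone.\<close>

lemma leading_component_moments:
  assumes s: "s < 1" and F: "\<And>j. j \<le> m \<Longrightarrow> sq_int (disk_measure s) (F j)"
    and mom: "transversal_moments_vanish m F"
  shows "(LINT z|lebesgue_on (cball 0 1). F 0 z * cnj (z ^ l)) = 0"
proof -
  define A where "A j k = of_nat (l choose k) * (- 1) ^ k *
      (LINT z|lebesgue_on (cball 0 1). F j z * (z ^ (l - k) * cnj z ^ k))" for j k
  have "(\<Sum>j\<le>m. \<Sum>k\<le>l. A j k * w ^ (m - j + k)) = 0" for w
  proof -
    have "(\<Sum>j\<le>m. \<Sum>k\<le>l. A j k * w ^ (m - j + k))
        = (\<Sum>j\<le>m. w ^ (m - j) * (LINT z|lebesgue_on (cball 0 1). F j z * (z - cnj z * w) ^ l))"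
    proof (rule sum.cong[OF refl])
      fix j assume "j \<in> {..m}"
      then have "sq_int (disk_measure s) (F j)" using F by simp
      then show "(\<Sum>k\<le>l. A j k * w ^ (m - j + k))
          = w ^ (m - j) * (LINT z|lebesgue_on (cball 0 1). F j z * (z - cnj z * w) ^ l)"
        unfolding binomial_moment_expansion[OF s \<open>sq_int (disk_measure s) (F j)\<close>] A_def[symmetric] sum_distrib_left
        by (simp only: power_add mult_ac)
    qed
    also have "\<dots> = 0" using mom by (simp add: transversal_moments_vanish_def)
    finally show ?thesis .
  qed
  then have "A 0 l = 0" by (rule poly_sum_leading_coeff)
  then show ?thesis by (simp add: A_def)
qed

lemma all_moments_of_function:
  assumes s: "s < 1" and F: "sq_int (disk_measure s) (F 0)"
    and mom: "transversal_moments_vanish 0 F"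
  shows "(LINT z|lebesgue_on (cball 0 1). F 0 z * (z ^ a * cnj z ^ b)) = 0"
proof -
  define A where "A k = of_nat ((a + b) choose k) * (- 1) ^ k *
      (LINT z|lebesgue_on (cball 0 1). F 0 z * (z ^ (a + b - k) * cnj z ^ k))" for k
  have "(\<Sum>k\<le>a + b. A k * w ^ k) = 0" for w
    using mom unfolding transversal_moments_vanish_def A_def
    by (simp add: binomial_moment_expansion[OF s F])
  then have "A b = 0" using polyfun_eq_0[of A "a + b"] by simp
  then show ?thesis by (simp add: A_def)
qed

text \<open>With respect to the unweighted pairing, \<open>F\<close> is a functional on the space with weight \<open>- s\<close>, in
  which the polynomials are dense.\<close>

lemma vanishing_moments_imp_zero:
  assumes s: "-1 < s" "s < 1" and F: "sq_int (disk_measure s) F"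
    and mom: "\<And>a b. (LINT z|lebesgue_on (cball 0 1). F z * (z ^ a * cnj z ^ b)) = 0"
  shows "sq_norm (disk_measure s) F = 0"
proof -
  let ?M = "disk_measure s"
  have poly: "(LINT z|lebesgue_on (cball 0 1). F z * cnj (p z)) = 0" if "bipoly p" for p
  proof -
    have "integrable (lebesgue_on (cball 0 1)) (\<lambda>z. F z * cnj (p z)) \<and> (LINT z|lebesgue_on (cball 0 1). F z * cnj (p z)) = 0"
      using that
    proof (induction rule: bipoly.induct)
      case (monom a b)
      have "integrable (lebesgue_on (cball 0 1)) (\<lambda>z. F z * cnj (z ^ a * cnj z ^ b))"
        by (intro unweighted_continuous_integrable[OF s(2) F] continuous_intros)
      then show ?case using mom[of b a] by (simp add: mult.commute)
    next
      case (scale p c)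
      have "(\<lambda>z. F z * cnj (c * p z)) = (\<lambda>z. cnj c * (F z * cnj (p z)))" by auto
      then show ?case using scale.IH by simp
    next
      case (add p q)
      have "(\<lambda>z. F z * cnj (p z + q z)) = (\<lambda>z. F z * cnj (p z) + F z * cnj (q z))" by (auto simp: distrib_left)
      then show ?case using add.IH by simp
    qed
    then show ?thesis ..
  qed
  define H where "H = dual_weight (- s) F"
  have H: "sq_int (disk_measure (- s)) H"
    unfolding H_def by (rule dual_weight_isometry(1)) (use F in simp)
  have "(sq_norm ?M F)\<^sup>2 \<le> sq_norm ?M F * e" if e: "0 < e" for e
  proof -
    obtain p where p: "bipoly p" "sq_int (disk_measure (- s)) p" "sq_norm (disk_measure (- s)) (\<lambda>z. p z - H z) < e"
      using bipoly_dense[OF _ H e] s by auto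
    have pd: "sq_int ?M (dual_weight s p)" by (rule dual_weight_isometry(1)[OF p(2)])
    have mp: "p \<in> borel_measurable ?M" by (rule continuous_measurable_disk[OF bipoly_continuous[OF p(1)]])
    have mH: "dual_weight s H \<in> borel_measurable ?M"
      by (rule sq_int_measurable[OF dual_weight_isometry(1)[OF H]])
    have HF: "AE z in ?M. dual_weight s H z = F z"
    proof (rule eventually_mono[OF AE_disk_interior])
      fix z :: complex assume "cmod z < 1"
      then have "bdf z powr (- s) * bdf z powr s = 1"
        by (simp add: bdf_pos_iff[symmetric] powr_add[symmetric])
      then have "complex_of_real (bdf z powr (- s)) * of_real (bdf z powr s) = 1"
        by (simp only: of_real_mult[symmetric] of_real_1)
      then show "dual_weight s H z = F z"
        unfolding H_def dual_weight_def by (simp only: mult.assoc[symmetric] minus_minus mult_1_left)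
    qed
    have d: "sq_int ?M (\<lambda>z. dual_weight s p z - F z)" by (rule sq_int_diff(1)[OF pd F])
    have "(\<lambda>z. dual_weight s (\<lambda>z. p z - H z) z) = (\<lambda>z. dual_weight s p z - dual_weight s H z)"
      by (auto simp: dual_weight_def right_diff_distrib)
    then have "sq_norm ?M (\<lambda>z. dual_weight s p z - dual_weight s H z) < e"
      using dual_weight_isometry(2)[OF sq_int_diff(1)[OF p(2) H]] p(3) by simp
    moreover have "sq_norm ?M (\<lambda>z. dual_weight s p z - dual_weight s H z) = sq_norm ?M (\<lambda>z. dual_weight s p z - F z)"
      by (rule sq_norm_cong_AE)
         (use HF d sq_int_measurable[OF pd] mH in \<open>auto simp: sq_int_def\<close>)
    ultimately have small: "sq_norm ?M (\<lambda>z. dual_weight s p z - F z) < e" by simp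
    have "(LINT z|?M. F z * cnj (dual_weight s p z)) = 0"
      unfolding pairing_dual_weight[OF sq_int_measurable[OF F] mp] by (rule poly[OF p(1)])
    then have "(LINT z|?M. F z * cnj (dual_weight s p z - F z)) = - (LINT z|?M. F z * cnj (F z))"
      by (simp add: right_diff_distrib sq_int_mult_integrable[OF F pd] sq_int_mult_integrable[OF F F])
    also have "(LINT z|?M. F z * cnj (F z)) = of_real (sq_norm ?M F)"
      unfolding sq_norm_def integral_complex_of_real[symmetric] complex_norm_square ..
    finally have "(sq_norm ?M F)\<^sup>2 \<le> sq_norm ?M F * sq_norm ?M (\<lambda>z. dual_weight s p z - F z)"
      using Cauchy_Schwarz_integral[OF F d] by simp
    also have "\<dots> \<le> sq_norm ?M F * e" using small sq_norm_nonneg[of ?M F] by (intro mult_left_mono) auto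
    finally show ?thesis .
  qed
  note key = this
  show ?thesis
  proof (rule ccontr)
    assume "sq_norm ?M F \<noteq> 0"
    then have N: "0 < sq_norm ?M F" using sq_norm_nonneg[of ?M F] by simp
    then have "(sq_norm ?M F)\<^sup>2 \<le> sq_norm ?M F * (sq_norm ?M F / 2)" by (intro key) simp
    then have "sq_norm ?M F * sq_norm ?M F \<le> 0" by (simp add: power2_eq_square)
    then show False using N mult_pos_pos[OF N N] by linarith
  qed
qed

text \<open>The operator \<open>w dz + dzb\<close> annihilates \<open>z - cnj z * w\<close>, so the integrand is a total derivative.\<close>

lemma transversal_derivative_integral:
  assumes \<phi>: "\<phi> \<in> test_functions"
  shows "w * (LINT z|lebesgue_on (cball 0 1). dz \<phi> z * (z - cnj z * w) ^ l)
    + (LINT z|lebesgue_on (cball 0 1). dzb \<phi> z * (z - cnj z * w) ^ l) = 0"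
proof -
  define P where "P z = z - cnj z * w" for z
  have bl: "bounded_linear P" unfolding P_def[abs_def]
    by (intro bounded_linear_sub bounded_linear_ident bounded_linear_mult_const bounded_linear_cnj)
  have sP: "smooth P" by (rule smooth_bounded_linear[OF bl])
  note hP = bounded_linear_imp_has_derivative[OF bl]
  have D1: "dz P z = 1" "dzb P z = - w" for z
    unfolding dz_def dzb_def dir_deriv_eqI[OF hP] by (simp_all add: P_def field_simps)
  have DP: "w * dz (\<lambda>z. P z ^ l) z + dzb (\<lambda>z. P z ^ l) z = 0" for z l
  proof (induction l)
    case 0
    then show ?case by (simp add: dz_def dzb_def dir_deriv_const)
  next
    case (Suc l)
    note dd = smooth_differentiable[OF sP] smooth_differentiable[OF smooth_power[OF sP]]
    have "w * dz (\<lambda>z. P z ^ Suc l) z + dzb (\<lambda>z. P z ^ Suc l) z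
        = P z * (w * dz (\<lambda>z. P z ^ l) z + dzb (\<lambda>z. P z ^ l) z)"
      unfolding power_Suc dz_mult[OF dd] dzb_mult[OF dd] D1 by (simp add: algebra_simps)
    then show ?case using Suc by simp
  qed
  define \<psi> where "\<psi> z = P z ^ l * \<phi> z" for z
  have psi: "\<psi> \<in> test_functions" unfolding \<psi>_def by (rule test_functions_mult[OF \<phi> smooth_power[OF sP]])
  note dd = smooth_differentiable[OF smooth_power[OF sP, of l]] smooth_differentiable[OF test_functions_smooth[OF \<phi>]]
  have point: "w * dz \<psi> z + dzb \<psi> z = w * (dz \<phi> z * P z ^ l) + dzb \<phi> z * P z ^ l" for z
  proof -
    have "w * dz \<psi> z + dzb \<psi> z = (w * dz (\<lambda>z. P z ^ l) z + dzb (\<lambda>z. P z ^ l) z) * \<phi> z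
        + (w * (dz \<phi> z * P z ^ l) + dzb \<phi> z * P z ^ l)"
      unfolding \<psi>_def dz_mult[OF dd] dzb_mult[OF dd] by (simp add: algebra_simps)
    then show ?thesis by (simp add: DP)
  qed
  have int: "integrable (lebesgue_on (cball 0 1)) (\<lambda>z. g z * P z ^ l)" if "g \<in> test_functions" for g
    using inner_supported_lborel(2)[OF inner_supported_mult[OF inner_supported_test[OF that]
          continuous_on_subset[OF smooth_continuous[OF smooth_power[OF sP, of l]]]]] by (simp add: mult.commute)
  have i2: "integrable (lebesgue_on (cball 0 1)) (dz \<psi>)" "integrable (lebesgue_on (cball 0 1)) (dzb \<psi>)"
    by (intro inner_supported_lborel(2) inner_supported_test test_functions_dz test_functions_dzb psi)+
  note i1 = int[OF test_functions_dz[OF \<phi>]] int[OF test_functions_dzb[OF \<phi>]]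
  have "w * (LINT z|lebesgue_on (cball 0 1). dz \<phi> z * P z ^ l) + (LINT z|lebesgue_on (cball 0 1). dzb \<phi> z * P z ^ l)
      = (LINT z|lebesgue_on (cball 0 1). w * dz \<psi> z + dzb \<psi> z)"
    unfolding point by (simp only: Bochner_Integration.integral_add integrable_mult_right i1 integral_mult_right_zero)
  also have "\<dots> = 0"
    by (simp only: Bochner_Integration.integral_add integrable_mult_right i2 integral_mult_right_zero integral_dz_test[OF psi]) simp
  finally show ?thesis by (simp add: P_def)
qed

text \<open>The coefficients of the derivative of \<open>\<Sum>j. \<phi> j * v ^ (m - 1 - j) * cnj v ^ j\<close> along \<open>v\<close>.\<close>

definition transport_coeff :: "nat \<Rightarrow> (nat \<Rightarrow> complex \<Rightarrow> complex) \<Rightarrow> nat \<Rightarrow> complex \<Rightarrow> complex" where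
  "transport_coeff m \<phi> j z = (if j < m then dz (\<phi> j) z else 0) + (if 0 < j then dzb (\<phi> (j - 1)) z else 0)"

definition H1_Cauchy :: "real \<Rightarrow> (nat \<Rightarrow> complex \<Rightarrow> complex) \<Rightarrow> bool" where
  "H1_Cauchy s \<phi> \<longleftrightarrow> (\<forall>e>0. \<exists>N. \<forall>k\<ge>N. \<forall>n\<ge>N. H1_norm s (\<lambda>z. \<phi> k z - \<phi> n z) < e)"

lemma sq_norm_Cauchy:
  assumes u: "\<And>n. sq_int M (u n)" and G: "sq_int M G"
    and lim: "(\<lambda>n. sq_norm M (\<lambda>z. u n z - G z)) \<longlonglongrightarrow> 0" and e: "0 < e"
  shows "\<exists>N. \<forall>k\<ge>N. \<forall>n\<ge>N. sq_norm M (\<lambda>z. u k z - u n z) < e"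
proof -
  have "\<forall>\<^sub>F n in sequentially. sq_norm M (\<lambda>z. u n z - G z) < e / 4"
    by (rule order_tendstoD[OF lim]) (use e in simp)
  then obtain N where N: "\<And>n. n \<ge> N \<Longrightarrow> sq_norm M (\<lambda>z. u n z - G z) < e / 4"
    unfolding eventually_sequentially by blast
  have "sq_norm M (\<lambda>z. u k z - u n z) < e" if "k \<ge> N" "n \<ge> N" for k n
  proof -
    have "sq_norm M (\<lambda>z. u k z - u n z) \<le> 2 * sq_norm M (\<lambda>z. u k z - G z) + 2 * sq_norm M (\<lambda>z. G z - u n z)"
      by (rule sq_norm_diff_trans[OF u G u])
    then show ?thesis using N[OF that(1)] N[OF that(2)] sq_norm_minus_commute[of M G "u n"] by linarith
  qed
  then show ?thesis by blast
qed

lemma dz_diff: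
  assumes "f differentiable (at z)" "g differentiable (at z)"
  shows "dz (\<lambda>z. f z - g z) z = dz f z - dz g z" "dzb (\<lambda>z. f z - g z) z = dzb f z - dzb g z"
  by (simp_all add: dz_def dzb_def dir_deriv_diff[OF assms] field_simps)

text \<open>One step of the construction: the a priori estimate turns convergence of \<open>dz \<phi>\<close> into
  convergence of all first derivatives, in particular of \<open>dzb \<phi>\<close>.\<close>

lemma dz_solution_sequence:
  assumes s: "-1 < s" "s < 1" and G: "sq_int (disk_measure s) G"
    and mom: "\<And>l. (LINT z|lebesgue_on (cball 0 1). G z * cnj (z ^ l)) = 0"
  obtains \<phi> B where "\<And>n. \<phi> n \<in> test_functions" "H1_Cauchy s \<phi>"
    "(\<lambda>n. sq_norm (disk_measure s) (\<lambda>z. dz (\<phi> n) z - G z)) \<longlonglongrightarrow> 0"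
    "sq_int (disk_measure s) B" "(\<lambda>n. sq_norm (disk_measure s) (\<lambda>z. dzb (\<phi> n) z - B z)) \<longlonglongrightarrow> 0"
proof -
  let ?M = "disk_measure s"
  have "\<forall>n. \<exists>\<phi>. \<phi> \<in> test_functions \<and> sq_norm ?M (\<lambda>z. dz \<phi> z - G z) < inverse (real (Suc n))"
  proof
    fix n
    have "0 < inverse (real (Suc n))" by simp
    from dz_range_dense[OF s G mom this]
    show "\<exists>\<phi>. \<phi> \<in> test_functions \<and> sq_norm ?M (\<lambda>z. dz \<phi> z - G z) < inverse (real (Suc n))" by blast
  qed
  from choice[OF this] obtain \<phi> where \<phi>: "\<And>n. \<phi> n \<in> test_functions"
    and small: "\<And>n. sq_norm ?M (\<lambda>z. dz (\<phi> n) z - G z) < inverse (real (Suc n))"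
    by blast
  have ds: "sq_int ?M (dz (\<phi> n))" "sq_int ?M (dzb (\<phi> n))" for n
    by (intro test_functions_sq_int test_functions_dz test_functions_dzb \<phi>)+
  have lim: "(\<lambda>n. sq_norm ?M (\<lambda>z. dz (\<phi> n) z - G z)) \<longlonglongrightarrow> 0"
    by (rule Lim_null_comparison[OF always_eventually LIMSEQ_inverse_real_of_nat])
       (use small in \<open>auto simp: sq_norm_nonneg intro: less_imp_le\<close>)
  note dd = smooth_differentiable[OF test_functions_smooth[OF \<phi>]]
  have dzd: "dz (\<lambda>z. \<phi> k z - \<phi> n z) = (\<lambda>z. dz (\<phi> k) z - dz (\<phi> n) z)"
    "dzb (\<lambda>z. \<phi> k z - \<phi> n z) = (\<lambda>z. dzb (\<phi> k) z - dzb (\<phi> n) z)" for k n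
    using dz_diff[OF dd dd] by auto
  have td: "(\<lambda>z. \<phi> k z - \<phi> n z) \<in> test_functions" for k n by (rule test_functions_diff[OF \<phi> \<phi>])
  obtain C where C: "C > 0" "\<And>q. q \<in> test_functions \<Longrightarrow> (H1_norm s q)\<^sup>2 \<le> C * sq_norm ?M (dz q)"
    using H1_norm_le_dz[OF s] by blast
  have "H1_Cauchy s \<phi>" unfolding H1_Cauchy_def
  proof (intro allI impI)
    fix e :: real assume e: "0 < e"
    have ep: "0 < e\<^sup>2 / C" using e C(1) by simp
    obtain N where N: "\<And>k n. k \<ge> N \<Longrightarrow> n \<ge> N \<Longrightarrow> sq_norm ?M (\<lambda>z. dz (\<phi> k) z - dz (\<phi> n) z) < e\<^sup>2 / C"
      using sq_norm_Cauchy[OF ds(1) G lim ep] by blast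
    have "H1_norm s (\<lambda>z. \<phi> k z - \<phi> n z) < e" if "k \<ge> N" "n \<ge> N" for k n
    proof -
      have "(H1_norm s (\<lambda>z. \<phi> k z - \<phi> n z))\<^sup>2 \<le> C * sq_norm ?M (\<lambda>z. dz (\<phi> k) z - dz (\<phi> n) z)"
        using C(2)[OF td] unfolding dzd .
      also have "\<dots> < C * (e\<^sup>2 / C)" using N[OF that] C(1) by (intro mult_strict_left_mono) auto
      also have "\<dots> = e\<^sup>2" using C(1) by simp
      finally show ?thesis using e by (rule power_less_imp_less_base[OF _ less_imp_le])
    qed
    then show "\<exists>N. \<forall>k\<ge>N. \<forall>n\<ge>N. H1_norm s (\<lambda>z. \<phi> k z - \<phi> n z) < e" by blast
  qed
  moreover have "\<exists>N. \<forall>k\<ge>N. \<forall>n\<ge>N. sq_norm ?M (\<lambda>z. dzb (\<phi> k) z - dzb (\<phi> n) z) < e" if e: "e > 0" for e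
  proof -
    have c: "0 < 4 / (1 - s)" using s by simp
    then have ep: "0 < e / (4 / (1 - s))" using e by (rule divide_pos_pos[rotated])
    obtain N where N: "\<And>k n. k \<ge> N \<Longrightarrow> n \<ge> N \<Longrightarrow> sq_norm ?M (\<lambda>z. dz (\<phi> k) z - dz (\<phi> n) z) < e / (4 / (1 - s))"
      using sq_norm_Cauchy[OF ds(1) G lim ep] by blast
    have "sq_norm ?M (\<lambda>z. dzb (\<phi> k) z - dzb (\<phi> n) z) < e" if "k \<ge> N" "n \<ge> N" for k n
    proof -
      have "sq_norm ?M (\<lambda>z. dzb (\<phi> k) z - dzb (\<phi> n) z) \<le> 4 / (1 - s) * sq_norm ?M (\<lambda>z. dz (\<phi> k) z - dz (\<phi> n) z)"
        using dz_controls_dzb(1)[OF s td] unfolding dzd .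
      also have "\<dots> < 4 / (1 - s) * (e / (4 / (1 - s)))" using N[OF that] c by (intro mult_strict_left_mono) auto
      also have "\<dots> = e" using c by simp
      finally show ?thesis .
    qed
    then show ?thesis by blast
  qed
  then obtain B where "sq_int ?M B" "(\<lambda>n. sq_norm ?M (\<lambda>z. dzb (\<phi> n) z - B z)) \<longlonglongrightarrow> 0"
    using Riesz_Fischer[of ?M "\<lambda>n. dzb (\<phi> n)", OF ds(2)] by blast
  ultimately show ?thesis using that \<phi> lim by blast
qed

text \<open>Solve for the leading component, subtract the derivative of the solution, which has vanishing
  moments as well, and continue with one component less. When a single component is left, all its
  moments vanish.\<close>

lemma symmetric_gradient_range:
  fixes F :: "nat \<Rightarrow> complex \<Rightarrow> complex"
  assumes s: "-1 < s" "s < 1"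
  shows "(\<And>j. j \<le> m \<Longrightarrow> sq_int (disk_measure s) (F j)) \<Longrightarrow> transversal_moments_vanish m F \<Longrightarrow>
    \<exists>\<phi>. (\<forall>j n. \<phi> j n \<in> test_functions) \<and> (\<forall>j<m. H1_Cauchy s (\<phi> j)) \<and>
      (\<forall>j\<le>m. (\<lambda>n. sq_norm (disk_measure s) (\<lambda>z. transport_coeff m (\<lambda>j. \<phi> j n) j z - F j z)) \<longlonglongrightarrow> 0)"
proof (induction m arbitrary: F)
  case 0
  have F0: "sq_int (disk_measure s) (F 0)" by (rule 0) simp
  have "sq_norm (disk_measure s) (F 0) = 0"
    by (rule vanishing_moments_imp_zero[OF s F0]) (rule all_moments_of_function[OF s(2) F0 0(2)])
  then have "sq_norm (disk_measure s) (\<lambda>z. transport_coeff 0 (\<lambda>j z. 0) 0 z - F 0 z) = 0"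
    by (simp add: transport_coeff_def sq_norm_uminus)
  then show ?case
    by (intro exI[of _ "\<lambda>j n z. 0"]) (simp add: test_functions_zero)
next
  case (Suc m)
  let ?M = "disk_measure s"
  define I where "I u l w = (LINT z|lebesgue_on (cball 0 1). u z * (z - cnj z * w) ^ l)" for u l w
  have F0: "sq_int ?M (F 0)" by (rule Suc.prems) simp
  obtain \<psi> B where \<psi>: "\<And>n. \<psi> n \<in> test_functions" "H1_Cauchy s \<psi>"
    and lim0: "(\<lambda>n. sq_norm ?M (\<lambda>z. dz (\<psi> n) z - F 0 z)) \<longlonglongrightarrow> 0"
    and B: "sq_int ?M B" and limB: "(\<lambda>n. sq_norm ?M (\<lambda>z. dzb (\<psi> n) z - B z)) \<longlonglongrightarrow> 0"
    by (rule dz_solution_sequence[OF s F0 leading_component_moments[OF s(2) Suc.prems]], assumption, rule that)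
  have ds: "sq_int ?M (dz (\<psi> n))" "sq_int ?M (dzb (\<psi> n))" for n
    by (intro test_functions_sq_int test_functions_dz test_functions_dzb \<psi>)+
  have cp: "continuous_on UNIV (\<lambda>z. (z - cnj z * w) ^ l)" for w l by (intro continuous_intros)
  have rel: "w * I (F 0) l w + I B l w = 0" for l w
  proof -
    have "(\<lambda>n. w * I (dz (\<psi> n)) l w + I (dzb (\<psi> n)) l w) \<longlonglongrightarrow> w * I (F 0) l w + I B l w"
      unfolding I_def
      by (intro tendsto_add tendsto_mult tendsto_const
          unweighted_pairing_tendsto[OF s(2) ds(1) F0 cp lim0] unweighted_pairing_tendsto[OF s(2) ds(2) B cp limB])
    moreover have "w * I (dz (\<psi> n)) l w + I (dzb (\<psi> n)) l w = 0" for n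
      unfolding I_def by (rule transversal_derivative_integral[OF \<psi>(1)])
    ultimately show ?thesis by (simp add: LIMSEQ_const_iff)
  qed
  define F' where "F' j z = F (Suc j) z - (if j = 0 then B z else 0)" for j z
  have FS: "sq_int ?M (F (Suc j))" if "j \<le> m" for j using Suc.prems(1) that by simp
  have F's: "sq_int ?M (F' j)" if "j \<le> m" for j
    unfolding F'_def by (rule sq_int_diff(1)[OF FS[OF that]]) (use B in \<open>cases "j = 0"; simp\<close>)
  have I': "I (F' j) l w = I (F (Suc j)) l w - (if j = 0 then I B l w else 0)" if "j \<le> m" for j l w
  proof (cases "j = 0")
    case True
    have "(LINT z|lebesgue_on (cball 0 1). F (Suc 0) z * (z - cnj z * w) ^ l - B z * (z - cnj z * w) ^ l)
        = I (F (Suc 0)) l w - I B l w"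
      unfolding I_def
      by (rule Bochner_Integration.integral_diff) (intro unweighted_continuous_integrable[OF s(2) _ cp] B FS; simp)+
    then show ?thesis using True by (simp add: I_def F'_def left_diff_distrib)
  qed (simp add: I_def F'_def)
  have "transversal_moments_vanish m F'" unfolding transversal_moments_vanish_def
  proof (intro allI)
    fix l w
    have "(\<Sum>j\<le>m. w ^ (m - j) * I (F' j) l w)
        = (\<Sum>j\<le>m. w ^ (m - j) * I (F (Suc j)) l w - (if j = 0 then w ^ m * I B l w else 0))"
      by (intro sum.cong refl) (auto simp: I' right_diff_distrib)
    also have "\<dots> = (\<Sum>j\<le>m. w ^ (m - j) * I (F (Suc j)) l w) - w ^ m * I B l w"
      by (simp add: sum_subtractf)
    also have "(\<Sum>j\<le>m. w ^ (m - j) * I (F (Suc j)) l w) = (\<Sum>j\<le>Suc m. w ^ (Suc m - j) * I (F j) l w) - w ^ Suc m * I (F 0) l w"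
      unfolding sum.atMost_Suc_shift by simp
    also have "(\<Sum>j\<le>Suc m. w ^ (Suc m - j) * I (F j) l w) = 0"
      using Suc.prems(2) unfolding transversal_moments_vanish_def I_def by blast
    also have "0 - w ^ Suc m * I (F 0) l w - w ^ m * I B l w = - (w ^ m * (w * I (F 0) l w + I B l w))"
      by (simp add: algebra_simps)
    finally have "(\<Sum>j\<le>m. w ^ (m - j) * I (F' j) l w) = 0"
      unfolding rel by simp
    then show "(\<Sum>j\<le>m. w ^ (m - j) * (LINT z|lebesgue_on (cball 0 1). F' j z * (z - cnj z * w) ^ l)) = 0"
      by (simp only: I_def)
  qed
  from Suc.IH[OF F's this] obtain \<phi> where \<phi>: "\<And>j n. \<phi> j n \<in> test_functions" "\<And>j. j < m \<Longrightarrow> H1_Cauchy s (\<phi> j)"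
    "\<And>j. j \<le> m \<Longrightarrow> (\<lambda>n. sq_norm ?M (\<lambda>z. transport_coeff m (\<lambda>j. \<phi> j n) j z - F' j z)) \<longlonglongrightarrow> 0"
    by blast
  define \<xi> where "\<xi> j = (case j of 0 \<Rightarrow> \<psi> | Suc i \<Rightarrow> \<phi> i)" for j
  have "\<xi> j n \<in> test_functions" for j n using \<psi> \<phi> by (simp add: \<xi>_def split: nat.split)
  moreover have "H1_Cauchy s (\<xi> j)" if "j < Suc m" for j using \<psi> \<phi> that by (simp add: \<xi>_def split: nat.split)
  moreover have "(\<lambda>n. sq_norm ?M (\<lambda>z. transport_coeff (Suc m) (\<lambda>j. \<xi> j n) j z - F j z)) \<longlonglongrightarrow> 0" if j: "j \<le> Suc m" for j
  proof (cases j)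
    case 0
    then show ?thesis using lim0 by (simp add: transport_coeff_def \<xi>_def)
  next
    case (Suc i)
    then have i: "i \<le> m" using j by simp
    let ?e = "\<lambda>n z. if i = 0 then dzb (\<psi> n) z else 0" and ?B = "\<lambda>z. if i = 0 then B z else 0"
    have si: "sq_int ?M (transport_coeff m (\<lambda>j. \<phi> j n) i)" for n
    proof -
      have "sq_int ?M (\<lambda>z. if i < m then dz (\<phi> i n) z else 0)" "sq_int ?M (\<lambda>z. if 0 < i then dzb (\<phi> (i - 1) n) z else 0)"
        by (cases "i < m"; cases "0 < i"; simp add: test_functions_sq_int test_functions_dz test_functions_dzb \<phi>(1))+
      from sq_int_add(1)[OF this] show ?thesis by (simp add: transport_coeff_def[abs_def])
    qed
    have "(\<lambda>n. sq_norm ?M (\<lambda>z. (transport_coeff m (\<lambda>j. \<phi> j n) i z + ?e n z) - (F' i z + ?B z))) \<longlonglongrightarrow> 0"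
      by (rule sq_norm_tendsto_add[OF si F's[OF i] _ _ \<phi>(3)[OF i]])
         (use ds(2) B limB in \<open>cases "i = 0"; simp\<close>)+
    moreover have "transport_coeff m (\<lambda>j. \<phi> j n) i z + ?e n z = transport_coeff (Suc m) (\<lambda>j. \<xi> j n) j z" for n z
      using i Suc by (cases i) (auto simp: transport_coeff_def \<xi>_def)
    moreover have "F' i z + ?B z = F j z" for z by (simp add: F'_def Suc)
    ultimately show ?thesis by (simp only:)
  qed
  ultimately show ?case by blast
qed

section \<open>From vanishing chord integrals to vanishing moments\<close>

lemma AE_lborel_iff_negligible:
  "(AE x in lborel. P x) \<longleftrightarrow> negligible {x :: 'a :: euclidean_space. \<not> P x}"
proof -
  have "(AE x in lborel. P x) \<longleftrightarrow> (AE x in lebesgue. P x)" by (rule AE_completion_iff[symmetric])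
  also have "\<dots> \<longleftrightarrow> negligible {x. \<not> P x}"
    unfolding eventually_ae_filter_negligible using negligible_subset by blast
  finally show ?thesis .
qed

lemma lborel_swap: "distr lborel borel (\<lambda>p::real \<times> real. (snd p, fst p)) = lborel"
proof -
  have "(lborel \<Otimes>\<^sub>M lborel :: (real \<times> real) measure)
      = distr (lborel \<Otimes>\<^sub>M lborel) (lborel \<Otimes>\<^sub>M lborel) (\<lambda>(x, y). (y, x))"
    by (rule lborel_pair.distr_pair_swap)
  then have "(lborel :: (real \<times> real) measure) = distr lborel lborel (\<lambda>(x, y). (y, x))"
    by (simp only: lborel_prod)
  also have "\<dots> = distr lborel borel (\<lambda>p. (snd p, fst p))"
    by (rule distr_cong) (auto simp: case_prod_beta)
  finally show ?thesis by simp
qed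

text \<open>The first coordinate is the distance to the diameter of direction \<open>v\<close>, the second one the
  position along the chord.\<close>

lemma lborel_chord_coordinates:
  assumes v: "cmod v = 1" "Im v \<noteq> 0"
  shows "distr lborel borel (\<lambda>p. v * Complex (snd p) (fst p)) = (lborel :: complex measure)"
    and "(\<lambda>p. v * Complex (snd p) (fst p)) \<in> borel_measurable borel"
proof -
  have m1 [measurable]: "(\<lambda>p::real \<times> real. Complex (fst p) (snd p)) \<in> borel_measurable borel"
    unfolding complex_eq by (intro borel_measurable_continuous_onI continuous_intros)
  have m2 [measurable]: "(\<lambda>p::real \<times> real. (snd p, fst p)) \<in> borel_measurable borel"
    by (intro borel_measurable_continuous_onI continuous_intros)
  have m3 [measurable]: "(*) v \<in> borel_measurable borel"
    by (intro borel_measurable_continuous_onI continuous_intros)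
  have "(lborel :: complex measure) = distr (distr (distr lborel borel (\<lambda>p::real \<times> real. (snd p, fst p))) borel
      (\<lambda>p. Complex (fst p) (snd p))) borel ((*) v)"
    by (simp only: lborel_swap lborel_Complex lborel_rotation[OF v])
  also have "\<dots> = distr lborel borel ((*) v \<circ> ((\<lambda>p. Complex (fst p) (snd p)) \<circ> (\<lambda>p. (snd p, fst p))))"
    by (simp add: distr_distr comp_assoc)
  finally show "distr lborel borel (\<lambda>p. v * Complex (snd p) (fst p)) = (lborel :: complex measure)"
    by (simp add: comp_def)
  show "(\<lambda>p. v * Complex (snd p) (fst p)) \<in> borel_measurable borel"
    unfolding complex_eq by (intro borel_measurable_continuous_onI continuous_intros)
qed

text \<open>In the coordinates given by the direction \<open>\<tau>\<close> of a chord and its angle \<open>\<alpha>\<close> with the normal,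
  the base point is \<open>\<tau> + \<pi> - \<alpha>\<close>; this is a shear. For directions in an interval of length \<open>\<pi> / 2\<close>
  the base point stays in one fundamental domain, so that no periodicity is needed.\<close>

lemma influx_AE_chords:
  assumes "AE (\<beta>, \<alpha>) in influx_measure g. P \<beta> \<alpha>"
  shows "AE \<tau> in lborel. - pi / 2 < \<tau> \<longrightarrow> \<tau> < 0 \<longrightarrow>
    (AE \<alpha> in lborel. \<bar>\<alpha>\<bar> < pi / 2 \<longrightarrow> P (\<tau> + pi - \<alpha>) \<alpha>)"
proof -
  let ?S = "{0..2 * pi} \<times> {- (pi / 2)..pi / 2}"
  have S: "?S \<in> sets borel" by (intro borel_closed closed_Times) simp_all
  have wm: "(\<lambda>(\<beta>::real, \<alpha>). ennreal (cos \<alpha> powr (- 2 * g))) \<in> borel_measurable (lebesgue_on ?S)"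
  proof (rule measurable_restrict_space1, rule measurable_completion)
    have [measurable]: "(\<lambda>p::real \<times> real. cos (snd p)) \<in> borel_measurable borel"
      by (intro borel_measurable_continuous_onI continuous_intros)
    show "(\<lambda>(\<beta>::real, \<alpha>). ennreal (cos \<alpha> powr (- 2 * g))) \<in> borel_measurable lborel"
      unfolding case_prod_beta by measurable
  qed
  have "AE p in lebesgue_on ?S. 0 < (case p of (\<beta>, \<alpha>) \<Rightarrow> ennreal (cos \<alpha> powr (- 2 * g))) \<longrightarrow> (case p of (\<beta>, \<alpha>) \<Rightarrow> P \<beta> \<alpha>)"
    using assms unfolding influx_measure_def AE_density[OF wm] .
  then have "AE p in lebesgue. p \<in> ?S \<longrightarrow> 0 < (case p of (\<beta>, \<alpha>) \<Rightarrow> ennreal (cos \<alpha> powr (- 2 * g))) \<longrightarrow> (case p of (\<beta>, \<alpha>) \<Rightarrow> P \<beta> \<alpha>)"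
    by (subst (asm) AE_restrict_space_iff) (use S in \<open>auto\<close>)
  then have "AE p in lborel. p \<in> ?S \<longrightarrow> 0 < (case p of (\<beta>, \<alpha>) \<Rightarrow> ennreal (cos \<alpha> powr (- 2 * g))) \<longrightarrow> (case p of (\<beta>, \<alpha>) \<Rightarrow> P \<beta> \<alpha>)"
    by (simp only: AE_completion_iff)
  then have A: "AE p in lborel. fst p \<in> {0..2 * pi} \<and> \<bar>snd p\<bar> < pi / 2 \<longrightarrow> P (fst p) (snd p)"
  proof (rule eventually_mono)
    fix p :: "real \<times> real"
    assume h: "p \<in> ?S \<longrightarrow> 0 < (case p of (\<beta>, \<alpha>) \<Rightarrow> ennreal (cos \<alpha> powr (- 2 * g))) \<longrightarrow> (case p of (\<beta>, \<alpha>) \<Rightarrow> P \<beta> \<alpha>)"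
    show "fst p \<in> {0..2 * pi} \<and> \<bar>snd p\<bar> < pi / 2 \<longrightarrow> P (fst p) (snd p)"
    proof
      assume a: "fst p \<in> {0..2 * pi} \<and> \<bar>snd p\<bar> < pi / 2"
      have "0 < cos (snd p)" by (rule cos_gt_zero_pi) (use a in linarith)+
      moreover have "p \<in> ?S" using a by (auto simp: mem_Times_iff)
      ultimately show "P (fst p) (snd p)" using h by (simp add: case_prod_beta)
    qed
  qed
  have "AE p in distr lborel borel ((+) (pi, 0::real)). fst p \<in> {0..2 * pi} \<and> \<bar>snd p\<bar> < pi / 2 \<longrightarrow> P (fst p) (snd p)"
    using A by (simp only: lborel_distr_plus)
  then have B: "AE p in lborel. fst ((pi, 0) + p) \<in> {0..2 * pi} \<and> \<bar>snd ((pi, 0) + p)\<bar> < pi / 2 \<longrightarrow>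
      P (fst ((pi, 0) + p)) (snd ((pi, 0) + p))"
    by (rule AE_distrD[rotated]) simp
  have "AE p in distr lborel borel (\<lambda>p::real \<times> real. (fst p + (-1) * snd p, snd p)).
      fst ((pi, 0) + p) \<in> {0..2 * pi} \<and> \<bar>snd ((pi, 0) + p)\<bar> < pi / 2 \<longrightarrow>
      P (fst ((pi, 0) + p)) (snd ((pi, 0) + p))"
    using B by (simp only: lborel_shear_fst)
  then have "AE p in lborel. fst ((pi, 0) + (fst p + (-1) * snd p, snd p)) \<in> {0..2 * pi} \<and>
      \<bar>snd ((pi, 0) + (fst p + (-1) * snd p, snd p))\<bar> < pi / 2 \<longrightarrow>
      P (fst ((pi, 0) + (fst p + (-1) * snd p, snd p))) (snd ((pi, 0) + (fst p + (-1) * snd p, snd p)))"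
    by (rule AE_distrD[rotated]) (auto intro!: borel_measurable_continuous_onI continuous_intros)
  then have "AE p in lborel \<Otimes>\<^sub>M lborel. pi + (fst p - snd p) \<in> {0..2 * pi} \<and> \<bar>snd p\<bar> < pi / 2 \<longrightarrow>
      P (pi + (fst p - snd p)) (snd p)"
    by (simp only: lborel_prod fst_conv snd_conv plus_prod_def add_0 mult_minus1 uminus_add_conv_diff add_uminus_conv_diff)
  from lborel_pair.AE_pair[OF this]
  have "AE \<tau> in lborel. AE \<alpha> in lborel. pi + (\<tau> - \<alpha>) \<in> {0..2 * pi} \<and> \<bar>\<alpha>\<bar> < pi / 2 \<longrightarrow> P (pi + (\<tau> - \<alpha>)) \<alpha>"
    by simp
  then show ?thesis
  proof (rule eventually_mono, intro impI)
    fix \<tau> :: real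
    assume h: "AE \<alpha> in lborel. pi + (\<tau> - \<alpha>) \<in> {0..2 * pi} \<and> \<bar>\<alpha>\<bar> < pi / 2 \<longrightarrow> P (pi + (\<tau> - \<alpha>)) \<alpha>"
      and t: "- pi / 2 < \<tau>" "\<tau> < 0"
    from h show "AE \<alpha> in lborel. \<bar>\<alpha>\<bar> < pi / 2 \<longrightarrow> P (\<tau> + pi - \<alpha>) \<alpha>"
    proof (rule eventually_mono, intro impI)
      fix \<alpha> :: real
      assume h: "pi + (\<tau> - \<alpha>) \<in> {0..2 * pi} \<and> \<bar>\<alpha>\<bar> < pi / 2 \<longrightarrow> P (pi + (\<tau> - \<alpha>)) \<alpha>" and a: "\<bar>\<alpha>\<bar> < pi / 2"
      have I: "pi + (\<tau> - \<alpha>) \<in> {0..2 * pi}" unfolding atLeastAtMost_iff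
        using t a by (intro conjI) linarith+
      have "\<tau> + pi - \<alpha> = pi + (\<tau> - \<alpha>)" by simp
      moreover from I h a have "P (pi + (\<tau> - \<alpha>)) \<alpha>" by blast
      ultimately show "P (\<tau> + pi - \<alpha>) \<alpha>" by (simp only:)
    qed
  qed
qed

lemma xray_direction_form:
  "xray g m f (\<tau> + pi - \<alpha>) \<alpha> = (LINT t|lebesgue_on {0..2 * cos \<alpha>}.
     f (cis \<tau> * Complex (t - cos \<alpha>) (sin \<alpha>)) (replicate m (cis \<tau>)) *
     of_real (bdf (cis \<tau> * Complex (t - cos \<alpha>) (sin \<alpha>)) powr g))"
proof -
  have e: "\<tau> + pi - \<alpha> + pi + \<alpha> = \<tau> + 2 * pi" by simp
  have v: "cis (\<tau> + pi - \<alpha> + pi + \<alpha>) = cis \<tau>"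
    unfolding e by (simp add: complex_eq_iff)
  have "\<tau> + pi - \<alpha> = \<tau> + (pi + - \<alpha>)" by simp
  then have "cis (\<tau> + pi - \<alpha>) = cis \<tau> * (cis pi * cis (- \<alpha>))" by (simp only: cis_mult)
  moreover have "cis \<tau> * Complex (t - cos \<alpha>) (sin \<alpha>) = cis \<tau> * (cis pi * cis (- \<alpha>)) + of_real t * cis \<tau>" for t
    by (simp add: complex_eq_iff algebra_simps)
  ultimately have z: "cis (\<tau> + pi - \<alpha>) + of_real t * cis \<tau> = cis \<tau> * Complex (t - cos \<alpha>) (sin \<alpha>)" for t
    by simp
  show ?thesis unfolding xray_def Let_def v z ..
qed

lemma chord_point_in_disk:
  assumes "cmod v = 1" "\<bar>\<alpha>\<bar> < pi / 2"
  shows "v * Complex (t - cos \<alpha>) (sin \<alpha>) \<in> cball 0 1 \<longleftrightarrow> t \<in> {0..2 * cos \<alpha>}"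
proof -
  have c: "0 < cos \<alpha>" by (rule cos_gt_zero_pi) (use assms in linarith)+
  have "v * Complex (t - cos \<alpha>) (sin \<alpha>) \<in> cball 0 1 \<longleftrightarrow> (cmod (Complex (t - cos \<alpha>) (sin \<alpha>)))\<^sup>2 \<le> 1"
    using assms(1) by (simp add: norm_mult abs_square_le_1)
  also have "\<dots> \<longleftrightarrow> (t - cos \<alpha>)\<^sup>2 \<le> (cos \<alpha>)\<^sup>2"
    unfolding cmod_power2 complex.sel sin_squared_eq by linarith
  also have "\<dots> \<longleftrightarrow> \<bar>t - cos \<alpha>\<bar> \<le> cos \<alpha>" using c abs_le_square_iff[of "t - cos \<alpha>" "cos \<alpha>"] by simp
  also have "\<dots> \<longleftrightarrow> t \<in> {0..2 * cos \<alpha>}" by auto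
  finally show ?thesis .
qed

text \<open>The integral of \<open>G\<close> against a power of the distance to the central chord of direction \<open>v\<close>
  is, by Fubini's theorem, an average of the integrals over the chords parallel to \<open>v\<close>. Fubini's
  theorem is applied to a Borel representative of \<open>G\<close>; it has the same integral over almost every
  chord.\<close>

lemma vanishing_chords_imp_vanishing_moments:
  fixes G :: "complex \<Rightarrow> complex"
  assumes v: "cmod v = 1" "Im v \<noteq> 0"
    and int: "integrable (lebesgue_on (cball 0 1)) (\<lambda>z. G z * of_real (Im (z * cnj v)) ^ l)"
    and G: "G \<in> borel_measurable (lebesgue_on (cball 0 1))"
    and chords: "AE \<alpha> in lborel. \<bar>\<alpha>\<bar> < pi / 2 \<longrightarrow>
      (LINT t|lebesgue_on {0..2 * cos \<alpha>}. G (v * Complex (t - cos \<alpha>) (sin \<alpha>))) = 0"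
  shows "(LINT z|lebesgue_on (cball 0 1). G z * of_real (Im (z * cnj v)) ^ l) = 0"
proof -
  have "cball (0::complex) 1 \<in> sets lebesgue" by simp
  then obtain B g N where B [measurable]: "B \<in> borel_measurable borel"
    and N: "negligible N" and g: "\<And>n::nat. continuous_on UNIV (g n)"
    and BG: "\<And>z. z \<notin> N \<Longrightarrow> B z = (if z \<in> cball 0 1 then G z else 0)"
    and gB: "\<And>z. z \<notin> N \<Longrightarrow> (\<lambda>n. g n z) \<longlonglongrightarrow> B z"
    by (rule borel_representative[OF G]) (rule that)
  define H where "H z = indicator (cball 0 1) z * B z" for z
  have H [measurable]: "H \<in> borel_measurable borel" unfolding H_def[abs_def]
    by (intro borel_measurable_times borel_measurable_indicator B) simp
  have HG: "H z = (if z \<in> cball 0 1 then G z else 0)" if "z \<notin> N" for z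
    using BG[OF that] by (simp add: H_def)
  have H0: "H z = 0" if "z \<notin> cball 0 1" for z using that by (simp add: H_def)
  define p where "p z = complex_of_real (Im (z * cnj v)) ^ l" for z
  have p [measurable]: "p \<in> borel_measurable borel" unfolding p_def[abs_def]
    by (intro borel_measurable_continuous_onI continuous_intros)
  let ?T = "\<lambda>q. v * Complex (snd q) (fst q)"
  have T [measurable]: "?T \<in> borel_measurable borel" by (rule lborel_chord_coordinates(2)[OF v])
  have Tm: "?T \<in> borel_measurable lborel" by simp
  have pT: "p (?T q) = of_real (fst q) ^ l" for q
  proof -
    have "v * cnj v = 1" using v(1) complex_norm_square[of v] by simp
    then have "?T q * cnj v = Complex (snd q) (fst q)" by (simp add: mult_ac flip: mult.assoc)
    then show ?thesis by (simp only: p_def complex.sel)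
  qed
  have NAE: "AE z in lborel. z \<notin> N" using N by (simp add: AE_lborel_iff_negligible)
  have NAEl: "AE z in lebesgue. z \<notin> N" using NAE by (simp only: AE_completion_iff)
  have eqAE: "AE z in lebesgue. indicator (cball 0 1) z *\<^sub>R (G z * p z) = H z * p z"
    using NAEl by (rule eventually_mono) (simp add: HG)
  have Hpm: "(\<lambda>z. H z * p z) \<in> borel_measurable lborel" by simp
  have intR: "integrable lebesgue (\<lambda>z. indicator (cball 0 1) z *\<^sub>R (G z * p z))"
    using int unfolding p_def by (subst (asm) integrable_restrict_space) simp_all
  have intH: "integrable lborel (\<lambda>z. H z * p z)"
  proof -
    have "integrable lebesgue (\<lambda>z. H z * p z)"
      by (rule integrable_cong_AE_imp[OF intR]) (use eqAE in \<open>auto simp: measurable_completion intro: eventually_mono\<close>)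
    then show ?thesis by (subst (asm) integrable_completion) simp_all
  qed
  have "(LINT z|lebesgue_on (cball 0 1). G z * p z) = (LINT z|lebesgue. indicator (cball 0 1) z *\<^sub>R (G z * p z))"
    by (rule integral_restrict_space) simp
  also have "\<dots> = (LINT z|lebesgue. H z * p z)"
    by (rule integral_cong_AE[OF borel_measurable_integrable[OF intR] _ eqAE]) (simp add: measurable_completion)
  also have "\<dots> = (LINT z|lborel. H z * p z)" by (rule integral_completion[OF Hpm])
  also have "\<dots> = (LINT z|distr lborel borel ?T. H z * p z)" by (simp only: lborel_chord_coordinates(1)[OF v])
  also have "\<dots> = (LINT q|lborel. H (?T q) * p (?T q))"
    by (rule integral_distr[OF Tm]) simp
  finally have I1: "(LINT z|lebesgue_on (cball 0 1). G z * p z) = (LINT q|(lborel \<Otimes>\<^sub>M lborel). H (?T q) * of_real (fst q) ^ l)"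
    by (simp only: pT lborel_prod)
  have "integrable (distr lborel borel ?T) (\<lambda>z. H z * p z)"
    using intH by (simp only: lborel_chord_coordinates(1)[OF v])
  then have "integrable lborel (\<lambda>q. H (?T q) * p (?T q))"
    by (subst (asm) integrable_distr_eq[OF Tm]) simp_all
  then have "integrable (lborel \<Otimes>\<^sub>M lborel) (\<lambda>q. H (?T q) * of_real (fst q) ^ l)"
    by (simp only: pT lborel_prod)
  from lborel_pair.integral_fst'[OF this]
  have I2: "(LINT q|(lborel \<Otimes>\<^sub>M lborel). H (?T q) * of_real (fst q) ^ l)
      = (LINT y|lborel. (LINT x|lborel. H (v * Complex x y) * of_real y ^ l))"
    by simp
  define k where "k y = (LINT x|lborel. H (v * Complex x y))" for y
  have "AE z in distr lborel borel ?T. z \<notin> N"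
    using NAE by (simp only: lborel_chord_coordinates(1)[OF v])
  then have "AE q in lborel \<Otimes>\<^sub>M lborel. ?T q \<notin> N" unfolding lborel_prod
    by (rule AE_distrD[OF Tm])
  from lborel_pair.AE_pair[OF this] have NAE2: "AE y in lborel. AE x in lborel. v * Complex x y \<notin> N"
    by simp
  have chord: "k (sin \<alpha>) = (LINT t|lebesgue_on {0..2 * cos \<alpha>}. G (v * Complex (t - cos \<alpha>) (sin \<alpha>)))"
    if a: "\<bar>\<alpha>\<bar> < pi / 2" and n: "AE x in lborel. v * Complex x (sin \<alpha>) \<notin> N" for \<alpha>
  proof -
    have "AE x in distr lborel borel ((+) (- cos \<alpha>)). v * Complex x (sin \<alpha>) \<notin> N"
      using n by (simp only: lborel_distr_plus)
    then have "AE x in lborel. v * Complex (- cos \<alpha> + x) (sin \<alpha>) \<notin> N"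
      by (rule AE_distrD[rotated]) simp
    then have "AE t in lebesgue. v * Complex (- cos \<alpha> + t) (sin \<alpha>) \<notin> N" by (simp only: AE_completion_iff)
    then have e: "AE t in lebesgue. H (v * Complex (- cos \<alpha> + t) (sin \<alpha>))
        = indicator {0..2 * cos \<alpha>} t *\<^sub>R G (v * Complex (t - cos \<alpha>) (sin \<alpha>))"
    proof (rule eventually_mono)
      fix t assume "v * Complex (- cos \<alpha> + t) (sin \<alpha>) \<notin> N"
      then have n: "v * Complex (t - cos \<alpha>) (sin \<alpha>) \<notin> N" by simp
      show "H (v * Complex (- cos \<alpha> + t) (sin \<alpha>))
        = indicator {0..2 * cos \<alpha>} t *\<^sub>R G (v * Complex (t - cos \<alpha>) (sin \<alpha>))"
        using HG[OF n] chord_point_in_disk[OF v(1) a, of t] by (simp add: indicator_def)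
    qed
    have cm: "(\<lambda>t. v * Complex (- cos \<alpha> + t) (sin \<alpha>)) \<in> borel_measurable borel"
      unfolding complex_eq by (intro borel_measurable_continuous_onI continuous_intros)
    have m: "(\<lambda>t. H (v * Complex (- cos \<alpha> + t) (sin \<alpha>))) \<in> borel_measurable lborel"
      using measurable_compose[OF cm H] by simp
    have m1: "(\<lambda>t. H (v * Complex (- cos \<alpha> + t) (sin \<alpha>))) \<in> borel_measurable lebesgue"
      using m by (rule measurable_completion)
    have "k (sin \<alpha>) = (LINT t|lborel. H (v * Complex (- cos \<alpha> + t) (sin \<alpha>)))"
      unfolding k_def using lborel_integral_real_affine[where c = 1 and t = "- cos \<alpha>" and f = "\<lambda>x. H (v * Complex x (sin \<alpha>))"]
      by simp
    also have "\<dots> = (LINT t|lebesgue. H (v * Complex (- cos \<alpha> + t) (sin \<alpha>)))"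
      by (rule integral_completion[OF m, symmetric])
    also have "\<dots> = (LINT t|lebesgue. indicator {0..2 * cos \<alpha>} t *\<^sub>R G (v * Complex (t - cos \<alpha>) (sin \<alpha>)))"
      by (rule integral_cong_AE[OF m1 borel_measurable_AE[OF m1 e] e])
    also have "\<dots> = (LINT t|lebesgue_on {0..2 * cos \<alpha>}. G (v * Complex (t - cos \<alpha>) (sin \<alpha>)))"
      by (rule integral_restrict_space[symmetric]) simp
    finally show ?thesis .
  qed
  define E where "E = {\<alpha>. \<not> (\<bar>\<alpha>\<bar> < pi / 2 \<longrightarrow>
      (LINT t|lebesgue_on {0..2 * cos \<alpha>}. G (v * Complex (t - cos \<alpha>) (sin \<alpha>))) = 0)}"
  have "negligible E" unfolding E_def using chords by (simp only: AE_lborel_iff_negligible)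
  then have "negligible (sin ` E)"
    by (rule negligible_differentiable_image_negligible[OF order_refl])
      (simp add: differentiable_on_def field_differentiable_imp_differentiable field_differentiable_within_sin)
  then have E: "AE y in lborel. y \<notin> sin ` E" by (simp add: AE_lborel_iff_negligible image_def)
  have "negligible {1, -1 :: real}" by (intro negligible_finite) simp
  then have "AE y in lborel. y \<notin> {1, -1 :: real}" by (simp add: AE_lborel_iff_negligible)
  with E NAE2 have k0: "AE y in lborel. k y * of_real y ^ l = 0"
  proof eventually_elim
    fix y :: real assume y: "y \<notin> sin ` E" and n: "AE x in lborel. v * Complex x y \<notin> N" and y1: "y \<notin> {1, -1}"
    show "k y * of_real y ^ l = 0"
    proof (cases "\<bar>y\<bar> < 1")
      case True
      define \<alpha> where "\<alpha> = arcsin y"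
      have s: "sin \<alpha> = y" unfolding \<alpha>_def by (rule sin_arcsin) (use True in linarith)+
      have a: "\<bar>\<alpha>\<bar> < pi / 2" unfolding \<alpha>_def using arcsin_lt_bounded[of y] True by linarith
      have "\<alpha> \<notin> E" using y s by blast
      then have "(LINT t|lebesgue_on {0..2 * cos \<alpha>}. G (v * Complex (t - cos \<alpha>) (sin \<alpha>))) = 0"
        using a unfolding E_def by blast
      then have "k (sin \<alpha>) = 0" using chord[OF a] n unfolding s by simp
      then show ?thesis by (simp add: s)
    next
      case False
      then have "1 < \<bar>y\<bar>" using y1 by auto
      then have "v * Complex x y \<notin> cball 0 1" for x
        using abs_Im_le_cmod[of "Complex x y"] v(1) by (simp add: norm_mult)
      then have "H (v * Complex x y) = 0" for x by (intro H0)
      then have "k y = 0" by (simp add: k_def)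
      then show ?thesis by simp
    qed
  qed
  have "(LINT y|lborel. (LINT x|lborel. H (v * Complex x y) * of_real y ^ l)) = (LINT y|lborel. k y * of_real y ^ l)"
    by (simp add: k_def)
  also have "\<dots> = 0" by (rule integral_eq_zero_AE[OF k0])
  finally show ?thesis using I1 I2 unfolding p_def by simp
qed

lemma infinite_squared_directions:
  assumes "AE \<tau> in lborel. - pi / 2 < \<tau> \<longrightarrow> \<tau> < 0 \<longrightarrow> P \<tau>"
  shows "infinite ((\<lambda>\<tau>. cis \<tau> ^ 2) ` {\<tau>. - pi / 2 < \<tau> \<and> \<tau> < 0 \<and> P \<tau>})" (is "infinite (?h ` ?S)")
proof
  assume f: "finite (?h ` ?S)"
  have "inj_on ?h ?S"
  proof (rule inj_on_inverseI[where g = "\<lambda>w. Arg w / 2"])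
    fix \<tau> assume "\<tau> \<in> ?S"
    then have "2 * \<tau> \<in> {- pi<..pi}" using pi_gt_zero by auto
    then have "Arg (cis (2 * \<tau>)) = 2 * \<tau>" by (rule Arg_cis)
    then show "Arg (cis \<tau> ^ 2) / 2 = \<tau>" by (simp add: Complex.DeMoivre)
  qed
  then have fS: "finite ?S" by (rule finite_imageD[OF f])
  have neg: "negligible {\<tau>. \<not> (- pi / 2 < \<tau> \<longrightarrow> \<tau> < 0 \<longrightarrow> P \<tau>)}"
    using assms by (simp only: AE_lborel_iff_negligible)
  have "negligible ({\<tau>. \<not> (- pi / 2 < \<tau> \<longrightarrow> \<tau> < 0 \<longrightarrow> P \<tau>)} \<union> ?S)"
    by (rule negligible_Un[OF neg negligible_finite[OF fS]])
  then have "negligible {- pi / 2<..<0}" by (rule negligible_subset) auto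
  moreover have "- pi / 4 \<in> {- pi / 2<..<0}" using pi_gt_zero by simp
  ultimately show False using open_not_negligible[OF open_greaterThanLessThan, of "- pi / 2" 0] by blast
qed

text \<open>For a unit vector \<open>v\<close> and \<open>w = v\<^sup>2\<close>, the expression \<open>z - cnj z * w\<close> is \<open>2 \<i> v\<close> times the
  signed distance of \<open>z\<close> to the diameter of direction \<open>v\<close>. So the vanishing of the integrals over
  almost all chords of direction \<open>v\<close> gives the moment conditions for this \<open>w\<close>. They are polynomial
  in \<open>w\<close> and hold for infinitely many \<open>w\<close>.\<close>

lemma xray_zero_imp_transversal_moments_vanish:
  fixes F :: "nat \<Rightarrow> complex \<Rightarrow> complex"
  assumes s: "s < 1" and F: "\<And>j. j \<le> m \<Longrightarrow> sq_int (disk_measure s) (F j)"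
    and diag: "\<And>z v. z \<in> cball 0 1 \<Longrightarrow> cmod v = 1 \<Longrightarrow>
      f z (replicate m v) * of_real (bdf z powr g) = (\<Sum>j\<le>m. v ^ (m - j) * cnj v ^ j * F j z)"
    and zero: "AE (\<beta>, \<alpha>) in influx_measure g. xray g m f \<beta> \<alpha> = 0"
  shows "transversal_moments_vanish m F"
  unfolding transversal_moments_vanish_def
proof (intro allI)
  fix l :: nat and w :: complex
  let ?D = "lebesgue_on (cball (0::complex) 1)"
  define S where "S w = (\<Sum>j\<le>m. w ^ (m - j) * (LINT z|?D. F j z * (z - cnj z * w) ^ l))" for w
  define c where "c j k = of_nat (l choose k) * (- 1) ^ k * (LINT z|?D. F j z * (z ^ (l - k) * cnj z ^ k))" for j k
  define p where "p = (\<Sum>j\<le>m. monom 1 (m - j) * (\<Sum>k\<le>l. monom (c j k) k))"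
  have p: "poly p w = S w" for w
    unfolding S_def p_def poly_sum poly_mult poly_monom c_def mult_1_left
    by (intro sum.cong refl arg_cong2[where f = "(*)"] binomial_moment_expansion[OF s F, symmetric]) simp
  define good where "good \<tau> \<longleftrightarrow> (AE \<alpha> in lborel. \<bar>\<alpha>\<bar> < pi / 2 \<longrightarrow> xray g m f (\<tau> + pi - \<alpha>) \<alpha> = 0)" for \<tau>
  have vanish: "S (cis \<tau> ^ 2) = 0" if t: "- pi / 2 < \<tau>" "\<tau> < 0" and "good \<tau>" for \<tau>
  proof -
    define v where "v = cis \<tau>"
    have v: "cmod v = 1" "Im v \<noteq> 0" using t sin_gt_zero[of "- \<tau>"] pi_gt_zero by (auto simp: v_def)
    have vv: "v * cnj v = 1" using v(1) complex_norm_square[of v] by simp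
    define G where "G z = (\<Sum>j\<le>m. v ^ (m - j) * cnj v ^ j * F j z)" for z
    have Fm: "F j \<in> borel_measurable ?D" if "j \<le> m" for j
      using sq_int_measurable[OF F[OF that]] by (simp only: measurable_disk_iff)
    have G: "G \<in> borel_measurable ?D" unfolding G_def[abs_def]
      by (intro borel_measurable_sum borel_measurable_times borel_measurable_const Fm) simp
    have cp: "continuous_on UNIV (\<lambda>z. complex_of_real (Im (z * cnj v)) ^ l)" by (intro continuous_intros)
    have Fi: "integrable ?D (\<lambda>z. F j z * of_real (Im (z * cnj v)) ^ l)" if "j \<le> m" for j
      by (rule unweighted_continuous_integrable[OF s F[OF that] cp])
    have Gexp: "G z * of_real (Im (z * cnj v)) ^ l
        = (\<Sum>j\<le>m. v ^ (m - j) * cnj v ^ j * (F j z * of_real (Im (z * cnj v)) ^ l))" for z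
      unfolding G_def sum_distrib_right by (simp only: mult.assoc)
    have Gi: "integrable ?D (\<lambda>z. G z * of_real (Im (z * cnj v)) ^ l)"
      unfolding Gexp by (intro Bochner_Integration.integrable_sum integrable_mult_right Fi) simp
    have chords: "AE \<alpha> in lborel. \<bar>\<alpha>\<bar> < pi / 2 \<longrightarrow>
        (LINT t|lebesgue_on {0..2 * cos \<alpha>}. G (v * Complex (t - cos \<alpha>) (sin \<alpha>))) = 0"
      using \<open>good \<tau>\<close> unfolding good_def
    proof (rule eventually_mono, intro impI)
      fix \<alpha> :: real assume "\<bar>\<alpha>\<bar> < pi / 2 \<longrightarrow> xray g m f (\<tau> + pi - \<alpha>) \<alpha> = 0" and a: "\<bar>\<alpha>\<bar> < pi / 2"
      then have "xray g m f (\<tau> + pi - \<alpha>) \<alpha> = 0" by blast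
      moreover have "xray g m f (\<tau> + pi - \<alpha>) \<alpha>
          = (LINT t|lebesgue_on {0..2 * cos \<alpha>}. G (v * Complex (t - cos \<alpha>) (sin \<alpha>)))"
        unfolding xray_direction_form v_def[symmetric]
      proof (rule Bochner_Integration.integral_cong[OF refl])
        fix t assume "t \<in> space (lebesgue_on {0..2 * cos \<alpha>})"
        then have "t \<in> {0..2 * cos \<alpha>}" by simp
        then have "v * Complex (t - cos \<alpha>) (sin \<alpha>) \<in> cball 0 1"
          using chord_point_in_disk[OF v(1) a, of t] by blast
        then show "f (v * Complex (t - cos \<alpha>) (sin \<alpha>)) (replicate m v) *
            of_real (bdf (v * Complex (t - cos \<alpha>) (sin \<alpha>)) powr g) = G (v * Complex (t - cos \<alpha>) (sin \<alpha>))"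
          unfolding G_def by (rule diag[OF _ v(1)])
      qed
      ultimately show "(LINT t|lebesgue_on {0..2 * cos \<alpha>}. G (v * Complex (t - cos \<alpha>) (sin \<alpha>))) = 0" by simp
    qed
    have zero: "(LINT z|?D. G z * of_real (Im (z * cnj v)) ^ l) = 0"
      by (rule vanishing_chords_imp_vanishing_moments[OF v Gi G chords])
    have dist: "z - cnj z * v ^ 2 = 2 * \<i> * v * of_real (Im (z * cnj v))" for z
    proof -
      have "2 * \<i> * of_real (Im (z * cnj v)) = z * cnj v - cnj (z * cnj v)"
        by (simp add: complex_eq_iff)
      moreover have "2 * \<i> * v * of_real (Im (z * cnj v)) = v * (2 * \<i> * of_real (Im (z * cnj v)))"
        by (simp only: mult_ac)
      ultimately have "2 * \<i> * v * of_real (Im (z * cnj v)) = v * (z * cnj v - cnj (z * cnj v))"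
        by (rule back_subst[of "\<lambda>x. 2 * \<i> * v * of_real (Im (z * cnj v)) = v * x", rotated])
      also have "\<dots> = (v * cnj v) * z - cnj z * v ^ 2" by (simp add: algebra_simps power2_eq_square)
      finally show ?thesis by (simp only: vv mult_1_left)
    qed
    have pw: "(v ^ 2) ^ (m - j) = v ^ m * (v ^ (m - j) * cnj v ^ j)" if "j \<le> m" for j
    proof -
      have vm: "v ^ m = v ^ (m - j) * v ^ j" using that by (simp flip: power_add)
      have "v ^ m * (v ^ (m - j) * cnj v ^ j) = v ^ (m - j) * v ^ (m - j) * (v * cnj v) ^ j"
        unfolding vm power_mult_distrib by (simp only: mult_ac)
      then show ?thesis unfolding vv power_one mult_1_right power2_eq_square power_mult_distrib by (rule sym)
    qed
    have "S (v ^ 2) = (\<Sum>j\<le>m. v ^ m * (2 * \<i> * v) ^ l *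
        (LINT z|?D. v ^ (m - j) * cnj v ^ j * (F j z * of_real (Im (z * cnj v)) ^ l)))"
      unfolding S_def
    proof (rule sum.cong[OF refl])
      fix j assume j: "j \<in> {..m}"
      have "(LINT z|?D. F j z * (z - cnj z * v ^ 2) ^ l)
          = (LINT z|?D. (2 * \<i> * v) ^ l * (F j z * of_real (Im (z * cnj v)) ^ l))"
        unfolding dist power_mult_distrib by (simp only: mult_ac)
      also have "\<dots> = (2 * \<i> * v) ^ l * (LINT z|?D. F j z * of_real (Im (z * cnj v)) ^ l)"
        by (rule integral_mult_right_zero)
      finally have a: "(LINT z|?D. F j z * (z - cnj z * v ^ 2) ^ l)
          = (2 * \<i> * v) ^ l * (LINT z|?D. F j z * of_real (Im (z * cnj v)) ^ l)" .
      have b: "(LINT z|?D. v ^ (m - j) * cnj v ^ j * (F j z * of_real (Im (z * cnj v)) ^ l))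
          = v ^ (m - j) * cnj v ^ j * (LINT z|?D. F j z * of_real (Im (z * cnj v)) ^ l)"
        by (rule integral_mult_right_zero)
      have "j \<le> m" using j by simp
      from pw[OF this] show "(v ^ 2) ^ (m - j) * (LINT z|?D. F j z * (z - cnj z * v ^ 2) ^ l) = v ^ m * (2 * \<i> * v) ^ l *
          (LINT z|?D. v ^ (m - j) * cnj v ^ j * (F j z * of_real (Im (z * cnj v)) ^ l))"
        unfolding a b by (simp only: mult_ac)
    qed
    also have "\<dots> = v ^ m * (2 * \<i> * v) ^ l * (LINT z|?D. G z * of_real (Im (z * cnj v)) ^ l)"
      unfolding Gexp sum_distrib_left[symmetric]
      by (subst Bochner_Integration.integral_sum) (auto intro!: integrable_mult_right Fi simp del: complex_cnj_mult times_complex.sel)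
    finally have "S (v ^ 2) = 0" by (simp only: zero mult_zero_right)
    then show ?thesis by (simp only: v_def)
  qed
  have "AE \<tau> in lborel. - pi / 2 < \<tau> \<longrightarrow> \<tau> < 0 \<longrightarrow> good \<tau>"
    unfolding good_def by (rule influx_AE_chords[OF zero])
  then have "infinite ((\<lambda>\<tau>. cis \<tau> ^ 2) ` {\<tau>. - pi / 2 < \<tau> \<and> \<tau> < 0 \<and> good \<tau>})"
    by (rule infinite_squared_directions)
  moreover have "(\<lambda>\<tau>. cis \<tau> ^ 2) ` {\<tau>. - pi / 2 < \<tau> \<and> \<tau> < 0 \<and> good \<tau>} \<subseteq> {w. poly p w = 0}"
    using vanish by (auto simp: p)
  ultimately have "infinite {w. poly p w = 0}" by (rule infinite_super[rotated])
  then have "p = 0" using poly_roots_finite by blast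
  then show "S w = 0" using p[of w] by simp
qed

section \<open>Symmetric tensors and their diagonals\<close>

definition multilinear_form :: "nat \<Rightarrow> (complex list \<Rightarrow> complex) \<Rightarrow> bool" where
  "multilinear_form m T \<longleftrightarrow> (\<forall>vs. length vs = m \<longrightarrow> (\<forall>i<m. linear (\<lambda>v. T (vs[i := v]))))"

lemma sym_tensor_multilinear: "sym_tensor m T \<Longrightarrow> multilinear_form m T"
  by (simp add: sym_tensor_def multilinear_form_def)

lemma multilinear_form_slot:
  assumes "multilinear_form m T" "length us + Suc (length ws) = m"
  shows "linear (\<lambda>v. T (us @ v # ws))"
proof -
  have "length (us @ 0 # ws) = m" "length us < m" using assms(2) by auto
  then have "linear (\<lambda>v. T ((us @ 0 # ws)[length us := v]))"
    using assms(1) unfolding multilinear_form_def by blast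
  then show ?thesis by simp
qed

text \<open>Invariance under permutations is easier to use in terms of multisets.\<close>

lemma sym_tensor_mset:
  assumes "sym_tensor m T" "length ys = m" "mset xs = mset ys"
  shows "T xs = T ys"
proof -
  obtain p where "p permutes {..<length ys}" "permute_list p ys = xs"
    by (rule mset_eq_permutation[OF assms(3)])
  then show ?thesis using assms(1,2) unfolding sym_tensor_def by blast
qed

lemma sym_tensorI:
  assumes "multilinear_form m T"
    and "\<And>xs ys. length ys = m \<Longrightarrow> mset xs = mset ys \<Longrightarrow> T xs = T ys"
  shows "sym_tensor m T"
  unfolding sym_tensor_def
proof (intro allI impI conjI)
  fix vs :: "complex list" assume l: "length vs = m"
  show "linear (\<lambda>v. T (vs[i := v]))" if "i < m" for i
    using assms(1) l that unfolding multilinear_form_def by blast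
  show "T (permute_list p vs) = T vs" if "p permutes {..<m}" for p
    by (rule assms(2)[OF l mset_permute_list]) (use that l in simp)
qed

lemma linear_mult_left:
  fixes f :: "'a::real_vector \<Rightarrow> complex"
  assumes "linear f"
  shows "linear (\<lambda>v. c * f v)"
  by (rule linearI) (simp_all add: linear_add[OF assms] linear_scale[OF assms] distrib_left)

lemma multilinear_form_sum:
  assumes "\<And>j. j \<in> I \<Longrightarrow> multilinear_form m (S j)"
  shows "multilinear_form m (\<lambda>vs. \<Sum>j\<in>I. c j * S j vs)"
  unfolding multilinear_form_def
proof (intro allI impI)
  fix vs :: "complex list" and i assume "length vs = m" "i < m"
  then have "linear (\<lambda>v. S j (vs[i := v]))" if "j \<in> I" for j
    using assms[OF that] unfolding multilinear_form_def by blast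
  then show "linear (\<lambda>v. \<Sum>j\<in>I. c j * S j (vs[i := v]))"
    by (intro linear_compose_sum ballI linear_mult_left)
qed

lemma sym_tensor_sum:
  assumes "\<And>j. j \<in> I \<Longrightarrow> sym_tensor m (S j)"
  shows "sym_tensor m (\<lambda>vs. \<Sum>j\<in>I. c j * S j vs)"
proof (rule sym_tensorI)
  show "multilinear_form m (\<lambda>vs. \<Sum>j\<in>I. c j * S j vs)"
    by (rule multilinear_form_sum[where S = S]) (rule sym_tensor_multilinear[OF assms])
  fix xs ys :: "complex list" assume "length ys = m" "mset xs = mset ys"
  then have "S j xs = S j ys" if "j \<in> I" for j by (rule sym_tensor_mset[OF assms[OF that]])
  then show "(\<Sum>j\<in>I. c j * S j xs) = (\<Sum>j\<in>I. c j * S j ys)" by simp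
qed

lemma sym_tensor_diff:
  assumes "sym_tensor m S" "sym_tensor m T"
  shows "sym_tensor m (\<lambda>vs. S vs - T vs)"
proof (rule sym_tensorI)
  show "multilinear_form m (\<lambda>vs. S vs - T vs)" unfolding multilinear_form_def
  proof (intro allI impI)
    fix vs :: "complex list" and i assume l: "length vs = m" "i < m"
    have "linear (\<lambda>v. S (vs[i := v]))" "linear (\<lambda>v. T (vs[i := v]))"
      using assms l unfolding sym_tensor_def by blast+
    then show "linear (\<lambda>v. S (vs[i := v]) - T (vs[i := v]))" by (rule linear_compose_sub)
  qed
  show "S xs - T xs = S ys - T ys" if "length ys = m" "mset xs = mset ys" for xs ys
    by (simp only: sym_tensor_mset[OF assms(1) that] sym_tensor_mset[OF assms(2) that])
qed

text \<open>Along a line, the diagonal of a symmetric form is a polynomial whose linear coefficient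
  recovers the form with one argument replaced by the direction.\<close>

lemma diagonal_on_line:
  assumes T: "sym_tensor m T"
  shows "length us + n = m \<Longrightarrow> \<exists>p. (\<forall>t::real. T (us @ replicate n (w + t *\<^sub>R v)) = poly p (of_real t)) \<and>
    coeff p 0 = T (us @ replicate n w) \<and> coeff p 1 = of_nat n * T (v # us @ replicate (n - 1) w)"
proof (induction n arbitrary: us)
  case 0
  show ?case by (rule exI[of _ "[:T us:]"]) simp
next
  case (Suc n)
  have l: "length (us @ [w]) + n = m" "length (us @ [v]) + n = m" using Suc.prems by simp_all
  obtain p where p: "\<And>t::real. T ((us @ [w]) @ replicate n (w + t *\<^sub>R v)) = poly p (of_real t)"
    "coeff p 0 = T ((us @ [w]) @ replicate n w)" "coeff p 1 = of_nat n * T (v # (us @ [w]) @ replicate (n - 1) w)"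
    using Suc.IH[OF l(1)] by blast
  obtain r where r: "\<And>t::real. T ((us @ [v]) @ replicate n (w + t *\<^sub>R v)) = poly r (of_real t)"
    "coeff r 0 = T ((us @ [v]) @ replicate n w)"
    using Suc.IH[OF l(2)] by blast
  have "T (us @ replicate (Suc n) (w + t *\<^sub>R v)) = poly (p + pCons 0 r) (of_real t)" for t :: real
  proof -
    have lin: "linear (\<lambda>x. T (us @ x # replicate n (w + t *\<^sub>R v)))"
      by (rule multilinear_form_slot[OF sym_tensor_multilinear[OF T]]) (use Suc.prems in simp)
    have "T (us @ (w + t *\<^sub>R v) # replicate n (w + t *\<^sub>R v)) = T (us @ w # replicate n (w + t *\<^sub>R v))
        + t *\<^sub>R T (us @ v # replicate n (w + t *\<^sub>R v))"
      using linear_add[OF lin, of w "t *\<^sub>R v"] linear_scale[OF lin, of t v] by simp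
    then show ?thesis using p(1)[of t] r(1)[of t] by (simp add: scaleR_conv_of_real)
  qed
  moreover have "coeff (p + pCons 0 r) 1 = of_nat (Suc n) * T (v # us @ replicate n w)"
  proof -
    have "T ((us @ [v]) @ replicate n w) = T (v # us @ replicate n w)"
      by (rule sym_tensor_mset[OF T]) (use Suc.prems in simp_all)
    moreover have "of_nat n * T (v # (us @ [w]) @ replicate (n - 1) w) = of_nat n * T (v # us @ replicate n w)"
    proof (cases n)
      case (Suc k)
      have "T (v # (us @ [w]) @ replicate (n - 1) w) = T (v # us @ replicate n w)"
        by (rule sym_tensor_mset[OF T]) (use \<open>length us + Suc n = m\<close> Suc in simp_all)
      then show ?thesis by simp
    qed simp
    ultimately show ?thesis using p(3) r(2) by (simp add: algebra_simps)
  qed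
  moreover have "coeff (p + pCons 0 r) 0 = T (us @ replicate (Suc n) w)" using p(2) by simp
  ultimately show ?case by (intro exI[of _ "p + pCons 0 r"]) simp
qed

text \<open>Polarization. With its first argument frozen, the form is symmetric with one argument less, and
  by the previous lemma its diagonal vanishes as well.\<close>

lemma sym_tensor_diagonal_zero:
  shows "sym_tensor m T \<Longrightarrow> (\<And>v. T (replicate m v) = 0) \<Longrightarrow> length vs = m \<Longrightarrow> T vs = 0"
proof (induction m arbitrary: T vs)
  case 0
  then show ?case by simp
next
  case (Suc m)
  obtain v us where vs: "vs = v # us" "length us = m" using Suc.prems(3) by (cases vs) auto
  have "sym_tensor m (\<lambda>us. T (v # us))"
  proof (rule sym_tensorI)
    show "T (v # xs) = T (v # ys)" if "length ys = m" "mset xs = mset ys" for xs ys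
      by (rule sym_tensor_mset[OF Suc.prems(1)]) (use that in simp_all)
    show "multilinear_form m (\<lambda>us. T (v # us))" unfolding multilinear_form_def
    proof (intro allI impI)
      fix us :: "complex list" and i assume "length us = m" "i < m"
      then have "length (v # us) = Suc m" "Suc i < Suc m" by simp_all
      then have "linear (\<lambda>x. T ((v # us)[Suc i := x]))"
        using Suc.prems(1) unfolding sym_tensor_def by blast
      then show "linear (\<lambda>x. T (v # us[i := x]))" by simp
    qed
  qed
  moreover have "T (v # replicate m w) = 0" for w
  proof -
    obtain p where p: "\<And>t::real. T ([] @ replicate (Suc m) (w + t *\<^sub>R v)) = poly p (of_real t)"
      "coeff p 1 = of_nat (Suc m) * T (v # [] @ replicate (Suc m - 1) w)"
      using diagonal_on_line[OF Suc.prems(1), of "[]" "Suc m" w v] by auto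
    have "poly p (of_real t) = 0" for t :: real using p(1)[of t] Suc.prems(2) by simp
    then have "range complex_of_real \<subseteq> {x. poly p x = 0}" by auto
    moreover have "infinite (range complex_of_real)"
      by (simp add: finite_image_iff inj_on_def infinite_UNIV_char_0)
    ultimately have "p = 0" using poly_roots_finite[of p] finite_subset by blast
    then show ?thesis using p(2) by (simp del: of_nat_Suc)
  qed
  ultimately have "T (v # us) = 0" using vs(2) by (rule Suc.IH)
  then show ?case by (simp add: vs)
qed

text \<open>The symmetric product of \<open>length vs - j\<close> copies of the covector \<open>v \<mapsto> v\<close> and \<open>j\<close> copies of
  \<open>v \<mapsto> cnj v\<close>: expanding the polynomial sums over all choices of \<open>j\<close> vectors to be conjugated.\<close>

definition sym_basis :: "nat \<Rightarrow> complex list \<Rightarrow> complex" where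
  "sym_basis j vs = coeff (\<Prod>v\<leftarrow>vs. [:v, cnj v:]) j / of_nat (length vs choose j)"

lemma coeff_linear_factor_mult:
  "coeff ([:a, b:] * R) j = a * coeff R j + b * (if j = 0 then 0 else coeff R (j - 1))"
  for R :: "complex poly"
  by (cases j) (simp_all add: coeff_pCons)

lemma sym_basis_sym_tensor: "sym_tensor m (sym_basis j)"
proof (rule sym_tensorI)
  show "sym_basis j xs = sym_basis j ys" if "length ys = m" "mset xs = mset ys" for xs ys
  proof -
    have "(\<Prod>v\<leftarrow>xs. [:v, cnj v:]) = (\<Prod>v\<leftarrow>ys. [:v, cnj v:])"
      unfolding prod_mset_prod_list[symmetric] mset_map that(2) ..
    then show ?thesis by (simp add: sym_basis_def mset_eq_length[OF that(2)])
  qed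
  show "multilinear_form m (sym_basis j)" unfolding multilinear_form_def
  proof (intro allI impI)
    fix vs :: "complex list" and i assume l: "length vs = m" "i < m"
    define R where "R = (\<Prod>v\<leftarrow>take i vs. [:v, cnj v:]) * (\<Prod>v\<leftarrow>drop (Suc i) vs. [:v, cnj v:])"
    have "(\<Prod>v\<leftarrow>vs[i := v]. [:v, cnj v:]) = [:v, cnj v:] * R" for v
      using l by (simp only: upd_conv_take_nth_drop R_def map_append list.map prod_list.append prod_list.Cons mult_ac)
    then have "sym_basis j (vs[i := v])
        = (v * coeff R j + cnj v * (if j = 0 then 0 else coeff R (j - 1))) / of_nat (m choose j)" for v
      by (simp only: sym_basis_def coeff_linear_factor_mult length_list_update l)
    then show "linear (\<lambda>v. sym_basis j (vs[i := v]))"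
      by (intro linearI) (simp_all add: scaleR_conv_of_real add_divide_distrib algebra_simps)
  qed
qed

lemma sym_basis_diagonal:
  assumes "j \<le> m"
  shows "sym_basis j (replicate m v) = v ^ (m - j) * cnj v ^ j"
  using assms by (simp add: sym_basis_def prod_list_replicate coeff_linear_poly_power)

lemma sym_tensor_expansion:
  assumes T: "sym_tensor m T"
    and diag: "\<And>v. T (replicate m v) = (\<Sum>j\<le>m. a j * (v ^ (m - j) * cnj v ^ j))"
    and vs: "length vs = m"
  shows "T vs = (\<Sum>j\<le>m. a j * sym_basis j vs)"
proof -
  define D where "D vs = T vs - (\<Sum>j\<le>m. a j * sym_basis j vs)" for vs
  have "sym_tensor m D" unfolding D_def[abs_def]
    by (rule sym_tensor_diff[OF T sym_tensor_sum[where S = sym_basis and c = a]]) (rule sym_basis_sym_tensor)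
  moreover have "D (replicate m v) = 0" for v
  proof -
    have "(\<Sum>j\<le>m. a j * sym_basis j (replicate m v)) = (\<Sum>j\<le>m. a j * (v ^ (m - j) * cnj v ^ j))"
      by (rule sum.cong[OF refl]) (simp only: sym_basis_diagonal atMost_iff)
    then show ?thesis unfolding D_def diag by (simp only: diff_self)
  qed
  ultimately have "D vs = 0" using vs by (rule sym_tensor_diagonal_zero[where T = D and vs = vs and m = m])
  then show ?thesis unfolding D_def by (simp only: right_minus_eq)
qed

lemma frames_Suc: "frames (Suc n) = (#) 1 ` frames n \<union> (#) \<i> ` frames n"
  unfolding frames_def by (auto simp: length_Suc_conv)

lemma finite_frames: "finite (frames n)"
  by (induction n) (simp_all add: frames_Suc, simp add: frames_def)

lemma frames_expansion:
  assumes T: "multilinear_form m T"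
  shows "length us + n = m \<Longrightarrow> T (us @ replicate n v)
    = (\<Sum>es\<in>frames n. (\<Prod>e\<leftarrow>es. of_real (Re (v * cnj e))) * T (us @ es))"
proof (induction n arbitrary: us)
  case 0
  have "frames 0 = {[]}" by (auto simp: frames_def)
  then show ?case by simp
next
  case (Suc n)
  have l: "length (us @ [x]) + n = m" for x using Suc.prems by simp
  have lin: "linear (\<lambda>x. T (us @ x # replicate n v))"
    by (rule multilinear_form_slot[OF T]) (use Suc.prems in simp)
  have "v = Re v *\<^sub>R 1 + Im v *\<^sub>R \<i>" by (simp add: complex_eq_iff)
  then have "T (us @ v # replicate n v) = T (us @ (Re v *\<^sub>R 1 + Im v *\<^sub>R \<i>) # replicate n v)"
    by (rule arg_cong)
  also have "\<dots> = Re v *\<^sub>R T (us @ 1 # replicate n v) + Im v *\<^sub>R T (us @ \<i> # replicate n v)"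
    using linear_add[OF lin, of "Re v *\<^sub>R 1" "Im v *\<^sub>R \<i>"] linear_scale[OF lin, of "Re v" 1]
      linear_scale[OF lin, of "Im v" \<i>] by simp
  also have "\<dots> = (\<Sum>es\<in>frames n. (\<Prod>e\<leftarrow>1 # es. of_real (Re (v * cnj e))) * T (us @ 1 # es))
      + (\<Sum>es\<in>frames n. (\<Prod>e\<leftarrow>\<i> # es. of_real (Re (v * cnj e))) * T (us @ \<i> # es))"
    using Suc.IH[OF l, of 1] Suc.IH[OF l, of \<i>] by (simp add: scaleR_conv_of_real sum_distrib_left mult.assoc)
  also have "\<dots> = (\<Sum>es\<in>frames (Suc n). (\<Prod>e\<leftarrow>es. of_real (Re (v * cnj e))) * T (us @ es))"
    unfolding frames_Suc
    by (subst sum.union_disjoint) (auto simp: finite_frames sum.reindex inj_on_def)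
  finally show ?case by simp
qed

lemma prod_linear_homogeneous:
  fixes a b :: "'c \<Rightarrow> complex"
  shows "(\<forall>j>length es. coeff (\<Prod>e\<leftarrow>es. [:a e, b e:]) j = 0) \<and>
    (\<Prod>e\<leftarrow>es. a e * x + b e * y)
      = (\<Sum>j\<le>length es. coeff (\<Prod>e\<leftarrow>es. [:a e, b e:]) j * (x ^ (length es - j) * y ^ j))"
proof (induction es)
  case Nil
  show ?case by (simp add: coeff_eq_0)
next
  case (Cons e es)
  let ?R = "\<Prod>e\<leftarrow>es. [:a e, b e:]" and ?n = "length es"
  have z: "coeff ?R j = 0" if "j > ?n" for j using Cons.IH that by blast
  have c: "coeff (\<Prod>e\<leftarrow>e # es. [:a e, b e:]) j = a e * coeff ?R j + b e * (if j = 0 then 0 else coeff ?R (j - 1))" for j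
    unfolding list.map prod_list.Cons by (rule coeff_linear_factor_mult)
  have "(\<Sum>j\<le>Suc ?n. coeff (\<Prod>e\<leftarrow>e # es. [:a e, b e:]) j * (x ^ (Suc ?n - j) * y ^ j))
      = (\<Sum>j\<le>Suc ?n. a e * coeff ?R j * (x ^ (Suc ?n - j) * y ^ j))
      + (\<Sum>j\<le>Suc ?n. b e * (if j = 0 then 0 else coeff ?R (j - 1)) * (x ^ (Suc ?n - j) * y ^ j))"
    unfolding c distrib_right sum.distrib ..
  also have "(\<Sum>j\<le>Suc ?n. a e * coeff ?R j * (x ^ (Suc ?n - j) * y ^ j))
      = a e * x * (\<Sum>j\<le>?n. coeff ?R j * (x ^ (?n - j) * y ^ j))"
    unfolding sum.atMost_Suc sum_distrib_left
    by (simp add: z Suc_diff_le mult_ac)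
  also have "(\<Sum>j\<le>Suc ?n. b e * (if j = 0 then 0 else coeff ?R (j - 1)) * (x ^ (Suc ?n - j) * y ^ j))
      = b e * y * (\<Sum>j\<le>?n. coeff ?R j * (x ^ (?n - j) * y ^ j))"
    unfolding sum.atMost_Suc_shift sum_distrib_left by (simp add: mult_ac)
  also have "a e * x * (\<Sum>j\<le>?n. coeff ?R j * (x ^ (?n - j) * y ^ j)) + b e * y * (\<Sum>j\<le>?n. coeff ?R j * (x ^ (?n - j) * y ^ j))
      = (\<Prod>e\<leftarrow>e # es. a e * x + b e * y)"
    using conjunct2[OF Cons.IH] by (simp only: list.map prod_list.Cons distrib_right)
  finally have 2: "(\<Prod>e\<leftarrow>e # es. a e * x + b e * y)
      = (\<Sum>j\<le>length (e # es). coeff (\<Prod>e\<leftarrow>e # es. [:a e, b e:]) j * (x ^ (length (e # es) - j) * y ^ j))"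
    by (simp only: list.size add_Suc_right add_0_right)
  have 1: "coeff (\<Prod>e\<leftarrow>e # es. [:a e, b e:]) j = 0" if "j > length (e # es)" for j
    unfolding c using that z[of j] z[of "j - 1"] by simp
  show ?case using 1 2 by blast
qed

text \<open>The diagonal value is the sum of \<open>\<Prod>e. Re (v * cnj e)\<close> times the component at \<open>es\<close>, and
  \<open>Re (v * cnj e) = cnj e / 2 * v + e / 2 * cnj v\<close>; this collects the monomials in \<open>v\<close> and \<open>cnj v\<close>.\<close>

definition diag_coeff :: "nat \<Rightarrow> (complex list \<Rightarrow> complex) \<Rightarrow> nat \<Rightarrow> complex" where
  "diag_coeff m T j = (\<Sum>es\<in>frames m. coeff (\<Prod>e\<leftarrow>es. [:cnj e / 2, e / 2:]) j * T es)"

lemma diag_coeff_diagonal: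
  assumes "multilinear_form m T"
  shows "T (replicate m v) = (\<Sum>j\<le>m. diag_coeff m T j * (v ^ (m - j) * cnj v ^ j))"
proof -
  have "complex_of_real (Re (v * cnj e)) = cnj e / 2 * v + e / 2 * cnj v" for e
    by (simp add: complex_eq_iff field_simps)
  then have pr: "(\<Prod>e\<leftarrow>es. complex_of_real (Re (v * cnj e)))
      = (\<Sum>j\<le>m. coeff (\<Prod>e\<leftarrow>es. [:cnj e / 2, e / 2:]) j * (v ^ (m - j) * cnj v ^ j))" if "es \<in> frames m" for es
    using conjunct2[OF prod_linear_homogeneous[of es "\<lambda>e. cnj e / 2" "\<lambda>e. e / 2" v "cnj v"]] that
    by (simp add: frames_def)
  have "T (replicate m v) = (\<Sum>es\<in>frames m. (\<Prod>e\<leftarrow>es. of_real (Re (v * cnj e))) * T es)"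
    using frames_expansion[OF assms, of "[]" m v] by simp
  also have "\<dots> = (\<Sum>es\<in>frames m. \<Sum>j\<le>m. coeff (\<Prod>e\<leftarrow>es. [:cnj e / 2, e / 2:]) j * T es * (v ^ (m - j) * cnj v ^ j))"
    by (rule sum.cong[OF refl]) (simp only: pr sum_distrib_right, simp only: mult_ac)
  also have "\<dots> = (\<Sum>j\<le>m. diag_coeff m T j * (v ^ (m - j) * cnj v ^ j))"
    unfolding diag_coeff_def sum_distrib_right by (rule sum.swap)
  finally show ?thesis .
qed

subsection \<open>Symmetrization and the symmetrized derivative\<close>

lemma permute_list_update:
  assumes p: "p permutes {..<length vs}" and i: "i < length vs"
  shows "permute_list p (vs[i := v]) = (permute_list p vs)[inv p i := v]"
proof (rule nth_equalityI)
  fix k assume "k < length (permute_list p (vs[i := v]))"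
  then have k: "k < length vs" by simp
  have pk: "p k < length vs" using permutes_in_image[OF p, of k] k by simp
  have iff: "inv p i = k \<longleftrightarrow> i = p k" using permutes_inverses[OF p] by metis
  have ipi: "inv p i < length vs" using permutes_in_image[OF permutes_inv[OF p], of i] i by simp
  show "permute_list p (vs[i := v]) ! k = (permute_list p vs)[inv p i := v] ! k"
    using k pk p iff i ipi by (simp add: permute_list_nth nth_list_update)
qed simp

lemma symmetrize_sym_tensor:
  assumes T: "multilinear_form m T"
  shows "sym_tensor m (symmetrize m T)"
  unfolding sym_tensor_def
proof (intro allI impI conjI)
  fix vs :: "complex list" assume l: "length vs = m"
  show "linear (\<lambda>v. symmetrize m T (vs[i := v]))" if i: "i < m" for i
  proof -
    have "linear (\<lambda>v. T (permute_list p (vs[i := v])))" if p: "p permutes {..<m}" for p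
    proof -
      have "inv p i < m" using permutes_in_image[OF permutes_inv[OF p], of i] i by simp
      then have "linear (\<lambda>v. T ((permute_list p vs)[inv p i := v]))"
        using T l unfolding multilinear_form_def by simp
      then show ?thesis using permute_list_update[of p vs i] p l i by simp
    qed
    then have "linear (\<lambda>v. \<Sum>p | p permutes {..<m}. T (permute_list p (vs[i := v])))"
      by (intro linear_compose_sum) simp
    from linear_mult_left[OF this, of "1 / fact m"] show ?thesis by (simp add: symmetrize_def)
  qed
  show "symmetrize m T (permute_list p vs) = symmetrize m T vs" if p: "p permutes {..<m}" for p
  proof -
    have "(\<Sum>q | q permutes {..<m}. T (permute_list q (permute_list p vs)))
        = (\<Sum>q | q permutes {..<m}. T (permute_list (p \<circ> q) vs))"
      by (rule sum.cong) (simp_all add: permute_list_compose l)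
    also have "\<dots> = (\<Sum>q | q permutes {..<m}. T (permute_list q vs))"
      using setum_permutations_compose_left[OF p, of "\<lambda>q. T (permute_list q vs)"] by simp
    finally show ?thesis by (simp add: symmetrize_def)
  qed
qed

lemma symmetrize_diagonal: "symmetrize m T (replicate m v) = T (replicate m v)"
proof -
  have "permute_list p (replicate m v) = replicate m v" if "p permutes {..<m}" for p
  proof (rule replicate_eqI)
    show "\<And>y. y \<in> set (permute_list p (replicate m v)) \<Longrightarrow> y = v"
      using set_permute_list[of p "replicate m v"] that by simp
  qed simp
  then have "(\<Sum>p | p permutes {..<m}. T (permute_list p (replicate m v))) = of_nat (card {p. p permutes {..<m}}) * T (replicate m v)"
    by simp
  then show ?thesis by (simp add: symmetrize_def card_permutations)
qed

text \<open>On the diagonal the symmetrization disappears, and what is left is the derivative along \<open>v\<close>,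
  that is \<open>v dz + cnj v dzb\<close>, of the diagonal of the tensor. The diagonal determines both sides.\<close>

lemma sym_diff_sym_basis:
  assumes \<phi>: "\<And>j. j \<le> k \<Longrightarrow> \<phi> j \<in> test_functions" and vs: "length vs = Suc k"
  shows "sym_diff k (\<lambda>z vs. \<Sum>j\<le>k. \<phi> j z * sym_basis j vs) z vs
    = (\<Sum>j\<le>Suc k. transport_coeff (Suc k) \<phi> j z * sym_basis j vs)"
proof -
  define N where "N = nabla (\<lambda>z vs. \<Sum>j\<le>k. \<phi> j z * sym_basis j vs) z"
  have diff: "\<phi> j differentiable (at z)" if "j \<le> k" for j
    by (rule smooth_differentiable[OF test_functions_smooth[OF \<phi>[OF that]]])
  have N: "N vs = (\<Sum>j\<le>k. (hd vs * dz (\<phi> j) z + cnj (hd vs) * dzb (\<phi> j) z) * sym_basis j (tl vs))" for vs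
  proof -
    have d: "(\<lambda>z. sym_basis j (tl vs) * \<phi> j z) differentiable (at z)" if "j \<le> k" for j
      by (intro differentiable_mult differentiable_const diff that)
    have "N vs = dir_deriv (hd vs) (\<lambda>z. \<Sum>j\<le>k. sym_basis j (tl vs) * \<phi> j z) z"
      by (simp add: N_def nabla_def mult.commute)
    also have "\<dots> = (\<Sum>j\<le>k. dir_deriv (hd vs) (\<lambda>z. sym_basis j (tl vs) * \<phi> j z) z)"
      by (rule dir_deriv_sum, rule d) simp
    also have "\<dots> = (\<Sum>j\<le>k. (hd vs * dz (\<phi> j) z + cnj (hd vs) * dzb (\<phi> j) z) * sym_basis j (tl vs))"
      by (rule sum.cong[OF refl]) (simp only: dir_deriv_scale[OF diff] dir_deriv_complex[OF diff] atMost_iff, simp only: mult.commute)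
    finally show ?thesis .
  qed
  have Nm: "multilinear_form (Suc k) N" unfolding multilinear_form_def
  proof (intro allI impI)
    fix vs :: "complex list" and i assume l: "length vs = Suc k" and i: "i < Suc k"
    obtain u us where vs: "vs = u # us" "length us = k" using l by (cases vs) auto
    show "linear (\<lambda>v. N (vs[i := v]))"
    proof (cases i)
      case 0
      have "linear (\<lambda>v. (v * dz (\<phi> j) z + cnj v * dzb (\<phi> j) z) * sym_basis j us)" for j
        by (rule linearI) (simp_all add: scaleR_conv_of_real algebra_simps)
      then show ?thesis by (simp add: N vs 0 linear_compose_sum)
    next
      case (Suc i')
      then have "linear (\<lambda>v. sym_basis j (us[i' := v]))" for j
        using sym_basis_sym_tensor[of k j] i vs(2) unfolding sym_tensor_def by simp
      then show ?thesis unfolding N vs Suc list_update.simps nat.case list.sel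
        by (intro linear_compose_sum ballI linear_mult_left)
    qed
  qed
  have diag: "symmetrize (Suc k) N (replicate (Suc k) v)
      = (\<Sum>j\<le>Suc k. transport_coeff (Suc k) \<phi> j z * (v ^ (Suc k - j) * cnj v ^ j))" for v
  proof -
    have "symmetrize (Suc k) N (replicate (Suc k) v)
        = (\<Sum>j\<le>k. (v * dz (\<phi> j) z + cnj v * dzb (\<phi> j) z) * (v ^ (k - j) * cnj v ^ j))"
      unfolding symmetrize_diagonal N by (simp add: sym_basis_diagonal)
    also have "\<dots> = (\<Sum>j\<le>k. dz (\<phi> j) z * (v ^ (Suc k - j) * cnj v ^ j)) + (\<Sum>j\<le>k. dzb (\<phi> j) z * (v ^ (k - j) * cnj v ^ Suc j))"
      unfolding sum.distrib[symmetric] by (rule sum.cong[OF refl]) (simp add: Suc_diff_le algebra_simps)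
    also have "(\<Sum>j\<le>k. dz (\<phi> j) z * (v ^ (Suc k - j) * cnj v ^ j))
        = (\<Sum>j\<le>Suc k. (if j < Suc k then dz (\<phi> j) z else 0) * (v ^ (Suc k - j) * cnj v ^ j))"
      unfolding sum.atMost_Suc by simp
    also have "(\<Sum>j\<le>k. dzb (\<phi> j) z * (v ^ (k - j) * cnj v ^ Suc j))
        = (\<Sum>j\<le>Suc k. (if 0 < j then dzb (\<phi> (j - 1)) z else 0) * (v ^ (Suc k - j) * cnj v ^ j))"
      unfolding sum.atMost_Suc_shift by simp
    finally show ?thesis unfolding transport_coeff_def distrib_right sum.distrib .
  qed
  show ?thesis unfolding sym_diff_def N_def[symmetric]
    by (rule sym_tensor_expansion[OF symmetrize_sym_tensor[OF Nm] diag vs])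
qed

section \<open>The kernel of the X-ray transform\<close>

text \<open>The function and its two first partial derivatives, enumerated so that the three terms of
  the \<open>H1\<close> norm can be treated alike.\<close>

definition jet :: "nat \<Rightarrow> (complex \<Rightarrow> complex) \<Rightarrow> complex \<Rightarrow> complex" where
  "jet i u = (if i = 0 then u else if i = 1 then dir_deriv 1 u else dir_deriv \<i> u)"

lemma H1_norm_jet: "(H1_norm s u)\<^sup>2 = (\<Sum>i<3. sq_norm (disk_measure s) (jet i u))"
  by (simp add: H1_norm_def L2_norm_sq sq_norm_nonneg jet_def numeral_3_eq_3)

lemma jet_test_functions: "u \<in> test_functions \<Longrightarrow> jet i u \<in> test_functions"
  by (simp add: jet_def test_functions_dir_deriv)

lemma jet_diff:
  assumes "u \<in> test_functions" "v \<in> test_functions"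
  shows "jet i (\<lambda>z. u z - v z) = (\<lambda>z. jet i u z - jet i v z)"
  using dir_deriv_diff[OF smooth_differentiable smooth_differentiable, OF test_functions_smooth test_functions_smooth, OF assms]
  by (auto simp: jet_def)

lemma jet_sum:
  assumes "\<And>j. j \<in> I \<Longrightarrow> u j \<in> test_functions"
  shows "jet i (\<lambda>z. \<Sum>j\<in>I. c j * u j z) = (\<lambda>z. \<Sum>j\<in>I. c j * jet i (u j) z)"
proof -
  have d: "u j differentiable (at z)" if "j \<in> I" for j z
    by (rule smooth_differentiable[OF test_functions_smooth[OF assms[OF that]]])
  have "dir_deriv v (\<lambda>z. \<Sum>j\<in>I. c j * u j z) z = (\<Sum>j\<in>I. c j * dir_deriv v (u j) z)" for v z
  proof -
    have "dir_deriv v (\<lambda>z. \<Sum>j\<in>I. c j * u j z) z = (\<Sum>j\<in>I. dir_deriv v (\<lambda>z. c j * u j z) z)"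
      by (rule dir_deriv_sum) (intro differentiable_mult differentiable_const d)
    also have "\<dots> = (\<Sum>j\<in>I. c j * dir_deriv v (u j) z)"
      by (rule sum.cong[OF refl]) (rule dir_deriv_scale[OF d])
    finally show ?thesis .
  qed
  then show ?thesis by (auto simp: jet_def)
qed

lemma H1_CauchyD:
  "H1_Cauchy s \<phi> \<Longrightarrow> 0 < e \<Longrightarrow> \<exists>N. \<forall>k\<ge>N. \<forall>n\<ge>N. H1_norm s (\<lambda>z. \<phi> k z - \<phi> n z) < e"
  by (simp add: H1_Cauchy_def)

lemma H1_Cauchy_iff_jet:
  assumes \<phi>: "\<And>n. \<phi> n \<in> test_functions"
  shows "H1_Cauchy s \<phi> \<longleftrightarrow> (\<forall>i<3. \<forall>e>0. \<exists>N. \<forall>k\<ge>N. \<forall>n\<ge>N.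
    sq_norm (disk_measure s) (\<lambda>z. jet i (\<phi> k) z - jet i (\<phi> n) z) < e)" (is "_ \<longleftrightarrow> ?J")
proof
  let ?d = "\<lambda>i k n. sq_norm (disk_measure s) (\<lambda>z. jet i (\<phi> k) z - jet i (\<phi> n) z)"
  have H: "(H1_norm s (\<lambda>z. \<phi> k z - \<phi> n z))\<^sup>2 = (\<Sum>i<3. ?d i k n)" for k n
    unfolding H1_norm_jet jet_diff[OF \<phi> \<phi>] ..
  have H0: "0 \<le> H1_norm s u" for u by (simp add: H1_norm_def)
  {
    assume C: "H1_Cauchy s \<phi>"
    show ?J
    proof (intro allI impI)
      fix i :: nat and e :: real assume i: "i < 3" and e: "0 < e"
      have "0 < sqrt e" using e by simp
      from H1_CauchyD[OF C this] obtain N where N0: "\<forall>k\<ge>N. \<forall>n\<ge>N. H1_norm s (\<lambda>z. \<phi> k z - \<phi> n z) < sqrt e"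
        by (rule exE)
      have N: "H1_norm s (\<lambda>z. \<phi> k z - \<phi> n z) < sqrt e" if "k \<ge> N" "n \<ge> N" for k n
        using N0 that by simp
      have "?d i k n < e" if "k \<ge> N" "n \<ge> N" for k n
      proof -
        have "?d i k n \<le> (\<Sum>i<3. ?d i k n)" by (rule member_le_sum) (use i in \<open>simp_all add: sq_norm_nonneg\<close>)
        also have "\<dots> = (H1_norm s (\<lambda>z. \<phi> k z - \<phi> n z))\<^sup>2" by (rule H[symmetric])
        also have "\<dots> < (sqrt e)\<^sup>2" by (rule power_strict_mono[OF N[OF that] H0]) simp
        finally show ?thesis using e by simp
      qed
      then show "\<exists>N. \<forall>k\<ge>N. \<forall>n\<ge>N. ?d i k n < e" by blast
    qed
  }
  {
    assume J: ?J
    show "H1_Cauchy s \<phi>" unfolding H1_Cauchy_def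
    proof (intro allI impI)
      fix e :: real assume e: "0 < e"
      have e3: "0 < e\<^sup>2 / 3" using e by simp
      have "\<exists>N. i < 3 \<longrightarrow> (\<forall>k\<ge>N. \<forall>n\<ge>N. ?d i k n < e\<^sup>2 / 3)" for i
      proof (cases "i < 3")
        case True
        have "\<exists>N. \<forall>k\<ge>N. \<forall>n\<ge>N. ?d i k n < e\<^sup>2 / 3" by (rule J[rule_format, OF True e3])
        then show ?thesis by (rule ex_forward) (rule impI)
      qed simp
      then have "\<forall>i. \<exists>N. i < 3 \<longrightarrow> (\<forall>k\<ge>N. \<forall>n\<ge>N. ?d i k n < e\<^sup>2 / 3)" by (rule allI)
      from choice[OF this] obtain N where N0: "\<forall>i. i < 3 \<longrightarrow> (\<forall>k\<ge>N i. \<forall>n\<ge>N i. ?d i k n < e\<^sup>2 / 3)"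
        by (rule exE)
      have N: "?d i k n < e\<^sup>2 / 3" if "i < 3" "k \<ge> N i" "n \<ge> N i" for i k n
        using N0 that by simp
      have "H1_norm s (\<lambda>z. \<phi> k z - \<phi> n z) < e" if "k \<ge> Max (N ` {..<3})" "n \<ge> Max (N ` {..<3})" for k n
      proof -
        have "(\<Sum>i<3. ?d i k n) < (\<Sum>i<(3::nat). e\<^sup>2 / 3)"
        proof (rule sum_strict_mono)
          fix i :: nat assume "i \<in> {..<3}"
          then have i: "i < 3" and "N i \<le> Max (N ` {..<3})" by simp_all
          then show "?d i k n < e\<^sup>2 / 3" using that by (intro N) linarith+
        qed (simp_all add: lessThan_empty_iff)
        then have "(H1_norm s (\<lambda>z. \<phi> k z - \<phi> n z))\<^sup>2 < e\<^sup>2" unfolding H by simp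
        then show ?thesis using e by (rule power_less_imp_less_base[OF _ less_imp_le])
      qed
      then show "\<exists>N. \<forall>k\<ge>N. \<forall>n\<ge>N. H1_norm s (\<lambda>z. \<phi> k z - \<phi> n z) < e" by blast
    qed
  }
qed

lemma sq_norm_tendsto_linear_combination:
  assumes I: "finite I" and u: "\<And>j n. j \<in> I \<Longrightarrow> sq_int M (u j n)" and v: "\<And>j. j \<in> I \<Longrightarrow> sq_int M (v j)"
    and lim: "\<And>j. j \<in> I \<Longrightarrow> (\<lambda>n. sq_norm M (\<lambda>z. u j n z - v j z)) \<longlonglongrightarrow> 0"
  shows "(\<lambda>n. sq_norm M (\<lambda>z. (\<Sum>j\<in>I. c j * u j n z) - (\<Sum>j\<in>I. c j * v j z))) \<longlonglongrightarrow> 0"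
proof (rule sq_norm_tendsto_sum[where u = "\<lambda>j n z. c j * u j n z" and u' = "\<lambda>j z. c j * v j z", OF I])
  fix j assume j: "j \<in> I"
  show "sq_int M (\<lambda>z. c j * u j n z)" for n by (rule sq_int_scale(1)[OF u[OF j]])
  show "sq_int M (\<lambda>z. c j * v j z)" by (rule sq_int_scale(1)[OF v[OF j]])
  show "(\<lambda>n. sq_norm M (\<lambda>z. c j * u j n z - c j * v j z)) \<longlonglongrightarrow> 0"
    by (rule sq_norm_tendsto_scale[OF u[OF j] v[OF j] lim[OF j]])
qed

text \<open>By completeness, the Cauchy property is convergence of the function and of both partial
  derivatives in the weighted \<open>L\<^sup>2\<close> space, and this passes to linear combinations.\<close>

lemma H1_approx_sum:
  assumes I: "finite I" and \<phi>: "\<And>j n. j \<in> I \<Longrightarrow> \<phi> j n \<in> test_functions"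
    and C: "\<And>j. j \<in> I \<Longrightarrow> H1_Cauchy s (\<phi> j)"
    and Q: "\<And>j. j \<in> I \<Longrightarrow> sq_int (disk_measure s) (Q j)"
    and lim: "\<And>j. j \<in> I \<Longrightarrow> (\<lambda>n. sq_norm (disk_measure s) (\<lambda>z. \<phi> j n z - Q j z)) \<longlonglongrightarrow> 0"
  shows "H1_approx s (\<lambda>n z. \<Sum>j\<in>I. c j * \<phi> j n z) (\<lambda>z. \<Sum>j\<in>I. c j * Q j z)"
proof -
  let ?M = "disk_measure s"
  have td: "(\<lambda>z. \<Sum>j\<in>I. c j * \<phi> j n z) \<in> test_functions" for n
    by (intro test_functions_sum test_functions_scale \<phi>)
  have sq: "sq_int ?M (jet i (\<phi> j n))" if "j \<in> I" for i j n
    by (rule test_functions_sq_int[OF jet_test_functions[OF \<phi>[OF that]]])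
  have sq0: "sq_int ?M (\<phi> j n)" if "j \<in> I" for j n by (rule test_functions_sq_int[OF \<phi>[OF that]])
  have "H1_Cauchy s (\<lambda>n z. \<Sum>j\<in>I. c j * \<phi> j n z)"
    unfolding H1_Cauchy_iff_jet[OF td]
  proof (rule allI, rule impI)
    fix i :: nat assume i: "i < 3"
    have "\<forall>j. \<exists>U. j \<in> I \<longrightarrow> sq_int ?M U \<and> (\<lambda>n. sq_norm ?M (\<lambda>z. jet i (\<phi> j n) z - U z)) \<longlonglongrightarrow> 0"
    proof
      fix j
      show "\<exists>U. j \<in> I \<longrightarrow> sq_int ?M U \<and> (\<lambda>n. sq_norm ?M (\<lambda>z. jet i (\<phi> j n) z - U z)) \<longlonglongrightarrow> 0"
      proof (cases "j \<in> I")
        case True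
        have "\<exists>N. \<forall>k\<ge>N. \<forall>n\<ge>N. sq_norm ?M (\<lambda>z. jet i (\<phi> j k) z - jet i (\<phi> j n) z) < e" if "e > 0" for e
          using H1_Cauchy_iff_jet[where \<phi> = "\<phi> j" and s = s, OF \<phi>[OF True]] C[OF True] i that by simp
        from Riesz_Fischer[where M = ?M and u = "\<lambda>n. jet i (\<phi> j n)", OF sq[OF True] this]
        obtain U where "sq_int ?M U \<and> (\<lambda>n. sq_norm ?M (\<lambda>z. jet i (\<phi> j n) z - U z)) \<longlonglongrightarrow> 0"
          by (rule exE)
        then show ?thesis by (intro exI[of _ U] impI)
      qed blast
    qed
    from choice[OF this] obtain U where U: "\<And>j. j \<in> I \<Longrightarrow> sq_int ?M (U j)"
      "\<And>j. j \<in> I \<Longrightarrow> (\<lambda>n. sq_norm ?M (\<lambda>z. jet i (\<phi> j n) z - U j z)) \<longlonglongrightarrow> 0" by blast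
    have lims: "(\<lambda>n. sq_norm ?M (\<lambda>z. (\<Sum>j\<in>I. c j * jet i (\<phi> j n) z) - (\<Sum>j\<in>I. c j * U j z))) \<longlonglongrightarrow> 0"
      by (rule sq_norm_tendsto_linear_combination[where u = "\<lambda>j n. jet i (\<phi> j n)" and v = U, OF I sq U])
    have su: "sq_int ?M (\<lambda>z. \<Sum>j\<in>I. c j * jet i (\<phi> j n) z)" for n by (intro sq_int_sum I sq_int_scale(1) sq)
    have sU: "sq_int ?M (\<lambda>z. \<Sum>j\<in>I. c j * U j z)" by (intro sq_int_sum I sq_int_scale(1) U(1))
    have js: "jet i (\<lambda>z. \<Sum>j\<in>I. c j * \<phi> j n z) = (\<lambda>z. \<Sum>j\<in>I. c j * jet i (\<phi> j n) z)" for n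
      by (rule jet_sum[where u = "\<lambda>j. \<phi> j n"]) (rule \<phi>)
    show "\<forall>e>0. \<exists>N. \<forall>k\<ge>N. \<forall>n\<ge>N. sq_norm ?M (\<lambda>z. jet i (\<lambda>z. \<Sum>j\<in>I. c j * \<phi> j k z) z
        - jet i (\<lambda>z. \<Sum>j\<in>I. c j * \<phi> j n z) z) < e"
      unfolding js by (intro allI impI) (rule sq_norm_Cauchy[OF su sU lims])
  qed
  moreover have "(\<lambda>z. \<Sum>j\<in>I. c j * Q j z) \<in> L2 s"
    unfolding L2_iff_sq_int by (intro sq_int_sum I sq_int_scale(1) Q)
  moreover have "(\<lambda>n. L2_norm s (\<lambda>z. (\<Sum>j\<in>I. c j * \<phi> j n z) - (\<Sum>j\<in>I. c j * Q j z))) \<longlonglongrightarrow> 0"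
  proof -
    have "(\<lambda>n. sq_norm ?M (\<lambda>z. (\<Sum>j\<in>I. c j * \<phi> j n z) - (\<Sum>j\<in>I. c j * Q j z))) \<longlonglongrightarrow> 0"
      by (rule sq_norm_tendsto_linear_combination[where u = \<phi> and v = Q, OF I sq0 Q lim])
    from tendsto_real_sqrt[OF this] show ?thesis by (simp only: L2_norm_eq_sqrt real_sqrt_zero)
  qed
  ultimately show ?thesis unfolding H1_approx_def H1_Cauchy_def using td by blast
qed

theorem corollary11:
  fixes \<gamma> :: real and m :: nat and f :: "complex \<Rightarrow> complex list \<Rightarrow> complex"
  assumes "-1 < \<gamma>" and "\<gamma> < 1" and "1 \<le> m"
    and "f \<in> L2_tensor \<gamma> m"
    and "AE (\<beta>, \<alpha>) in influx_measure \<gamma>. xray \<gamma> m f \<beta> \<alpha> = 0"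
  shows "\<exists>q \<in> H10_tensor (- \<gamma>) (m - 1). \<exists>h. has_sym_diff (- \<gamma>) (m - 1) q h \<and>
           (AE z in disk_measure \<gamma>. \<forall>vs. length vs = m \<longrightarrow>
              f z vs = of_real (bdf z powr (- \<gamma>)) * h z vs)"
proof -
  define s where "s = - \<gamma>"
  let ?M = "disk_measure s"
  have s: "-1 < s" "s < 1" using assms(1,2) by (simp_all add: s_def)
  obtain k where m: "m = Suc k" using assms(3) by (cases m) auto
  have fsym: "sym_tensor m (f z)" if "z \<in> cball 0 1" for z
    using assms(4) that unfolding L2_tensor_def by blast
  have weighted: "sq_int ?M (dual_weight s (\<lambda>z. f z es))" if "es \<in> frames m" for es
  proof (rule dual_weight_isometry(1))
    show "sq_int (disk_measure (- s)) (\<lambda>z. f z es)"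
      using assms(4) that unfolding L2_tensor_def L2_iff_sq_int s_def by simp
  qed
  have dw: "dual_weight s (\<lambda>z. f z vs) z = of_real (bdf z powr \<gamma>) * f z vs" for vs z
    by (simp add: dual_weight_def s_def)
  \<comment> \<open>The coefficients of the diagonal of the weighted tensor; they belong to the space with weight
    \<open>- \<gamma>\<close> since multiplication by the weight is an isometry from the space with weight \<open>\<gamma>\<close>.\<close>
  define F where "F j z = of_real (bdf z powr \<gamma>) * diag_coeff m (f z) j" for j z
  have F: "sq_int ?M (F j)" for j
  proof -
    have "F j = (\<lambda>z. \<Sum>es\<in>frames m. coeff (\<Prod>e\<leftarrow>es. [:cnj e / 2, e / 2:]) j * dual_weight s (\<lambda>z. f z es) z)"
      unfolding F_def diag_coeff_def dw sum_distrib_left by (simp only: mult_ac)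
    then show ?thesis by (simp only:) (intro sq_int_sum finite_frames sq_int_scale(1) weighted)
  qed
  have mom: "transversal_moments_vanish m F"
  proof (rule xray_zero_imp_transversal_moments_vanish[where s = s and f = f and g = \<gamma>, OF s(2) F _ assms(5)])
    fix z v :: complex assume z: "z \<in> cball 0 1"
    show "f z (replicate m v) * of_real (bdf z powr \<gamma>) = (\<Sum>j\<le>m. v ^ (m - j) * cnj v ^ j * F j z)"
      unfolding diag_coeff_diagonal[OF sym_tensor_multilinear[OF fsym[OF z]]] F_def sum_distrib_right
      by (simp only: mult_ac)
  qed
  obtain \<phi> where \<phi>: "\<And>j n. \<phi> j n \<in> test_functions" and C: "\<And>j. j < m \<Longrightarrow> H1_Cauchy s (\<phi> j)"
    and lim: "\<And>j. j \<le> m \<Longrightarrow> (\<lambda>n. sq_norm ?M (\<lambda>z. transport_coeff m (\<lambda>j. \<phi> j n) j z - F j z)) \<longlonglongrightarrow> 0"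
    using symmetric_gradient_range[OF s F mom] by blast
  have sq\<phi>: "sq_int ?M (\<phi> j n)" for j n by (rule test_functions_sq_int[OF \<phi>])
  have "\<forall>j. \<exists>Q. j < m \<longrightarrow> sq_int ?M Q \<and> (\<lambda>n. sq_norm ?M (\<lambda>z. \<phi> j n z - Q z)) \<longlonglongrightarrow> 0"
  proof
    fix j
    show "\<exists>Q. j < m \<longrightarrow> sq_int ?M Q \<and> (\<lambda>n. sq_norm ?M (\<lambda>z. \<phi> j n z - Q z)) \<longlonglongrightarrow> 0"
    proof (cases "j < m")
      case True
      have "\<forall>e>0. \<exists>N. \<forall>k\<ge>N. \<forall>n\<ge>N. sq_norm ?M (\<lambda>z. jet 0 (\<phi> j k) z - jet 0 (\<phi> j n) z) < e"
        using C[OF True] unfolding H1_Cauchy_iff_jet[OF \<phi>] by simp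
      then have "\<exists>N. \<forall>k\<ge>N. \<forall>n\<ge>N. sq_norm ?M (\<lambda>z. \<phi> j k z - \<phi> j n z) < e" if "e > 0" for e
        using that by (simp add: jet_def)
      then show ?thesis using Riesz_Fischer[where M = ?M and u = "\<phi> j", OF sq\<phi>] by blast
    qed blast
  qed
  from choice[OF this] obtain Q where Q: "\<And>j. j < m \<Longrightarrow> sq_int ?M (Q j)"
    "\<And>j. j < m \<Longrightarrow> (\<lambda>n. sq_norm ?M (\<lambda>z. \<phi> j n z - Q j z)) \<longlonglongrightarrow> 0" by blast
  \<comment> \<open>The tensors with the coefficients constructed above.\<close>
  define q where "q z vs = (\<Sum>j\<le>k. Q j z * sym_basis j vs)" for z vs
  define \<Phi> where "\<Phi> n z vs = (\<Sum>j\<le>k. \<phi> j n z * sym_basis j vs)" for n z vs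
  define h where "h z vs = of_real (bdf z powr \<gamma>) * f z vs" for z vs
  have qsym: "sym_tensor k (q z)" for z unfolding q_def[abs_def] by (rule sym_tensor_sum[OF sym_basis_sym_tensor])
  have \<Phi>sym: "sym_tensor k (\<Phi> n z)" for n z
    unfolding \<Phi>_def[abs_def] by (rule sym_tensor_sum[OF sym_basis_sym_tensor])
  have approx: "H1_approx s (\<lambda>n z. \<Phi> n z es) (\<lambda>z. q z es)" for es
  proof -
    have "H1_approx s (\<lambda>n z. \<Sum>j\<le>k. sym_basis j es * \<phi> j n z) (\<lambda>z. \<Sum>j\<le>k. sym_basis j es * Q j z)"
      by (rule H1_approx_sum[OF finite_atMost \<phi> C Q]) (simp_all add: m)
    then show ?thesis unfolding \<Phi>_def q_def by (simp only: mult.commute)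
  qed
  have q: "q \<in> H10_tensor s k" unfolding H10_tensor_def H10_def using qsym approx by blast
  have hexp: "h z vs = (\<Sum>j\<le>m. sym_basis j vs * F j z)" if "z \<in> cball 0 1" "length vs = m" for z vs
    unfolding h_def F_def
      sym_tensor_expansion[OF fsym[OF that(1)] diag_coeff_diagonal[OF sym_tensor_multilinear[OF fsym[OF that(1)]]] that(2)]
      sum_distrib_left
    by (simp only: mult_ac)
  have "h \<in> L2_tensor s m" unfolding L2_tensor_def
  proof (intro CollectI conjI ballI)
    fix z :: complex assume "z \<in> cball 0 1"
    \<comment> \<open>A scalar multiple is regarded as a linear combination with a single term.\<close>
    then have "sym_tensor m (\<lambda>vs. \<Sum>i\<in>{0::nat}. of_real (bdf z powr \<gamma>) * f z vs)"
      by (intro sym_tensor_sum[where S = "\<lambda>i. f z"] fsym)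
    then show "sym_tensor m (h z)" by (simp add: h_def[abs_def])
  next
    fix es assume "es \<in> frames m"
    from weighted[OF this] show "(\<lambda>z. h z es) \<in> L2 s" unfolding L2_iff_sq_int
      by (simp only: h_def dw[abs_def])
  qed
  moreover have "(\<lambda>n. L2_norm s (\<lambda>z. sym_diff k (\<Phi> n) z es - h z es)) \<longlonglongrightarrow> 0" if es: "es \<in> frames m" for es
  proof -
    have l: "length es = m" using es by (simp add: frames_def)
    let ?t = "\<lambda>n j. transport_coeff m (\<lambda>j. \<phi> j n) j"
    have tq: "sq_int ?M (?t n j)" for n j
    proof -
      have d: "sq_int ?M (dz (\<phi> j n))" "sq_int ?M (dzb (\<phi> j n))" for j
        by (intro test_functions_sq_int test_functions_dz test_functions_dzb \<phi>)+
      have "sq_int ?M (\<lambda>z. if j < m then dz (\<phi> j n) z else 0)"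
        using d(1) by (cases "j < m") simp_all
      moreover have "sq_int ?M (\<lambda>z. if 0 < j then dzb (\<phi> (j - 1) n) z else 0)"
        using d(2) by (cases "0 < j") simp_all
      ultimately show ?thesis unfolding transport_coeff_def[abs_def] by (rule sq_int_add(1))
    qed
    have L: "(\<lambda>n. sq_norm ?M (\<lambda>z. (\<Sum>j\<le>m. sym_basis j es * ?t n j z) - (\<Sum>j\<le>m. sym_basis j es * F j z))) \<longlonglongrightarrow> 0"
      by (rule sq_norm_tendsto_linear_combination[where u = "\<lambda>j n. ?t n j" and v = F, OF finite_atMost tq F]) (simp only: atMost_iff lim)
    have "sq_norm ?M (\<lambda>z. (\<Sum>j\<le>m. sym_basis j es * ?t n j z) - (\<Sum>j\<le>m. sym_basis j es * F j z))
        = sq_norm ?M (\<lambda>z. sym_diff k (\<Phi> n) z es - h z es)" for n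
      unfolding sq_norm_def
    proof (rule Bochner_Integration.integral_cong[OF refl])
      fix z assume "z \<in> space ?M"
      then have z: "z \<in> cball 0 1" by (simp only: space_disk_measure)
      have "sym_diff k (\<Phi> n) z es = (\<Sum>j\<le>m. sym_basis j es * ?t n j z)"
        unfolding \<Phi>_def[abs_def] using sym_diff_sym_basis[where \<phi> = "\<lambda>j. \<phi> j n" and k = k and z = z, OF \<phi>, of es] l
        by (simp only: m mult.commute)
      then show "(cmod ((\<Sum>j\<le>m. sym_basis j es * ?t n j z) - (\<Sum>j\<le>m. sym_basis j es * F j z)))\<^sup>2
          = (cmod (sym_diff k (\<Phi> n) z es - h z es))\<^sup>2"
        by (simp only: hexp[OF z l])
    qed
    with L have "(\<lambda>n. sq_norm ?M (\<lambda>z. sym_diff k (\<Phi> n) z es - h z es)) \<longlonglongrightarrow> 0" by (simp only:)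
    from tendsto_real_sqrt[OF this] show ?thesis by (simp only: L2_norm_eq_sqrt real_sqrt_zero)
  qed
  ultimately have hsd: "has_sym_diff s k q h" unfolding has_sym_diff_def m[symmetric]
    by (intro conjI q exI[of _ \<Phi>] allI ballI \<Phi>sym approx) simp_all
  have "AE z in disk_measure \<gamma>. \<forall>vs. length vs = m \<longrightarrow> f z vs = of_real (bdf z powr (- \<gamma>)) * h z vs"
    \<comment> \<open>On the boundary circle the weights vanish by convention, so they cancel in the interior only.\<close>
    using AE_disk_interior
  proof (rule eventually_mono, intro allI impI)
    fix z :: complex and vs :: "complex list" assume "cmod z < 1"
    then have "bdf z powr (- \<gamma>) * bdf z powr \<gamma> = 1"
      by (simp add: bdf_pos_iff[symmetric] powr_add[symmetric])
    then have "complex_of_real (bdf z powr (- \<gamma>)) * of_real (bdf z powr \<gamma>) = 1"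
      by (simp only: of_real_mult[symmetric] of_real_1)
    then show "f z vs = of_real (bdf z powr (- \<gamma>)) * h z vs"
      by (simp only: h_def mult.assoc[symmetric] mult_1_left)
  qed
  with hsd q show ?thesis unfolding s_def[symmetric] m diff_Suc_1 by blast
qed

end
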